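(* Let $R=(R,\mu)$ be a Hopf-Galois algebra over a field $k$. Assume given a sextuple $(\tau,\omega,g,h,c,\xi)$ where \begin{enumerate} \item[(1)] $\tau,\omega\in\operatorname{Aut}(R)$ are commuting algebra automorphisms satisfying, for any $r\in R$, $$\tau(r)_{(1)}\otimes\tau(r)_{(2)}\otimes\tau(r)_{(3)}=\tau(r_{(1)})\otimes r_{(2)}\otimes r_{(3)}=\tau(r_{(1)})\otimes\tau(r_{(2)})\otimes\tau(r_{(3)}),$$ $$\omega(r)_{(1)}\otimes\omega(r)_{(2)}\otimes\omega(r)_{(3)}=\omega(r_{(1)})\otimes r_{(2)}\otimes r_{(3)}=\omega(r_{(1)})\otimes\omega(r_{(2)})\otimes\omega(r_{(3)}).$$ \item[(2)] $g,h\in G_0(R)$ are quasi-central group-like elements such that, for any $r\in R$, $$g\cdot r_{(1)}\otimes g\cdot r_{(2)}\otimes r_{(3)}=\tau(r_{(1)})\otimes\tau(r_{(2)})\otimes r_{(3)},$$ $$h\cdot r_{(1)}\otimes h\cdot r_{(2)}\otimes r_{(3)}=\omega(r_{(1)})\otimes\omega(r_{(2)})\otimes r_{(3)}.$$ \item[(3)] $\xi\in k^*$ is a scalar such that $\tau(h)=\xi h$ and $\omega(g)=\xi^{-1}g$. \item[(4)] $c\in Z_\sigma(R)\cap\mathcal P^0_{gh,1}(R)$ for $\sigma:=\tau\omega$; that is, $cr=\sigma(r)c$ for all $r\in R$ and $$\mu(c)=c\otimes 1\otimes 1-gh\otimes (gh)^{-1}c\otimes 1+gh\otimes(gh)^{-1}\otimes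 c.$$ \end{enumerate} Then there is a unique Hopf-Galois algebra structure on $A=A(R,X,Y,\tau,\omega,c,\xi)$ extending $\mu$ and such that $$(\ast)\qquad \begin{aligned}\mu(X)&=X\otimes 1\otimes 1-g\otimes g^{-1}X\otimes 1+g\otimes g^{-1}\otimes X,\\ \mu(Y)&=Y\otimes 1\otimes 1-h\otimes h^{-1}Y\otimes 1+h\otimes h^{-1}\otimes Y.\end{aligned}$$ Conversely, given commuting $\tau,\omega\in\operatorname{Aut}(R)$, $c\in Z_\sigma(R)$ for $\sigma=\tau\omega$, and $\xi\in k^*$, if $(\ast)$ defines a Hopf-Galois algebra structure on $A(R,X,Y,\tau,\omega,c,\xi)$ extending $\mu$, for some $g,h\in G_0(R)$, then conditions (1) to (4) are satisfied.
   Context: All algebras and tensor products are over a field $k$; $\operatorname{Aut}(R)$ denotes algebra automorphisms. A Hopf-Galois algebra is a non-zero algebra $R$ with an algebra map $\mu:R\to R\otimes R^{\rm op}\otimes R$ such that $(\mu\otimes{\rm id}_R\otimes{\rm id}_R)\circ\mu=({\rm id}_R\otimes{\rm id}_R\otimes\mu)\circ\mu$, $(m\otimes{\rm id}_R)\circ\mu=\eta\otimes{\rm id}_R$ and $({\rm id}_R\otimes m)\circ\mu={\rm id}_R\otimes\eta$, where $m:R\otimes R\to R$ and $\eta:k\to R$ are the multiplication and unit of $R$. Notation: $\mu(r)=r_{(1)}\otimes r_{(2)}\otimes r_{(3)}$. Thus $r_{(1)}\otimes r_{(2)}r_{(3)}=r\otimes 1$ and $r_{(1)}r_{(2)}\otimes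 r_{(3)}=1\otimes r$. A group-like element of $R$ is an invertible $g\in R$ with $\mu(g)=g\otimes g^{-1}\otimes g$; $G_0(R)$ is the group of group-like elements. An element $g\in G_0(R)$ is quasi-central if there is a character $\alpha:G_0(R)\to k^*$ with $xg=\alpha(x)gx$ for all $x\in G_0(R)$. For $g\in G_0(R)$ write $g\cdot r:=grg^{-1}$. For $g,h\in G_0(R)$, $\mathcal P^0_{g,h}(R)$ is the set of $x\in R$ with $\mu(x)=x\otimes h^{-1}\otimes h-g\otimes g^{-1}xh^{-1}\otimes h+g\otimes g^{-1}\otimes x$. In all these formulas, products inside a middle tensor factor are written using the product of $R$ (not of $R^{\rm op}$). For an algebra automorphism $\sigma$ of $R$, $Z_\sigma(R)=\{x\in R: xr=\sigma(r)x\text{ for all }r\in R\}$. Given commuting algebra automorphisms $\tau,\omega$ of $R$, $\sigma=\tau\omega$, $c\in Z_\sigma(R)$ and $\xi\in k^*$, the generalized ambiskew polynomial algebra $A(R,X,Y,\tau,\omega,c,\xi)$ is the quotient of the free product $R*k\langle X,Y\rangle$ by the relations $Xr=\tau(r)X$, $Yr=\omega(r)Y$ ($r\in R$) and $XY-\xi YX=c$. *)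

theory Defs
  imports "HOL-Algebra.Module" "HOL-Algebra.QuotRing"
begin

section \<open>Algebras over a field\<close>

text \<open>Associative unital, not necessarily commutative algebras. (The locale \<^locale>\<open>algebra\<close> of
  HOL-Algebra covers commutative algebras only.)\<close>

locale k_algebra = K?: field K + module K A + A?: ring A for K and A (structure) +
  assumes smult_mult_left:
      "\<lbrakk>a \<in> carrier K; x \<in> carrier A; y \<in> carrier A\<rbrakk> \<Longrightarrow> (a \<odot> x) \<otimes> y = a \<odot> (x \<otimes> y)"
    and smult_mult_right:
      "\<lbrakk>a \<in> carrier K; x \<in> carrier A; y \<in> carrier A\<rbrakk> \<Longrightarrow> x \<otimes> (a \<odot> y) = a \<odot> (x \<otimes> y)"

definition alg_hom ::
  "('k, 'm) ring_scheme \<Rightarrow> ('k, 'a, 'n) module_scheme \<Rightarrow> ('k, 'b, 'p) module_scheme \<Rightarrow> ('a \<Rightarrow> 'b) set"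
  where "alg_hom K A B =
    {f \<in> ring_hom A B. \<forall>a\<in>carrier K. \<forall>x\<in>carrier A. f (a \<odot>\<^bsub>A\<^esub> x) = a \<odot>\<^bsub>B\<^esub> f x}"

definition alg_aut ::
  "('k, 'm) ring_scheme \<Rightarrow> ('k, 'a, 'n) module_scheme \<Rightarrow> ('a \<Rightarrow> 'a) set"
  where "alg_aut K A = {f \<in> alg_hom K A A. bij_betw f (carrier A) (carrier A)}"

definition op_alg :: "('k, 'a, 'n) module_scheme \<Rightarrow> ('k, 'a, 'n) module_scheme"
  where "op_alg A = A\<lparr>mult := \<lambda>x y. y \<otimes>\<^bsub>A\<^esub> x\<rparr>"

text \<open>The quotient ring of the library together with the induced scalar action. As for
  \<^const>\<open>FactRing\<close>, the operations on cosets are meaningful when \<open>I\<close> is a two-sided ideal.\<close>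

definition quot_alg :: "('k, 'a, 'n) module_scheme \<Rightarrow> 'a set \<Rightarrow> ('k, 'a set) module"
  where "quot_alg A I =
    \<lparr>carrier = carrier (A Quot I), mult = mult (A Quot I), one = one (A Quot I),
     zero = zero (A Quot I), add = add (A Quot I),
     smult = (\<lambda>a C. \<Union>x\<in>C. I +>\<^bsub>A\<^esub> (a \<odot>\<^bsub>A\<^esub> x))\<rparr>"

definition lin_span ::
  "('k, 'm) ring_scheme \<Rightarrow> ('k, 'a, 'n) module_scheme \<Rightarrow> 'a set \<Rightarrow> 'a set"
  where "lin_span K M S = \<Inter>{N. submodule N K M \<and> S \<subseteq> N}"


section \<open>Monoid algebras, free algebras and free products\<close>

text \<open>\<open>mon_alg K M\<close> is the vector space with basis \<open>carrier M\<close>, realised as finitely supported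
  functions, with the convolution product.\<close>

definition mon_alg :: "('k, 'm) ring_scheme \<Rightarrow> ('b, 'n) monoid_scheme \<Rightarrow> ('k, 'b \<Rightarrow> 'k) module"
  where "mon_alg K M =
    \<lparr>carrier = {f. range f \<subseteq> carrier K \<and> finite {x. f x \<noteq> \<zero>\<^bsub>K\<^esub>} \<and> {x. f x \<noteq> \<zero>\<^bsub>K\<^esub>} \<subseteq> carrier M},
     mult = (\<lambda>f g x. \<Oplus>\<^bsub>K\<^esub>p \<in> {(y, z). f y \<noteq> \<zero>\<^bsub>K\<^esub> \<and> g z \<noteq> \<zero>\<^bsub>K\<^esub> \<and> y \<otimes>\<^bsub>M\<^esub> z = x}. f (fst p) \<otimes>\<^bsub>K\<^esub> g (snd p)),
     one = (\<lambda>x. if x = \<one>\<^bsub>M\<^esub> then \<one>\<^bsub>K\<^esub> else \<zero>\<^bsub>K\<^esub>),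
     zero = (\<lambda>x. \<zero>\<^bsub>K\<^esub>),
     add = (\<lambda>f g x. f x \<oplus>\<^bsub>K\<^esub> g x),
     smult = (\<lambda>a f x. a \<otimes>\<^bsub>K\<^esub> f x)\<rparr>"

definition basis_elt :: "('k, 'm) ring_scheme \<Rightarrow> 'b \<Rightarrow> 'b \<Rightarrow> 'k"
  where "basis_elt K y = (\<lambda>x. if x = y then \<one>\<^bsub>K\<^esub> else \<zero>\<^bsub>K\<^esub>)"

definition free_alg :: "('k, 'm) ring_scheme \<Rightarrow> 'b set \<Rightarrow> ('k, 'b list \<Rightarrow> 'k) module"
  where "free_alg K S = mon_alg K \<lparr>carrier = lists S, mult = (@), one = []\<rparr>"

text \<open>The free product (coproduct of unital algebras) \<open>A * B\<close> is presented by one generator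
  for each element of \<open>A\<close> and of \<open>B\<close>, subject to the relations saying that both
  \<open>A\<close> and \<open>B\<close> map to the quotient by algebra homomorphisms.\<close>

definition hom_rels ::
  "('k, 'm) ring_scheme \<Rightarrow> ('k, 'l list \<Rightarrow> 'k) module \<Rightarrow> ('k, 'a, 'n) module_scheme
    \<Rightarrow> ('a \<Rightarrow> 'l) \<Rightarrow> ('l list \<Rightarrow> 'k) set"
  where "hom_rels K F A e = (let d = (\<lambda>x. basis_elt K [e x]) in
      {d (x \<oplus>\<^bsub>A\<^esub> y) \<ominus>\<^bsub>F\<^esub> (d x \<oplus>\<^bsub>F\<^esub> d y) | x y. x \<in> carrier A \<and> y \<in> carrier A}
    \<union> {d (a \<odot>\<^bsub>A\<^esub> x) \<ominus>\<^bsub>F\<^esub> (a \<odot>\<^bsub>F\<^esub> d x) | a x. a \<in> carrier K \<and> x \<in> carrier A}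
    \<union> {d (x \<otimes>\<^bsub>A\<^esub> y) \<ominus>\<^bsub>F\<^esub> (d x \<otimes>\<^bsub>F\<^esub> d y) | x y. x \<in> carrier A \<and> y \<in> carrier A}
    \<union> {d \<one>\<^bsub>A\<^esub> \<ominus>\<^bsub>F\<^esub> \<one>\<^bsub>F\<^esub>})"

definition fp_free ::
  "('k, 'm) ring_scheme \<Rightarrow> ('k, 'a, 'n) module_scheme \<Rightarrow> ('k, 'b, 'p) module_scheme
    \<Rightarrow> ('k, ('a + 'b) list \<Rightarrow> 'k) module"
  where "fp_free K A B = free_alg K (carrier A <+> carrier B)"

definition fp_ideal ::
  "('k, 'm) ring_scheme \<Rightarrow> ('k, 'a, 'n) module_scheme \<Rightarrow> ('k, 'b, 'p) module_scheme
    \<Rightarrow> (('a + 'b) list \<Rightarrow> 'k) set"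
  where "fp_ideal K A B =
    Idl\<^bsub>fp_free K A B\<^esub> (hom_rels K (fp_free K A B) A Inl \<union> hom_rels K (fp_free K A B) B Inr)"

definition free_product ::
  "('k, 'm) ring_scheme \<Rightarrow> ('k, 'a, 'n) module_scheme \<Rightarrow> ('k, 'b, 'p) module_scheme
    \<Rightarrow> ('k, (('a + 'b) list \<Rightarrow> 'k) set) module"
  where "free_product K A B = quot_alg (fp_free K A B) (fp_ideal K A B)"

definition fp_inl ::
  "('k, 'm) ring_scheme \<Rightarrow> ('k, 'a, 'n) module_scheme \<Rightarrow> ('k, 'b, 'p) module_scheme
    \<Rightarrow> 'a \<Rightarrow> (('a + 'b) list \<Rightarrow> 'k) set"
  where "fp_inl K A B x = fp_ideal K A B +>\<^bsub>fp_free K A B\<^esub> basis_elt K [Inl x]"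

definition fp_inr ::
  "('k, 'm) ring_scheme \<Rightarrow> ('k, 'a, 'n) module_scheme \<Rightarrow> ('k, 'b, 'p) module_scheme
    \<Rightarrow> 'b \<Rightarrow> (('a + 'b) list \<Rightarrow> 'k) set"
  where "fp_inr K A B y = fp_ideal K A B +>\<^bsub>fp_free K A B\<^esub> basis_elt K [Inr y]"


section \<open>Tensor products of algebras\<close>

text \<open>The tensor product over \<open>K\<close> of a list \<open>[A\<^sub>1, \<dots>, A\<^sub>n]\<close> of algebras (with elements of the
  same type): the vector space with basis \<open>A\<^sub>1 \<times> \<dots> \<times> A\<^sub>n\<close> modulo the subspace spanned by the
  multilinearity relations, with the product determined by
  \<open>(x\<^sub>1 \<otimes> \<dots> \<otimes> x\<^sub>n) (y\<^sub>1 \<otimes> \<dots> \<otimes> y\<^sub>n) = x\<^sub>1 y\<^sub>1 \<otimes> \<dots> \<otimes> x\<^sub>n y\<^sub>n\<close>. The latter is inherited from the monoid algebra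
  of the multiplicative monoid \<open>A\<^sub>1 \<times> \<dots> \<times> A\<^sub>n\<close>, in which that subspace is a two-sided ideal.
  Working with lists makes iterated tensor products associative on the nose.\<close>

definition prod_monoid :: "('k, 'a, 'n) module_scheme list \<Rightarrow> 'a list monoid"
  where "prod_monoid As =
    \<lparr>carrier = {xs. length xs = length As \<and> (\<forall>i<length As. xs ! i \<in> carrier (As ! i))},
     mult = (\<lambda>xs ys. map (\<lambda>i. xs ! i \<otimes>\<^bsub>As ! i\<^esub> ys ! i) [0..<length As]),
     one = map (\<lambda>A. \<one>\<^bsub>A\<^esub>) As\<rparr>"

definition multilin_rels ::
  "('k, 'm) ring_scheme \<Rightarrow> ('k, 'a, 'n) module_scheme list \<Rightarrow> ('a list \<Rightarrow> 'k) set"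
  where "multilin_rels K As = (let F = mon_alg K (prod_monoid As); d = basis_elt K in
      {d (xs[i := x \<oplus>\<^bsub>As ! i\<^esub> y]) \<ominus>\<^bsub>F\<^esub> (d (xs[i := x]) \<oplus>\<^bsub>F\<^esub> d (xs[i := y])) | xs i x y.
         xs \<in> carrier (prod_monoid As) \<and> i < length As \<and> x \<in> carrier (As ! i) \<and> y \<in> carrier (As ! i)}
    \<union> {d (xs[i := a \<odot>\<^bsub>As ! i\<^esub> x]) \<ominus>\<^bsub>F\<^esub> (a \<odot>\<^bsub>F\<^esub> d (xs[i := x])) | xs i a x.
         xs \<in> carrier (prod_monoid As) \<and> i < length As \<and> a \<in> carrier K \<and> x \<in> carrier (As ! i)})"

definition tensor_null ::
  "('k, 'm) ring_scheme \<Rightarrow> ('k, 'a, 'n) module_scheme list \<Rightarrow> ('a list \<Rightarrow> 'k) set"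
  where "tensor_null K As = lin_span K (mon_alg K (prod_monoid As)) (multilin_rels K As)"

definition tensor_alg ::
  "('k, 'm) ring_scheme \<Rightarrow> ('k, 'a, 'n) module_scheme list \<Rightarrow> ('k, ('a list \<Rightarrow> 'k) set) module"
  where "tensor_alg K As = quot_alg (mon_alg K (prod_monoid As)) (tensor_null K As)"

text \<open>\<open>pure K [A\<^sub>1, \<dots>, A\<^sub>n] [x\<^sub>1, \<dots>, x\<^sub>n]\<close> is \<open>x\<^sub>1 \<otimes> \<dots> \<otimes> x\<^sub>n\<close>.\<close>

definition pure ::
  "('k, 'm) ring_scheme \<Rightarrow> ('k, 'a, 'n) module_scheme list \<Rightarrow> 'a list \<Rightarrow> ('a list \<Rightarrow> 'k) set"
  where "pure K As xs = tensor_null K As +>\<^bsub>mon_alg K (prod_monoid As)\<^esub> basis_elt K xs"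

text \<open>For multilinear \<open>\<phi>\<close>, \<open>tensor_lift K W \<phi>\<close> is the linear map into \<open>W\<close> sending
  \<open>x\<^sub>1 \<otimes> \<dots> \<otimes> x\<^sub>n\<close> to \<open>\<phi> [x\<^sub>1, \<dots>, x\<^sub>n]\<close>: the value at \<open>t\<close> is computed on a representative of the
  coset \<open>t\<close>, and multilinearity makes the choice immaterial.\<close>

definition tensor_lift ::
  "('k, 'm) ring_scheme \<Rightarrow> ('k, 'w, 'n) module_scheme \<Rightarrow> ('a list \<Rightarrow> 'w) \<Rightarrow> ('a list \<Rightarrow> 'k) set \<Rightarrow> 'w"
  where "tensor_lift K W \<phi> t =
    (let f = (SOME f. f \<in> t) in \<Oplus>\<^bsub>W\<^esub>xs \<in> {xs. f xs \<noteq> \<zero>\<^bsub>K\<^esub>}. f xs \<odot>\<^bsub>W\<^esub> \<phi> xs)"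

text \<open>\<open>tensor_map K Bs [f\<^sub>1, \<dots>, f\<^sub>n]\<close> is \<open>f\<^sub>1 \<otimes> \<dots> \<otimes> f\<^sub>n\<close> with values in the tensor product of \<open>Bs\<close>.\<close>

definition tensor_map ::
  "('k, 'm) ring_scheme \<Rightarrow> ('k, 'b, 'n) module_scheme list \<Rightarrow> ('a \<Rightarrow> 'b) list
    \<Rightarrow> ('a list \<Rightarrow> 'k) set \<Rightarrow> ('b list \<Rightarrow> 'k) set"
  where "tensor_map K Bs fs =
    tensor_lift K (tensor_alg K Bs) (\<lambda>xs. pure K Bs (map2 (\<lambda>f x. f x) fs xs))"


section \<open>Hopf-Galois algebras\<close>

abbreviation tri :: "('k, 'a, 'n) module_scheme \<Rightarrow> ('k, 'a, 'n) module_scheme list"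
  where "tri R \<equiv> [R, op_alg R, R]"

abbreviation quin :: "('k, 'a, 'n) module_scheme \<Rightarrow> ('k, 'a, 'n) module_scheme list"
  where "quin R \<equiv> [R, op_alg R, R, op_alg R, R]"

text \<open>The maps \<open>\<mu> \<otimes> id \<otimes> id\<close> and \<open>id \<otimes> id \<otimes> \<mu>\<close> from \<open>R\<^sup>\<otimes>\<^sup>3\<close> to \<open>R\<^sup>\<otimes>\<^sup>5\<close>, then \<open>m \<otimes> id\<close> and \<open>id \<otimes> m\<close>
  from \<open>R\<^sup>\<otimes>\<^sup>3\<close> to \<open>R\<^sup>\<otimes>\<^sup>2\<close>, where \<open>m\<close> is the multiplication of \<open>R\<close> itself.\<close>

definition mu_id_id ::
  "('k, 'm) ring_scheme \<Rightarrow> ('k, 'a, 'n) module_scheme \<Rightarrow> ('a \<Rightarrow> ('a list \<Rightarrow> 'k) set)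
    \<Rightarrow> ('a list \<Rightarrow> 'k) set \<Rightarrow> ('a list \<Rightarrow> 'k) set"
  where "mu_id_id K R \<mu> = tensor_lift K (tensor_alg K (quin R))
    (\<lambda>xs. tensor_lift K (tensor_alg K (quin R)) (\<lambda>ys. pure K (quin R) (ys @ [xs ! 1, xs ! 2])) (\<mu> (xs ! 0)))"

definition id_id_mu ::
  "('k, 'm) ring_scheme \<Rightarrow> ('k, 'a, 'n) module_scheme \<Rightarrow> ('a \<Rightarrow> ('a list \<Rightarrow> 'k) set)
    \<Rightarrow> ('a list \<Rightarrow> 'k) set \<Rightarrow> ('a list \<Rightarrow> 'k) set"
  where "id_id_mu K R \<mu> = tensor_lift K (tensor_alg K (quin R))
    (\<lambda>xs. tensor_lift K (tensor_alg K (quin R)) (\<lambda>ys. pure K (quin R) ([xs ! 0, xs ! 1] @ ys)) (\<mu> (xs ! 2)))"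

definition mult_id ::
  "('k, 'm) ring_scheme \<Rightarrow> ('k, 'a, 'n) module_scheme \<Rightarrow> ('a list \<Rightarrow> 'k) set \<Rightarrow> ('a list \<Rightarrow> 'k) set"
  where "mult_id K R = tensor_lift K (tensor_alg K [R, R])
    (\<lambda>xs. pure K [R, R] [xs ! 0 \<otimes>\<^bsub>R\<^esub> xs ! 1, xs ! 2])"

definition id_mult ::
  "('k, 'm) ring_scheme \<Rightarrow> ('k, 'a, 'n) module_scheme \<Rightarrow> ('a list \<Rightarrow> 'k) set \<Rightarrow> ('a list \<Rightarrow> 'k) set"
  where "id_mult K R = tensor_lift K (tensor_alg K [R, R])
    (\<lambda>xs. pure K [R, R] [xs ! 0, xs ! 1 \<otimes>\<^bsub>R\<^esub> xs ! 2])"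

text \<open>With \<open>k \<otimes> R = R = R \<otimes> k\<close>, the maps \<open>\<eta> \<otimes> id\<close> and \<open>id \<otimes> \<eta>\<close> are \<open>r \<mapsto> 1 \<otimes> r\<close> and \<open>r \<mapsto> r \<otimes> 1\<close>.\<close>

locale hopf_galois_algebra = k_algebra K R for K and R (structure) +
  fixes \<mu> :: "'c \<Rightarrow> ('c list \<Rightarrow> 'a) set"
  assumes nonzero: "carrier R \<noteq> {\<zero>}"
    and mu_alg_hom: "\<mu> \<in> alg_hom K R (tensor_alg K (tri R))"
    and mu_coassoc: "r \<in> carrier R \<Longrightarrow> mu_id_id K R \<mu> (\<mu> r) = id_id_mu K R \<mu> (\<mu> r)"
    and mu_unit_left: "r \<in> carrier R \<Longrightarrow> mult_id K R (\<mu> r) = pure K [R, R] [\<one>, r]"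
    and mu_unit_right: "r \<in> carrier R \<Longrightarrow> id_mult K R (\<mu> r) = pure K [R, R] [r, \<one>]"

definition group_likes ::
  "('k, 'm) ring_scheme \<Rightarrow> ('k, 'a, 'n) module_scheme \<Rightarrow> ('a \<Rightarrow> ('a list \<Rightarrow> 'k) set) \<Rightarrow> 'a set"
  where "group_likes K R \<mu> = {g \<in> Units R. \<mu> g = pure K (tri R) [g, inv\<^bsub>R\<^esub> g, g]}"

definition quasi_central ::
  "('k, 'm) ring_scheme \<Rightarrow> ('k, 'a, 'n) module_scheme \<Rightarrow> ('a \<Rightarrow> ('a list \<Rightarrow> 'k) set) \<Rightarrow> 'a \<Rightarrow> bool"
  where "quasi_central K R \<mu> g \<longleftrightarrow> g \<in> group_likes K R \<mu> \<and>
    (\<exists>\<alpha> \<in> hom (R\<lparr>carrier := group_likes K R \<mu>\<rparr>) (units_of K).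
      \<forall>x \<in> group_likes K R \<mu>. x \<otimes>\<^bsub>R\<^esub> g = \<alpha> x \<odot>\<^bsub>R\<^esub> (g \<otimes>\<^bsub>R\<^esub> x))"

definition conj_by :: "('k, 'a, 'n) module_scheme \<Rightarrow> 'a \<Rightarrow> 'a \<Rightarrow> 'a"
  where "conj_by R g r = g \<otimes>\<^bsub>R\<^esub> r \<otimes>\<^bsub>R\<^esub> inv\<^bsub>R\<^esub> g"

text \<open>\<open>skew_prims K R \<mu> g h\<close> is the set written \<open>P\<^sup>0\<^sub>g\<^sub>,\<^sub>h(R)\<close> in the literature.\<close>

definition skew_prims ::
  "('k, 'm) ring_scheme \<Rightarrow> ('k, 'a, 'n) module_scheme \<Rightarrow> ('a \<Rightarrow> ('a list \<Rightarrow> 'k) set) \<Rightarrow> 'a \<Rightarrow> 'a \<Rightarrow> 'a set"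
  where "skew_prims K R \<mu> g h = {x \<in> carrier R.
    \<mu> x = pure K (tri R) [x, inv\<^bsub>R\<^esub> h, h]
      \<ominus>\<^bsub>tensor_alg K (tri R)\<^esub> pure K (tri R) [g, inv\<^bsub>R\<^esub> g \<otimes>\<^bsub>R\<^esub> x \<otimes>\<^bsub>R\<^esub> inv\<^bsub>R\<^esub> h, h]
      \<oplus>\<^bsub>tensor_alg K (tri R)\<^esub> pure K (tri R) [g, inv\<^bsub>R\<^esub> g, x]}"


section \<open>Generalized ambiskew polynomial algebras\<close>

definition twisted_center :: "('k, 'a, 'n) module_scheme \<Rightarrow> ('a \<Rightarrow> 'a) \<Rightarrow> 'a set"
  where "twisted_center R \<sigma> = {x \<in> carrier R. \<forall>r \<in> carrier R. x \<otimes>\<^bsub>R\<^esub> r = \<sigma> r \<otimes>\<^bsub>R\<^esub> x}"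

datatype xy = LetterX | LetterY

definition free_XY :: "('k, 'm) ring_scheme \<Rightarrow> ('k, xy list \<Rightarrow> 'k) module"
  where "free_XY K = free_alg K UNIV"

type_synonym ('k, 'a) fp_XY = "(('a + (xy list \<Rightarrow> 'k)) list \<Rightarrow> 'k) set"

definition ambiskew_ideal ::
  "('k, 'm) ring_scheme \<Rightarrow> ('k, 'a, 'n) module_scheme \<Rightarrow> ('a \<Rightarrow> 'a) \<Rightarrow> ('a \<Rightarrow> 'a) \<Rightarrow> 'a \<Rightarrow> 'k
    \<Rightarrow> ('k, 'a) fp_XY set"
  where "ambiskew_ideal K R \<tau> \<omega> c \<xi> =
    (let P = free_product K R (free_XY K);
         i = fp_inl K R (free_XY K);
         X = fp_inr K R (free_XY K) (basis_elt K [LetterX]);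
         Y = fp_inr K R (free_XY K) (basis_elt K [LetterY])
     in Idl\<^bsub>P\<^esub> ({X \<otimes>\<^bsub>P\<^esub> i r \<ominus>\<^bsub>P\<^esub> i (\<tau> r) \<otimes>\<^bsub>P\<^esub> X | r. r \<in> carrier R}
           \<union> {Y \<otimes>\<^bsub>P\<^esub> i r \<ominus>\<^bsub>P\<^esub> i (\<omega> r) \<otimes>\<^bsub>P\<^esub> Y | r. r \<in> carrier R}
           \<union> {(X \<otimes>\<^bsub>P\<^esub> Y \<ominus>\<^bsub>P\<^esub> \<xi> \<odot>\<^bsub>P\<^esub> (Y \<otimes>\<^bsub>P\<^esub> X)) \<ominus>\<^bsub>P\<^esub> i c}))"

definition ambiskew ::
  "('k, 'm) ring_scheme \<Rightarrow> ('k, 'a, 'n) module_scheme \<Rightarrow> ('a \<Rightarrow> 'a) \<Rightarrow> ('a \<Rightarrow> 'a) \<Rightarrow> 'a \<Rightarrow> 'k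
    \<Rightarrow> ('k, ('k, 'a) fp_XY set) module"
  where "ambiskew K R \<tau> \<omega> c \<xi> =
    quot_alg (free_product K R (free_XY K)) (ambiskew_ideal K R \<tau> \<omega> c \<xi>)"

definition ambiskew_proj ::
  "('k, 'm) ring_scheme \<Rightarrow> ('k, 'a, 'n) module_scheme \<Rightarrow> ('a \<Rightarrow> 'a) \<Rightarrow> ('a \<Rightarrow> 'a) \<Rightarrow> 'a \<Rightarrow> 'k
    \<Rightarrow> ('k, 'a) fp_XY \<Rightarrow> ('k, 'a) fp_XY set"
  where "ambiskew_proj K R \<tau> \<omega> c \<xi> p =
    ambiskew_ideal K R \<tau> \<omega> c \<xi> +>\<^bsub>free_product K R (free_XY K)\<^esub> p"

definition ambiskew_incl ::
  "('k, 'm) ring_scheme \<Rightarrow> ('k, 'a, 'n) module_scheme \<Rightarrow> ('a \<Rightarrow> 'a) \<Rightarrow> ('a \<Rightarrow> 'a) \<Rightarrow> 'a \<Rightarrow> 'k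
    \<Rightarrow> 'a \<Rightarrow> ('k, 'a) fp_XY set"
  where "ambiskew_incl K R \<tau> \<omega> c \<xi> r = ambiskew_proj K R \<tau> \<omega> c \<xi> (fp_inl K R (free_XY K) r)"

definition ambiskew_X ::
  "('k, 'm) ring_scheme \<Rightarrow> ('k, 'a, 'n) module_scheme \<Rightarrow> ('a \<Rightarrow> 'a) \<Rightarrow> ('a \<Rightarrow> 'a) \<Rightarrow> 'a \<Rightarrow> 'k
    \<Rightarrow> ('k, 'a) fp_XY set"
  where "ambiskew_X K R \<tau> \<omega> c \<xi> =
    ambiskew_proj K R \<tau> \<omega> c \<xi> (fp_inr K R (free_XY K) (basis_elt K [LetterX]))"

definition ambiskew_Y ::
  "('k, 'm) ring_scheme \<Rightarrow> ('k, 'a, 'n) module_scheme \<Rightarrow> ('a \<Rightarrow> 'a) \<Rightarrow> ('a \<Rightarrow> 'a) \<Rightarrow> 'a \<Rightarrow> 'k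
    \<Rightarrow> ('k, 'a) fp_XY set"
  where "ambiskew_Y K R \<tau> \<omega> c \<xi> =
    ambiskew_proj K R \<tau> \<omega> c \<xi> (fp_inr K R (free_XY K) (basis_elt K [LetterY]))"


section \<open>Hopf-Galois structures on ambiskew algebras\<close>

definition commuting_auts ::
  "('k, 'm) ring_scheme \<Rightarrow> ('k, 'a, 'n) module_scheme \<Rightarrow> ('a \<Rightarrow> 'a) \<Rightarrow> ('a \<Rightarrow> 'a) \<Rightarrow> bool"
  where "commuting_auts K R \<tau> \<omega> \<longleftrightarrow>
    \<tau> \<in> alg_aut K R \<and> \<omega> \<in> alg_aut K R \<and> (\<forall>r\<in>carrier R. \<tau> (\<omega> r) = \<omega> (\<tau> r))"

definition ambiskew_cond1 ::
  "('k, 'm) ring_scheme \<Rightarrow> ('k, 'a, 'n) module_scheme \<Rightarrow> ('a \<Rightarrow> ('a list \<Rightarrow> 'k) set)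
    \<Rightarrow> ('a \<Rightarrow> 'a) \<Rightarrow> ('a \<Rightarrow> 'a) \<Rightarrow> bool"
  where "ambiskew_cond1 K R \<mu> \<tau> \<omega> \<longleftrightarrow> commuting_auts K R \<tau> \<omega> \<and>
    (\<forall>r\<in>carrier R.
      \<mu> (\<tau> r) = tensor_map K (tri R) [\<tau>, id, id] (\<mu> r) \<and>
      tensor_map K (tri R) [\<tau>, id, id] (\<mu> r) = tensor_map K (tri R) [\<tau>, \<tau>, \<tau>] (\<mu> r) \<and>
      \<mu> (\<omega> r) = tensor_map K (tri R) [\<omega>, id, id] (\<mu> r) \<and>
      tensor_map K (tri R) [\<omega>, id, id] (\<mu> r) = tensor_map K (tri R) [\<omega>, \<omega>, \<omega>] (\<mu> r))"

definition ambiskew_cond2 ::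
  "('k, 'm) ring_scheme \<Rightarrow> ('k, 'a, 'n) module_scheme \<Rightarrow> ('a \<Rightarrow> ('a list \<Rightarrow> 'k) set)
    \<Rightarrow> ('a \<Rightarrow> 'a) \<Rightarrow> ('a \<Rightarrow> 'a) \<Rightarrow> 'a \<Rightarrow> 'a \<Rightarrow> bool"
  where "ambiskew_cond2 K R \<mu> \<tau> \<omega> g h \<longleftrightarrow>
    g \<in> group_likes K R \<mu> \<and> h \<in> group_likes K R \<mu> \<and>
    quasi_central K R \<mu> g \<and> quasi_central K R \<mu> h \<and>
    (\<forall>r\<in>carrier R.
      tensor_map K (tri R) [conj_by R g, conj_by R g, id] (\<mu> r)
        = tensor_map K (tri R) [\<tau>, \<tau>, id] (\<mu> r) \<and>
      tensor_map K (tri R) [conj_by R h, conj_by R h, id] (\<mu> r)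
        = tensor_map K (tri R) [\<omega>, \<omega>, id] (\<mu> r))"

definition ambiskew_cond3 ::
  "('k, 'm) ring_scheme \<Rightarrow> ('k, 'a, 'n) module_scheme \<Rightarrow> ('a \<Rightarrow> 'a) \<Rightarrow> ('a \<Rightarrow> 'a)
    \<Rightarrow> 'a \<Rightarrow> 'a \<Rightarrow> 'k \<Rightarrow> bool"
  where "ambiskew_cond3 K R \<tau> \<omega> g h \<xi> \<longleftrightarrow>
    \<xi> \<in> Units K \<and> \<tau> h = \<xi> \<odot>\<^bsub>R\<^esub> h \<and> \<omega> g = inv\<^bsub>K\<^esub> \<xi> \<odot>\<^bsub>R\<^esub> g"

definition ambiskew_cond4 ::
  "('k, 'm) ring_scheme \<Rightarrow> ('k, 'a, 'n) module_scheme \<Rightarrow> ('a \<Rightarrow> ('a list \<Rightarrow> 'k) set)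
    \<Rightarrow> ('a \<Rightarrow> 'a) \<Rightarrow> ('a \<Rightarrow> 'a) \<Rightarrow> 'a \<Rightarrow> 'a \<Rightarrow> 'a \<Rightarrow> bool"
  where "ambiskew_cond4 K R \<mu> \<tau> \<omega> g h c \<longleftrightarrow>
    c \<in> twisted_center R (\<tau> \<circ> \<omega>) \<inter> skew_prims K R \<mu> (g \<otimes>\<^bsub>R\<^esub> h) \<one>\<^bsub>R\<^esub>"

text \<open>\<open>M\<close> is a Hopf-Galois structure on the ambiskew algebra that extends \<open>\<mu>\<close> (via the canonical map
  from \<open>R\<close>) and has the prescribed values at \<open>X\<close> and \<open>Y\<close>.\<close>

definition extended_structure ::
  "('k, 'm) ring_scheme \<Rightarrow> ('k, 'a, 'n) module_scheme \<Rightarrow> ('a \<Rightarrow> ('a list \<Rightarrow> 'k) set)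
    \<Rightarrow> ('a \<Rightarrow> 'a) \<Rightarrow> ('a \<Rightarrow> 'a) \<Rightarrow> 'a \<Rightarrow> 'a \<Rightarrow> 'a \<Rightarrow> 'k
    \<Rightarrow> (('k, 'a) fp_XY set \<Rightarrow> (('k, 'a) fp_XY set list \<Rightarrow> 'k) set) \<Rightarrow> bool"
  where "extended_structure K R \<mu> \<tau> \<omega> g h c \<xi> M \<longleftrightarrow>
    (let A = ambiskew K R \<tau> \<omega> c \<xi>; T = tensor_alg K (tri A);
         i = ambiskew_incl K R \<tau> \<omega> c \<xi>;
         X = ambiskew_X K R \<tau> \<omega> c \<xi>; Y = ambiskew_Y K R \<tau> \<omega> c \<xi>
     in hopf_galois_algebra K A M \<and>
        (\<forall>r\<in>carrier R. M (i r) = tensor_map K (tri A) [i, i, i] (\<mu> r)) \<and>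
        M X = pure K (tri A) [X, \<one>\<^bsub>A\<^esub>, \<one>\<^bsub>A\<^esub>]
              \<ominus>\<^bsub>T\<^esub> pure K (tri A) [i g, i (inv\<^bsub>R\<^esub> g) \<otimes>\<^bsub>A\<^esub> X, \<one>\<^bsub>A\<^esub>]
              \<oplus>\<^bsub>T\<^esub> pure K (tri A) [i g, i (inv\<^bsub>R\<^esub> g), X] \<and>
        M Y = pure K (tri A) [Y, \<one>\<^bsub>A\<^esub>, \<one>\<^bsub>A\<^esub>]
              \<ominus>\<^bsub>T\<^esub> pure K (tri A) [i h, i (inv\<^bsub>R\<^esub> h) \<otimes>\<^bsub>A\<^esub> Y, \<one>\<^bsub>A\<^esub>]
              \<oplus>\<^bsub>T\<^esub> pure K (tri A) [i h, i (inv\<^bsub>R\<^esub> h), Y])"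

end

theory Submission
  imports Defs
begin

text \<open>By the universal property of \<open>A\<close>, an algebra map from \<open>A\<close> to \<open>A \<otimes> A\<^sup>o\<^sup>p \<otimes> A\<close> that extends \<open>\<mu>\<close> and has
  the prescribed values at \<open>X\<close> and \<open>Y\<close> exists if and only if these values satisfy the defining relations.
  In the relation for \<open>X r\<close>, moving \<open>X\<close> to the right in each tensor factor and comparing the coefficients of
  \<open>X \<otimes> 1 \<otimes> 1\<close>, \<open>1 \<otimes> X \<otimes> 1\<close> and \<open>1 \<otimes> 1 \<otimes> X\<close> gives three identities in \<open>R \<otimes> R\<^sup>o\<^sup>p \<otimes> R\<close> that together amount to
  conditions (1) and (2) for \<open>\<tau>\<close>, except for the character of \<open>g\<close>; similarly for \<open>Y\<close> and \<open>\<omega>\<close>. A group-like \<open>x\<close>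
  and its conjugate \<open>g x g\<^sup>-\<^sup>1\<close> are both proportional to \<open>\<tau> x\<close>, which yields the character. In the relation for
  \<open>X Y\<close>, the coefficients of \<open>X \<otimes> Y \<otimes> 1\<close> and \<open>Y \<otimes> X \<otimes> 1\<close> give condition (3), after which all mixed terms cancel
  and what remains is condition (4). A full PBW basis of \<open>A\<close> is not needed to compare coefficients: the actions of
  \<open>A\<close> on \<open>A / A X\<close> and on \<open>A / A Y\<close> provide left \<open>R\<close>-linear functionals that read off the coefficients of \<open>1\<close>,
  \<open>X\<close> and \<open>Y\<close>. Coassociativity is an equality of algebra maps and so needs checking on generators only; the unit
  axioms are not of this form, but the elements satisfying them still form a subalgebra.\<close>

section \<open>Linear maps, algebra homomorphisms and quotients\<close>

text \<open>Maps out of a tensor product are given by a choice of representative, so identities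
  between them are proved by linearity, on pure tensors. This is why statements about
  \<open>\<mu> r\<close> are phrased as equalities of \<open>tensor_map\<close>s and never in
  coordinates. The algebra \<open>A\<close> is a quotient whose size is a priori unknown: that it is
  nonzero, and that \<open>R\<close> and its triple tensor power embed, has to be extracted from
  explicit operators on sequences in \<open>R\<close>. The quotient by \<open>A X\<close> sees only
  powers of \<open>Y\<close>; the coefficient of \<open>X\<close> comes from the same construction
  after solving the last relation for \<open>Y X\<close>, which uses that \<open>\<xi>\<close> is
  invertible. Proportionality of group-likes needs a linear form on \<open>R\<close> with value 1 at
  \<open>\<one>\<close>; it comes from a maximal subspace avoiding \<open>\<one>\<close>. The unit
  axioms are stable under products because the middle factor multiplies in the opposite order: in a
  product \<open>s t\<close>, the two legs of one factor that are to be multiplied become adjacent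
  and collapse.\<close>

definition lin_maps ::
  "('k, 'm) ring_scheme \<Rightarrow> ('k, 'a, 'n) module_scheme \<Rightarrow> ('k, 'b, 'p) module_scheme \<Rightarrow> ('a \<Rightarrow> 'b) set"
  where "lin_maps K V W = {f \<in> carrier V \<rightarrow> carrier W.
    (\<forall>x\<in>carrier V. \<forall>y\<in>carrier V. f (x \<oplus>\<^bsub>V\<^esub> y) = f x \<oplus>\<^bsub>W\<^esub> f y) \<and>
    (\<forall>a\<in>carrier K. \<forall>x\<in>carrier V. f (a \<odot>\<^bsub>V\<^esub> x) = a \<odot>\<^bsub>W\<^esub> f x)}"

lemma lin_mapsI:
  assumes "\<And>x. x \<in> carrier V \<Longrightarrow> f x \<in> carrier W"
    and "\<And>x y. x \<in> carrier V \<Longrightarrow> y \<in> carrier V \<Longrightarrow> f (x \<oplus>\<^bsub>V\<^esub> y) = f x \<oplus>\<^bsub>W\<^esub> f y"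
    and "\<And>a x. a \<in> carrier K \<Longrightarrow> x \<in> carrier V \<Longrightarrow> f (a \<odot>\<^bsub>V\<^esub> x) = a \<odot>\<^bsub>W\<^esub> f x"
  shows "f \<in> lin_maps K V W"
  using assms by (auto simp: lin_maps_def)

lemma lin_closed: "f \<in> lin_maps K V W \<Longrightarrow> x \<in> carrier V \<Longrightarrow> f x \<in> carrier W"
  and lin_add: "f \<in> lin_maps K V W \<Longrightarrow> x \<in> carrier V \<Longrightarrow> y \<in> carrier V \<Longrightarrow> f (x \<oplus>\<^bsub>V\<^esub> y) = f x \<oplus>\<^bsub>W\<^esub> f y"
  and lin_smult: "f \<in> lin_maps K V W \<Longrightarrow> a \<in> carrier K \<Longrightarrow> x \<in> carrier V \<Longrightarrow> f (a \<odot>\<^bsub>V\<^esub> x) = a \<odot>\<^bsub>W\<^esub> f x"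
  by (auto simp: lin_maps_def)

lemma lin_zero:
  assumes "module K V" "module K W" "f \<in> lin_maps K V W"
  shows "f \<zero>\<^bsub>V\<^esub> = \<zero>\<^bsub>W\<^esub>"
proof -
  interpret V: module K V by fact
  interpret W: module K W by fact
  have "f (\<zero>\<^bsub>K\<^esub> \<odot>\<^bsub>V\<^esub> \<zero>\<^bsub>V\<^esub>) = \<zero>\<^bsub>K\<^esub> \<odot>\<^bsub>W\<^esub> f \<zero>\<^bsub>V\<^esub>"
    using assms(3) by (intro lin_smult) auto
  moreover have "f \<zero>\<^bsub>V\<^esub> \<in> carrier W"
    using assms(3) by (rule lin_closed) simp
  ultimately show ?thesis by simp
qed

lemma module_minus_smult:
  assumes "module K V" "x \<in> carrier V"
  shows "\<ominus>\<^bsub>V\<^esub> x = (\<ominus>\<^bsub>K\<^esub> \<one>\<^bsub>K\<^esub>) \<odot>\<^bsub>V\<^esub> x"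
proof -
  interpret V: module K V by fact
  show ?thesis using assms(2) by (simp add: V.smult_l_minus)
qed

lemma lin_minus:
  assumes "module K V" "module K W" "f \<in> lin_maps K V W" "x \<in> carrier V"
  shows "f (\<ominus>\<^bsub>V\<^esub> x) = \<ominus>\<^bsub>W\<^esub> f x"
proof -
  interpret V: module K V by fact
  show ?thesis
    using assms lin_closed[OF assms(3,4)]
    by (simp add: module_minus_smult[OF assms(1)] module_minus_smult[OF assms(2)] lin_smult)
qed

lemma lin_sub:
  assumes "module K V" "module K W" "f \<in> lin_maps K V W" "x \<in> carrier V" "y \<in> carrier V"
  shows "f (x \<ominus>\<^bsub>V\<^esub> y) = f x \<ominus>\<^bsub>W\<^esub> f y"
proof -
  interpret V: module K V by fact
  show ?thesis
    using assms by (simp add: a_minus_def lin_add lin_minus)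
qed

lemma diff_eq_zero_iff:
  assumes "abelian_group G" "x \<in> carrier G" "y \<in> carrier G"
  shows "x \<ominus>\<^bsub>G\<^esub> y = \<zero>\<^bsub>G\<^esub> \<longleftrightarrow> x = y"
proof -
  interpret abelian_group G by fact
  have "x = (x \<ominus>\<^bsub>G\<^esub> y) \<oplus>\<^bsub>G\<^esub> y" using assms by (simp add: a_minus_def a_assoc l_neg)
  then show ?thesis using assms by (metis a_minus_def l_zero r_neg)
qed

lemma lin_comp: "f \<in> lin_maps K V W \<Longrightarrow> g \<in> lin_maps K U V \<Longrightarrow> (\<lambda>x. f (g x)) \<in> lin_maps K U W"
  by (auto simp: lin_maps_def Pi_iff)

lemma lin_id: "(\<lambda>x. x) \<in> lin_maps K V V" "id \<in> lin_maps K V V"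
  by (auto simp: lin_maps_def)

text \<open>Linear maps are constrained on the carrier only, so values elsewhere may be changed
  freely; the module structure guarantees that sums and multiples stay in the carrier, where
  \<open>f\<close> and \<open>g\<close> agree.\<close>

lemma lin_cong: "f \<in> lin_maps K V W \<Longrightarrow> module K V \<Longrightarrow> (\<And>x. x \<in> carrier V \<Longrightarrow> f x = g x) \<Longrightarrow> g \<in> lin_maps K V W"
proof -
  assume *: "f \<in> lin_maps K V W" "module K V" "\<And>x. x \<in> carrier V \<Longrightarrow> f x = g x"
  interpret V: module K V by fact
  show ?thesis using *(1) by (auto simp: lin_maps_def Pi_iff *(3)[symmetric])
qed

lemma lin_plus:
  assumes "module K V" "module K W" "f \<in> lin_maps K V W" "g \<in> lin_maps K V W"
  shows "(\<lambda>x. f x \<oplus>\<^bsub>W\<^esub> g x) \<in> lin_maps K V W"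
proof -
  interpret V: module K V by fact
  interpret W: module K W by fact
  show ?thesis
  proof (rule lin_mapsI)
    fix x y assume xy: "x \<in> carrier V" "y \<in> carrier V"
    show "f (x \<oplus>\<^bsub>V\<^esub> y) \<oplus>\<^bsub>W\<^esub> g (x \<oplus>\<^bsub>V\<^esub> y) = (f x \<oplus>\<^bsub>W\<^esub> g x) \<oplus>\<^bsub>W\<^esub> (f y \<oplus>\<^bsub>W\<^esub> g y)"
      using assms(3,4) xy by (simp add: lin_add lin_closed W.M.add.m_ac)
  qed (use assms(3,4) in \<open>auto simp: lin_closed lin_smult W.smult_r_distr\<close>)
qed

lemma lin_scale:
  assumes "module K V" "module K W" "f \<in> lin_maps K V W" "a \<in> carrier K"
  shows "(\<lambda>x. a \<odot>\<^bsub>W\<^esub> f x) \<in> lin_maps K V W"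
proof -
  interpret V: module K V by fact
  interpret W: module K W by fact
  have *: "a \<odot>\<^bsub>W\<^esub> (b \<odot>\<^bsub>W\<^esub> y) = b \<odot>\<^bsub>W\<^esub> (a \<odot>\<^bsub>W\<^esub> y)" if "b \<in> carrier K" "y \<in> carrier W" for b y
    using that assms(4) cring.cring_simprules(14)[OF module.axioms(1)[OF assms(2)]]
    by (simp flip: W.smult_assoc1)
  show ?thesis
    using assms(3,4)
    by (intro lin_mapsI) (auto simp: lin_add lin_closed lin_smult W.smult_r_distr *)
qed

lemma alg_hom_lin: "f \<in> alg_hom K A B \<Longrightarrow> f \<in> lin_maps K A B"
  by (auto simp: alg_hom_def ring_hom_def lin_maps_def)

lemma alg_homI:
  assumes "f \<in> lin_maps K A B" "f \<one>\<^bsub>A\<^esub> = \<one>\<^bsub>B\<^esub>"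
    and "\<And>x y. x \<in> carrier A \<Longrightarrow> y \<in> carrier A \<Longrightarrow> f (x \<otimes>\<^bsub>A\<^esub> y) = f x \<otimes>\<^bsub>B\<^esub> f y"
  shows "f \<in> alg_hom K A B"
  using assms by (auto simp: alg_hom_def ring_hom_def lin_maps_def)

lemma alg_hom_mult: "f \<in> alg_hom K A B \<Longrightarrow> x \<in> carrier A \<Longrightarrow> y \<in> carrier A \<Longrightarrow> f (x \<otimes>\<^bsub>A\<^esub> y) = f x \<otimes>\<^bsub>B\<^esub> f y"
  and alg_hom_one: "f \<in> alg_hom K A B \<Longrightarrow> f \<one>\<^bsub>A\<^esub> = \<one>\<^bsub>B\<^esub>"
  and alg_hom_closed: "f \<in> alg_hom K A B \<Longrightarrow> x \<in> carrier A \<Longrightarrow> f x \<in> carrier B"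
  and alg_hom_add: "f \<in> alg_hom K A B \<Longrightarrow> x \<in> carrier A \<Longrightarrow> y \<in> carrier A \<Longrightarrow> f (x \<oplus>\<^bsub>A\<^esub> y) = f x \<oplus>\<^bsub>B\<^esub> f y"
  and alg_hom_smult: "f \<in> alg_hom K A B \<Longrightarrow> a \<in> carrier K \<Longrightarrow> x \<in> carrier A \<Longrightarrow> f (a \<odot>\<^bsub>A\<^esub> x) = a \<odot>\<^bsub>B\<^esub> f x"
  by (auto simp: alg_hom_def ring_hom_def)

lemma alg_hom_comp:
  "f \<in> alg_hom K B C \<Longrightarrow> g \<in> alg_hom K A B \<Longrightarrow> (\<lambda>x. f (g x)) \<in> alg_hom K A C"
  by (auto simp: alg_hom_def ring_hom_def Pi_iff)

section \<open>Algebras as modules with a bilinear product\<close>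

lemma k_algebra_module: "k_algebra K A \<Longrightarrow> module K A"
  and k_algebra_ring: "k_algebra K A \<Longrightarrow> ring A"
  and k_algebra_field: "k_algebra K A \<Longrightarrow> field K"
  by (auto simp: k_algebra_def)

lemma k_algebraI:
  fixes A (structure)
  assumes "field K" "module K A"
    and "\<And>x y. x \<in> carrier A \<Longrightarrow> y \<in> carrier A \<Longrightarrow> x \<otimes> y \<in> carrier A"
    and "\<one> \<in> carrier A"
    and "\<And>x y z. x \<in> carrier A \<Longrightarrow> y \<in> carrier A \<Longrightarrow> z \<in> carrier A \<Longrightarrow> (x \<otimes> y) \<otimes> z = x \<otimes> (y \<otimes> z)"
    and "\<And>x. x \<in> carrier A \<Longrightarrow> \<one> \<otimes> x = x"
    and "\<And>x. x \<in> carrier A \<Longrightarrow> x \<otimes> \<one> = x"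
    and "\<And>x y z. x \<in> carrier A \<Longrightarrow> y \<in> carrier A \<Longrightarrow> z \<in> carrier A \<Longrightarrow> (x \<oplus> y) \<otimes> z = x \<otimes> z \<oplus> y \<otimes> z"
    and "\<And>x y z. x \<in> carrier A \<Longrightarrow> y \<in> carrier A \<Longrightarrow> z \<in> carrier A \<Longrightarrow> z \<otimes> (x \<oplus> y) = z \<otimes> x \<oplus> z \<otimes> y"
    and "\<And>a x y. a \<in> carrier K \<Longrightarrow> x \<in> carrier A \<Longrightarrow> y \<in> carrier A \<Longrightarrow> (a \<odot> x) \<otimes> y = a \<odot> (x \<otimes> y)"
    and "\<And>a x y. a \<in> carrier K \<Longrightarrow> x \<in> carrier A \<Longrightarrow> y \<in> carrier A \<Longrightarrow> x \<otimes> (a \<odot> y) = a \<odot> (x \<otimes> y)"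
  shows "k_algebra K A"
proof -
  interpret module K A by fact
  have "ring A" by (intro ringI monoidI M.abelian_group_axioms) (use assms in auto)
  then show ?thesis
    by (intro k_algebra.intro k_algebra_axioms.intro) (use assms in auto)
qed

lemma lin_left_mult: "k_algebra K A \<Longrightarrow> u \<in> carrier A \<Longrightarrow> (\<lambda>x. u \<otimes>\<^bsub>A\<^esub> x) \<in> lin_maps K A A"
proof -
  assume *: "k_algebra K A" "u \<in> carrier A"
  interpret k_algebra K A by fact
  show ?thesis using * by (intro lin_mapsI) (auto simp: A.r_distr smult_mult_right)
qed

lemma lin_right_mult: "k_algebra K A \<Longrightarrow> u \<in> carrier A \<Longrightarrow> (\<lambda>x. x \<otimes>\<^bsub>A\<^esub> u) \<in> lin_maps K A A"
proof -
  assume *: "k_algebra K A" "u \<in> carrier A"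
  interpret k_algebra K A by fact
  show ?thesis using * by (intro lin_mapsI) (auto simp: A.l_distr smult_mult_left)
qed

section \<open>Submodules, spans and agreement on a spanning set\<close>

lemma module_submoduleI:
  assumes "module K V" "N \<subseteq> carrier V" "\<zero>\<^bsub>V\<^esub> \<in> N"
    and "\<And>x y. x \<in> N \<Longrightarrow> y \<in> N \<Longrightarrow> x \<oplus>\<^bsub>V\<^esub> y \<in> N"
    and "\<And>a x. a \<in> carrier K \<Longrightarrow> x \<in> N \<Longrightarrow> a \<odot>\<^bsub>V\<^esub> x \<in> N"
  shows "submodule N K V"
proof -
  interpret V: module K V by fact
  show ?thesis
    using assms(2-5) module_minus_smult[OF assms(1)] by (intro V.submoduleI) auto
qed

lemma submodule_props:
  assumes "module K V" "submodule N K V"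
  shows "N \<subseteq> carrier V" "\<zero>\<^bsub>V\<^esub> \<in> N"
    and "\<And>x y. x \<in> N \<Longrightarrow> y \<in> N \<Longrightarrow> x \<oplus>\<^bsub>V\<^esub> y \<in> N"
    and "\<And>x y. x \<in> N \<Longrightarrow> y \<in> N \<Longrightarrow> x \<ominus>\<^bsub>V\<^esub> y \<in> N"
    and "\<And>a x. a \<in> carrier K \<Longrightarrow> x \<in> N \<Longrightarrow> a \<odot>\<^bsub>V\<^esub> x \<in> N"
proof -
  interpret V: module K V by fact
  note E = V.submoduleE[OF assms(2)]
  show "N \<subseteq> carrier V" by (rule E(1))
  show "\<zero>\<^bsub>V\<^esub> \<in> N" using subgroup.one_closed[OF submodule.axioms(1)[OF assms(2)]] by simp
qed (use module.submoduleE[OF assms] in \<open>auto simp: a_minus_def\<close>)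

lemma equalizer_submodule:
  assumes "module K V" "module K W" "f \<in> lin_maps K V W" "g \<in> lin_maps K V W"
  shows "submodule {x \<in> carrier V. f x = g x} K V"
proof -
  interpret V: module K V by fact
  show ?thesis
    by (rule module_submoduleI) (use assms in \<open>auto simp: lin_add lin_smult lin_zero\<close>)
qed

lemma preimage_submodule:
  assumes "module K V" "module K W" "f \<in> lin_maps K V W" "submodule N K W"
  shows "submodule {x \<in> carrier V. f x \<in> N} K V"
proof -
  interpret V: module K V by fact
  note N = submodule_props[OF assms(2,4)]
  show ?thesis
    by (rule module_submoduleI) (use assms N in \<open>auto simp: lin_add lin_smult lin_zero\<close>)
qed

lemma lin_span_minimal: "submodule N K V \<Longrightarrow> S \<subseteq> N \<Longrightarrow> lin_span K V S \<subseteq> N"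
  by (auto simp: lin_span_def)

lemma lin_span_superset: "S \<subseteq> lin_span K V S"
  by (auto simp: lin_span_def)

text \<open>The hypothesis on \<open>S\<close> makes the whole carrier one of the submodules being
  intersected; otherwise the family would be empty and its intersection the whole type.\<close>

lemma lin_span_submodule:
  assumes "module K V" "S \<subseteq> carrier V"
  shows "submodule (lin_span K V S) K V"
proof -
  interpret V: module K V by fact
  note C = V.carrier_is_submodule
  show ?thesis
  proof (rule module_submoduleI[OF assms(1)])
    show "lin_span K V S \<subseteq> carrier V" using C assms by (intro lin_span_minimal)
  qed (auto simp: lin_span_def intro!: submodule_props[OF assms(1)])
qed

text \<open>The equaliser of two linear maps is a submodule, so it contains the span of
  \<open>S\<close> as soon as it contains \<open>S\<close>. All identities between maps out of
  tensor products and monoid algebras rest on this.\<close>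

lemma lin_ext:
  assumes "module K V" "module K W" "lin_span K V S = carrier V"
    and "f \<in> lin_maps K V W" "g \<in> lin_maps K V W" "\<And>s. s \<in> S \<Longrightarrow> f s = g s" "x \<in> carrier V"
  shows "f x = g x"
proof -
  have "S \<subseteq> carrier V" using assms(3) lin_span_superset[of S K V] by simp
  then have "lin_span K V S \<subseteq> {x \<in> carrier V. f x = g x}"
    using assms by (intro lin_span_minimal equalizer_submodule) auto
  then show ?thesis using assms by blast
qed

lemma span_induct:
  assumes "submodule N K V" "lin_span K V S = carrier V" "\<And>s. s \<in> S \<Longrightarrow> s \<in> N" "x \<in> carrier V"
  shows "x \<in> N"
  using lin_span_minimal[OF assms(1), of S] assms by auto

section \<open>Two-sided ideals and quotient algebras\<close>

lemma alg_hom_kernel_ideal: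
  assumes "k_algebra K A" "k_algebra K B" "f \<in> alg_hom K A B"
  shows "ideal {x \<in> carrier A. f x = \<zero>\<^bsub>B\<^esub>} A"
proof -
  interpret A: k_algebra K A by fact
  interpret B: k_algebra K B by fact
  have "ring_hom_ring A B f"
    using assms(3) by (intro ring_hom_ringI2 A.A.ring_axioms B.A.ring_axioms) (auto simp: alg_hom_def)
  then show ?thesis using ring_hom_ring.kernel_is_ideal[of A B f] by (simp add: a_kernel_def')
qed

text \<open>Scaling by \<open>a\<close> is multiplication by \<open>a \<odot> \<one>\<close>, so a
  ring ideal of an algebra is automatically a subspace and the quotient ring inherits the scalar
  action.\<close>

lemma ideal_smult:
  assumes "k_algebra K F" "ideal I F" "a \<in> carrier K" "x \<in> I"
  shows "a \<odot>\<^bsub>F\<^esub> x \<in> I"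
proof -
  interpret F: k_algebra K F by fact
  interpret ideal I F by fact
  have x: "x \<in> carrier F" using assms by (simp add: a_Hcarr)
  have "a \<odot>\<^bsub>F\<^esub> x = (a \<odot>\<^bsub>F\<^esub> \<one>\<^bsub>F\<^esub>) \<otimes>\<^bsub>F\<^esub> x"
    using assms x by (simp add: F.smult_mult_left)
  also have "\<dots> \<in> I" using assms by (intro I_l_closed) auto
  finally show ?thesis .
qed

lemma quot_alg_ops:
  assumes "k_algebra K F" "ideal I F"
  shows "carrier (quot_alg F I) = (\<lambda>x. I +>\<^bsub>F\<^esub> x) ` carrier F"
    and "\<zero>\<^bsub>quot_alg F I\<^esub> = I +>\<^bsub>F\<^esub> \<zero>\<^bsub>F\<^esub>"
    and "\<one>\<^bsub>quot_alg F I\<^esub> = I +>\<^bsub>F\<^esub> \<one>\<^bsub>F\<^esub>"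
    and "\<And>x y. x \<in> carrier F \<Longrightarrow> y \<in> carrier F \<Longrightarrow> (I +>\<^bsub>F\<^esub> x) \<oplus>\<^bsub>quot_alg F I\<^esub> (I +>\<^bsub>F\<^esub> y) = I +>\<^bsub>F\<^esub> (x \<oplus>\<^bsub>F\<^esub> y)"
    and "\<And>x y. x \<in> carrier F \<Longrightarrow> y \<in> carrier F \<Longrightarrow> (I +>\<^bsub>F\<^esub> x) \<otimes>\<^bsub>quot_alg F I\<^esub> (I +>\<^bsub>F\<^esub> y) = I +>\<^bsub>F\<^esub> (x \<otimes>\<^bsub>F\<^esub> y)"
    and "\<And>a x. a \<in> carrier K \<Longrightarrow> x \<in> carrier F \<Longrightarrow> a \<odot>\<^bsub>quot_alg F I\<^esub> (I +>\<^bsub>F\<^esub> x) = I +>\<^bsub>F\<^esub> (a \<odot>\<^bsub>F\<^esub> x)"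
    and "\<And>x y. x \<in> carrier F \<Longrightarrow> y \<in> carrier F \<Longrightarrow> (I +>\<^bsub>F\<^esub> x = I +>\<^bsub>F\<^esub> y) \<longleftrightarrow> x \<ominus>\<^bsub>F\<^esub> y \<in> I"
proof -
  interpret F: k_algebra K F by fact
  interpret ideal I F by fact
  show "carrier (quot_alg F I) = (\<lambda>x. I +>\<^bsub>F\<^esub> x) ` carrier F"
    by (auto simp: quot_alg_def FactRing_def A_RCOSETS_def')
  show "\<zero>\<^bsub>quot_alg F I\<^esub> = I +>\<^bsub>F\<^esub> \<zero>\<^bsub>F\<^esub>" "\<one>\<^bsub>quot_alg F I\<^esub> = I +>\<^bsub>F\<^esub> \<one>\<^bsub>F\<^esub>"
    by (auto simp: quot_alg_def FactRing_def a_rcos_const)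
  fix x y assume xy: "x \<in> carrier F" "y \<in> carrier F"
  show "(I +>\<^bsub>F\<^esub> x) \<oplus>\<^bsub>quot_alg F I\<^esub> (I +>\<^bsub>F\<^esub> y) = I +>\<^bsub>F\<^esub> (x \<oplus>\<^bsub>F\<^esub> y)"
    using xy by (simp add: quot_alg_def FactRing_def a_rcos_sum)
  show "(I +>\<^bsub>F\<^esub> x) \<otimes>\<^bsub>quot_alg F I\<^esub> (I +>\<^bsub>F\<^esub> y) = I +>\<^bsub>F\<^esub> (x \<otimes>\<^bsub>F\<^esub> y)"
    using xy by (simp add: quot_alg_def FactRing_def rcoset_mult_add)
  show "(I +>\<^bsub>F\<^esub> x = I +>\<^bsub>F\<^esub> y) \<longleftrightarrow> x \<ominus>\<^bsub>F\<^esub> y \<in> I"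
    using F.A.quotient_eq_iff_same_a_r_cos[OF assms(2) xy] by simp
next
  interpret F: k_algebra K F by fact
  interpret ideal I F by fact
  fix a x assume ax: "a \<in> carrier K" "x \<in> carrier F"
  \<comment> \<open>All representatives of a coset give the same coset after scaling, since their
    difference stays in \<open>I\<close>. Hence the union in the definition of the scalar action on
    cosets is a union of equal sets.\<close>
  have "I +>\<^bsub>F\<^esub> (a \<odot>\<^bsub>F\<^esub> x') = I +>\<^bsub>F\<^esub> (a \<odot>\<^bsub>F\<^esub> x)" if "x' \<in> I +>\<^bsub>F\<^esub> x" for x'
  proof -
    obtain i where i: "i \<in> I" "x' = i \<oplus>\<^bsub>F\<^esub> x" using \<open>x' \<in> I +>\<^bsub>F\<^esub> x\<close> by (auto simp: a_r_coset_def')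
    have ic: "i \<in> carrier F" "a \<odot>\<^bsub>F\<^esub> i \<in> I" using i ax ideal_smult[OF assms] by (auto simp: a_Hcarr)
    have "a \<odot>\<^bsub>F\<^esub> x' = a \<odot>\<^bsub>F\<^esub> i \<oplus>\<^bsub>F\<^esub> a \<odot>\<^bsub>F\<^esub> x" using i ic ax by (simp add: F.smult_r_distr)
    then have "I +>\<^bsub>F\<^esub> (a \<odot>\<^bsub>F\<^esub> x') = (I +>\<^bsub>F\<^esub> (a \<odot>\<^bsub>F\<^esub> i)) <+>\<^bsub>F\<^esub> (I +>\<^bsub>F\<^esub> (a \<odot>\<^bsub>F\<^esub> x))"
      using ic ax by (simp add: a_rcos_sum)
    also have "\<dots> = (I +>\<^bsub>F\<^esub> \<zero>\<^bsub>F\<^esub>) <+>\<^bsub>F\<^esub> (I +>\<^bsub>F\<^esub> (a \<odot>\<^bsub>F\<^esub> x))"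
      using ic(2) by (simp add: a_rcos_const)
    also have "\<dots> = I +>\<^bsub>F\<^esub> (a \<odot>\<^bsub>F\<^esub> x)" using ax by (subst a_rcos_sum) auto
    finally show ?thesis .
  qed
  then have "(\<Union>x'\<in>I +>\<^bsub>F\<^esub> x. I +>\<^bsub>F\<^esub> (a \<odot>\<^bsub>F\<^esub> x')) = (\<Union>x'\<in>I +>\<^bsub>F\<^esub> x. I +>\<^bsub>F\<^esub> (a \<odot>\<^bsub>F\<^esub> x))"
    by (intro SUP_cong refl)
  moreover have "x \<in> I +>\<^bsub>F\<^esub> x" using ax by (simp add: a_rcos_self)
  ultimately show "a \<odot>\<^bsub>quot_alg F I\<^esub> (I +>\<^bsub>F\<^esub> x) = I +>\<^bsub>F\<^esub> (a \<odot>\<^bsub>F\<^esub> x)"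
    by (auto simp: quot_alg_def simp del: UN_simps)
qed

lemma quot_alg_k_algebra:
  assumes "k_algebra K F" "ideal I F"
  shows "k_algebra K (quot_alg F I)"
proof -
  interpret F: k_algebra K F by fact
  note ops = quot_alg_ops[OF assms]
  have ab: "abelian_group (quot_alg F I)"
  proof (rule abelian_groupI)
    fix x assume "x \<in> carrier (quot_alg F I)"
    then obtain x' where x': "x' \<in> carrier F" "x = I +>\<^bsub>F\<^esub> x'" by (auto simp: ops(1))
    then have "(I +>\<^bsub>F\<^esub> (\<ominus>\<^bsub>F\<^esub> x')) \<oplus>\<^bsub>quot_alg F I\<^esub> x = \<zero>\<^bsub>quot_alg F I\<^esub>"
      by (simp add: ops F.M.l_neg)
    then show "\<exists>y\<in>carrier (quot_alg F I). y \<oplus>\<^bsub>quot_alg F I\<^esub> x = \<zero>\<^bsub>quot_alg F I\<^esub>"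
      using x' by (auto simp: ops(1))
  qed (auto simp: ops F.M.add.m_ac)
  show ?thesis
  proof (rule k_algebraI)
    show "module K (quot_alg F I)"
      by (rule moduleI[OF _ ab]) (auto simp: ops F.smult_l_distr F.smult_r_distr F.smult_assoc1 F.K.is_cring)
  qed (auto simp: ops F.K.field_axioms F.A.m_assoc F.A.l_distr F.A.r_distr F.smult_mult_left F.smult_mult_right)
qed

lemma quot_proj_hom:
  assumes "k_algebra K F" "ideal I F"
  shows "(\<lambda>x. I +>\<^bsub>F\<^esub> x) \<in> alg_hom K F (quot_alg F I)"
  by (rule alg_homI) (auto simp: quot_alg_ops[OF assms] ring.ring_simprules k_algebra_ring[OF assms(1)] intro!: lin_mapsI)

lemma quot_lift_exists:
  assumes "k_algebra K F" "ideal I F" "k_algebra K B" "f \<in> alg_hom K F B" "\<And>x. x \<in> I \<Longrightarrow> f x = \<zero>\<^bsub>B\<^esub>"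
  obtains g where "g \<in> alg_hom K (quot_alg F I) B" "\<And>x. x \<in> carrier F \<Longrightarrow> g (I +>\<^bsub>F\<^esub> x) = f x"
proof -
  interpret F: k_algebra K F by fact
  interpret B: k_algebra K B by fact
  note ops = quot_alg_ops[OF assms(1,2)]
  \<comment> \<open>The value is taken at an arbitrary representative; two representatives differ by
    an element of \<open>I\<close>, where \<open>f\<close> vanishes.\<close>
  define g where "g t = f (SOME x. x \<in> carrier F \<and> t = I +>\<^bsub>F\<^esub> x)" for t
  have g: "g (I +>\<^bsub>F\<^esub> x) = f x" if x: "x \<in> carrier F" for x
  proof -
    define y where "y = (SOME y. y \<in> carrier F \<and> I +>\<^bsub>F\<^esub> x = I +>\<^bsub>F\<^esub> y)"
    have y: "y \<in> carrier F \<and> I +>\<^bsub>F\<^esub> x = I +>\<^bsub>F\<^esub> y"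
      unfolding y_def by (rule someI[of _ x]) (use x in auto)
    then have "x \<ominus>\<^bsub>F\<^esub> y \<in> I" using x ops(7) by auto
    then have "f (x \<ominus>\<^bsub>F\<^esub> y) = \<zero>\<^bsub>B\<^esub>" by (rule assms(5))
    then have "f x \<ominus>\<^bsub>B\<^esub> f y = \<zero>\<^bsub>B\<^esub>"
      using x y lin_sub[OF F.module_axioms B.module_axioms alg_hom_lin[OF assms(4)]] by simp
    then have "f x = f y"
      using x y alg_hom_closed[OF assms(4)] diff_eq_zero_iff[OF B.M.abelian_group_axioms] by auto
    then show ?thesis by (simp add: g_def y_def)
  qed
  have "g \<in> alg_hom K (quot_alg F I) B"
    by (rule alg_homI)
      (use assms(4) in \<open>auto simp: ops g alg_hom_closed alg_hom_one alg_hom_mult alg_hom_add alg_hom_smult intro!: lin_mapsI\<close>)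
  with g show ?thesis by (rule that[rotated])
qed

section \<open>Monoid algebras\<close>

lemma mon_alg_carrier:
  "f \<in> carrier (mon_alg K M) \<longleftrightarrow>
    (\<forall>x. f x \<in> carrier K) \<and> finite {x. f x \<noteq> \<zero>\<^bsub>K\<^esub>} \<and> {x. f x \<noteq> \<zero>\<^bsub>K\<^esub>} \<subseteq> carrier M"
  by (auto simp: mon_alg_def)

lemma mon_alg_add_apply: "(f \<oplus>\<^bsub>mon_alg K M\<^esub> g) x = f x \<oplus>\<^bsub>K\<^esub> g x"
  and mon_alg_smult_apply: "(a \<odot>\<^bsub>mon_alg K M\<^esub> f) x = a \<otimes>\<^bsub>K\<^esub> f x"
  and mon_alg_zero_apply: "\<zero>\<^bsub>mon_alg K M\<^esub> x = \<zero>\<^bsub>K\<^esub>"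
  and mon_alg_one: "\<one>\<^bsub>mon_alg K M\<^esub> = basis_elt K \<one>\<^bsub>M\<^esub>"
  by (simp_all add: mon_alg_def basis_elt_def)

lemmas mon_alg_apply = mon_alg_add_apply mon_alg_smult_apply mon_alg_zero_apply

lemma mon_alg_module:
  fixes K (structure)
  assumes "field K"
  shows "module K (mon_alg K M)"
proof -
  interpret field K by fact
  have add_closed: "f \<oplus>\<^bsub>mon_alg K M\<^esub> g \<in> carrier (mon_alg K M)"
    if "f \<in> carrier (mon_alg K M)" "g \<in> carrier (mon_alg K M)" for f g
  proof -
    have "{x. f x \<oplus> g x \<noteq> \<zero>} \<subseteq> {x. f x \<noteq> \<zero>} \<union> {x. g x \<noteq> \<zero>}"
      by auto
    then show ?thesis using that by (auto simp: mon_alg_carrier mon_alg_apply intro: finite_subset)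
  qed
  have smult_closed: "a \<odot>\<^bsub>mon_alg K M\<^esub> f \<in> carrier (mon_alg K M)"
    if "a \<in> carrier K" "f \<in> carrier (mon_alg K M)" for a f
  proof -
    have "{x. a \<otimes> f x \<noteq> \<zero>} \<subseteq> {x. f x \<noteq> \<zero>}"
      using that by auto
    then show ?thesis using that by (auto simp: mon_alg_carrier mon_alg_apply intro: finite_subset)
  qed
  have ab: "abelian_group (mon_alg K M)"
  proof (rule abelian_groupI)
    fix f assume f: "f \<in> carrier (mon_alg K M)"
    have "(\<ominus> \<one>) \<odot>\<^bsub>mon_alg K M\<^esub> f \<oplus>\<^bsub>mon_alg K M\<^esub> f = \<zero>\<^bsub>mon_alg K M\<^esub>"
      using f by (auto simp: mon_alg_carrier mon_alg_apply l_minus l_neg)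
    then show "\<exists>g\<in>carrier (mon_alg K M). g \<oplus>\<^bsub>mon_alg K M\<^esub> f = \<zero>\<^bsub>mon_alg K M\<^esub>"
      using smult_closed[of "\<ominus> \<one>" f] f by auto
  qed (auto simp: add_closed, auto simp: mon_alg_carrier mon_alg_apply a_ac)
  show ?thesis
    by (rule moduleI[OF is_cring ab])
      (auto simp: smult_closed, auto simp: mon_alg_carrier mon_alg_apply l_distr r_distr m_assoc)
qed

lemma basis_elt_closed:
  fixes K (structure)
  assumes *: "field K" "x \<in> carrier M"
  shows "basis_elt K x \<in> carrier (mon_alg K M)"
proof -
  interpret field K by fact
  have "{y. basis_elt K x y \<noteq> \<zero>} = {x}" by (auto simp: basis_elt_def)
  then show ?thesis using * by (auto simp: mon_alg_carrier) (auto simp: basis_elt_def)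
qed

lemma mon_alg_span:
  fixes K (structure)
  assumes "field K"
  shows "lin_span K (mon_alg K M) (basis_elt K ` carrier M) = carrier (mon_alg K M)"
proof -
  interpret field K by fact
  let ?F = "mon_alg K M" and ?N = "lin_span K (mon_alg K M) (basis_elt K ` carrier M)"
  have mod: "module K ?F" by (rule mon_alg_module[OF assms])
  have sub: "submodule ?N K ?F"
    using assms by (intro lin_span_submodule mod) (auto simp: basis_elt_closed)
  note N = submodule_props[OF mod sub]
  have B: "basis_elt K x \<in> ?N" if "x \<in> carrier M" for x
    using lin_span_superset[of "basis_elt K ` carrier M"] that by blast
  \<comment> \<open>The induction runs over a finite set bounding the support, rather than over the
    support itself, so that a point of the set at which \<open>f\<close> vanishes can simply be
    dropped.\<close>
  have "f \<in> ?N" if "finite S" "f \<in> carrier ?F" "{x. f x \<noteq> \<zero>} \<subseteq> S" for f S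
    using that
  proof (induction S arbitrary: f rule: finite_induct)
    case empty
    then have "f = \<zero>\<^bsub>?F\<^esub>" by (auto simp: mon_alg_apply)
    then show ?case using N(2) by simp
  next
    case (insert s S)
    show ?case
    proof (cases "f s = \<zero>")
      case True
      then show ?thesis using insert by (intro insert.IH) auto
    next
      case False
      then have s: "s \<in> carrier M" using insert.prems(1) by (auto simp: mon_alg_carrier)
      let ?g = "f(s := \<zero>)"
      have "{x. ?g x \<noteq> \<zero>} \<subseteq> {x. f x \<noteq> \<zero>}" by auto
      then have "?g \<in> carrier ?F" "{x. ?g x \<noteq> \<zero>} \<subseteq> S"
        using insert.prems by (auto simp: mon_alg_carrier intro: finite_subset)
      then have "?g \<in> ?N" by (rule insert.IH)
      moreover have "f s \<in> carrier K" using insert.prems(1) by (auto simp: mon_alg_carrier)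
      ultimately have "f s \<odot>\<^bsub>?F\<^esub> basis_elt K s \<oplus>\<^bsub>?F\<^esub> ?g \<in> ?N"
        using B[OF s] N by auto
      also have "f s \<odot>\<^bsub>?F\<^esub> basis_elt K s \<oplus>\<^bsub>?F\<^esub> ?g = f"
        using insert.prems(1) by (auto simp: mon_alg_apply mon_alg_carrier basis_elt_def)
      finally show ?thesis .
    qed
  qed
  then have "carrier ?F \<subseteq> ?N" by (auto simp: mon_alg_carrier)
  then show ?thesis using N(1) by auto
qed

text \<open>This is the sum inside \<open>tensor_lift\<close>, taken at a given function instead of
  a chosen representative of a coset; \<open>lift_coset\<close> connects the two.\<close>

definition lin_extend ::
  "('k, 'm) ring_scheme \<Rightarrow> ('k, 'w, 'n) module_scheme \<Rightarrow> ('b \<Rightarrow> 'w) \<Rightarrow> ('b \<Rightarrow> 'k) \<Rightarrow> 'w"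
  where "lin_extend K W \<phi> f = (\<Oplus>\<^bsub>W\<^esub>x \<in> {x. f x \<noteq> \<zero>\<^bsub>K\<^esub>}. f x \<odot>\<^bsub>W\<^esub> \<phi> x)"

text \<open>The support of a sum depends on cancellation. Summing over a common finite set
  containing all supports involved adds only zero terms and makes additivity a termwise
  statement.\<close>

lemma lin_extend_superset:
  fixes K (structure)
  assumes "field K" "module K W" "\<phi> \<in> carrier M \<rightarrow> carrier W" "f \<in> carrier (mon_alg K M)"
    and "finite S" "{x. f x \<noteq> \<zero>\<^bsub>K\<^esub>} \<subseteq> S" "S \<subseteq> carrier M"
  shows "lin_extend K W \<phi> f = (\<Oplus>\<^bsub>W\<^esub>x \<in> S. f x \<odot>\<^bsub>W\<^esub> \<phi> x)"
proof -
  interpret W: module K W by fact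
  show ?thesis
    unfolding lin_extend_def using assms
    by (intro W.M.add.finprod_mono_neutral_cong_left) (auto simp: Pi_iff mon_alg_carrier subset_iff)
qed

lemma lin_extend_lin:
  fixes K (structure)
  assumes "field K" "module K W" "\<phi> \<in> carrier M \<rightarrow> carrier W"
  shows "lin_extend K W \<phi> \<in> lin_maps K (mon_alg K M) W"
proof -
  interpret field K by fact
  interpret W: module K W by fact
  let ?F = "mon_alg K M"
  interpret F: module K ?F by (rule mon_alg_module[OF assms(1)])
  note ext = lin_extend_superset[OF assms]
  show ?thesis
  proof (rule lin_mapsI)
    fix f assume f: "f \<in> carrier ?F"
    show "lin_extend K W \<phi> f \<in> carrier W"
      unfolding lin_extend_def using f assms(3)
      by (intro W.M.finsum_closed) (auto simp: mon_alg_carrier)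
  next
    fix f g assume fg: "f \<in> carrier ?F" "g \<in> carrier ?F"
    define S where "S = {x. f x \<noteq> \<zero>} \<union> {x. g x \<noteq> \<zero>}"
    have S: "finite S" "S \<subseteq> carrier M" using fg by (auto simp: S_def mon_alg_carrier)
    have "lin_extend K W \<phi> (f \<oplus>\<^bsub>?F\<^esub> g) = (\<Oplus>\<^bsub>W\<^esub>x \<in> S. (f \<oplus>\<^bsub>?F\<^esub> g) x \<odot>\<^bsub>W\<^esub> \<phi> x)"
      by (rule ext) (use fg S in \<open>auto simp: S_def mon_alg_apply\<close>)
    also have "\<dots> = (\<Oplus>\<^bsub>W\<^esub>x \<in> S. f x \<odot>\<^bsub>W\<^esub> \<phi> x \<oplus>\<^bsub>W\<^esub> g x \<odot>\<^bsub>W\<^esub> \<phi> x)"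
      using fg S assms(3)
      by (intro W.M.finsum_cong') (auto simp: mon_alg_apply mon_alg_carrier Pi_iff subset_iff W.smult_l_distr)
    also have "\<dots> = (\<Oplus>\<^bsub>W\<^esub>x \<in> S. f x \<odot>\<^bsub>W\<^esub> \<phi> x) \<oplus>\<^bsub>W\<^esub> (\<Oplus>\<^bsub>W\<^esub>x \<in> S. g x \<odot>\<^bsub>W\<^esub> \<phi> x)"
      using fg S assms(3) by (intro W.M.finsum_addf) (auto simp: mon_alg_carrier Pi_iff subset_iff)
    also have "(\<Oplus>\<^bsub>W\<^esub>x \<in> S. f x \<odot>\<^bsub>W\<^esub> \<phi> x) = lin_extend K W \<phi> f"
      by (rule ext[symmetric]) (use fg S in \<open>auto simp: S_def\<close>)
    also have "(\<Oplus>\<^bsub>W\<^esub>x \<in> S. g x \<odot>\<^bsub>W\<^esub> \<phi> x) = lin_extend K W \<phi> g"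
      by (rule ext[symmetric]) (use fg S in \<open>auto simp: S_def\<close>)
    finally show "lin_extend K W \<phi> (f \<oplus>\<^bsub>?F\<^esub> g) = lin_extend K W \<phi> f \<oplus>\<^bsub>W\<^esub> lin_extend K W \<phi> g" .
  next
    fix a f assume af: "a \<in> carrier K" "f \<in> carrier ?F"
    define S where "S = {x. f x \<noteq> \<zero>}"
    have S: "finite S" "S \<subseteq> carrier M" using af by (auto simp: S_def mon_alg_carrier)
    have "lin_extend K W \<phi> (a \<odot>\<^bsub>?F\<^esub> f) = (\<Oplus>\<^bsub>W\<^esub>x \<in> S. (a \<odot>\<^bsub>?F\<^esub> f) x \<odot>\<^bsub>W\<^esub> \<phi> x)"
      by (rule ext) (use af S in \<open>auto simp: S_def mon_alg_apply\<close>)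
    also have "\<dots> = (\<Oplus>\<^bsub>W\<^esub>x \<in> S. a \<odot>\<^bsub>W\<^esub> (f x \<odot>\<^bsub>W\<^esub> \<phi> x))"
      using af S assms(3)
      by (intro W.M.finsum_cong') (auto simp: mon_alg_apply mon_alg_carrier Pi_iff subset_iff W.smult_assoc1)
    also have "\<dots> = a \<odot>\<^bsub>W\<^esub> (\<Oplus>\<^bsub>W\<^esub>x \<in> S. f x \<odot>\<^bsub>W\<^esub> \<phi> x)"
      using af S assms(3)
      by (intro W.finsum_smult_ldistr[symmetric]) (auto simp: mon_alg_carrier Pi_iff subset_iff)
    finally show "lin_extend K W \<phi> (a \<odot>\<^bsub>?F\<^esub> f) = a \<odot>\<^bsub>W\<^esub> lin_extend K W \<phi> f"
      by (simp add: lin_extend_def S_def)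
  qed
qed

lemma lin_extend_basis:
  fixes K (structure) and M :: "('b, 'n) monoid_scheme"
  assumes "field K" "module K W" "\<phi> \<in> carrier M \<rightarrow> carrier W" "x \<in> carrier M"
  shows "lin_extend K W \<phi> (basis_elt K x) = \<phi> x"
proof -
  interpret field K by fact
  interpret W: module K W by fact
  have x: "\<phi> x \<in> carrier W" using assms by auto
  have "lin_extend K W \<phi> (basis_elt K x) = (\<Oplus>\<^bsub>W\<^esub>y \<in> {x}. basis_elt K x y \<odot>\<^bsub>W\<^esub> \<phi> y)"
    by (rule lin_extend_superset[OF assms(1-3)]) (use assms basis_elt_closed[OF assms(1,4)] in \<open>auto simp: basis_elt_def\<close>)
  also have "\<dots> = basis_elt K x x \<odot>\<^bsub>W\<^esub> \<phi> x"
    using x by (subst W.M.finsum_insert) (auto simp: basis_elt_def)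
  finally show ?thesis using x by (simp add: basis_elt_def)
qed

text \<open>The convolution sums over the exact supports, which change under addition and scaling.
  Enlarging them to finite sets \<open>S\<close> and \<open>T\<close> lets bilinearity be checked
  over one index set.\<close>

lemma mon_alg_mult_superset:
  fixes K (structure)
  assumes "field K" "f \<in> carrier (mon_alg K M)" "g \<in> carrier (mon_alg K M)"
    and "finite S" "finite T" "{y. f y \<noteq> \<zero>\<^bsub>K\<^esub>} \<subseteq> S" "{z. g z \<noteq> \<zero>\<^bsub>K\<^esub>} \<subseteq> T"
  shows "(f \<otimes>\<^bsub>mon_alg K M\<^esub> g) x
    = (\<Oplus>\<^bsub>K\<^esub>p \<in> {p \<in> S \<times> T. fst p \<otimes>\<^bsub>M\<^esub> snd p = x}. f (fst p) \<otimes>\<^bsub>K\<^esub> g (snd p))"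
proof -
  interpret field K by fact
  have "(f \<otimes>\<^bsub>mon_alg K M\<^esub> g) x = (\<Oplus>\<^bsub>K\<^esub>p \<in> {(y, z). f y \<noteq> \<zero>\<^bsub>K\<^esub> \<and> g z \<noteq> \<zero>\<^bsub>K\<^esub> \<and> y \<otimes>\<^bsub>M\<^esub> z = x}. f (fst p) \<otimes>\<^bsub>K\<^esub> g (snd p))"
    by (simp add: mon_alg_def)
  also have "\<dots> = (\<Oplus>\<^bsub>K\<^esub>p \<in> {p \<in> S \<times> T. fst p \<otimes>\<^bsub>M\<^esub> snd p = x}. f (fst p) \<otimes>\<^bsub>K\<^esub> g (snd p))"
    using assms(2-)
    by (intro add.finprod_mono_neutral_cong_left) (auto simp: mon_alg_carrier)
  finally show ?thesis .
qed

lemma mon_alg_mult_closed: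
  fixes K (structure)
  assumes "field K" "monoid M" "f \<in> carrier (mon_alg K M)" "g \<in> carrier (mon_alg K M)"
  shows "f \<otimes>\<^bsub>mon_alg K M\<^esub> g \<in> carrier (mon_alg K M)"
proof -
  interpret field K by fact
  interpret M: monoid M by fact
  let ?S = "{y. f y \<noteq> \<zero>}" and ?T = "{z. g z \<noteq> \<zero>}"
  have fin: "finite ?S" "finite ?T" using assms by (auto simp: mon_alg_carrier)
  note eq = mon_alg_mult_superset[OF assms(1,3,4) fin subset_refl subset_refl]
  have sub: "{x. (f \<otimes>\<^bsub>mon_alg K M\<^esub> g) x \<noteq> \<zero>} \<subseteq> (\<lambda>p. fst p \<otimes>\<^bsub>M\<^esub> snd p) ` (?S \<times> ?T)"
  proof
    fix x assume "x \<in> {x. (f \<otimes>\<^bsub>mon_alg K M\<^esub> g) x \<noteq> \<zero>}"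
    then have "{p \<in> ?S \<times> ?T. fst p \<otimes>\<^bsub>M\<^esub> snd p = x} \<noteq> {}"
      by (auto simp only: eq finsum_empty)
    then show "x \<in> (\<lambda>p. fst p \<otimes>\<^bsub>M\<^esub> snd p) ` (?S \<times> ?T)" by force
  qed
  moreover have "(\<lambda>p. fst p \<otimes>\<^bsub>M\<^esub> snd p) ` (?S \<times> ?T) \<subseteq> carrier M"
    using assms(3,4) by (auto simp: mon_alg_carrier subset_iff intro!: M.m_closed)
  moreover have "(f \<otimes>\<^bsub>mon_alg K M\<^esub> g) x \<in> carrier K" for x
    unfolding eq using assms by (intro finsum_closed) (auto simp: mon_alg_carrier)
  ultimately show ?thesis
    using fin unfolding mon_alg_carrier by (auto intro: finite_subset)
qed

lemma mon_alg_mult_add: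
  fixes K (structure)
  assumes "field K" "monoid M" "f \<in> carrier (mon_alg K M)" "g \<in> carrier (mon_alg K M)" "h \<in> carrier (mon_alg K M)"
  shows "(f \<oplus>\<^bsub>mon_alg K M\<^esub> g) \<otimes>\<^bsub>mon_alg K M\<^esub> h = f \<otimes>\<^bsub>mon_alg K M\<^esub> h \<oplus>\<^bsub>mon_alg K M\<^esub> g \<otimes>\<^bsub>mon_alg K M\<^esub> h"
    and "h \<otimes>\<^bsub>mon_alg K M\<^esub> (f \<oplus>\<^bsub>mon_alg K M\<^esub> g) = h \<otimes>\<^bsub>mon_alg K M\<^esub> f \<oplus>\<^bsub>mon_alg K M\<^esub> h \<otimes>\<^bsub>mon_alg K M\<^esub> g"
proof -
  interpret field K by fact
  interpret F: module K "mon_alg K M" by (rule mon_alg_module[OF assms(1)])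
  let ?S = "{y. f y \<noteq> \<zero>} \<union> {y. g y \<noteq> \<zero>}" and ?T = "{z. h z \<noteq> \<zero>}"
  have fin: "finite ?S" "finite ?T" using assms by (auto simp: mon_alg_carrier)
  note eq = mon_alg_mult_superset[OF assms(1) _ _ fin] mon_alg_mult_superset[OF assms(1) _ _ fin(2,1)]
  have car: "f x \<in> carrier K" "g x \<in> carrier K" "h x \<in> carrier K" for x
    using assms by (auto simp: mon_alg_carrier)
  show "(f \<oplus>\<^bsub>mon_alg K M\<^esub> g) \<otimes>\<^bsub>mon_alg K M\<^esub> h = f \<otimes>\<^bsub>mon_alg K M\<^esub> h \<oplus>\<^bsub>mon_alg K M\<^esub> g \<otimes>\<^bsub>mon_alg K M\<^esub> h"
  proof
    fix x
    let ?P = "{p \<in> ?S \<times> ?T. fst p \<otimes>\<^bsub>M\<^esub> snd p = x}"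
    have "((f \<oplus>\<^bsub>mon_alg K M\<^esub> g) \<otimes>\<^bsub>mon_alg K M\<^esub> h) x = (\<Oplus>\<^bsub>K\<^esub>p \<in> ?P. (f \<oplus>\<^bsub>mon_alg K M\<^esub> g) (fst p) \<otimes>\<^bsub>K\<^esub> h (snd p))"
      by (rule eq(1)) (use assms in \<open>auto simp: mon_alg_apply\<close>)
    also have "\<dots> = (\<Oplus>\<^bsub>K\<^esub>p \<in> ?P. f (fst p) \<otimes>\<^bsub>K\<^esub> h (snd p) \<oplus> g (fst p) \<otimes>\<^bsub>K\<^esub> h (snd p))"
      by (intro finsum_cong') (auto simp: car mon_alg_apply l_distr)
    also have "\<dots> = (\<Oplus>\<^bsub>K\<^esub>p \<in> ?P. f (fst p) \<otimes>\<^bsub>K\<^esub> h (snd p)) \<oplus> (\<Oplus>\<^bsub>K\<^esub>p \<in> ?P. g (fst p) \<otimes>\<^bsub>K\<^esub> h (snd p))"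
      by (intro finsum_addf) (auto simp: car)
    also have "(\<Oplus>\<^bsub>K\<^esub>p \<in> ?P. f (fst p) \<otimes>\<^bsub>K\<^esub> h (snd p)) = (f \<otimes>\<^bsub>mon_alg K M\<^esub> h) x"
      by (rule eq(1)[symmetric]) (use assms in auto)
    also have "(\<Oplus>\<^bsub>K\<^esub>p \<in> ?P. g (fst p) \<otimes>\<^bsub>K\<^esub> h (snd p)) = (g \<otimes>\<^bsub>mon_alg K M\<^esub> h) x"
      by (rule eq(1)[symmetric]) (use assms in auto)
    finally show "((f \<oplus>\<^bsub>mon_alg K M\<^esub> g) \<otimes>\<^bsub>mon_alg K M\<^esub> h) x = (f \<otimes>\<^bsub>mon_alg K M\<^esub> h \<oplus>\<^bsub>mon_alg K M\<^esub> g \<otimes>\<^bsub>mon_alg K M\<^esub> h) x"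
      by (simp only: mon_alg_add_apply[of _ _ _ _ x])
  qed
  show "h \<otimes>\<^bsub>mon_alg K M\<^esub> (f \<oplus>\<^bsub>mon_alg K M\<^esub> g) = h \<otimes>\<^bsub>mon_alg K M\<^esub> f \<oplus>\<^bsub>mon_alg K M\<^esub> h \<otimes>\<^bsub>mon_alg K M\<^esub> g"
  proof
    fix x
    let ?P = "{p \<in> ?T \<times> ?S. fst p \<otimes>\<^bsub>M\<^esub> snd p = x}"
    have "(h \<otimes>\<^bsub>mon_alg K M\<^esub> (f \<oplus>\<^bsub>mon_alg K M\<^esub> g)) x = (\<Oplus>\<^bsub>K\<^esub>p \<in> ?P. h (fst p) \<otimes>\<^bsub>K\<^esub> (f \<oplus>\<^bsub>mon_alg K M\<^esub> g) (snd p))"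
      by (rule eq(2)) (use assms in \<open>auto simp: mon_alg_apply\<close>)
    also have "\<dots> = (\<Oplus>\<^bsub>K\<^esub>p \<in> ?P. h (fst p) \<otimes>\<^bsub>K\<^esub> f (snd p) \<oplus> h (fst p) \<otimes>\<^bsub>K\<^esub> g (snd p))"
      by (intro finsum_cong') (auto simp: car mon_alg_apply r_distr)
    also have "\<dots> = (\<Oplus>\<^bsub>K\<^esub>p \<in> ?P. h (fst p) \<otimes>\<^bsub>K\<^esub> f (snd p)) \<oplus> (\<Oplus>\<^bsub>K\<^esub>p \<in> ?P. h (fst p) \<otimes>\<^bsub>K\<^esub> g (snd p))"
      by (intro finsum_addf) (auto simp: car)
    also have "(\<Oplus>\<^bsub>K\<^esub>p \<in> ?P. h (fst p) \<otimes>\<^bsub>K\<^esub> f (snd p)) = (h \<otimes>\<^bsub>mon_alg K M\<^esub> f) x"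
      by (rule eq(2)[symmetric]) (use assms in auto)
    also have "(\<Oplus>\<^bsub>K\<^esub>p \<in> ?P. h (fst p) \<otimes>\<^bsub>K\<^esub> g (snd p)) = (h \<otimes>\<^bsub>mon_alg K M\<^esub> g) x"
      by (rule eq(2)[symmetric]) (use assms in auto)
    finally show "(h \<otimes>\<^bsub>mon_alg K M\<^esub> (f \<oplus>\<^bsub>mon_alg K M\<^esub> g)) x = (h \<otimes>\<^bsub>mon_alg K M\<^esub> f \<oplus>\<^bsub>mon_alg K M\<^esub> h \<otimes>\<^bsub>mon_alg K M\<^esub> g) x"
      by (simp only: mon_alg_add_apply[of _ _ _ _ x])
  qed
qed

lemma mon_alg_mult_smult:
  fixes K (structure)
  assumes "field K" "monoid M" "f \<in> carrier (mon_alg K M)" "g \<in> carrier (mon_alg K M)" "a \<in> carrier K"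
  shows "(a \<odot>\<^bsub>mon_alg K M\<^esub> f) \<otimes>\<^bsub>mon_alg K M\<^esub> g = a \<odot>\<^bsub>mon_alg K M\<^esub> (f \<otimes>\<^bsub>mon_alg K M\<^esub> g)"
    and "f \<otimes>\<^bsub>mon_alg K M\<^esub> (a \<odot>\<^bsub>mon_alg K M\<^esub> g) = a \<odot>\<^bsub>mon_alg K M\<^esub> (f \<otimes>\<^bsub>mon_alg K M\<^esub> g)"
proof -
  interpret field K by fact
  interpret F: module K "mon_alg K M" by (rule mon_alg_module[OF assms(1)])
  let ?S = "{y. f y \<noteq> \<zero>}" and ?T = "{z. g z \<noteq> \<zero>}"
  have fin: "finite ?S" "finite ?T" using assms by (auto simp: mon_alg_carrier)
  note eq = mon_alg_mult_superset[OF assms(1) _ _ fin]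
  have car: "f x \<in> carrier K" "g x \<in> carrier K" for x
    using assms by (auto simp: mon_alg_carrier)
  have *: "a \<otimes> (\<Oplus>\<^bsub>K\<^esub>p \<in> {p \<in> ?S \<times> ?T. fst p \<otimes>\<^bsub>M\<^esub> snd p = x}. f (fst p) \<otimes>\<^bsub>K\<^esub> g (snd p))
      = (\<Oplus>\<^bsub>K\<^esub>p \<in> {p \<in> ?S \<times> ?T. fst p \<otimes>\<^bsub>M\<^esub> snd p = x}. a \<otimes> (f (fst p) \<otimes>\<^bsub>K\<^esub> g (snd p)))" for x
    using fin assms(5) by (intro finsum_rdistr) (auto simp: car)
  have **: "(f \<otimes>\<^bsub>mon_alg K M\<^esub> g) x = (\<Oplus>\<^bsub>K\<^esub>p \<in> {p \<in> ?S \<times> ?T. fst p \<otimes>\<^bsub>M\<^esub> snd p = x}. f (fst p) \<otimes>\<^bsub>K\<^esub> g (snd p))" for x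
    by (rule eq) (use assms in auto)
  show "(a \<odot>\<^bsub>mon_alg K M\<^esub> f) \<otimes>\<^bsub>mon_alg K M\<^esub> g = a \<odot>\<^bsub>mon_alg K M\<^esub> (f \<otimes>\<^bsub>mon_alg K M\<^esub> g)"
  proof
    fix x
    let ?P = "{p \<in> ?S \<times> ?T. fst p \<otimes>\<^bsub>M\<^esub> snd p = x}"
    have "((a \<odot>\<^bsub>mon_alg K M\<^esub> f) \<otimes>\<^bsub>mon_alg K M\<^esub> g) x = (\<Oplus>\<^bsub>K\<^esub>p \<in> ?P. (a \<odot>\<^bsub>mon_alg K M\<^esub> f) (fst p) \<otimes>\<^bsub>K\<^esub> g (snd p))"
      by (rule eq) (use assms in \<open>auto simp: mon_alg_apply\<close>)
    also have "\<dots> = (\<Oplus>\<^bsub>K\<^esub>p \<in> ?P. a \<otimes> (f (fst p) \<otimes>\<^bsub>K\<^esub> g (snd p)))"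
      using assms(5) by (intro finsum_cong') (auto simp: car mon_alg_apply m_assoc)
    finally show "((a \<odot>\<^bsub>mon_alg K M\<^esub> f) \<otimes>\<^bsub>mon_alg K M\<^esub> g) x = (a \<odot>\<^bsub>mon_alg K M\<^esub> (f \<otimes>\<^bsub>mon_alg K M\<^esub> g)) x"
      by (simp add: mon_alg_apply * **)
  qed
  show "f \<otimes>\<^bsub>mon_alg K M\<^esub> (a \<odot>\<^bsub>mon_alg K M\<^esub> g) = a \<odot>\<^bsub>mon_alg K M\<^esub> (f \<otimes>\<^bsub>mon_alg K M\<^esub> g)"
  proof
    fix x
    let ?P = "{p \<in> ?S \<times> ?T. fst p \<otimes>\<^bsub>M\<^esub> snd p = x}"
    have "(f \<otimes>\<^bsub>mon_alg K M\<^esub> (a \<odot>\<^bsub>mon_alg K M\<^esub> g)) x = (\<Oplus>\<^bsub>K\<^esub>p \<in> ?P. f (fst p) \<otimes>\<^bsub>K\<^esub> (a \<odot>\<^bsub>mon_alg K M\<^esub> g) (snd p))"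
      by (rule eq) (use assms in \<open>auto simp: mon_alg_apply\<close>)
    also have "\<dots> = (\<Oplus>\<^bsub>K\<^esub>p \<in> ?P. a \<otimes> (f (fst p) \<otimes>\<^bsub>K\<^esub> g (snd p)))"
      using assms(5) by (intro finsum_cong') (auto simp: car mon_alg_apply m_lcomm)
    finally show "(f \<otimes>\<^bsub>mon_alg K M\<^esub> (a \<odot>\<^bsub>mon_alg K M\<^esub> g)) x = (a \<odot>\<^bsub>mon_alg K M\<^esub> (f \<otimes>\<^bsub>mon_alg K M\<^esub> g)) x"
      by (simp add: mon_alg_apply * **)
  qed
qed

lemma basis_elt_mult:
  fixes K (structure)
  assumes "field K" "y \<in> carrier M" "z \<in> carrier M"
  shows "basis_elt K y \<otimes>\<^bsub>mon_alg K M\<^esub> basis_elt K z = basis_elt K (y \<otimes>\<^bsub>M\<^esub> z)"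
proof
  fix x
  interpret field K by fact
  have "(basis_elt K y \<otimes>\<^bsub>mon_alg K M\<^esub> basis_elt K z) x
    = (\<Oplus>\<^bsub>K\<^esub>p \<in> {p \<in> {y} \<times> {z}. fst p \<otimes>\<^bsub>M\<^esub> snd p = x}. basis_elt K y (fst p) \<otimes> basis_elt K z (snd p))"
    using assms by (intro mon_alg_mult_superset basis_elt_closed) (auto simp: basis_elt_def)
  also have "{p \<in> {y} \<times> {z}. fst p \<otimes>\<^bsub>M\<^esub> snd p = x} = (if x = y \<otimes>\<^bsub>M\<^esub> z then {(y, z)} else {})"
    by auto
  also have "(\<Oplus>\<^bsub>K\<^esub>p \<in> \<dots>. basis_elt K y (fst p) \<otimes> basis_elt K z (snd p)) = basis_elt K (y \<otimes>\<^bsub>M\<^esub> z) x"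
    by (auto simp: basis_elt_def)
  finally show "(basis_elt K y \<otimes>\<^bsub>mon_alg K M\<^esub> basis_elt K z) x = basis_elt K (y \<otimes>\<^bsub>M\<^esub> z) x" .
qed

lemma mon_alg_k_algebra:
  fixes K (structure)
  assumes "field K" "monoid M"
  shows "k_algebra K (mon_alg K M)"
proof -
  let ?F = "mon_alg K M"
  interpret M: monoid M by fact
  note mod = mon_alg_module[OF assms(1), of M]
  note span = mon_alg_span[OF assms(1), of M]
  note closed = mon_alg_mult_closed[OF assms]
  note B = basis_elt_closed[OF assms(1), of _ M]
  have L: "(\<lambda>f. f \<otimes>\<^bsub>?F\<^esub> g) \<in> lin_maps K ?F ?F" and R: "(\<lambda>f. g \<otimes>\<^bsub>?F\<^esub> f) \<in> lin_maps K ?F ?F"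
    if "g \<in> carrier ?F" for g
    using that by (auto intro!: lin_mapsI simp: closed mon_alg_mult_add[OF assms] mon_alg_mult_smult[OF assms])
  have one: "\<one>\<^bsub>?F\<^esub> \<in> carrier ?F" by (simp add: mon_alg_one B)
  show ?thesis
  proof (rule k_algebraI[OF assms(1) mod])
    fix f g h assume f: "f \<in> carrier ?F" and g: "g \<in> carrier ?F" and h: "h \<in> carrier ?F"
    \<comment> \<open>Associativity is linear in each of the three arguments, so it is reduced one
      argument at a time to basis elements, where it is associativity in \<open>M\<close>.\<close>
    have "(\<lambda>f. f \<otimes>\<^bsub>?F\<^esub> g \<otimes>\<^bsub>?F\<^esub> h) f = (\<lambda>f. f \<otimes>\<^bsub>?F\<^esub> (g \<otimes>\<^bsub>?F\<^esub> h)) f"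
    proof (rule lin_ext[OF mod mod span _ _ _ f])
      show "(\<lambda>f. f \<otimes>\<^bsub>?F\<^esub> g \<otimes>\<^bsub>?F\<^esub> h) \<in> lin_maps K ?F ?F"
        by (rule lin_comp[OF L[OF h] L[OF g]])
      show "(\<lambda>f. f \<otimes>\<^bsub>?F\<^esub> (g \<otimes>\<^bsub>?F\<^esub> h)) \<in> lin_maps K ?F ?F"
        by (rule L[OF closed[OF g h]])
      fix s assume "s \<in> basis_elt K ` carrier M"
      then obtain x where x: "x \<in> carrier M" "s = basis_elt K x" by auto
      have s: "s \<in> carrier ?F" using x B by simp
      show "s \<otimes>\<^bsub>?F\<^esub> g \<otimes>\<^bsub>?F\<^esub> h = s \<otimes>\<^bsub>?F\<^esub> (g \<otimes>\<^bsub>?F\<^esub> h)"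
      proof (rule lin_ext[OF mod mod span _ _ _ g])
        show "(\<lambda>g. s \<otimes>\<^bsub>?F\<^esub> g \<otimes>\<^bsub>?F\<^esub> h) \<in> lin_maps K ?F ?F"
          by (rule lin_comp[OF L[OF h] R[OF s]])
        show "(\<lambda>g. s \<otimes>\<^bsub>?F\<^esub> (g \<otimes>\<^bsub>?F\<^esub> h)) \<in> lin_maps K ?F ?F"
          by (rule lin_comp[OF R[OF s] L[OF h]])
        fix t assume "t \<in> basis_elt K ` carrier M"
        then obtain y where y: "y \<in> carrier M" "t = basis_elt K y" by auto
        have t: "t \<in> carrier ?F" using y B by simp
        show "s \<otimes>\<^bsub>?F\<^esub> t \<otimes>\<^bsub>?F\<^esub> h = s \<otimes>\<^bsub>?F\<^esub> (t \<otimes>\<^bsub>?F\<^esub> h)"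
        proof (rule lin_ext[OF mod mod span _ _ _ h])
          show "(\<lambda>h. s \<otimes>\<^bsub>?F\<^esub> t \<otimes>\<^bsub>?F\<^esub> h) \<in> lin_maps K ?F ?F"
            by (rule R[OF closed[OF s t]])
          show "(\<lambda>h. s \<otimes>\<^bsub>?F\<^esub> (t \<otimes>\<^bsub>?F\<^esub> h)) \<in> lin_maps K ?F ?F"
            by (rule lin_comp[OF R[OF s] R[OF t]])
          fix u assume "u \<in> basis_elt K ` carrier M"
          then show "s \<otimes>\<^bsub>?F\<^esub> t \<otimes>\<^bsub>?F\<^esub> u = s \<otimes>\<^bsub>?F\<^esub> (t \<otimes>\<^bsub>?F\<^esub> u)"
            using x y by (auto simp: basis_elt_mult[OF assms(1)] M.m_assoc)
        qed
      qed
    qed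
    then show "f \<otimes>\<^bsub>?F\<^esub> g \<otimes>\<^bsub>?F\<^esub> h = f \<otimes>\<^bsub>?F\<^esub> (g \<otimes>\<^bsub>?F\<^esub> h)" .
  next
    fix f assume f: "f \<in> carrier ?F"
    show "\<one>\<^bsub>?F\<^esub> \<otimes>\<^bsub>?F\<^esub> f = f"
      by (rule lin_ext[OF mod mod span R[OF one] lin_id(1) _ f])
        (auto simp: mon_alg_one basis_elt_mult[OF assms(1)])
    show "f \<otimes>\<^bsub>?F\<^esub> \<one>\<^bsub>?F\<^esub> = f"
      by (rule lin_ext[OF mod mod span L[OF one] lin_id(1) _ f])
        (auto simp: mon_alg_one basis_elt_mult[OF assms(1)])
  qed (auto simp: closed one mon_alg_mult_add[OF assms] mon_alg_mult_smult[OF assms])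
qed

text \<open>Both sides of the multiplicativity equation are bilinear, so agreement on
  \<open>S\<close> extends first in the second argument and then in the first.\<close>

lemma alg_hom_from_span:
  assumes "k_algebra K A" "k_algebra K B" "lin_span K A S = carrier A"
    and "f \<in> lin_maps K A B" "f \<one>\<^bsub>A\<^esub> = \<one>\<^bsub>B\<^esub>"
    and "\<And>x y. x \<in> S \<Longrightarrow> y \<in> S \<Longrightarrow> f (x \<otimes>\<^bsub>A\<^esub> y) = f x \<otimes>\<^bsub>B\<^esub> f y"
  shows "f \<in> alg_hom K A B"
proof -
  note mod = k_algebra_module[OF assms(1)] k_algebra_module[OF assms(2)]
  have S: "s \<in> carrier A" if "s \<in> S" for s using that assms(3) lin_span_superset[of S K A] by auto
  have 1: "f (s \<otimes>\<^bsub>A\<^esub> y) = f s \<otimes>\<^bsub>B\<^esub> f y" if "s \<in> S" "y \<in> carrier A" for s y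
    by (rule lin_ext[OF mod assms(3) _ _ _ that(2)])
      (use assms(6) that in \<open>auto intro!: lin_comp[OF assms(4)] lin_comp[OF lin_left_mult[OF assms(2)] assms(4)]
        lin_left_mult[OF assms(1)] lin_closed[OF assms(4)] S\<close>)
  have "f (x \<otimes>\<^bsub>A\<^esub> y) = f x \<otimes>\<^bsub>B\<^esub> f y" if "x \<in> carrier A" "y \<in> carrier A" for x y
    by (rule lin_ext[OF mod assms(3) _ _ _ that(1)])
      (use 1 that in \<open>auto intro!: lin_comp[OF assms(4)] lin_comp[OF lin_right_mult[OF assms(2)] assms(4)]
        lin_right_mult[OF assms(1)] lin_closed[OF assms(4)]\<close>)
  then show ?thesis using assms by (intro alg_homI) auto
qed

lemma mon_alg_hom:
  fixes K (structure)
  assumes "field K" "monoid M" "k_algebra K B" "\<phi> \<in> carrier M \<rightarrow> carrier B" "\<phi> \<one>\<^bsub>M\<^esub> = \<one>\<^bsub>B\<^esub>"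
    and "\<And>x y. x \<in> carrier M \<Longrightarrow> y \<in> carrier M \<Longrightarrow> \<phi> (x \<otimes>\<^bsub>M\<^esub> y) = \<phi> x \<otimes>\<^bsub>B\<^esub> \<phi> y"
  shows "lin_extend K B \<phi> \<in> alg_hom K (mon_alg K M) B"
proof -
  interpret M: monoid M by fact
  note ext = lin_extend_basis[OF assms(1) k_algebra_module[OF assms(3)] assms(4)]
  show ?thesis
    by (rule alg_hom_from_span[OF mon_alg_k_algebra[OF assms(1,2)] assms(3) mon_alg_span[OF assms(1)]
          lin_extend_lin[OF assms(1) k_algebra_module[OF assms(3)] assms(4)]])
      (auto simp: mon_alg_one basis_elt_mult[OF assms(1)] ext assms(5,6))
qed

section \<open>Tensor products\<close>

text \<open>The preimage under the projection of the span of the image of \<open>S\<close> is a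
  submodule containing \<open>S\<close>, hence everything.\<close>

lemma quot_span:
  assumes "k_algebra K F" "ideal I F" "lin_span K F S = carrier F"
  shows "lin_span K (quot_alg F I) ((\<lambda>x. I +>\<^bsub>F\<^esub> x) ` S) = carrier (quot_alg F I)"
proof -
  let ?Q = "quot_alg F I" and ?p = "\<lambda>x. I +>\<^bsub>F\<^esub> x"
  note Q = k_algebra_module[OF quot_alg_k_algebra[OF assms(1,2)]]
  note p = alg_hom_lin[OF quot_proj_hom[OF assms(1,2)]]
  have S: "S \<subseteq> carrier F" using assms(3) lin_span_superset[of S K F] by simp
  have sub: "submodule (lin_span K ?Q (?p ` S)) K ?Q"
    by (rule lin_span_submodule[OF Q]) (use S lin_closed[OF p] in auto)
  have "carrier F \<subseteq> {x \<in> carrier F. ?p x \<in> lin_span K ?Q (?p ` S)}"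
    unfolding assms(3)[symmetric]
  proof (rule lin_span_minimal)
    show "submodule {x \<in> lin_span K F S. ?p x \<in> lin_span K ?Q (?p ` S)} K F"
      unfolding assms(3) by (rule preimage_submodule[OF k_algebra_module[OF assms(1)] Q p sub])
    show "S \<subseteq> {x \<in> lin_span K F S. ?p x \<in> lin_span K ?Q (?p ` S)}"
      using lin_span_superset[of S K F] lin_span_superset[of "?p ` S" K ?Q] by blast
  qed
  then show ?thesis
    using submodule_props(1)[OF Q sub] by (auto simp: quot_alg_ops(1)[OF assms(1,2)])
qed

definition alg_list :: "('k, 'm) ring_scheme \<Rightarrow> ('k, 'a, 'n) module_scheme list \<Rightarrow> bool"
  where "alg_list K As \<longleftrightarrow> field K \<and> (\<forall>i<length As. k_algebra K (As ! i))"

text \<open>Phrased with list updates, in the shape of \<open>multilin_rels\<close>, so that a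
  multilinear \<open>\<phi>\<close> kills each relation by the very equations it satisfies.\<close>

definition multilin ::
  "('k, 'm) ring_scheme \<Rightarrow> ('k, 'a, 'n) module_scheme list \<Rightarrow> ('k, 'w, 'p) module_scheme
    \<Rightarrow> ('a list \<Rightarrow> 'w) \<Rightarrow> bool"
  where "multilin K As W \<phi> \<longleftrightarrow> \<phi> \<in> carrier (prod_monoid As) \<rightarrow> carrier W \<and>
    (\<forall>xs\<in>carrier (prod_monoid As). \<forall>i<length As. \<forall>x\<in>carrier (As ! i).
      (\<forall>y\<in>carrier (As ! i). \<phi> (xs[i := x \<oplus>\<^bsub>As ! i\<^esub> y]) = \<phi> (xs[i := x]) \<oplus>\<^bsub>W\<^esub> \<phi> (xs[i := y])) \<and>
      (\<forall>a\<in>carrier K. \<phi> (xs[i := a \<odot>\<^bsub>As ! i\<^esub> x]) = a \<odot>\<^bsub>W\<^esub> \<phi> (xs[i := x])))"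

lemma prod_monoid_carrier:
  "xs \<in> carrier (prod_monoid As) \<longleftrightarrow> length xs = length As \<and> (\<forall>i<length As. xs ! i \<in> carrier (As ! i))"
  by (simp add: prod_monoid_def)

lemma prod_monoid_update:
  "xs \<in> carrier (prod_monoid As) \<Longrightarrow> x \<in> carrier (As ! i) \<Longrightarrow> xs[i := x] \<in> carrier (prod_monoid As)"
  by (auto simp: prod_monoid_carrier) (case_tac "ia = i"; simp)

lemma prod_monoid_mult_nth:
  "i < length As \<Longrightarrow> (xs \<otimes>\<^bsub>prod_monoid As\<^esub> ys) ! i = xs ! i \<otimes>\<^bsub>As ! i\<^esub> ys ! i"
  and prod_monoid_mult_length: "length (xs \<otimes>\<^bsub>prod_monoid As\<^esub> ys) = length As"
  by (simp_all add: prod_monoid_def)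

text \<open>Multiplying by a fixed list and changing one coordinate commute in this sense; therefore
  multiplication by a basis element carries multilinearity relations to multilinearity
  relations.\<close>

lemma prod_monoid_mult_update:
  assumes "length xs = length As"
  shows "ys \<otimes>\<^bsub>prod_monoid As\<^esub> xs[i := x] = (ys \<otimes>\<^bsub>prod_monoid As\<^esub> xs)[i := ys ! i \<otimes>\<^bsub>As ! i\<^esub> x]" (is ?l)
    and "xs[i := x] \<otimes>\<^bsub>prod_monoid As\<^esub> ys = (xs \<otimes>\<^bsub>prod_monoid As\<^esub> ys)[i := x \<otimes>\<^bsub>As ! i\<^esub> ys ! i]" (is ?r)
proof -
  have "(ys \<otimes>\<^bsub>prod_monoid As\<^esub> xs[i := x]) ! j = (ys \<otimes>\<^bsub>prod_monoid As\<^esub> xs)[i := ys ! i \<otimes>\<^bsub>As ! i\<^esub> x] ! j"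
    "(xs[i := x] \<otimes>\<^bsub>prod_monoid As\<^esub> ys) ! j = (xs \<otimes>\<^bsub>prod_monoid As\<^esub> ys)[i := x \<otimes>\<^bsub>As ! i\<^esub> ys ! i] ! j"
    if "j < length As" for j
    using that assms by (cases "i = j"; simp add: prod_monoid_mult_nth prod_monoid_mult_length)+
  then show ?l ?r
    by (simp_all add: list_eq_iff_nth_eq prod_monoid_mult_length)
qed

lemma prod_monoid_monoid:
  assumes "alg_list K As"
  shows "monoid (prod_monoid As)"
proof -
  have M: "monoid (As ! i)" if "i < length As" for i
    using assms that by (auto simp: alg_list_def k_algebra_def ring_def)
  show ?thesis
  proof (rule monoidI)
    fix xs ys zs
    assume "xs \<in> carrier (prod_monoid As)" "ys \<in> carrier (prod_monoid As)" "zs \<in> carrier (prod_monoid As)"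
    then show "xs \<otimes>\<^bsub>prod_monoid As\<^esub> ys \<otimes>\<^bsub>prod_monoid As\<^esub> zs = xs \<otimes>\<^bsub>prod_monoid As\<^esub> (ys \<otimes>\<^bsub>prod_monoid As\<^esub> zs)"
      by (intro nth_equalityI)
        (auto simp: prod_monoid_mult_nth prod_monoid_mult_length prod_monoid_carrier monoid.m_assoc[OF M])
  next
    fix xs assume "xs \<in> carrier (prod_monoid As)"
    moreover have "\<one>\<^bsub>prod_monoid As\<^esub> = map (\<lambda>A. \<one>\<^bsub>A\<^esub>) As" by (simp add: prod_monoid_def)
    ultimately show "\<one>\<^bsub>prod_monoid As\<^esub> \<otimes>\<^bsub>prod_monoid As\<^esub> xs = xs" "xs \<otimes>\<^bsub>prod_monoid As\<^esub> \<one>\<^bsub>prod_monoid As\<^esub> = xs"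
      by (auto simp: prod_monoid_mult_nth prod_monoid_mult_length prod_monoid_carrier
          monoid.l_one[OF M] monoid.r_one[OF M] intro!: nth_equalityI)
  qed (auto simp: prod_monoid_carrier prod_monoid_mult_nth prod_monoid_mult_length monoid.m_closed[OF M] monoid.one_closed[OF M],
    auto simp: prod_monoid_def monoid.one_closed[OF M])
qed

section \<open>The tensor product algebra and its universal property\<close>

context
  fixes K :: "('k, 'm) ring_scheme" and As :: "('k, 'a, 'n) module_scheme list"
  assumes algs: "alg_list K As"
begin

private abbreviation (input) "F \<equiv> mon_alg K (prod_monoid As)"
private abbreviation (input) "N \<equiv> tensor_null K As"
private abbreviation (input) "T \<equiv> tensor_alg K As"
private abbreviation (input) "C \<equiv> carrier (prod_monoid As)"

lemma alg_list_field: "field K"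
  using algs by (simp add: alg_list_def)

lemma alg_list_nth: "i < length As \<Longrightarrow> k_algebra K (As ! i)"
  using algs by (simp add: alg_list_def)

private lemma F_alg: "k_algebra K F"
  by (rule mon_alg_k_algebra[OF alg_list_field prod_monoid_monoid[OF algs]])

private lemma F_mod: "module K F"
  by (rule k_algebra_module[OF F_alg])

private lemma B: "xs \<in> C \<Longrightarrow> basis_elt K xs \<in> carrier F"
  by (rule basis_elt_closed[OF alg_list_field])

private lemma nth_add_closed:
  assumes "i < length As" "x \<in> carrier (As ! i)" "y \<in> carrier (As ! i)"
  shows "x \<oplus>\<^bsub>As ! i\<^esub> y \<in> carrier (As ! i)"
proof -
  interpret k_algebra K "As ! i" by (rule alg_list_nth[OF assms(1)])
  show ?thesis using assms by auto
qed

private lemma nth_smult_closed: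
  assumes "i < length As" "a \<in> carrier K" "x \<in> carrier (As ! i)"
  shows "a \<odot>\<^bsub>As ! i\<^esub> x \<in> carrier (As ! i)"
proof -
  interpret k_algebra K "As ! i" by (rule alg_list_nth[OF assms(1)])
  show ?thesis using assms by auto
qed

private lemmas nth_closed = nth_add_closed nth_smult_closed

private lemma rel_add:
  assumes "xs \<in> C" "i < length As" "x \<in> carrier (As ! i)" "y \<in> carrier (As ! i)"
  shows "basis_elt K (xs[i := x \<oplus>\<^bsub>As ! i\<^esub> y]) \<ominus>\<^bsub>F\<^esub> (basis_elt K (xs[i := x]) \<oplus>\<^bsub>F\<^esub> basis_elt K (xs[i := y]))
    \<in> multilin_rels K As"
  using assms by (auto simp: multilin_rels_def Let_def)

private lemma rel_smult:
  assumes "xs \<in> C" "i < length As" "x \<in> carrier (As ! i)" "a \<in> carrier K"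
  shows "basis_elt K (xs[i := a \<odot>\<^bsub>As ! i\<^esub> x]) \<ominus>\<^bsub>F\<^esub> (a \<odot>\<^bsub>F\<^esub> basis_elt K (xs[i := x])) \<in> multilin_rels K As"
  using assms by (auto simp: multilin_rels_def Let_def)

private lemma rels_cases:
  assumes "r \<in> multilin_rels K As"
  obtains (add) xs i x y where "xs \<in> C" "i < length As" "x \<in> carrier (As ! i)" "y \<in> carrier (As ! i)"
      "r = basis_elt K (xs[i := x \<oplus>\<^bsub>As ! i\<^esub> y]) \<ominus>\<^bsub>F\<^esub> (basis_elt K (xs[i := x]) \<oplus>\<^bsub>F\<^esub> basis_elt K (xs[i := y]))"
  | (smult) xs i x a where "xs \<in> C" "i < length As" "x \<in> carrier (As ! i)" "a \<in> carrier K"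
      "r = basis_elt K (xs[i := a \<odot>\<^bsub>As ! i\<^esub> x]) \<ominus>\<^bsub>F\<^esub> (a \<odot>\<^bsub>F\<^esub> basis_elt K (xs[i := x]))"
  using assms unfolding multilin_rels_def Let_def by blast

private lemma rels_closed: "multilin_rels K As \<subseteq> carrier F"
proof
  interpret F: k_algebra K F by (rule F_alg)
  fix r assume "r \<in> multilin_rels K As"
  then show "r \<in> carrier F"
    by (cases rule: rels_cases) (auto simp: nth_closed intro!: F.M.minus_closed B prod_monoid_update)
qed

private lemma N_sub: "submodule N K F"
  unfolding tensor_null_def by (rule lin_span_submodule[OF F_mod rels_closed])

text \<open>By distributivity and compatibility with scalars in the \<open>i\<close>-th factor,
  multiplying a relation in slot \<open>i\<close> by a basis element gives again a relation in slot
  \<open>i\<close>. Multiplication by a basis element is linear, so it preserves the span of the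
  relations.\<close>

private lemma N_mult_basis:
  assumes "ys \<in> C" "f \<in> N"
  shows "basis_elt K ys \<otimes>\<^bsub>F\<^esub> f \<in> N" "f \<otimes>\<^bsub>F\<^esub> basis_elt K ys \<in> N"
proof -
  interpret F: k_algebra K F by (rule F_alg)
  interpret P: monoid "prod_monoid As" by (rule prod_monoid_monoid[OF algs])
  let ?l = "\<lambda>f. basis_elt K ys \<otimes>\<^bsub>F\<^esub> f" and ?r = "\<lambda>f. f \<otimes>\<^bsub>F\<^esub> basis_elt K ys"
  note lin = lin_left_mult[OF F_alg B[OF assms(1)]] lin_right_mult[OF F_alg B[OF assms(1)]]
  have sub: "multilin_rels K As \<subseteq> N" unfolding tensor_null_def by (rule lin_span_superset)
  have "?l r \<in> multilin_rels K As \<and> ?r r \<in> multilin_rels K As" if "r \<in> multilin_rels K As" for r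
    using that
  proof (cases rule: rels_cases)
    case (add xs i x y)
    interpret A: k_algebra K "As ! i" by (rule alg_list_nth[OF add(2)])
    have c: "ys ! i \<in> carrier (As ! i)" "length xs = length As"
      using assms(1) add by (auto simp: prod_monoid_carrier)
    have b: "basis_elt K (xs[i := x \<oplus>\<^bsub>As ! i\<^esub> y]) \<in> carrier F" "basis_elt K (xs[i := x]) \<in> carrier F"
      "basis_elt K (xs[i := y]) \<in> carrier F"
      using add by (auto intro!: B prod_monoid_update)
    have "?l r = basis_elt K ((ys \<otimes>\<^bsub>prod_monoid As\<^esub> xs)[i := ys ! i \<otimes>\<^bsub>As ! i\<^esub> x \<oplus>\<^bsub>As ! i\<^esub> ys ! i \<otimes>\<^bsub>As ! i\<^esub> y])
      \<ominus>\<^bsub>F\<^esub> (basis_elt K ((ys \<otimes>\<^bsub>prod_monoid As\<^esub> xs)[i := ys ! i \<otimes>\<^bsub>As ! i\<^esub> x])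
        \<oplus>\<^bsub>F\<^esub> basis_elt K ((ys \<otimes>\<^bsub>prod_monoid As\<^esub> xs)[i := ys ! i \<otimes>\<^bsub>As ! i\<^esub> y]))"
      unfolding add(5) using add(1-4) assms(1) b c
      by (simp add: lin_sub[OF F_mod F_mod lin(1)] lin_add[OF lin(1)] basis_elt_mult[OF alg_list_field]
          prod_monoid_update prod_monoid_mult_update A.A.r_distr)
    moreover have "?r r = basis_elt K ((xs \<otimes>\<^bsub>prod_monoid As\<^esub> ys)[i := x \<otimes>\<^bsub>As ! i\<^esub> ys ! i \<oplus>\<^bsub>As ! i\<^esub> y \<otimes>\<^bsub>As ! i\<^esub> ys ! i])
      \<ominus>\<^bsub>F\<^esub> (basis_elt K ((xs \<otimes>\<^bsub>prod_monoid As\<^esub> ys)[i := x \<otimes>\<^bsub>As ! i\<^esub> ys ! i])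
        \<oplus>\<^bsub>F\<^esub> basis_elt K ((xs \<otimes>\<^bsub>prod_monoid As\<^esub> ys)[i := y \<otimes>\<^bsub>As ! i\<^esub> ys ! i]))"
      unfolding add(5) using add(1-4) assms(1) b c
      by (simp add: lin_sub[OF F_mod F_mod lin(2)] lin_add[OF lin(2)] basis_elt_mult[OF alg_list_field]
          prod_monoid_update prod_monoid_mult_update A.A.l_distr)
    ultimately show ?thesis using add assms(1) c by (auto intro!: rel_add)
  next
    case (smult xs i x a)
    interpret A: k_algebra K "As ! i" by (rule alg_list_nth[OF smult(2)])
    have c: "ys ! i \<in> carrier (As ! i)" "length xs = length As"
      using assms(1) smult by (auto simp: prod_monoid_carrier)
    have b: "basis_elt K (xs[i := a \<odot>\<^bsub>As ! i\<^esub> x]) \<in> carrier F" "basis_elt K (xs[i := x]) \<in> carrier F"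
      using smult by (auto intro!: B prod_monoid_update)
    have "?l r = basis_elt K ((ys \<otimes>\<^bsub>prod_monoid As\<^esub> xs)[i := a \<odot>\<^bsub>As ! i\<^esub> (ys ! i \<otimes>\<^bsub>As ! i\<^esub> x)])
      \<ominus>\<^bsub>F\<^esub> (a \<odot>\<^bsub>F\<^esub> basis_elt K ((ys \<otimes>\<^bsub>prod_monoid As\<^esub> xs)[i := ys ! i \<otimes>\<^bsub>As ! i\<^esub> x]))"
      unfolding smult(5) using smult(1-4) assms(1) b c
      by (simp add: lin_sub[OF F_mod F_mod lin(1)] lin_smult[OF lin(1)] basis_elt_mult[OF alg_list_field]
          prod_monoid_update prod_monoid_mult_update A.smult_mult_right)
    moreover have "?r r = basis_elt K ((xs \<otimes>\<^bsub>prod_monoid As\<^esub> ys)[i := a \<odot>\<^bsub>As ! i\<^esub> (x \<otimes>\<^bsub>As ! i\<^esub> ys ! i)])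
      \<ominus>\<^bsub>F\<^esub> (a \<odot>\<^bsub>F\<^esub> basis_elt K ((xs \<otimes>\<^bsub>prod_monoid As\<^esub> ys)[i := x \<otimes>\<^bsub>As ! i\<^esub> ys ! i]))"
      unfolding smult(5) using smult(1-4) assms(1) b c
      by (simp add: lin_sub[OF F_mod F_mod lin(2)] lin_smult[OF lin(2)] basis_elt_mult[OF alg_list_field]
          prod_monoid_update prod_monoid_mult_update A.smult_mult_left)
    ultimately show ?thesis using smult assms(1) c by (auto intro!: rel_smult)
  qed
  then have "multilin_rels K As \<subseteq> {f \<in> carrier F. ?l f \<in> N}" "multilin_rels K As \<subseteq> {f \<in> carrier F. ?r f \<in> N}"
    using rels_closed sub by blast+
  from lin_span_minimal[OF preimage_submodule[OF F_mod F_mod lin(1) N_sub] this(1)]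
    lin_span_minimal[OF preimage_submodule[OF F_mod F_mod lin(2) N_sub] this(2)]
  have "N \<subseteq> {f \<in> carrier F. ?l f \<in> N}" "N \<subseteq> {f \<in> carrier F. ?r f \<in> N}"
    by (simp_all only: tensor_null_def)
  then show "?l f \<in> N" "?r f \<in> N" using assms by blast+
qed

text \<open>The null space is defined as a linear span; only its being a two-sided ideal makes the
  product of cosets meaningful. Absorption is known for basis elements and extends to all elements
  because, for fixed \<open>f\<close>, the multipliers that keep \<open>f\<close> in the null space
  form a submodule.\<close>

private lemma N_ideal: "ideal N F"
proof (rule idealI)
  interpret F: k_algebra K F by (rule F_alg)
  show "ring F" by (rule F.A.ring_axioms)
  show "subgroup N (add_monoid F)" by (rule submodule.axioms(1)[OF N_sub])
  fix f g assume fg: "f \<in> N" "g \<in> carrier F"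
  have f: "f \<in> carrier F" using fg submodule_props(1)[OF F_mod N_sub] by auto
  have "g \<in> {g \<in> carrier F. g \<otimes>\<^bsub>F\<^esub> f \<in> N}"
    by (rule span_induct[OF preimage_submodule[OF F_mod F_mod lin_right_mult[OF F_alg f] N_sub]
          mon_alg_span[OF alg_list_field] _ fg(2)]) (use fg B N_mult_basis in auto)
  then show "g \<otimes>\<^bsub>F\<^esub> f \<in> N" by simp
  have "g \<in> {g \<in> carrier F. f \<otimes>\<^bsub>F\<^esub> g \<in> N}"
    by (rule span_induct[OF preimage_submodule[OF F_mod F_mod lin_left_mult[OF F_alg f] N_sub]
          mon_alg_span[OF alg_list_field] _ fg(2)]) (use fg B N_mult_basis in auto)
  then show "f \<otimes>\<^bsub>F\<^esub> g \<in> N" by simp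
qed

private lemmas ops = quot_alg_ops[OF F_alg N_ideal, folded tensor_alg_def]

lemma tensor_k_algebra: "k_algebra K T"
  unfolding tensor_alg_def by (rule quot_alg_k_algebra[OF F_alg N_ideal])

lemma tensor_module: "module K T"
  by (rule k_algebra_module[OF tensor_k_algebra])

lemma pure_closed: "xs \<in> C \<Longrightarrow> pure K As xs \<in> carrier T"
  using B by (auto simp: pure_def ops)

lemma tensor_span: "lin_span K T (pure K As ` C) = carrier T"
  using quot_span[OF F_alg N_ideal mon_alg_span[OF alg_list_field], folded tensor_alg_def]
  by (simp add: image_image pure_def[abs_def])

lemma pure_mult:
  "xs \<in> C \<Longrightarrow> ys \<in> C \<Longrightarrow> pure K As xs \<otimes>\<^bsub>T\<^esub> pure K As ys = pure K As (xs \<otimes>\<^bsub>prod_monoid As\<^esub> ys)"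
  using B by (simp add: pure_def ops basis_elt_mult[OF alg_list_field])

lemma pure_one: "\<one>\<^bsub>T\<^esub> = pure K As (map (\<lambda>A. \<one>\<^bsub>A\<^esub>) As)"
proof -
  have "\<one>\<^bsub>prod_monoid As\<^esub> = map (\<lambda>A. \<one>\<^bsub>A\<^esub>) As" by (simp add: prod_monoid_def)
  then show ?thesis by (simp add: pure_def ops mon_alg_one)
qed

lemma pure_multilin: "multilin K As T (pure K As)"
proof -
  interpret F: k_algebra K F by (rule F_alg)
  have sub: "multilin_rels K As \<subseteq> N" unfolding tensor_null_def by (rule lin_span_superset)
  have 1: "pure K As (xs[i := x \<oplus>\<^bsub>As ! i\<^esub> y]) = pure K As (xs[i := x]) \<oplus>\<^bsub>T\<^esub> pure K As (xs[i := y])"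
    if h: "xs \<in> C" "i < length As" "x \<in> carrier (As ! i)" "y \<in> carrier (As ! i)" for xs i x y
  proof -
    have b: "basis_elt K (xs[i := x \<oplus>\<^bsub>As ! i\<^esub> y]) \<in> carrier F" "basis_elt K (xs[i := x]) \<in> carrier F"
      "basis_elt K (xs[i := y]) \<in> carrier F"
      using h by (auto intro!: B prod_monoid_update simp: nth_closed)
    then show ?thesis
      unfolding pure_def using subsetD[OF sub rel_add[OF h]] by (simp add: ops)
  qed
  have 2: "pure K As (xs[i := a \<odot>\<^bsub>As ! i\<^esub> x]) = a \<odot>\<^bsub>T\<^esub> pure K As (xs[i := x])"
    if h: "xs \<in> C" "i < length As" "x \<in> carrier (As ! i)" "a \<in> carrier K" for xs i x a
  proof -
    have b: "basis_elt K (xs[i := a \<odot>\<^bsub>As ! i\<^esub> x]) \<in> carrier F" "basis_elt K (xs[i := x]) \<in> carrier F"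
      using h by (auto intro!: B prod_monoid_update simp: nth_closed)
    then show ?thesis
      unfolding pure_def using subsetD[OF sub rel_smult[OF h]] h by (simp add: ops)
  qed
  show ?thesis by (auto simp: multilin_def pure_closed 1 2)
qed

lemma tensor_ext:
  assumes "module K W" "f \<in> lin_maps K T W" "g \<in> lin_maps K T W"
    and "\<And>xs. xs \<in> C \<Longrightarrow> f (pure K As xs) = g (pure K As xs)" "t \<in> carrier T"
  shows "f t = g t"
  using assms(4) by (intro lin_ext[OF tensor_module assms(1) tensor_span assms(2,3) _ assms(5)]) auto

context
  fixes W :: "('k, 'w, 'p) module_scheme" and \<phi>
  assumes W: "module K W" and \<phi>: "multilin K As W \<phi>"
begin

private lemma \<phi>_closed: "\<phi> \<in> C \<rightarrow> carrier W"
  using \<phi> by (simp add: multilin_def)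

private lemma L_lin: "lin_extend K W \<phi> \<in> lin_maps K F W"
  by (rule lin_extend_lin[OF alg_list_field W \<phi>_closed])

text \<open>Multilinearity of \<open>\<phi>\<close> says that each relation goes to zero; the kernel
  of the linear extension then contains the span of the relations.\<close>

private lemma L_null:
  assumes "f \<in> N"
  shows "lin_extend K W \<phi> f = \<zero>\<^bsub>W\<^esub>"
proof -
  interpret F: k_algebra K F by (rule F_alg)
  interpret W: module K W by (rule W)
  note L = L_lin
  have z: "(\<lambda>f. \<zero>\<^bsub>W\<^esub>) \<in> lin_maps K F W" by (rule lin_mapsI) auto
  have "multilin_rels K As \<subseteq> {f \<in> carrier F. lin_extend K W \<phi> f = \<zero>\<^bsub>W\<^esub>}"
  proof
    fix r assume r: "r \<in> multilin_rels K As"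
    then have rc: "r \<in> carrier F" using rels_closed by auto
    have "lin_extend K W \<phi> r = \<zero>\<^bsub>W\<^esub>"
      using r
    proof (cases rule: rels_cases)
      case (add xs i x y)
      have c: "xs[i := x \<oplus>\<^bsub>As ! i\<^esub> y] \<in> C" "xs[i := x] \<in> C" "xs[i := y] \<in> C"
        using add by (auto intro!: prod_monoid_update simp: nth_closed)
      have "\<phi> (xs[i := x \<oplus>\<^bsub>As ! i\<^esub> y]) = \<phi> (xs[i := x]) \<oplus>\<^bsub>W\<^esub> \<phi> (xs[i := y])"
        using \<phi> add by (auto simp: multilin_def)
      then show ?thesis
        unfolding add(5) using c B \<phi>_closed
        by (simp add: lin_sub[OF F_mod W L] lin_add[OF L] lin_extend_basis[OF alg_list_field W \<phi>_closed]
            diff_eq_zero_iff[OF W.M.abelian_group_axioms] Pi_iff)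
    next
      case (smult xs i x a)
      have c: "xs[i := a \<odot>\<^bsub>As ! i\<^esub> x] \<in> C" "xs[i := x] \<in> C"
        using smult by (auto intro!: prod_monoid_update simp: nth_closed)
      have "\<phi> (xs[i := a \<odot>\<^bsub>As ! i\<^esub> x]) = a \<odot>\<^bsub>W\<^esub> \<phi> (xs[i := x])"
        using \<phi> smult by (auto simp: multilin_def)
      then show ?thesis
        unfolding smult(5) using c B \<phi>_closed smult(4)
        by (simp add: lin_sub[OF F_mod W L] lin_smult[OF L] lin_extend_basis[OF alg_list_field W \<phi>_closed]
            diff_eq_zero_iff[OF W.M.abelian_group_axioms] Pi_iff)
    qed
    with rc show "r \<in> {f \<in> carrier F. lin_extend K W \<phi> f = \<zero>\<^bsub>W\<^esub>}" by simp
  qed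
  from lin_span_minimal[OF equalizer_submodule[OF F_mod W L z] this] assms
  show ?thesis by (auto simp: tensor_null_def)
qed

text \<open>The choice made in \<open>tensor_lift\<close> is harmless: the chosen representative
  differs from \<open>f\<close> by an element of the null space, on which the linear extension
  vanishes.\<close>

private lemma lift_coset:
  assumes f: "f \<in> carrier F"
  shows "tensor_lift K W \<phi> (N +>\<^bsub>F\<^esub> f) = lin_extend K W \<phi> f"
proof -
  interpret F: k_algebra K F by (rule F_alg)
  interpret W: module K W by (rule W)
  interpret N: ideal N F by (rule N_ideal)
  define g where "g = (SOME g. g \<in> N +>\<^bsub>F\<^esub> f)"
  have "g \<in> N +>\<^bsub>F\<^esub> f" unfolding g_def by (rule someI[of _ f]) (use f in \<open>simp add: N.a_rcos_self\<close>)
  then obtain n where n: "n \<in> N" "g = n \<oplus>\<^bsub>F\<^esub> f" by (auto simp: a_r_coset_def')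
  have "lin_extend K W \<phi> g = lin_extend K W \<phi> f"
    using n f L_null[OF n(1)] lin_closed[OF L_lin f] N.a_Hcarr[OF n(1)] by (simp add: lin_add[OF L_lin])
  then show ?thesis by (simp add: tensor_lift_def Let_def g_def lin_extend_def)
qed

lemma tensor_lift_pure: "xs \<in> C \<Longrightarrow> tensor_lift K W \<phi> (pure K As xs) = \<phi> xs"
  unfolding pure_def using B by (simp add: lift_coset lin_extend_basis[OF alg_list_field W \<phi>_closed])

lemma tensor_lift_lin: "tensor_lift K W \<phi> \<in> lin_maps K T W"
proof -
  interpret F: k_algebra K F by (rule F_alg)
  show ?thesis
    by (rule lin_mapsI) (auto simp: ops lift_coset lin_closed[OF L_lin] lin_add[OF L_lin] lin_smult[OF L_lin])
qed

end

text \<open>Pure tensors span and are closed under multiplication, so multiplicativity of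
  \<open>\<phi>\<close> on lists is enough.\<close>

lemma tensor_lift_alg_hom:
  assumes "k_algebra K W" "multilin K As W \<phi>" "\<phi> (map (\<lambda>A. \<one>\<^bsub>A\<^esub>) As) = \<one>\<^bsub>W\<^esub>"
    and "\<And>xs ys. xs \<in> C \<Longrightarrow> ys \<in> C \<Longrightarrow> \<phi> (xs \<otimes>\<^bsub>prod_monoid As\<^esub> ys) = \<phi> xs \<otimes>\<^bsub>W\<^esub> \<phi> ys"
  shows "tensor_lift K W \<phi> \<in> alg_hom K T W"
proof -
  interpret P: monoid "prod_monoid As" by (rule prod_monoid_monoid[OF algs])
  have one: "map (\<lambda>A. \<one>\<^bsub>A\<^esub>) As \<in> C" using P.one_closed by (simp add: prod_monoid_def)
  note W = k_algebra_module[OF assms(1)]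
  show ?thesis
    by (rule alg_hom_from_span[OF tensor_k_algebra assms(1) tensor_span tensor_lift_lin[OF W assms(2)]])
      (auto simp: pure_one tensor_lift_pure[OF W assms(2)] one pure_mult assms(3,4))
qed

end

section \<open>Free products and ambiskew polynomial algebras\<close>

text \<open>Serves as an induction principle: a property whose elements form a subalgebra holds
  everywhere once it holds on generators. Equalisers of algebra maps and preimages are the typical
  instances.\<close>

definition subalg :: "('k, 'm) ring_scheme \<Rightarrow> ('k, 'a, 'n) module_scheme \<Rightarrow> 'a set \<Rightarrow> bool"
  where "subalg K A P \<longleftrightarrow> submodule P K A \<and> \<one>\<^bsub>A\<^esub> \<in> P \<and> (\<forall>x\<in>P. \<forall>y\<in>P. x \<otimes>\<^bsub>A\<^esub> y \<in> P)"

lemma subalg_preimage: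
  assumes "k_algebra K A" "k_algebra K B" "f \<in> alg_hom K A B" "subalg K B P"
  shows "subalg K A {x \<in> carrier A. f x \<in> P}"
proof -
  interpret A: k_algebra K A by fact
  show ?thesis
    using assms(4) preimage_submodule[OF k_algebra_module[OF assms(1)] k_algebra_module[OF assms(2)] alg_hom_lin[OF assms(3)], of P]
    by (auto simp: subalg_def alg_hom_one[OF assms(3)] alg_hom_mult[OF assms(3)])
qed

lemma subalg_equalizer:
  assumes "k_algebra K A" "k_algebra K B" "f \<in> alg_hom K A B" "g \<in> alg_hom K A B"
  shows "subalg K A {x \<in> carrier A. f x = g x}"
proof -
  interpret A: k_algebra K A by fact
  show ?thesis
    using equalizer_submodule[OF k_algebra_module[OF assms(1)] k_algebra_module[OF assms(2)]
        alg_hom_lin[OF assms(3)] alg_hom_lin[OF assms(4)]] assms(3,4)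
    by (auto simp: subalg_def alg_hom_one alg_hom_mult)
qed

lemma free_monoid: "monoid \<lparr>carrier = lists S, mult = (@), one = []\<rparr>"
  by (rule monoidI) auto

lemma free_alg_k_algebra: "field K \<Longrightarrow> k_algebra K (free_alg K S)"
  unfolding free_alg_def by (rule mon_alg_k_algebra[OF _ free_monoid])

lemma free_alg_letter: "field K \<Longrightarrow> s \<in> S \<Longrightarrow> basis_elt K [s] \<in> carrier (free_alg K S)"
  unfolding free_alg_def by (rule basis_elt_closed) auto

lemma free_alg_hom:
  assumes "field K" "k_algebra K B" "\<phi> \<in> S \<rightarrow> carrier B"
  obtains f where "f \<in> alg_hom K (free_alg K S) B" "\<And>s. s \<in> S \<Longrightarrow> f (basis_elt K [s]) = \<phi> s"
proof -
  interpret B: k_algebra K B by fact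
  let ?M = "\<lparr>carrier = lists S, mult = (@), one = []\<rparr>"
  define \<psi> where "\<psi> xs = foldr (\<lambda>s b. \<phi> s \<otimes>\<^bsub>B\<^esub> b) xs \<one>\<^bsub>B\<^esub>" for xs
  have closed: "\<psi> xs \<in> carrier B" if "xs \<in> lists S" for xs
    using that assms(3) by (induction xs) (auto simp: \<psi>_def)
  have app: "\<psi> (xs @ ys) = \<psi> xs \<otimes>\<^bsub>B\<^esub> \<psi> ys" if "xs \<in> lists S" "ys \<in> lists S" for xs ys
    using that(1)
  proof (induction xs)
    case (Cons s xs)
    then show ?case using assms(3) closed that(2)
      by (auto simp: \<psi>_def Pi_iff B.A.m_assoc)
  qed (use closed that in \<open>auto simp: \<psi>_def\<close>)
  have "lin_extend K B \<psi> \<in> alg_hom K (mon_alg K ?M) B"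
    by (rule mon_alg_hom[OF assms(1) free_monoid assms(2)]) (auto simp: closed app, simp add: \<psi>_def)
  moreover have "lin_extend K B \<psi> (basis_elt K [s]) = \<phi> s" if "s \<in> S" for s
  proof -
    have "lin_extend K B \<psi> (basis_elt K [s]) = \<psi> [s]"
      by (rule lin_extend_basis[OF assms(1) k_algebra_module[OF assms(2)], where M = ?M])
        (use that closed in auto)
    then show ?thesis using that assms(3) by (auto simp: \<psi>_def Pi_iff)
  qed
  ultimately show ?thesis using that unfolding free_alg_def by blast
qed

text \<open>Words are products of letters, and words span.\<close>

lemma free_alg_generated:
  assumes "field K" "subalg K (free_alg K S) P" "\<And>s. s \<in> S \<Longrightarrow> basis_elt K [s] \<in> P"
    and "x \<in> carrier (free_alg K S)"
  shows "x \<in> P"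
proof -
  let ?M = "\<lparr>carrier = lists S, mult = (@), one = []\<rparr>"
  have P: "subalg K (mon_alg K ?M) P" using assms(2) by (simp add: free_alg_def)
  have "basis_elt K xs \<in> P" if "xs \<in> lists S" for xs
    using that
  proof (induction xs)
    case Nil
    then show ?case using P by (simp add: subalg_def mon_alg_one)
  next
    case (Cons s xs)
    then have "basis_elt K [s] \<otimes>\<^bsub>mon_alg K ?M\<^esub> basis_elt K xs \<in> P"
      using P assms(3) by (auto simp: subalg_def)
    also have "basis_elt K [s] \<otimes>\<^bsub>mon_alg K ?M\<^esub> basis_elt K xs = basis_elt K (s # xs)"
      using Cons by (subst basis_elt_mult[OF assms(1)]) auto
    finally show ?case .
  qed
  then show ?thesis
    using span_induct[OF _ mon_alg_span[OF assms(1)], of P ?M x] P assms(4)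
    by (auto simp: subalg_def free_alg_def)
qed

lemma hom_rels_cases:
  assumes "r \<in> hom_rels K F A e"
  obtains (add) x y where "x \<in> carrier A" "y \<in> carrier A"
      "r = basis_elt K [e (x \<oplus>\<^bsub>A\<^esub> y)] \<ominus>\<^bsub>F\<^esub> (basis_elt K [e x] \<oplus>\<^bsub>F\<^esub> basis_elt K [e y])"
  | (smult) a x where "a \<in> carrier K" "x \<in> carrier A"
      "r = basis_elt K [e (a \<odot>\<^bsub>A\<^esub> x)] \<ominus>\<^bsub>F\<^esub> (a \<odot>\<^bsub>F\<^esub> basis_elt K [e x])"
  | (mult) x y where "x \<in> carrier A" "y \<in> carrier A"
      "r = basis_elt K [e (x \<otimes>\<^bsub>A\<^esub> y)] \<ominus>\<^bsub>F\<^esub> (basis_elt K [e x] \<otimes>\<^bsub>F\<^esub> basis_elt K [e y])"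
  | (one) "r = basis_elt K [e \<one>\<^bsub>A\<^esub>] \<ominus>\<^bsub>F\<^esub> \<one>\<^bsub>F\<^esub>"
  using assms unfolding hom_rels_def Let_def by blast

lemma hom_rels_closed:
  assumes "k_algebra K F" "k_algebra K A" "\<And>x. x \<in> carrier A \<Longrightarrow> basis_elt K [e x] \<in> carrier F"
  shows "hom_rels K F A e \<subseteq> carrier F"
proof
  interpret F: k_algebra K F by fact
  interpret A: k_algebra K A by fact
  fix r assume "r \<in> hom_rels K F A e"
  then show "r \<in> carrier F"
    by (cases rule: hom_rels_cases) (auto intro!: F.M.minus_closed assms(3))
qed

lemma hom_rels_null:
  assumes "k_algebra K F" "k_algebra K A" "\<And>x. x \<in> carrier A \<Longrightarrow> basis_elt K [e x] \<in> carrier F"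
    and "k_algebra K B" "h \<in> alg_hom K F B" "f \<in> alg_hom K A B"
    and "\<And>x. x \<in> carrier A \<Longrightarrow> h (basis_elt K [e x]) = f x" "r \<in> hom_rels K F A e"
  shows "h r = \<zero>\<^bsub>B\<^esub>"
proof -
  interpret F: k_algebra K F by fact
  interpret A: k_algebra K A by fact
  interpret B: k_algebra K B by fact
  note sub = lin_sub[OF F.module_axioms B.module_axioms alg_hom_lin[OF assms(5)]]
  note zero = diff_eq_zero_iff[OF B.M.abelian_group_axioms]
  note h = alg_hom_add[OF assms(5)] alg_hom_mult[OF assms(5)] alg_hom_smult[OF assms(5)] alg_hom_one[OF assms(5)]
  note f = alg_hom_add[OF assms(6)] alg_hom_mult[OF assms(6)] alg_hom_smult[OF assms(6)] alg_hom_one[OF assms(6)]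
    alg_hom_closed[OF assms(6)]
  from assms(8) show ?thesis
    by (cases rule: hom_rels_cases) (simp_all add: sub zero h f assms(3,7))
qed

lemma hom_rels_alg_hom:
  assumes "k_algebra K F" "k_algebra K A" "\<And>x. x \<in> carrier A \<Longrightarrow> basis_elt K [e x] \<in> carrier F"
    and "ideal I F" "hom_rels K F A e \<subseteq> I"
  shows "(\<lambda>x. I +>\<^bsub>F\<^esub> basis_elt K [e x]) \<in> alg_hom K A (quot_alg F I)"
proof -
  interpret F: k_algebra K F by fact
  interpret A: k_algebra K A by fact
  note ops = quot_alg_ops[OF assms(1,4)]
  have 1: "I +>\<^bsub>F\<^esub> basis_elt K [e (x \<oplus>\<^bsub>A\<^esub> y)] = I +>\<^bsub>F\<^esub> (basis_elt K [e x] \<oplus>\<^bsub>F\<^esub> basis_elt K [e y])"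
    "I +>\<^bsub>F\<^esub> basis_elt K [e (x \<otimes>\<^bsub>A\<^esub> y)] = I +>\<^bsub>F\<^esub> (basis_elt K [e x] \<otimes>\<^bsub>F\<^esub> basis_elt K [e y])"
    if "x \<in> carrier A" "y \<in> carrier A" for x y
    using that assms(5) by (subst ops(7); force simp: assms(3) hom_rels_def Let_def)+
  have 2: "I +>\<^bsub>F\<^esub> basis_elt K [e (a \<odot>\<^bsub>A\<^esub> x)] = I +>\<^bsub>F\<^esub> (a \<odot>\<^bsub>F\<^esub> basis_elt K [e x])"
    if "a \<in> carrier K" "x \<in> carrier A" for a x
    using that assms(5) by (subst ops(7)) (force simp: assms(3) hom_rels_def Let_def)+
  have 3: "I +>\<^bsub>F\<^esub> basis_elt K [e \<one>\<^bsub>A\<^esub>] = I +>\<^bsub>F\<^esub> \<one>\<^bsub>F\<^esub>"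
    using assms(5) by (subst ops(7)) (auto simp: assms(3) hom_rels_def Let_def)
  show ?thesis
    by (intro alg_homI lin_mapsI) (use assms(3) in \<open>auto simp: 1 2 3 ops\<close>)
qed

lemma genideal_null:
  assumes "k_algebra K A" "k_algebra K B" "f \<in> alg_hom K A B" "S \<subseteq> carrier A"
    and "\<And>s. s \<in> S \<Longrightarrow> f s = \<zero>\<^bsub>B\<^esub>" "x \<in> Idl\<^bsub>A\<^esub> S"
  shows "f x = \<zero>\<^bsub>B\<^esub>"
proof -
  interpret A: k_algebra K A by fact
  have "Idl\<^bsub>A\<^esub> S \<subseteq> {x \<in> carrier A. f x = \<zero>\<^bsub>B\<^esub>}"
    using assms(4,5) by (intro A.A.genideal_minimal alg_hom_kernel_ideal[OF assms(1-3)]) auto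
  then show ?thesis using assms(6) by auto
qed

section \<open>Free products: universal property and generation\<close>

context
  fixes K :: "('k, 'm) ring_scheme" and A :: "('k, 'a, 'n) module_scheme" and B :: "('k, 'b, 'p) module_scheme"
  assumes A: "k_algebra K A" and B: "k_algebra K B"
begin

private abbreviation (input) "FP \<equiv> fp_free K A B"
private abbreviation (input) "IP \<equiv> fp_ideal K A B"
private abbreviation (input) "prels \<equiv> hom_rels K FP A Inl \<union> hom_rels K FP B Inr"

private lemma FP: "k_algebra K FP"
  unfolding fp_free_def by (rule free_alg_k_algebra[OF k_algebra_field[OF A]])

private lemma letters:
  "x \<in> carrier A \<Longrightarrow> basis_elt K [Inl x] \<in> carrier FP" "y \<in> carrier B \<Longrightarrow> basis_elt K [Inr y] \<in> carrier FP"
  unfolding fp_free_def by (auto intro!: free_alg_letter[OF k_algebra_field[OF A]])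

private lemma prels_closed: "prels \<subseteq> carrier FP"
  using hom_rels_closed[where e = Inl, OF FP A letters(1)] hom_rels_closed[where e = Inr, OF FP B letters(2)] by blast

private lemma IP: "ideal IP FP" "prels \<subseteq> IP"
proof -
  interpret F: k_algebra K FP by (rule FP)
  show "ideal IP FP" "prels \<subseteq> IP"
    unfolding fp_ideal_def using F.A.genideal_ideal[OF prels_closed] F.A.genideal_self[OF prels_closed] by auto
qed

lemma free_product_k_algebra: "k_algebra K (free_product K A B)"
  unfolding free_product_def by (rule quot_alg_k_algebra[OF FP IP(1)])

lemma fp_inl_hom: "fp_inl K A B \<in> alg_hom K A (free_product K A B)"
  and fp_inr_hom: "fp_inr K A B \<in> alg_hom K B (free_product K A B)"
  unfolding fp_inl_def[abs_def] fp_inr_def[abs_def] free_product_def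
  using hom_rels_alg_hom[where e = Inl, OF FP A letters(1) IP(1)] hom_rels_alg_hom[where e = Inr, OF FP B letters(2) IP(1)] IP(2) by auto

lemma free_product_lift:
  assumes "k_algebra K D" "f \<in> alg_hom K A D" "g \<in> alg_hom K B D"
  obtains h where "h \<in> alg_hom K (free_product K A B) D"
    "\<And>x. x \<in> carrier A \<Longrightarrow> h (fp_inl K A B x) = f x" "\<And>y. y \<in> carrier B \<Longrightarrow> h (fp_inr K A B y) = g y"
proof -
  obtain h0 where h0: "h0 \<in> alg_hom K FP D"
    "\<And>s. s \<in> carrier A <+> carrier B \<Longrightarrow> h0 (basis_elt K [s]) = case_sum f g s"
    by (rule free_alg_hom[OF k_algebra_field[OF A] assms(1), of "case_sum f g" "carrier A <+> carrier B",
          folded fp_free_def]) (use assms in \<open>auto simp: alg_hom_closed\<close>)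
  have e: "h0 (basis_elt K [Inl x]) = f x" if "x \<in> carrier A" for x
    using h0(2)[of "Inl x"] that by auto
  have e': "h0 (basis_elt K [Inr y]) = g y" if "y \<in> carrier B" for y
    using h0(2)[of "Inr y"] that by auto
  \<comment> \<open>The relations are the equations of an algebra homomorphism, and \<open>f\<close>
    and \<open>g\<close> satisfy these equations.\<close>
  have "h0 r = \<zero>\<^bsub>D\<^esub>" if "r \<in> prels" for r
    using that hom_rels_null[where e = Inl, OF FP A letters(1) assms(1) h0(1) assms(2) e]
      hom_rels_null[where e = Inr, OF FP B letters(2) assms(1) h0(1) assms(3) e'] by blast
  then have "h0 x = \<zero>\<^bsub>D\<^esub>" if "x \<in> IP" for x
    using genideal_null[OF FP assms(1) h0(1) prels_closed] that by (auto simp: fp_ideal_def)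
  then obtain h where h: "h \<in> alg_hom K (free_product K A B) D" "\<And>x. x \<in> carrier FP \<Longrightarrow> h (IP +>\<^bsub>FP\<^esub> x) = h0 x"
    unfolding free_product_def using quot_lift_exists[OF FP IP(1) assms(1) h0(1)] by blast
  show ?thesis
    by (rule that[OF h(1)]) (auto simp: fp_inl_def fp_inr_def h(2) letters e e')
qed

text \<open>The subalgebra is pulled back along the projection from the word algebra, where it
  contains all letters.\<close>

lemma free_product_generated:
  assumes "subalg K (free_product K A B) P"
    and "\<And>x. x \<in> carrier A \<Longrightarrow> fp_inl K A B x \<in> P" "\<And>y. y \<in> carrier B \<Longrightarrow> fp_inr K A B y \<in> P"
    and "x \<in> carrier (free_product K A B)"
  shows "x \<in> P"
proof -
  let ?p = "\<lambda>x. IP +>\<^bsub>FP\<^esub> x"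
  have "subalg K FP {x \<in> carrier FP. ?p x \<in> P}"
    by (rule subalg_preimage[OF FP free_product_k_algebra _ assms(1)])
      (simp add: free_product_def quot_proj_hom[OF FP IP(1)])
  then have P: "subalg K (free_alg K (carrier A <+> carrier B)) {x \<in> carrier FP. ?p x \<in> P}"
    by (simp add: fp_free_def)
  have "y \<in> {x \<in> carrier FP. ?p x \<in> P}" if "y \<in> carrier FP" for y
    by (rule free_alg_generated[OF k_algebra_field[OF A] P])
      (use that letters assms(2,3) in \<open>auto simp: fp_inl_def fp_inr_def fp_free_def\<close>)
  then show ?thesis using assms(4) quot_alg_ops(1)[OF FP IP(1)] by (auto simp: free_product_def)
qed

end

section \<open>The ambiskew algebra: relations, universal property and generation\<close>

context
  fixes K :: "('k, 'm) ring_scheme" and R :: "('k, 'a, 'n) module_scheme" and \<tau> \<omega> c \<xi>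
  assumes R: "k_algebra K R" and \<tau>: "\<tau> \<in> alg_hom K R R" and \<omega>: "\<omega> \<in> alg_hom K R R"
    and c: "c \<in> carrier R" and \<xi>: "\<xi> \<in> carrier K"
begin

private abbreviation (input) "FR \<equiv> free_product K R (free_XY K)"
private abbreviation (input) "IA \<equiv> ambiskew_ideal K R \<tau> \<omega> c \<xi>"
private abbreviation (input) "inl \<equiv> fp_inl K R (free_XY K)"
private abbreviation (input) "pX \<equiv> fp_inr K R (free_XY K) (basis_elt K [LetterX])"
private abbreviation (input) "pY \<equiv> fp_inr K R (free_XY K) (basis_elt K [LetterY])"
private abbreviation (input) "A \<equiv> ambiskew K R \<tau> \<omega> c \<xi>"
private abbreviation (input) "i \<equiv> ambiskew_incl K R \<tau> \<omega> c \<xi>"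
private abbreviation (input) "XA \<equiv> ambiskew_X K R \<tau> \<omega> c \<xi>"
private abbreviation (input) "YA \<equiv> ambiskew_Y K R \<tau> \<omega> c \<xi>"
private abbreviation (input) "arels \<equiv> {pX \<otimes>\<^bsub>FR\<^esub> inl r \<ominus>\<^bsub>FR\<^esub> inl (\<tau> r) \<otimes>\<^bsub>FR\<^esub> pX | r. r \<in> carrier R}
           \<union> {pY \<otimes>\<^bsub>FR\<^esub> inl r \<ominus>\<^bsub>FR\<^esub> inl (\<omega> r) \<otimes>\<^bsub>FR\<^esub> pY | r. r \<in> carrier R}
           \<union> {(pX \<otimes>\<^bsub>FR\<^esub> pY \<ominus>\<^bsub>FR\<^esub> \<xi> \<odot>\<^bsub>FR\<^esub> (pY \<otimes>\<^bsub>FR\<^esub> pX)) \<ominus>\<^bsub>FR\<^esub> inl c}"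

private lemma K: "field K" by (rule k_algebra_field[OF R])

private lemma XY: "k_algebra K (free_XY K)"
  unfolding free_XY_def by (rule free_alg_k_algebra[OF K])

private lemma letter: "basis_elt K [l] \<in> carrier (free_XY K)"
  unfolding free_XY_def by (rule free_alg_letter[OF K]) simp

private lemma FR: "k_algebra K FR"
  by (rule free_product_k_algebra[OF R XY])

private lemmas inl = fp_inl_hom[OF R XY]
private lemmas inr = fp_inr_hom[OF R XY]

private lemma gen_closed: "pX \<in> carrier FR" "pY \<in> carrier FR" "r \<in> carrier R \<Longrightarrow> inl r \<in> carrier FR"
  using alg_hom_closed[OF inl] alg_hom_closed[OF inr letter] by auto

private lemma arels_closed: "arels \<subseteq> carrier FR"
proof -
  interpret FR: k_algebra K FR by (rule FR)
  show ?thesis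
    using gen_closed c \<xi> alg_hom_closed[OF \<tau>] alg_hom_closed[OF \<omega>] by auto
qed

private lemma IA_eq: "IA = Idl\<^bsub>FR\<^esub> arels"
  by (simp add: ambiskew_ideal_def Let_def)

private lemma IA: "ideal IA FR" "arels \<subseteq> IA"
proof -
  interpret FR: k_algebra K FR by (rule FR)
  show "ideal IA FR" "arels \<subseteq> IA"
    unfolding IA_eq using FR.A.genideal_ideal[OF arels_closed] FR.A.genideal_self[OF arels_closed] by auto
qed

private lemmas aops = quot_alg_ops[OF FR IA(1), folded ambiskew_def]

private lemma proj_hom: "ambiskew_proj K R \<tau> \<omega> c \<xi> \<in> alg_hom K FR A"
  unfolding ambiskew_def ambiskew_proj_def[abs_def] by (rule quot_proj_hom[OF FR IA(1)])

lemma ambiskew_k_algebra: "k_algebra K A"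
  unfolding ambiskew_def by (rule quot_alg_k_algebra[OF FR IA(1)])

lemma ambiskew_incl_hom: "i \<in> alg_hom K R A"
  unfolding ambiskew_incl_def[abs_def] by (rule alg_hom_comp[OF proj_hom inl])

lemma ambiskew_X_closed: "XA \<in> carrier A" and ambiskew_Y_closed: "YA \<in> carrier A"
  unfolding ambiskew_X_def ambiskew_Y_def using gen_closed by (auto intro: alg_hom_closed[OF proj_hom])

lemma ambiskew_X_rel: "r \<in> carrier R \<Longrightarrow> XA \<otimes>\<^bsub>A\<^esub> i r = i (\<tau> r) \<otimes>\<^bsub>A\<^esub> XA"
  and ambiskew_Y_rel: "r \<in> carrier R \<Longrightarrow> YA \<otimes>\<^bsub>A\<^esub> i r = i (\<omega> r) \<otimes>\<^bsub>A\<^esub> YA"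
  and ambiskew_XY_rel: "XA \<otimes>\<^bsub>A\<^esub> YA = \<xi> \<odot>\<^bsub>A\<^esub> (YA \<otimes>\<^bsub>A\<^esub> XA) \<oplus>\<^bsub>A\<^esub> i c"
proof -
  interpret FR: k_algebra K FR by (rule FR)
  interpret A: k_algebra K A by (rule ambiskew_k_algebra)
  note cl = gen_closed alg_hom_closed[OF \<tau>] alg_hom_closed[OF \<omega>] c \<xi>
  note defs = ambiskew_incl_def ambiskew_X_def ambiskew_Y_def ambiskew_proj_def
  show "XA \<otimes>\<^bsub>A\<^esub> i r = i (\<tau> r) \<otimes>\<^bsub>A\<^esub> XA" if "r \<in> carrier R"
  proof -
    have "pX \<otimes>\<^bsub>FR\<^esub> inl r \<ominus>\<^bsub>FR\<^esub> inl (\<tau> r) \<otimes>\<^bsub>FR\<^esub> pX \<in> IA" using IA(2) that by auto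
    then show ?thesis using that cl by (simp add: defs aops)
  qed
  show "YA \<otimes>\<^bsub>A\<^esub> i r = i (\<omega> r) \<otimes>\<^bsub>A\<^esub> YA" if "r \<in> carrier R"
  proof -
    have "pY \<otimes>\<^bsub>FR\<^esub> inl r \<ominus>\<^bsub>FR\<^esub> inl (\<omega> r) \<otimes>\<^bsub>FR\<^esub> pY \<in> IA" using IA(2) that by auto
    then show ?thesis using that cl by (simp add: defs aops)
  qed
  have "(pX \<otimes>\<^bsub>FR\<^esub> pY \<ominus>\<^bsub>FR\<^esub> \<xi> \<odot>\<^bsub>FR\<^esub> (pY \<otimes>\<^bsub>FR\<^esub> pX)) \<ominus>\<^bsub>FR\<^esub> inl c \<in> IA" using IA(2) by auto
  also have "(pX \<otimes>\<^bsub>FR\<^esub> pY \<ominus>\<^bsub>FR\<^esub> \<xi> \<odot>\<^bsub>FR\<^esub> (pY \<otimes>\<^bsub>FR\<^esub> pX)) \<ominus>\<^bsub>FR\<^esub> inl c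
      = pX \<otimes>\<^bsub>FR\<^esub> pY \<ominus>\<^bsub>FR\<^esub> (\<xi> \<odot>\<^bsub>FR\<^esub> (pY \<otimes>\<^bsub>FR\<^esub> pX) \<oplus>\<^bsub>FR\<^esub> inl c)"
    using cl by (simp add: a_minus_def FR.M.minus_add FR.M.a_assoc)
  finally show "XA \<otimes>\<^bsub>A\<^esub> YA = \<xi> \<odot>\<^bsub>A\<^esub> (YA \<otimes>\<^bsub>A\<^esub> XA) \<oplus>\<^bsub>A\<^esub> i c"
    using cl by (simp add: defs aops)
qed

text \<open>The universal property of \<open>A\<close>: the map is assembled along the presentation,
  from words in the two letters to the free product and then to the quotient. Both the coefficient
  functionals and the structure map of the main result are obtained from it.\<close>

lemma ambiskew_lift:
  assumes B: "k_algebra K B" and f: "f \<in> alg_hom K R B" and xy: "x \<in> carrier B" "y \<in> carrier B"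
    and xr: "\<And>r. r \<in> carrier R \<Longrightarrow> x \<otimes>\<^bsub>B\<^esub> f r = f (\<tau> r) \<otimes>\<^bsub>B\<^esub> x"
    and yr: "\<And>r. r \<in> carrier R \<Longrightarrow> y \<otimes>\<^bsub>B\<^esub> f r = f (\<omega> r) \<otimes>\<^bsub>B\<^esub> y"
    and xyc: "x \<otimes>\<^bsub>B\<^esub> y = \<xi> \<odot>\<^bsub>B\<^esub> (y \<otimes>\<^bsub>B\<^esub> x) \<oplus>\<^bsub>B\<^esub> f c"
  obtains h where "h \<in> alg_hom K A B" "\<And>r. r \<in> carrier R \<Longrightarrow> h (i r) = f r" "h XA = x" "h YA = y"
proof -
  interpret FR: k_algebra K FR by (rule FR)
  interpret B: k_algebra K B by (rule B)
  obtain e where e: "e \<in> alg_hom K (free_XY K) B" "\<And>l. e (basis_elt K [l]) = (case l of LetterX \<Rightarrow> x | LetterY \<Rightarrow> y)"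
    unfolding free_XY_def
    by (rule free_alg_hom[OF K B, of "\<lambda>l. case l of LetterX \<Rightarrow> x | LetterY \<Rightarrow> y" UNIV]) (use xy in \<open>auto split: xy.split\<close>)
  obtain h0 where h0: "h0 \<in> alg_hom K FR B" "\<And>r. r \<in> carrier R \<Longrightarrow> h0 (inl r) = f r"
    "\<And>p. p \<in> carrier (free_XY K) \<Longrightarrow> h0 (fp_inr K R (free_XY K) p) = e p"
    using free_product_lift[OF R XY B f e(1)] by blast
  have h0': "h0 pX = x" "h0 pY = y" using h0(3)[OF letter] e(2) by auto
  note cl = gen_closed alg_hom_closed[OF \<tau>] alg_hom_closed[OF \<omega>] c \<xi> alg_hom_closed[OF f] xy
  note sub = lin_sub[OF FR.module_axioms B.module_axioms alg_hom_lin[OF h0(1)]]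
  note zero = diff_eq_zero_iff[OF B.M.abelian_group_axioms]
  note hs = sub alg_hom_mult[OF h0(1)] alg_hom_smult[OF h0(1)] h0' h0(2) zero
  \<comment> \<open>The last relation generates the ideal as a difference, whereas
    \<open>xyc\<close> gives a sum; this cancellation translates between the two.\<close>
  have "(u \<oplus>\<^bsub>B\<^esub> v) \<ominus>\<^bsub>B\<^esub> u = v" if "u \<in> carrier B" "v \<in> carrier B" for u v
    using that by (simp add: a_minus_def B.M.a_comm[of u v] B.M.a_assoc B.M.r_neg)
  then have "h0 r = \<zero>\<^bsub>B\<^esub>" if "r \<in> arels" for r
    using that cl by (auto simp: hs xr yr xyc)
  then have "h0 r = \<zero>\<^bsub>B\<^esub>" if "r \<in> IA" for r
    using genideal_null[OF FR B h0(1) arels_closed] that by (auto simp: IA_eq)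
  then obtain h where h: "h \<in> alg_hom K A B" "\<And>x. x \<in> carrier FR \<Longrightarrow> h (IA +>\<^bsub>FR\<^esub> x) = h0 x"
    unfolding ambiskew_def using quot_lift_exists[OF FR IA(1) B h0(1)] by blast
  show ?thesis
    by (rule that[OF h(1)])
      (auto simp: ambiskew_incl_def ambiskew_X_def ambiskew_Y_def ambiskew_proj_def h(2) gen_closed h0 h0')
qed

text \<open>The subalgebra is pulled back twice, to the free product and from there to the free
  algebra on the two letters, until the generation principles for words apply.\<close>

lemma ambiskew_generated:
  assumes Q: "subalg K A Q" and "\<And>r. r \<in> carrier R \<Longrightarrow> i r \<in> Q" "XA \<in> Q" "YA \<in> Q" and "x \<in> carrier A"
  shows "x \<in> Q"
proof -
  let ?p = "ambiskew_proj K R \<tau> \<omega> c \<xi>" and ?inr = "fp_inr K R (free_XY K)"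
  let ?Q = "{x \<in> carrier FR. ?p x \<in> Q}"
  have S: "subalg K FR ?Q" by (rule subalg_preimage[OF FR ambiskew_k_algebra proj_hom Q])
  have S': "subalg K (free_alg K UNIV) {x \<in> carrier (free_XY K). ?inr x \<in> ?Q}"
    using subalg_preimage[OF XY FR inr S] by (simp add: free_XY_def)
  have inr_Q: "?inr y \<in> ?Q" if "y \<in> carrier (free_XY K)" for y
  proof -
    have "y \<in> {x \<in> carrier (free_XY K). ?inr x \<in> ?Q}"
    proof (rule free_alg_generated[OF K S'])
      fix l show "basis_elt K [l] \<in> {x \<in> carrier (free_XY K). ?inr x \<in> ?Q}"
        using letter gen_closed assms(3,4) by (cases l) (auto simp: ambiskew_X_def ambiskew_Y_def)
    qed (use that in \<open>simp add: free_XY_def\<close>)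
    then show ?thesis by simp
  qed
  have "y \<in> ?Q" if "y \<in> carrier FR" for y
    by (rule free_product_generated[OF R XY S _ inr_Q that])
      (use gen_closed assms(2) in \<open>auto simp: ambiskew_incl_def\<close>)
  then show ?thesis using assms(5) by (auto simp: aops ambiskew_proj_def)
qed

end

section \<open>Reading off coefficients\<close>

text \<open>Operators are cut down to extensional functions on \<open>carrier V\<close>, so that two
  operators agreeing on the carrier are equal and the defining relations can hold as equations in
  this algebra.\<close>

definition end_alg :: "('k, 'm) ring_scheme \<Rightarrow> ('k, 'v, 'n) module_scheme \<Rightarrow> ('k, 'v \<Rightarrow> 'v) module"
  where "end_alg K V =
    \<lparr>carrier = lin_maps K V V \<inter> extensional (carrier V),
     mult = compose (carrier V),
     one = (\<lambda>x\<in>carrier V. x),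
     zero = (\<lambda>x\<in>carrier V. \<zero>\<^bsub>V\<^esub>),
     add = (\<lambda>f g. \<lambda>x\<in>carrier V. f x \<oplus>\<^bsub>V\<^esub> g x),
     smult = (\<lambda>a f. \<lambda>x\<in>carrier V. a \<odot>\<^bsub>V\<^esub> f x)\<rparr>"

lemma end_alg_k_algebra:
  assumes "field K" "module K V"
  shows "k_algebra K (end_alg K V)"
proof -
  interpret V: module K V by fact
  let ?E = "end_alg K V"
  have restrict_lin: "(\<lambda>x\<in>carrier V. f x) \<in> carrier ?E" if "f \<in> lin_maps K V V" for f
    using lin_cong[OF that assms(2)] by (simp add: end_alg_def)
  have lin: "f \<in> lin_maps K V V" if "f \<in> carrier ?E" for f
    using that by (simp add: end_alg_def)
  have ext: "f = g" if "f \<in> carrier ?E" "g \<in> carrier ?E" "\<And>x. x \<in> carrier V \<Longrightarrow> f x = g x" for f g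
    using that by (intro extensionalityI[of f "carrier V" g]) (auto simp: end_alg_def)
  have add: "f \<oplus>\<^bsub>?E\<^esub> g \<in> carrier ?E" if "f \<in> carrier ?E" "g \<in> carrier ?E" for f g
    using restrict_lin[OF lin_plus[OF assms(2) assms(2) lin lin]] that by (simp add: end_alg_def)
  have smult: "a \<odot>\<^bsub>?E\<^esub> f \<in> carrier ?E" if "a \<in> carrier K" "f \<in> carrier ?E" for a f
    using restrict_lin[OF lin_scale[OF assms(2) assms(2) lin]] that by (simp add: end_alg_def)
  have mult: "f \<otimes>\<^bsub>?E\<^esub> g \<in> carrier ?E" if "f \<in> carrier ?E" "g \<in> carrier ?E" for f g
    using restrict_lin[OF lin_comp[OF lin lin]] that by (simp add: end_alg_def compose_def)
  have one: "\<one>\<^bsub>?E\<^esub> \<in> carrier ?E" using restrict_lin[OF lin_id(1)] by (simp add: end_alg_def)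
  have zero: "\<zero>\<^bsub>?E\<^esub> \<in> carrier ?E"
    using restrict_lin[of "\<lambda>x. \<zero>\<^bsub>V\<^esub>"] by (auto simp: end_alg_def lin_maps_def)
  note closed = add smult mult one zero
  have app: "(f \<oplus>\<^bsub>?E\<^esub> g) x = f x \<oplus>\<^bsub>V\<^esub> g x" "(a \<odot>\<^bsub>?E\<^esub> f) x = a \<odot>\<^bsub>V\<^esub> f x" "(f \<otimes>\<^bsub>?E\<^esub> g) x = f (g x)"
    "\<one>\<^bsub>?E\<^esub> x = x" "\<zero>\<^bsub>?E\<^esub> x = \<zero>\<^bsub>V\<^esub>" if "x \<in> carrier V" for f g a x
    using that by (simp_all add: end_alg_def compose_def)
  note V = lin_closed[OF lin] lin_add[OF lin] lin_smult[OF lin]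
  have ab: "abelian_group ?E"
  proof (rule abelian_groupI)
    fix f assume f: "f \<in> carrier ?E"
    have "(\<ominus>\<^bsub>K\<^esub> \<one>\<^bsub>K\<^esub>) \<odot>\<^bsub>?E\<^esub> f \<oplus>\<^bsub>?E\<^esub> f = \<zero>\<^bsub>?E\<^esub>"
      using f by (intro ext closed) (auto simp: app V V.smult_l_minus V.M.l_neg)
    then show "\<exists>g\<in>carrier ?E. g \<oplus>\<^bsub>?E\<^esub> f = \<zero>\<^bsub>?E\<^esub>" using smult[of "\<ominus>\<^bsub>K\<^esub> \<one>\<^bsub>K\<^esub>" f] f by auto
  qed (intro ext closed; auto simp: app V V.M.add.m_ac)+
  show ?thesis
  proof (rule k_algebraI[OF assms(1)])
    show "module K ?E"
    proof (rule moduleI[OF _ ab])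
      show "cring K" by (rule V.R.is_cring)
    qed (intro ext closed; auto simp: app V V.smult_l_distr V.smult_r_distr V.smult_assoc1)+
  qed (intro ext closed; auto simp: app V V.smult_l_distr V.smult_r_distr V.smult_assoc1)+
qed

definition seq_module :: "('k, 'a, 'n) module_scheme \<Rightarrow> ('k, nat \<Rightarrow> 'a) module"
  where "seq_module R =
    \<lparr>carrier = {v. \<forall>n. v n \<in> carrier R}, mult = undefined, one = undefined, zero = (\<lambda>n. \<zero>\<^bsub>R\<^esub>),
     add = (\<lambda>v w n. v n \<oplus>\<^bsub>R\<^esub> w n), smult = (\<lambda>a v n. a \<odot>\<^bsub>R\<^esub> v n)\<rparr>"

lemma seq_module_module:
  assumes "module K R"
  shows "module K (seq_module R)"
proof -
  interpret R: module K R by fact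
  have ab: "abelian_group (seq_module R)"
  proof (rule abelian_groupI)
    fix v assume v: "v \<in> carrier (seq_module R)"
    show "\<exists>w\<in>carrier (seq_module R). w \<oplus>\<^bsub>seq_module R\<^esub> v = \<zero>\<^bsub>seq_module R\<^esub>"
      by (rule bexI[of _ "\<lambda>n. \<ominus>\<^bsub>R\<^esub> v n"]) (use v in \<open>auto simp: seq_module_def R.M.l_neg\<close>)
  qed (auto simp: seq_module_def R.M.add.m_ac)
  show ?thesis
    by (rule moduleI[OF R.R.is_cring ab])
      (auto simp: seq_module_def R.smult_l_distr R.smult_r_distr R.smult_assoc1)
qed

text \<open>As in a Verma module, the cyclic vector is killed by \<open>x\<close> and moved up by
  \<open>y\<close>. The properties are packed into a predicate because it is instantiated twice, the
  second time with \<open>\<tau>\<close> and \<open>\<omega>\<close> exchanged and with modified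
  \<open>c\<close> and \<open>\<xi>\<close>.\<close>

definition verma_operators where
  "verma_operators K R \<tau> \<omega> c \<xi> f x y \<longleftrightarrow> (let E = end_alg K (seq_module R); V = seq_module R in
    f \<in> alg_hom K R E \<and> x \<in> carrier E \<and> y \<in> carrier E \<and>
    (\<forall>r\<in>carrier R. x \<otimes>\<^bsub>E\<^esub> f r = f (\<tau> r) \<otimes>\<^bsub>E\<^esub> x) \<and>
    (\<forall>r\<in>carrier R. y \<otimes>\<^bsub>E\<^esub> f r = f (\<omega> r) \<otimes>\<^bsub>E\<^esub> y) \<and>
    x \<otimes>\<^bsub>E\<^esub> y = \<xi> \<odot>\<^bsub>E\<^esub> (y \<otimes>\<^bsub>E\<^esub> x) \<oplus>\<^bsub>E\<^esub> f c \<and>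
    (\<forall>r. \<forall>v\<in>carrier V. \<forall>n. f r v n = r \<otimes>\<^bsub>R\<^esub> v n) \<and>
    (\<forall>v\<in>carrier V. (\<forall>n. v (Suc n) = \<zero>\<^bsub>R\<^esub>) \<longrightarrow> x v = (\<lambda>n. \<zero>\<^bsub>R\<^esub>)) \<and>
    (\<forall>v\<in>carrier V. y v 0 = \<zero>\<^bsub>R\<^esub>) \<and> (\<forall>v\<in>carrier V. \<forall>n. y v (Suc n) = \<omega> (v n)))"

text \<open>The operators below are the actions of \<open>r\<close>, \<open>X\<close> and \<open>Y\<close> on the left module \<open>A / A X\<close>, which is
  free over \<open>R\<close> on the powers of \<open>Y\<close>; the sequence \<open>d\<close> records \<open>X Y\<^sup>n = d\<^sub>n Y\<^sup>n\<^sup>-\<^sup>1\<close> modulo \<open>A X\<close>.\<close>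

context
  fixes K :: "('k, 'm) ring_scheme" and R :: "('k, 'a, 'n) module_scheme" and \<tau> \<omega> c \<xi>
  assumes R: "k_algebra K R" and \<tau>: "\<tau> \<in> alg_hom K R R" and \<omega>: "\<omega> \<in> alg_hom K R R"
    and comm: "\<And>r. r \<in> carrier R \<Longrightarrow> \<tau> (\<omega> r) = \<omega> (\<tau> r)"
    and c: "c \<in> carrier R" and c_twist: "\<And>r. r \<in> carrier R \<Longrightarrow> c \<otimes>\<^bsub>R\<^esub> r = \<tau> (\<omega> r) \<otimes>\<^bsub>R\<^esub> c"
    and \<xi>: "\<xi> \<in> carrier K"
begin

private abbreviation (input) "V \<equiv> seq_module R"
private abbreviation (input) "E \<equiv> end_alg K (seq_module R)"

private fun d :: "nat \<Rightarrow> 'a" where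
  "d 0 = \<zero>\<^bsub>R\<^esub>"
| "d (Suc n) = \<xi> \<odot>\<^bsub>R\<^esub> \<omega> (d n) \<oplus>\<^bsub>R\<^esub> c"

private definition "opR r = (\<lambda>v\<in>carrier V. \<lambda>n. r \<otimes>\<^bsub>R\<^esub> v n)"
private definition "opX = (\<lambda>v\<in>carrier V. \<lambda>n. \<tau> (v (Suc n)) \<otimes>\<^bsub>R\<^esub> d (Suc n))"
private definition "opY = (\<lambda>v\<in>carrier V. \<lambda>n. case n of 0 \<Rightarrow> \<zero>\<^bsub>R\<^esub> | Suc m \<Rightarrow> \<omega> (v m))"

lemma verma_operators_exist:
  obtains f x y where "verma_operators K R \<tau> \<omega> c \<xi> f x y"
proof -
  interpret R: k_algebra K R by (rule R)
  note tc = alg_hom_closed[OF \<tau>] alg_hom_mult[OF \<tau>] alg_hom_add[OF \<tau>] alg_hom_smult[OF \<tau>]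
  note oc = alg_hom_closed[OF \<omega>] alg_hom_mult[OF \<omega>] alg_hom_add[OF \<omega>] alg_hom_smult[OF \<omega>]
  have z: "\<tau> \<zero>\<^bsub>R\<^esub> = \<zero>\<^bsub>R\<^esub>" "\<omega> \<zero>\<^bsub>R\<^esub> = \<zero>\<^bsub>R\<^esub>"
    using lin_zero[OF R.module_axioms R.module_axioms alg_hom_lin[OF \<tau>]]
      lin_zero[OF R.module_axioms R.module_axioms alg_hom_lin[OF \<omega>]] by auto
  have dc: "d n \<in> carrier R" for n using c \<xi> oc(1) by (induction n) auto
  have E: "g \<in> carrier E" if "g \<in> extensional (carrier V)" "\<And>v. v \<in> carrier V \<Longrightarrow> g v \<in> carrier V"
    "\<And>v w. v \<in> carrier V \<Longrightarrow> w \<in> carrier V \<Longrightarrow> g (v \<oplus>\<^bsub>V\<^esub> w) = g v \<oplus>\<^bsub>V\<^esub> g w"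
    "\<And>a v. a \<in> carrier K \<Longrightarrow> v \<in> carrier V \<Longrightarrow> g (a \<odot>\<^bsub>V\<^esub> v) = a \<odot>\<^bsub>V\<^esub> g v" for g
    using that by (auto simp: end_alg_def lin_maps_def)
  have rc: "opR r \<in> carrier E" if "r \<in> carrier R" for r
    by (rule E) (use that in \<open>auto simp: opR_def seq_module_def R.A.r_distr R.smult_mult_right\<close>)
  have xc: "opX \<in> carrier E"
    by (rule E) (auto simp: opX_def seq_module_def tc dc R.A.l_distr R.smult_mult_left simp del: d.simps)
  have yc: "opY \<in> carrier E"
    by (rule E) (auto simp: opY_def seq_module_def oc z split: nat.split)
  have ext: "f = g" if "f \<in> extensional (carrier V)" "g \<in> extensional (carrier V)"
    "\<And>v n. v \<in> carrier V \<Longrightarrow> f v n = g v n" for f g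
    using that by (intro extensionalityI[of f "carrier V" g]) auto
  have Vc: "v \<in> carrier V \<longleftrightarrow> (\<forall>n. v n \<in> carrier R)" for v by (simp add: seq_module_def)
  have Ee: "f \<otimes>\<^bsub>E\<^esub> g \<in> extensional (carrier V)" "f \<oplus>\<^bsub>E\<^esub> g \<in> extensional (carrier V)"
    "a \<odot>\<^bsub>E\<^esub> f \<in> extensional (carrier V)" "\<one>\<^bsub>E\<^esub> \<in> extensional (carrier V)" for f g a
    by (auto simp: end_alg_def compose_def)
  have oe: "opR r \<in> extensional (carrier V)" for r by (simp add: opR_def)
  have app: "(f \<otimes>\<^bsub>E\<^esub> g) v = f (g v)" "(f \<oplus>\<^bsub>E\<^esub> g) v n = f v n \<oplus>\<^bsub>R\<^esub> g v n" "(a \<odot>\<^bsub>E\<^esub> f) v n = a \<odot>\<^bsub>R\<^esub> f v n" "\<one>\<^bsub>E\<^esub> v = v"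
    if "v \<in> carrier V" for f g v n a
    using that by (simp_all add: end_alg_def seq_module_def compose_def)
  have oV: "opR r v \<in> carrier V" if "r \<in> carrier R" "v \<in> carrier V" for r v
    using that by (auto simp: opR_def seq_module_def)
  have xV: "opX v \<in> carrier V" if "v \<in> carrier V" for v
    using that by (auto simp: opX_def seq_module_def tc dc simp del: d.simps)
  have yV: "opY v \<in> carrier V" if "v \<in> carrier V" for v
    using that by (auto simp: opY_def seq_module_def oc split: nat.split)
  have ra: "opR r v n = r \<otimes>\<^bsub>R\<^esub> v n" and xa: "opX v n = \<tau> (v (Suc n)) \<otimes>\<^bsub>R\<^esub> d (Suc n)"
    and ya: "opY v n = (case n of 0 \<Rightarrow> \<zero>\<^bsub>R\<^esub> | Suc m \<Rightarrow> \<omega> (v m))" if "v \<in> carrier V" for r v n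
    using that by (simp_all add: opR_def opX_def opY_def)
  have f_hom: "opR \<in> alg_hom K R E"
  proof (intro alg_homI lin_mapsI)
    fix r s assume rs: "r \<in> carrier R" "s \<in> carrier R"
    show "opR (r \<oplus>\<^bsub>R\<^esub> s) = opR r \<oplus>\<^bsub>E\<^esub> opR s"
      using rs by (intro ext Ee oe) (auto simp: app ra Vc R.A.l_distr)
    show "opR (r \<otimes>\<^bsub>R\<^esub> s) = opR r \<otimes>\<^bsub>E\<^esub> opR s"
      by (intro ext Ee oe) (use rs in \<open>auto simp: app ra oV Vc R.A.m_assoc\<close>)
  next
    fix a r assume ar: "a \<in> carrier K" "r \<in> carrier R"
    show "opR (a \<odot>\<^bsub>R\<^esub> r) = a \<odot>\<^bsub>E\<^esub> opR r"
      using ar by (intro ext Ee oe) (auto simp: app ra Vc R.smult_mult_left)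
  next
    show "opR \<one>\<^bsub>R\<^esub> = \<one>\<^bsub>E\<^esub>" by (intro ext Ee oe) (auto simp: app ra Vc)
  qed (rule rc)
  have xr: "opX \<otimes>\<^bsub>E\<^esub> opR r = opR (\<tau> r) \<otimes>\<^bsub>E\<^esub> opX" if "r \<in> carrier R" for r
    by (intro ext Ee)
      (use that in \<open>auto simp: app ra xa oV xV Vc tc dc R.A.m_assoc simp del: d.simps\<close>)
  have yr: "opY \<otimes>\<^bsub>E\<^esub> opR r = opR (\<omega> r) \<otimes>\<^bsub>E\<^esub> opY" if "r \<in> carrier R" for r
    by (intro ext Ee) (use that in \<open>auto simp: app ra ya oV yV Vc oc split: nat.split\<close>)
  have xy: "opX \<otimes>\<^bsub>E\<^esub> opY = \<xi> \<odot>\<^bsub>E\<^esub> (opY \<otimes>\<^bsub>E\<^esub> opX) \<oplus>\<^bsub>E\<^esub> opR c"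
  proof (intro ext Ee)
    fix v n assume v: "v \<in> carrier V"
    then have vc: "v k \<in> carrier R" for k by (simp add: Vc)
    \<comment> \<open>At \<open>n = 0\<close> the left side vanishes since \<open>opY\<close>
      produces 0 in entry 0, and the right side vanishes because of the initial value
      \<open>d 0 = \<zero>\<close>. For positive \<open>n\<close>, \<open>comm\<close> brings
      \<open>\<omega>\<close> and \<open>\<tau>\<close> into the same order.\<close>
    have yx: "(opY \<otimes>\<^bsub>E\<^esub> opX) v n = \<tau> (\<omega> (v n)) \<otimes>\<^bsub>R\<^esub> \<omega> (d n)"
    proof (cases n)
      case 0
      then show ?thesis using v by (simp add: app ya xV tc oc vc z)
    next
      case (Suc m)
      then show ?thesis using v by (simp add: app ya xa xV tc oc vc dc comm del: d.simps)
    qed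
    \<comment> \<open>The recursion for \<open>d\<close> is made for this step:
      \<open>c_twist\<close> moves \<open>v n\<close> to the left of \<open>c\<close>, turning it
      into \<open>\<tau> (\<omega> (v n))\<close>, so both summands have this left factor and what
      remains is \<open>\<xi> \<odot> \<omega> (d n) \<oplus> c\<close>, that is
      \<open>d (Suc n)\<close>.\<close>
    have "(\<xi> \<odot>\<^bsub>E\<^esub> (opY \<otimes>\<^bsub>E\<^esub> opX) \<oplus>\<^bsub>E\<^esub> opR c) v n = \<xi> \<odot>\<^bsub>R\<^esub> (\<tau> (\<omega> (v n)) \<otimes>\<^bsub>R\<^esub> \<omega> (d n)) \<oplus>\<^bsub>R\<^esub> c \<otimes>\<^bsub>R\<^esub> v n"
      using v by (simp add: app(2,3) yx ra)
    also have "\<dots> = \<tau> (\<omega> (v n)) \<otimes>\<^bsub>R\<^esub> d (Suc n)"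
      using vc c \<xi> by (simp add: c_twist tc oc dc R.A.r_distr R.smult_mult_right)
    also have "\<dots> = (opX \<otimes>\<^bsub>E\<^esub> opY) v n"
      using v by (simp add: app yV xa ya del: d.simps)
    finally show "(opX \<otimes>\<^bsub>E\<^esub> opY) v n = (\<xi> \<odot>\<^bsub>E\<^esub> (opY \<otimes>\<^bsub>E\<^esub> opX) \<oplus>\<^bsub>E\<^esub> opR c) v n" by simp
  qed
  have x0: "opX v = (\<lambda>n. \<zero>\<^bsub>R\<^esub>)" if "v \<in> carrier V" "\<forall>n. v (Suc n) = \<zero>\<^bsub>R\<^esub>" for v
    using that by (auto simp: xa z dc simp del: d.simps)
  show ?thesis
    by (rule that[of opR opX opY], unfold verma_operators_def Let_def)
      (simp add: f_hom xc yc xr yr xy x0 ra ya)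
qed

end

text \<open>The vector \<open>e0\<close> plays the role of the class of 1 in the cyclic module, so
  \<open>h a e0\<close> is the class of \<open>a\<close> and its n-th entry a coefficient. Left
  \<open>R\<close>-linearity holds because \<open>R\<close> acts on sequences by left multiplication
  in every entry.\<close>

lemma verma_functionals:
  assumes R: "k_algebra K R" and A: "k_algebra K A" and i: "i \<in> alg_hom K R A"
    and f: "f \<in> alg_hom K R (end_alg K (seq_module R))"
    and h: "h \<in> alg_hom K A (end_alg K (seq_module R))" "\<And>r. r \<in> carrier R \<Longrightarrow> h (i r) = f r"
    and fr: "\<And>r v n. v \<in> carrier (seq_module R) \<Longrightarrow> f r v n = r \<otimes>\<^bsub>R\<^esub> v n"
  defines "e0 \<equiv> (\<lambda>n. if n = 0 then \<one>\<^bsub>R\<^esub> else \<zero>\<^bsub>R\<^esub>)"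
  shows "(\<lambda>a. h a e0 n) \<in> lin_maps K A R" "e0 \<in> carrier (seq_module R)"
    "\<And>r a. r \<in> carrier R \<Longrightarrow> a \<in> carrier A \<Longrightarrow> h (i r \<otimes>\<^bsub>A\<^esub> a) e0 n = r \<otimes>\<^bsub>R\<^esub> h a e0 n"
    "\<And>a b. a \<in> carrier A \<Longrightarrow> b \<in> carrier A \<Longrightarrow> h (a \<otimes>\<^bsub>A\<^esub> b) e0 = h a (h b e0)"
    "h \<one>\<^bsub>A\<^esub> e0 = e0"
proof -
  interpret R: k_algebra K R by (rule R)
  show e0: "e0 \<in> carrier (seq_module R)" by (simp add: e0_def seq_module_def)
  have hV: "h a v \<in> carrier (seq_module R)" if "a \<in> carrier A" "v \<in> carrier (seq_module R)" for a v
    using alg_hom_closed[OF h(1) that(1)] that(2) by (auto simp: end_alg_def lin_maps_def)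
  then have hc: "h a e0 n \<in> carrier R" if "a \<in> carrier A" for a
    using hV[OF that e0] by (simp add: seq_module_def)
  show "(\<lambda>a. h a e0 n) \<in> lin_maps K A R"
    by (rule lin_mapsI)
      (use e0 hc in \<open>auto simp: alg_hom_add[OF h(1)] alg_hom_smult[OF h(1)] end_alg_def seq_module_def\<close>)
  show m: "h (a \<otimes>\<^bsub>A\<^esub> b) e0 = h a (h b e0)" if "a \<in> carrier A" "b \<in> carrier A" for a b
    using that e0 by (simp add: alg_hom_mult[OF h(1)] end_alg_def compose_def)
  show "h (i r \<otimes>\<^bsub>A\<^esub> a) e0 n = r \<otimes>\<^bsub>R\<^esub> h a e0 n" if "r \<in> carrier R" "a \<in> carrier A" for r a
    using that e0 hV alg_hom_closed[OF i] by (simp add: m h(2) fr)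
  show "h \<one>\<^bsub>A\<^esub> e0 = e0" using e0 by (simp add: alg_hom_one[OF h(1)] end_alg_def)
qed

text \<open>Here \<open>p\<close>, \<open>q\<close> and \<open>s\<close> are the coefficients of 1,
  \<open>X\<close> and \<open>Y\<close>. The module killed by \<open>X\<close> on its cyclic vector
  yields \<open>p\<close> and \<open>s\<close>; the one in which \<open>Y\<close> takes this role
  yields \<open>q\<close>.\<close>

lemma ambiskew_functionals:
  assumes R: "k_algebra K R" and \<tau>: "\<tau> \<in> alg_hom K R R" and \<omega>: "\<omega> \<in> alg_hom K R R"
    and comm: "\<And>r. r \<in> carrier R \<Longrightarrow> \<tau> (\<omega> r) = \<omega> (\<tau> r)"
    and c: "c \<in> carrier R" and c_twist: "\<And>r. r \<in> carrier R \<Longrightarrow> c \<otimes>\<^bsub>R\<^esub> r = \<tau> (\<omega> r) \<otimes>\<^bsub>R\<^esub> c"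
    and \<xi>: "\<xi> \<in> Units K"
  defines "A \<equiv> ambiskew K R \<tau> \<omega> c \<xi>" and "i \<equiv> ambiskew_incl K R \<tau> \<omega> c \<xi>"
    and "X \<equiv> ambiskew_X K R \<tau> \<omega> c \<xi>" and "Y \<equiv> ambiskew_Y K R \<tau> \<omega> c \<xi>"
  obtains p q s where
    "p \<in> lin_maps K A R" "q \<in> lin_maps K A R" "s \<in> lin_maps K A R"
    "\<And>r a. r \<in> carrier R \<Longrightarrow> a \<in> carrier A \<Longrightarrow> p (i r \<otimes>\<^bsub>A\<^esub> a) = r \<otimes>\<^bsub>R\<^esub> p a"
    "\<And>r a. r \<in> carrier R \<Longrightarrow> a \<in> carrier A \<Longrightarrow> q (i r \<otimes>\<^bsub>A\<^esub> a) = r \<otimes>\<^bsub>R\<^esub> q a"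
    "\<And>r a. r \<in> carrier R \<Longrightarrow> a \<in> carrier A \<Longrightarrow> s (i r \<otimes>\<^bsub>A\<^esub> a) = r \<otimes>\<^bsub>R\<^esub> s a"
    "p \<one>\<^bsub>A\<^esub> = \<one>\<^bsub>R\<^esub>" "p X = \<zero>\<^bsub>R\<^esub>" "p Y = \<zero>\<^bsub>R\<^esub>" "p (Y \<otimes>\<^bsub>A\<^esub> X) = \<zero>\<^bsub>R\<^esub>"
    "q \<one>\<^bsub>A\<^esub> = \<zero>\<^bsub>R\<^esub>" "q X = \<one>\<^bsub>R\<^esub>" "q Y = \<zero>\<^bsub>R\<^esub>"
    "s \<one>\<^bsub>A\<^esub> = \<zero>\<^bsub>R\<^esub>" "s X = \<zero>\<^bsub>R\<^esub>" "s Y = \<one>\<^bsub>R\<^esub>"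
proof -
  interpret R: k_algebra K R by (rule R)
  let ?V = "seq_module R" and ?E = "end_alg K (seq_module R)"
  let ?e = "\<lambda>n::nat. if n = 0 then \<one>\<^bsub>R\<^esub> else \<zero>\<^bsub>R\<^esub>"
  have \<xi>K: "\<xi> \<in> carrier K" "inv\<^bsub>K\<^esub> \<xi> \<in> carrier K" "\<xi> \<otimes>\<^bsub>K\<^esub> inv\<^bsub>K\<^esub> \<xi> = \<one>\<^bsub>K\<^esub>" using \<xi> by auto
  note A = ambiskew_k_algebra[OF R \<tau> \<omega> c \<xi>K(1), folded A_def]
  note i = ambiskew_incl_hom[OF R \<tau> \<omega> c \<xi>K(1), folded A_def i_def]
  note X = ambiskew_X_closed[OF R \<tau> \<omega> c \<xi>K(1), folded A_def X_def]
  note Y = ambiskew_Y_closed[OF R \<tau> \<omega> c \<xi>K(1), folded A_def Y_def]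
  note lift = ambiskew_lift[OF R \<tau> \<omega> c \<xi>K(1), folded A_def i_def X_def Y_def]
  have E: "k_algebra K ?E" by (rule end_alg_k_algebra[OF R.K.field_axioms seq_module_module[OF R.module_axioms]])
  interpret E: k_algebra K ?E by (rule E)
  have z: "\<tau> \<zero>\<^bsub>R\<^esub> = \<zero>\<^bsub>R\<^esub>" "\<omega> \<zero>\<^bsub>R\<^esub> = \<zero>\<^bsub>R\<^esub>" "\<tau> \<one>\<^bsub>R\<^esub> = \<one>\<^bsub>R\<^esub>" "\<omega> \<one>\<^bsub>R\<^esub> = \<one>\<^bsub>R\<^esub>"
    using lin_zero[OF R.module_axioms R.module_axioms alg_hom_lin[OF \<tau>]] alg_hom_one[OF \<tau>]
      lin_zero[OF R.module_axioms R.module_axioms alg_hom_lin[OF \<omega>]] alg_hom_one[OF \<omega>] by auto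
  obtain f x y where fxy: "verma_operators K R \<tau> \<omega> c \<xi> f x y"
    using verma_operators_exist[OF R \<tau> \<omega> comm c c_twist \<xi>K(1)] by blast
  then have 1: "f \<in> alg_hom K R ?E" "x \<in> carrier ?E" "y \<in> carrier ?E"
    "\<And>r. r \<in> carrier R \<Longrightarrow> x \<otimes>\<^bsub>?E\<^esub> f r = f (\<tau> r) \<otimes>\<^bsub>?E\<^esub> x"
    "\<And>r. r \<in> carrier R \<Longrightarrow> y \<otimes>\<^bsub>?E\<^esub> f r = f (\<omega> r) \<otimes>\<^bsub>?E\<^esub> y"
    "x \<otimes>\<^bsub>?E\<^esub> y = \<xi> \<odot>\<^bsub>?E\<^esub> (y \<otimes>\<^bsub>?E\<^esub> x) \<oplus>\<^bsub>?E\<^esub> f c"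
    "\<And>r v n. v \<in> carrier ?V \<Longrightarrow> f r v n = r \<otimes>\<^bsub>R\<^esub> v n"
    "\<And>v. v \<in> carrier ?V \<Longrightarrow> (\<And>n. v (Suc n) = \<zero>\<^bsub>R\<^esub>) \<Longrightarrow> x v = (\<lambda>n. \<zero>\<^bsub>R\<^esub>)"
    "\<And>v n. v \<in> carrier ?V \<Longrightarrow> y v 0 = \<zero>\<^bsub>R\<^esub>" "\<And>v n. v \<in> carrier ?V \<Longrightarrow> y v (Suc n) = \<omega> (v n)"
    by (simp_all add: verma_operators_def Let_def)
  obtain h where h: "h \<in> alg_hom K A ?E" "\<And>r. r \<in> carrier R \<Longrightarrow> h (i r) = f r" "h X = x" "h Y = y"
    using lift[OF E 1(1-6)] by blast
  note F = verma_functionals[OF R A i 1(1) h(1,2) 1(7)]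
  have xe: "x ?e = (\<lambda>n. \<zero>\<^bsub>R\<^esub>)" by (rule 1(8)) (auto simp: F(2))
  have ye: "y ?e 0 = \<zero>\<^bsub>R\<^esub>" "y ?e 1 = \<one>\<^bsub>R\<^esub>" using 1(9,10)[OF F(2)] by (auto simp: z)
  have yz: "y (\<lambda>n. \<zero>\<^bsub>R\<^esub>) 0 = \<zero>\<^bsub>R\<^esub>" by (rule 1(9)) (auto simp: seq_module_def)
  \<comment> \<open>Solving the last relation for \<open>Y X\<close> gives \<open>Y X\<close> as
    inverse \<open>\<xi>\<close> times \<open>X Y\<close> minus inverse \<open>\<xi>\<close> times
    \<open>c\<close>. This is a relation of the same form with \<open>\<tau>\<close> and
    \<open>\<omega>\<close> exchanged, and \<open>?c\<close> is its constant term.\<close>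
  let ?c = "\<ominus>\<^bsub>R\<^esub> (inv\<^bsub>K\<^esub> \<xi> \<odot>\<^bsub>R\<^esub> c)"
  have c': "?c \<in> carrier R" using c \<xi>K by simp
  have ct: "?c \<otimes>\<^bsub>R\<^esub> r = \<omega> (\<tau> r) \<otimes>\<^bsub>R\<^esub> ?c" if "r \<in> carrier R" for r
    using that c \<xi>K c_twist[OF that] comm[OF that] alg_hom_closed[OF \<tau>] alg_hom_closed[OF \<omega>]
    by (simp add: R.A.l_minus R.A.r_minus R.smult_mult_left R.smult_mult_right)
  obtain f' x' y' where fxy': "verma_operators K R \<omega> \<tau> ?c (inv\<^bsub>K\<^esub> \<xi>) f' x' y'"
    using verma_operators_exist[OF R \<omega> \<tau> comm[symmetric] c' ct \<xi>K(2)] by blast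
  then have 2: "f' \<in> alg_hom K R ?E" "x' \<in> carrier ?E" "y' \<in> carrier ?E"
    "\<And>r. r \<in> carrier R \<Longrightarrow> x' \<otimes>\<^bsub>?E\<^esub> f' r = f' (\<omega> r) \<otimes>\<^bsub>?E\<^esub> x'"
    "\<And>r. r \<in> carrier R \<Longrightarrow> y' \<otimes>\<^bsub>?E\<^esub> f' r = f' (\<tau> r) \<otimes>\<^bsub>?E\<^esub> y'"
    "x' \<otimes>\<^bsub>?E\<^esub> y' = inv\<^bsub>K\<^esub> \<xi> \<odot>\<^bsub>?E\<^esub> (y' \<otimes>\<^bsub>?E\<^esub> x') \<oplus>\<^bsub>?E\<^esub> f' ?c"
    "\<And>r v n. v \<in> carrier ?V \<Longrightarrow> f' r v n = r \<otimes>\<^bsub>R\<^esub> v n"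
    "\<And>v. v \<in> carrier ?V \<Longrightarrow> (\<And>n. v (Suc n) = \<zero>\<^bsub>R\<^esub>) \<Longrightarrow> x' v = (\<lambda>n. \<zero>\<^bsub>R\<^esub>)"
    "\<And>v n. v \<in> carrier ?V \<Longrightarrow> y' v 0 = \<zero>\<^bsub>R\<^esub>" "\<And>v n. v \<in> carrier ?V \<Longrightarrow> y' v (Suc n) = \<tau> (v n)"
    by (simp_all add: verma_operators_def Let_def)
  have "f' ?c = \<ominus>\<^bsub>?E\<^esub> (inv\<^bsub>K\<^esub> \<xi> \<odot>\<^bsub>?E\<^esub> f' c)"
    using c \<xi>K by (simp add: lin_minus[OF R.module_axioms E.module_axioms alg_hom_lin[OF 2(1)]] alg_hom_smult[OF 2(1)])
  \<comment> \<open>Multiplication by \<open>\<xi>\<close> turns the relation for \<open>x'\<close>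
    and \<open>y'\<close> back into the original one, with \<open>y'\<close> in the role of
    \<open>X\<close> and \<open>x'\<close> in that of \<open>Y\<close>.\<close>
  then have "\<xi> \<odot>\<^bsub>?E\<^esub> (x' \<otimes>\<^bsub>?E\<^esub> y') \<oplus>\<^bsub>?E\<^esub> f' c = (y' \<otimes>\<^bsub>?E\<^esub> x' \<oplus>\<^bsub>?E\<^esub> \<ominus>\<^bsub>?E\<^esub> f' c) \<oplus>\<^bsub>?E\<^esub> f' c"
    using 2(2,3) \<xi>K alg_hom_closed[OF 2(1) c]
    by (simp add: 2(6) E.smult_r_distr E.smult_r_minus flip: E.smult_assoc1)
  then have 3: "y' \<otimes>\<^bsub>?E\<^esub> x' = \<xi> \<odot>\<^bsub>?E\<^esub> (x' \<otimes>\<^bsub>?E\<^esub> y') \<oplus>\<^bsub>?E\<^esub> f' c"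
    using 2(2,3) alg_hom_closed[OF 2(1) c] by (simp add: E.M.a_assoc E.M.l_neg)
  obtain h' where h': "h' \<in> alg_hom K A ?E" "\<And>r. r \<in> carrier R \<Longrightarrow> h' (i r) = f' r" "h' X = y'" "h' Y = x'"
    using lift[OF E 2(1,3,2,5,4) 3] by blast
  note F' = verma_functionals[OF R A i 2(1) h'(1,2) 2(7)]
  have xe': "x' ?e = (\<lambda>n. \<zero>\<^bsub>R\<^esub>)" by (rule 2(8)) (auto simp: F'(2))
  have ye': "y' ?e 1 = \<one>\<^bsub>R\<^esub>" using 2(10)[OF F'(2), of 0] by (auto simp: z)
  show ?thesis
    \<comment> \<open>\<open>p\<close> and \<open>s\<close> are entries 0 and 1 for the first
      action, \<open>q\<close> is entry 1 for the second. The unwanted generator is killed in each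
      case: \<open>X\<close> annihilates the cyclic vector of the first module and \<open>Y\<close>
      that of the second.\<close>
    by (rule that[OF F(1)[of 0] F'(1)[of 1] F(1)[of 1]])
      (use X Y in \<open>simp_all add: F(3-5) F'(3-5) h h' xe ye yz xe' ye' del: One_nat_def\<close>)
qed

section \<open>Triple tensor products\<close>

lemma multilinI:
  assumes "\<And>xs. xs \<in> carrier (prod_monoid As) \<Longrightarrow> \<phi> xs \<in> carrier W"
    and "\<And>xs i. xs \<in> carrier (prod_monoid As) \<Longrightarrow> i < length As \<Longrightarrow> (\<lambda>x. \<phi> (xs[i := x])) \<in> lin_maps K (As ! i) W"
  shows "multilin K As W \<phi>"
  using assms unfolding multilin_def lin_maps_def by blast

lemma multilin_lin:
  assumes "alg_list K As" "multilin K As W \<phi>" "xs \<in> carrier (prod_monoid As)" "i < length As"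
  shows "(\<lambda>x. \<phi> (xs[i := x])) \<in> lin_maps K (As ! i) W"
proof -
  interpret k_algebra K "As ! i" using assms(1,4) by (simp add: alg_list_def)
  show ?thesis
    using assms(2-4) by (intro lin_mapsI) (auto simp: multilin_def Pi_iff prod_monoid_update)
qed

definition lin_list where
  "lin_list K As Bs fs \<longleftrightarrow> length fs = length As \<and> length Bs = length As \<and>
    (\<forall>i<length As. fs ! i \<in> lin_maps K (As ! i) (Bs ! i))"

lemma lin_list_map2_closed:
  "lin_list K As Bs fs \<Longrightarrow> xs \<in> carrier (prod_monoid As) \<Longrightarrow> map2 (\<lambda>f x. f x) fs xs \<in> carrier (prod_monoid Bs)"
  by (auto simp: lin_list_def prod_monoid_carrier lin_closed)

lemma tensor_map_multilin:
  assumes "alg_list K As" "alg_list K Bs" "lin_list K As Bs fs"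
  shows "multilin K As (tensor_alg K Bs) (\<lambda>xs. pure K Bs (map2 (\<lambda>f x. f x) fs xs))"
proof (rule multilinI)
  fix xs assume xs: "xs \<in> carrier (prod_monoid As)"
  note c = lin_list_map2_closed[OF assms(3) xs]
  show "pure K Bs (map2 (\<lambda>f x. f x) fs xs) \<in> carrier (tensor_alg K Bs)"
    by (rule pure_closed[OF assms(2) c])
  fix i assume i: "i < length As"
  have "map2 (\<lambda>f x. f x) fs (xs[i := x]) = (map2 (\<lambda>f x. f x) fs xs)[i := (fs ! i) x]" for x
    using i assms(3) xs by (intro nth_equalityI) (auto simp: lin_list_def prod_monoid_carrier nth_list_update)
  then show "(\<lambda>x. pure K Bs (map2 (\<lambda>f x. f x) fs (xs[i := x]))) \<in> lin_maps K (As ! i) (tensor_alg K Bs)"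
    using lin_comp[OF multilin_lin[OF assms(2) pure_multilin[OF assms(2)] c, of i], of "fs ! i" "As ! i"] i assms(3)
    by (simp add: lin_list_def)
qed

lemma tensor_map_pure:
  assumes "alg_list K As" "alg_list K Bs" "lin_list K As Bs fs" "xs \<in> carrier (prod_monoid As)"
  shows "tensor_map K Bs fs (pure K As xs) = pure K Bs (map2 (\<lambda>f x. f x) fs xs)"
  unfolding tensor_map_def
  by (rule tensor_lift_pure[OF assms(1) tensor_module[OF assms(2)] tensor_map_multilin[OF assms(1-3)] assms(4)])

lemma tensor_map_lin:
  assumes "alg_list K As" "alg_list K Bs" "lin_list K As Bs fs"
  shows "tensor_map K Bs fs \<in> lin_maps K (tensor_alg K As) (tensor_alg K Bs)"
  unfolding tensor_map_def
  by (rule tensor_lift_lin[OF assms(1) tensor_module[OF assms(2)] tensor_map_multilin[OF assms(1-3)]])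

text \<open>Functoriality. It merges chains such as conjugation in two factors followed by
  \<open>\<tau>\<close> in the third into one \<open>tensor_map\<close>, which is how conditions (1)
  and (2) are combined later.\<close>

lemma tensor_map_comp:
  assumes "alg_list K As" "alg_list K Bs" "alg_list K Cs" "lin_list K As Bs gs" "lin_list K Bs Cs fs"
    and "t \<in> carrier (tensor_alg K As)"
  shows "tensor_map K Cs fs (tensor_map K Bs gs t) = tensor_map K Cs (map2 (\<lambda>f g x. f (g x)) fs gs) t"
proof (rule tensor_ext[OF assms(1) tensor_module[OF assms(3)] _ _ _ assms(6)])
  have fg: "lin_list K As Cs (map2 (\<lambda>f g x. f (g x)) fs gs)"
    using assms(4,5) by (auto simp: lin_list_def intro: lin_comp)
  then show "tensor_map K Cs (map2 (\<lambda>f g x. f (g x)) fs gs) \<in> lin_maps K (tensor_alg K As) (tensor_alg K Cs)"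
    by (rule tensor_map_lin[OF assms(1,3)])
  show "(\<lambda>t. tensor_map K Cs fs (tensor_map K Bs gs t)) \<in> lin_maps K (tensor_alg K As) (tensor_alg K Cs)"
    by (rule lin_comp[OF tensor_map_lin[OF assms(2,3,5)] tensor_map_lin[OF assms(1,2,4)]])
  fix xs assume xs: "xs \<in> carrier (prod_monoid As)"
  have "map2 (\<lambda>f x. f x) fs (map2 (\<lambda>f x. f x) gs xs) = map2 (\<lambda>f x. f x) (map2 (\<lambda>f g x. f (g x)) fs gs) xs"
    using assms(4,5) xs by (intro nth_equalityI) (auto simp: lin_list_def prod_monoid_carrier)
  then show "tensor_map K Cs fs (tensor_map K Bs gs (pure K As xs))
      = tensor_map K Cs (map2 (\<lambda>f g x. f (g x)) fs gs) (pure K As xs)"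
    using tensor_map_pure[OF assms(1,2,4) xs] tensor_map_pure[OF assms(2,3,5) lin_list_map2_closed[OF assms(4) xs]]
      tensor_map_pure[OF assms(1,3) fg xs] by simp
qed

text \<open>Linearity of \<open>gs\<close> is inherited from \<open>fs\<close> by
  \<open>lin_cong\<close>, so pointwise agreement on the carriers is all that has to be
  supplied.\<close>

lemma tensor_map_cong:
  assumes "alg_list K As" "alg_list K Bs" "lin_list K As Bs fs" "length gs = length As"
    and "\<And>i x. i < length As \<Longrightarrow> x \<in> carrier (As ! i) \<Longrightarrow> (fs ! i) x = (gs ! i) x" "t \<in> carrier (tensor_alg K As)"
  shows "tensor_map K Bs fs t = tensor_map K Bs gs t"
proof -
  have "gs ! i \<in> lin_maps K (As ! i) (Bs ! i)" if "i < length As" for i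
  proof (rule lin_cong[of "fs ! i"])
    show "fs ! i \<in> lin_maps K (As ! i) (Bs ! i)" "module K (As ! i)"
      using assms(1,3) that by (auto simp: lin_list_def alg_list_def k_algebra_module)
  qed (rule assms(5)[OF that])
  then have gs: "lin_list K As Bs gs"
    using assms(3,4) by (simp add: lin_list_def)
  have "tensor_map K Bs fs (pure K As xs) = tensor_map K Bs gs (pure K As xs)"
    if xs: "xs \<in> carrier (prod_monoid As)" for xs
  proof -
    have "map2 (\<lambda>f x. f x) fs xs = map2 (\<lambda>f x. f x) gs xs"
      using assms(3-5) xs by (intro nth_equalityI) (auto simp: lin_list_def prod_monoid_carrier)
    then show ?thesis
      by (simp only: tensor_map_pure[OF assms(1-3) xs] tensor_map_pure[OF assms(1,2) gs xs])
  qed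
  then show ?thesis
    by (rule tensor_ext[OF assms(1) tensor_module[OF assms(2)] tensor_map_lin[OF assms(1-3)]
          tensor_map_lin[OF assms(1,2) gs] _ assms(6)])
qed

lemma op_alg_simps [simp]:
  "carrier (op_alg A) = carrier A" "\<one>\<^bsub>op_alg A\<^esub> = \<one>\<^bsub>A\<^esub>" "\<zero>\<^bsub>op_alg A\<^esub> = \<zero>\<^bsub>A\<^esub>"
  "x \<oplus>\<^bsub>op_alg A\<^esub> y = x \<oplus>\<^bsub>A\<^esub> y" "a \<odot>\<^bsub>op_alg A\<^esub> x = a \<odot>\<^bsub>A\<^esub> x" "x \<otimes>\<^bsub>op_alg A\<^esub> y = y \<otimes>\<^bsub>A\<^esub> x"
  by (simp_all add: op_alg_def)

lemma op_alg_k_algebra: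
  assumes "k_algebra K A"
  shows "k_algebra K (op_alg A)"
proof -
  interpret A: k_algebra K A by fact
  have ab: "abelian_group (op_alg A)"
  proof (rule abelian_groupI)
    fix x assume "x \<in> carrier (op_alg A)"
    then show "\<exists>y\<in>carrier (op_alg A). y \<oplus>\<^bsub>op_alg A\<^esub> x = \<zero>\<^bsub>op_alg A\<^esub>"
      by (intro bexI[of _ "\<ominus>\<^bsub>A\<^esub> x"]) (auto simp: A.M.l_neg)
  qed (auto simp: A.M.add.m_ac)
  show ?thesis
  proof (rule k_algebraI)
    show "module K (op_alg A)"
      by (rule moduleI[OF A.K.is_cring ab]) (auto simp: A.smult_l_distr A.smult_r_distr A.smult_assoc1)
  qed (auto simp: A.K.field_axioms A.A.m_assoc A.A.l_distr A.A.r_distr A.smult_mult_left A.smult_mult_right)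
qed

text \<open>The opposite algebra differs only in its product, so in the middle factor of a triple
  linear maps can be handled as maps of the algebra itself.\<close>

lemma lin_maps_op [simp]:
  "lin_maps K (op_alg A) B = lin_maps K A B" "lin_maps K A (op_alg B) = lin_maps K A B"
  by (simp_all add: lin_maps_def)

lemma tri_alg_list: "k_algebra K A \<Longrightarrow> alg_list K (tri A)"
  and quin_alg_list: "k_algebra K A \<Longrightarrow> alg_list K (quin A)"
  and pair_alg_list: "k_algebra K A \<Longrightarrow> alg_list K [A, A]"
  by (auto simp: alg_list_def k_algebra_field op_alg_k_algebra less_Suc_eq numeral_eq_Suc)

lemma tri_carrier:
  "xs \<in> carrier (prod_monoid (tri A)) \<longleftrightarrow> (\<exists>x\<in>carrier A. \<exists>y\<in>carrier A. \<exists>z\<in>carrier A. xs = [x, y, z])"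
  by (auto simp: prod_monoid_carrier length_Suc_conv less_Suc_eq numeral_eq_Suc all_conj_distrib imp_conjR)

lemma pair_carrier:
  "xs \<in> carrier (prod_monoid [A, A]) \<longleftrightarrow> (\<exists>x\<in>carrier A. \<exists>y\<in>carrier A. xs = [x, y])"
  by (auto simp: prod_monoid_carrier length_Suc_conv less_Suc_eq numeral_eq_Suc)

lemma quin_carrier:
  "xs \<in> carrier (prod_monoid (quin A)) \<longleftrightarrow>
    (\<exists>x\<in>carrier A. \<exists>y\<in>carrier A. \<exists>z\<in>carrier A. \<exists>u\<in>carrier A. \<exists>v\<in>carrier A. xs = [x, y, z, u, v])"
  by (auto simp: prod_monoid_carrier length_Suc_conv less_Suc_eq numeral_eq_Suc)

lemma tri_mult:
  "[x, y, z] \<otimes>\<^bsub>prod_monoid (tri A)\<^esub> [x', y', z'] = [x \<otimes>\<^bsub>A\<^esub> x', y' \<otimes>\<^bsub>A\<^esub> y, z \<otimes>\<^bsub>A\<^esub> z']"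
  by (simp add: prod_monoid_def upt_rec)

lemma pair_mult: "[x, y] \<otimes>\<^bsub>prod_monoid [A, A]\<^esub> [x', y'] = [x \<otimes>\<^bsub>A\<^esub> x', y \<otimes>\<^bsub>A\<^esub> y']"
  by (simp add: prod_monoid_def upt_rec)

lemma quin_mult:
  "[x, y, z, u, v] \<otimes>\<^bsub>prod_monoid (quin A)\<^esub> [x', y', z', u', v']
    = [x \<otimes>\<^bsub>A\<^esub> x', y' \<otimes>\<^bsub>A\<^esub> y, z \<otimes>\<^bsub>A\<^esub> z', u' \<otimes>\<^bsub>A\<^esub> u, v \<otimes>\<^bsub>A\<^esub> v']"
  by (simp add: prod_monoid_def upt_rec)

lemma tri_lin_list:
  "lin_list K (tri R) (tri A) [f, g, h] \<longleftrightarrow> f \<in> lin_maps K R A \<and> g \<in> lin_maps K R A \<and> h \<in> lin_maps K R A"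
  by (auto simp: lin_list_def less_Suc_eq numeral_eq_Suc all_conj_distrib imp_conjR)

lemma multilin_triI:
  assumes "k_algebra K A"
    and "\<And>y z. y \<in> carrier A \<Longrightarrow> z \<in> carrier A \<Longrightarrow> (\<lambda>x. \<phi> [x, y, z]) \<in> lin_maps K A W"
    and "\<And>x z. x \<in> carrier A \<Longrightarrow> z \<in> carrier A \<Longrightarrow> (\<lambda>y. \<phi> [x, y, z]) \<in> lin_maps K A W"
    and "\<And>x y. x \<in> carrier A \<Longrightarrow> y \<in> carrier A \<Longrightarrow> (\<lambda>z. \<phi> [x, y, z]) \<in> lin_maps K A W"
  shows "multilin K (tri A) W \<phi>"
  using assms(2-4) lin_closed[OF assms(2)]
  by (intro multilinI) (auto simp: tri_carrier less_Suc_eq numeral_eq_Suc)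

context
  fixes K :: "('k, 'm) ring_scheme" and A :: "('k, 'a, 'n) module_scheme"
  assumes A: "k_algebra K A"
begin

lemma tri_pure_lin:
  "y \<in> carrier A \<Longrightarrow> z \<in> carrier A \<Longrightarrow> (\<lambda>x. pure K (tri A) [x, y, z]) \<in> lin_maps K A (tensor_alg K (tri A))"
  "x \<in> carrier A \<Longrightarrow> z \<in> carrier A \<Longrightarrow> (\<lambda>y. pure K (tri A) [x, y, z]) \<in> lin_maps K A (tensor_alg K (tri A))"
  "x \<in> carrier A \<Longrightarrow> y \<in> carrier A \<Longrightarrow> (\<lambda>z. pure K (tri A) [x, y, z]) \<in> lin_maps K A (tensor_alg K (tri A))"
proof -
  interpret A: k_algebra K A by (rule A)
  note lin = multilin_lin[OF tri_alg_list[OF A] pure_multilin[OF tri_alg_list[OF A]]]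
  show "y \<in> carrier A \<Longrightarrow> z \<in> carrier A \<Longrightarrow> (\<lambda>x. pure K (tri A) [x, y, z]) \<in> lin_maps K A (tensor_alg K (tri A))"
    using lin[of "[\<zero>\<^bsub>A\<^esub>, y, z]" 0] by (simp add: tri_carrier)
  show "x \<in> carrier A \<Longrightarrow> z \<in> carrier A \<Longrightarrow> (\<lambda>y. pure K (tri A) [x, y, z]) \<in> lin_maps K A (tensor_alg K (tri A))"
    using lin[of "[x, \<zero>\<^bsub>A\<^esub>, z]" 1] by (simp add: tri_carrier)
  show "x \<in> carrier A \<Longrightarrow> y \<in> carrier A \<Longrightarrow> (\<lambda>z. pure K (tri A) [x, y, z]) \<in> lin_maps K A (tensor_alg K (tri A))"
    using lin[of "[x, y, \<zero>\<^bsub>A\<^esub>]" 2] by (simp add: tri_carrier)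
qed

lemma tri_pure_closed:
  "x \<in> carrier A \<Longrightarrow> y \<in> carrier A \<Longrightarrow> z \<in> carrier A \<Longrightarrow> pure K (tri A) [x, y, z] \<in> carrier (tensor_alg K (tri A))"
  using lin_closed[OF tri_pure_lin(1)] .

lemma tri_pure_mult:
  assumes "x \<in> carrier A" "y \<in> carrier A" "z \<in> carrier A" "x' \<in> carrier A" "y' \<in> carrier A" "z' \<in> carrier A"
  shows "pure K (tri A) [x, y, z] \<otimes>\<^bsub>tensor_alg K (tri A)\<^esub> pure K (tri A) [x', y', z']
    = pure K (tri A) [x \<otimes>\<^bsub>A\<^esub> x', y' \<otimes>\<^bsub>A\<^esub> y, z \<otimes>\<^bsub>A\<^esub> z']"
  using assms by (subst pure_mult[OF tri_alg_list[OF A]]) (auto simp: tri_carrier tri_mult)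

lemma tri_pure_one: "\<one>\<^bsub>tensor_alg K (tri A)\<^esub> = pure K (tri A) [\<one>\<^bsub>A\<^esub>, \<one>\<^bsub>A\<^esub>, \<one>\<^bsub>A\<^esub>]"
  by (simp add: pure_one[OF tri_alg_list[OF A]])

lemma tri_pure_zero:
  assumes "x \<in> carrier A" "y \<in> carrier A"
  shows "pure K (tri A) [\<zero>\<^bsub>A\<^esub>, x, y] = \<zero>\<^bsub>tensor_alg K (tri A)\<^esub>"
    and "pure K (tri A) [x, \<zero>\<^bsub>A\<^esub>, y] = \<zero>\<^bsub>tensor_alg K (tri A)\<^esub>"
    and "pure K (tri A) [x, y, \<zero>\<^bsub>A\<^esub>] = \<zero>\<^bsub>tensor_alg K (tri A)\<^esub>"
  using lin_zero[OF k_algebra_module[OF A] tensor_module[OF tri_alg_list[OF A]]] tri_pure_lin assms by blast+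

lemma tri_ext:
  assumes "module K W" "f \<in> lin_maps K (tensor_alg K (tri A)) W" "g \<in> lin_maps K (tensor_alg K (tri A)) W"
    and "\<And>x y z. x \<in> carrier A \<Longrightarrow> y \<in> carrier A \<Longrightarrow> z \<in> carrier A
      \<Longrightarrow> f (pure K (tri A) [x, y, z]) = g (pure K (tri A) [x, y, z])"
    and "t \<in> carrier (tensor_alg K (tri A))"
  shows "f t = g t"
  by (rule tensor_ext[OF tri_alg_list[OF A] assms(1-3) _ assms(5)]) (use assms(4) in \<open>auto simp: tri_carrier\<close>)

end

context
  fixes K :: "('k, 'm) ring_scheme" and A :: "('k, 'a, 'n) module_scheme" and B :: "('k, 'b, 'p) module_scheme"
    and f g h
  assumes A: "k_algebra K A" and B: "k_algebra K B"
    and fgh: "f \<in> lin_maps K A B" "g \<in> lin_maps K A B" "h \<in> lin_maps K A B"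
begin

private lemmas AL = tri_alg_list[OF A]
private lemmas BL = tri_alg_list[OF B]

private lemma L: "lin_list K (tri A) (tri B) [f, g, h]"
  using fgh by (simp add: tri_lin_list)

lemma tri_map_lin: "tensor_map K (tri B) [f, g, h] \<in> lin_maps K (tensor_alg K (tri A)) (tensor_alg K (tri B))"
  by (rule tensor_map_lin[OF AL BL L])

lemma tri_map_closed:
  "t \<in> carrier (tensor_alg K (tri A)) \<Longrightarrow> tensor_map K (tri B) [f, g, h] t \<in> carrier (tensor_alg K (tri B))"
  by (rule lin_closed[OF tri_map_lin])

lemma tri_map_pure:
  "x \<in> carrier A \<Longrightarrow> y \<in> carrier A \<Longrightarrow> z \<in> carrier A
    \<Longrightarrow> tensor_map K (tri B) [f, g, h] (pure K (tri A) [x, y, z]) = pure K (tri B) [f x, g y, h z]"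
  by (subst tensor_map_pure[OF AL BL L]) (auto simp: tri_carrier)

lemma tri_map_comp:
  assumes "k_algebra K C" "f' \<in> lin_maps K B C" "g' \<in> lin_maps K B C" "h' \<in> lin_maps K B C"
    and "t \<in> carrier (tensor_alg K (tri A))"
  shows "tensor_map K (tri C) [f', g', h'] (tensor_map K (tri B) [f, g, h] t)
    = tensor_map K (tri C) [\<lambda>x. f' (f x), \<lambda>x. g' (g x), \<lambda>x. h' (h x)] t"
  using tensor_map_comp[OF AL BL tri_alg_list[OF assms(1)] L, of "[f', g', h']" t] assms(2-5)
  by (simp add: tri_lin_list)

lemma tri_map_cong:
  assumes "\<And>x. x \<in> carrier A \<Longrightarrow> f x = f' x" "\<And>x. x \<in> carrier A \<Longrightarrow> g x = g' x" "\<And>x. x \<in> carrier A \<Longrightarrow> h x = h' x"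
    and "t \<in> carrier (tensor_alg K (tri A))"
  shows "tensor_map K (tri B) [f, g, h] t = tensor_map K (tri B) [f', g', h'] t"
  by (rule tensor_map_cong[OF AL BL L]) (use assms in \<open>auto simp: less_Suc_eq numeral_eq_Suc\<close>)

lemma tri_map_zero:
  assumes "(\<forall>x\<in>carrier A. f x = \<zero>\<^bsub>B\<^esub>) \<or> (\<forall>x\<in>carrier A. g x = \<zero>\<^bsub>B\<^esub>) \<or> (\<forall>x\<in>carrier A. h x = \<zero>\<^bsub>B\<^esub>)"
    and "t \<in> carrier (tensor_alg K (tri A))"
  shows "tensor_map K (tri B) [f, g, h] t = \<zero>\<^bsub>tensor_alg K (tri B)\<^esub>"
proof -
  interpret T: module K "tensor_alg K (tri B)" by (rule tensor_module[OF BL])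
  have "tensor_map K (tri B) [f, g, h] t = (\<lambda>t. \<zero>\<^bsub>tensor_alg K (tri B)\<^esub>) t"
  proof (rule tri_ext[OF A T.module_axioms tri_map_lin _ _ assms(2)])
    show "(\<lambda>t. \<zero>\<^bsub>tensor_alg K (tri B)\<^esub>) \<in> lin_maps K (tensor_alg K (tri A)) (tensor_alg K (tri B))"
      by (rule lin_mapsI) auto
  qed (use assms(1) fgh[THEN lin_closed] in \<open>auto simp: tri_map_pure tri_pure_zero[OF B]\<close>)
  then show ?thesis .
qed

text \<open>Multiplication by a pure tensor is absorbed into the component maps, so the relations
  with \<open>\<mu> r\<close> become equalities of \<open>tensor_map\<close>s. The middle entry
  \<open>b\<close> ends up on the right of \<open>g x\<close>, because that factor carries the
  opposite product.\<close>

lemma tri_map_mult_left: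
  assumes "a \<in> carrier B" "b \<in> carrier B" "c \<in> carrier B" "t \<in> carrier (tensor_alg K (tri A))"
  shows "pure K (tri B) [a, b, c] \<otimes>\<^bsub>tensor_alg K (tri B)\<^esub> tensor_map K (tri B) [f, g, h] t
    = tensor_map K (tri B) [\<lambda>x. a \<otimes>\<^bsub>B\<^esub> f x, \<lambda>x. g x \<otimes>\<^bsub>B\<^esub> b, \<lambda>x. c \<otimes>\<^bsub>B\<^esub> h x] t"
proof -
  have l: "(\<lambda>x. a \<otimes>\<^bsub>B\<^esub> f x) \<in> lin_maps K A B" "(\<lambda>x. g x \<otimes>\<^bsub>B\<^esub> b) \<in> lin_maps K A B" "(\<lambda>x. c \<otimes>\<^bsub>B\<^esub> h x) \<in> lin_maps K A B"
    using lin_comp[OF lin_left_mult[OF B assms(1)] fgh(1)] lin_comp[OF lin_right_mult[OF B assms(2)] fgh(2)]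
      lin_comp[OF lin_left_mult[OF B assms(3)] fgh(3)] by auto
  have L: "lin_list K (tri A) (tri B) [\<lambda>x. a \<otimes>\<^bsub>B\<^esub> f x, \<lambda>x. g x \<otimes>\<^bsub>B\<^esub> b, \<lambda>x. c \<otimes>\<^bsub>B\<^esub> h x]"
    using l by (simp add: tri_lin_list)
  show ?thesis
  proof (rule tri_ext[OF A tensor_module[OF BL] lin_comp[OF lin_left_mult[OF tensor_k_algebra[OF BL]] tri_map_lin]
        tensor_map_lin[OF AL BL L] _ assms(4)])
    fix x y z assume xyz: "x \<in> carrier A" "y \<in> carrier A" "z \<in> carrier A"
    then show "pure K (tri B) [a, b, c] \<otimes>\<^bsub>tensor_alg K (tri B)\<^esub> tensor_map K (tri B) [f, g, h] (pure K (tri A) [x, y, z])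
      = tensor_map K (tri B) [\<lambda>x. a \<otimes>\<^bsub>B\<^esub> f x, \<lambda>x. g x \<otimes>\<^bsub>B\<^esub> b, \<lambda>x. c \<otimes>\<^bsub>B\<^esub> h x] (pure K (tri A) [x, y, z])"
      using assms(1-3) fgh[THEN lin_closed]
      by (subst tensor_map_pure[OF AL BL L]) (auto simp: tri_carrier tri_map_pure tri_pure_mult[OF B])
  qed (use assms tri_pure_closed[OF B] in auto)
qed

lemma tri_map_mult_right:
  assumes "a \<in> carrier B" "b \<in> carrier B" "c \<in> carrier B" "t \<in> carrier (tensor_alg K (tri A))"
  shows "tensor_map K (tri B) [f, g, h] t \<otimes>\<^bsub>tensor_alg K (tri B)\<^esub> pure K (tri B) [a, b, c]
    = tensor_map K (tri B) [\<lambda>x. f x \<otimes>\<^bsub>B\<^esub> a, \<lambda>x. b \<otimes>\<^bsub>B\<^esub> g x, \<lambda>x. h x \<otimes>\<^bsub>B\<^esub> c] t"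
proof -
  have l: "(\<lambda>x. f x \<otimes>\<^bsub>B\<^esub> a) \<in> lin_maps K A B" "(\<lambda>x. b \<otimes>\<^bsub>B\<^esub> g x) \<in> lin_maps K A B" "(\<lambda>x. h x \<otimes>\<^bsub>B\<^esub> c) \<in> lin_maps K A B"
    using lin_comp[OF lin_right_mult[OF B assms(1)] fgh(1)] lin_comp[OF lin_left_mult[OF B assms(2)] fgh(2)]
      lin_comp[OF lin_right_mult[OF B assms(3)] fgh(3)] by auto
  have L: "lin_list K (tri A) (tri B) [\<lambda>x. f x \<otimes>\<^bsub>B\<^esub> a, \<lambda>x. b \<otimes>\<^bsub>B\<^esub> g x, \<lambda>x. h x \<otimes>\<^bsub>B\<^esub> c]"
    using l by (simp add: tri_lin_list)
  show ?thesis
  proof (rule tri_ext[OF A tensor_module[OF BL] lin_comp[OF lin_right_mult[OF tensor_k_algebra[OF BL]] tri_map_lin]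
        tensor_map_lin[OF AL BL L] _ assms(4)])
    fix x y z assume xyz: "x \<in> carrier A" "y \<in> carrier A" "z \<in> carrier A"
    then show "tensor_map K (tri B) [f, g, h] (pure K (tri A) [x, y, z]) \<otimes>\<^bsub>tensor_alg K (tri B)\<^esub> pure K (tri B) [a, b, c]
      = tensor_map K (tri B) [\<lambda>x. f x \<otimes>\<^bsub>B\<^esub> a, \<lambda>x. b \<otimes>\<^bsub>B\<^esub> g x, \<lambda>x. h x \<otimes>\<^bsub>B\<^esub> c] (pure K (tri A) [x, y, z])"
      using assms(1-3) fgh[THEN lin_closed]
      by (subst tensor_map_pure[OF AL BL L]) (auto simp: tri_carrier tri_map_pure tri_pure_mult[OF B])
  qed (use assms tri_pure_closed[OF B] in auto)
qed

end

lemma tri_map_id: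
  assumes "k_algebra K A" "t \<in> carrier (tensor_alg K (tri A))"
  shows "tensor_map K (tri A) [\<lambda>x. x, \<lambda>x. x, \<lambda>x. x] t = t"
proof -
  have "tensor_map K (tri A) [\<lambda>x. x, \<lambda>x. x, \<lambda>x. x] t = (\<lambda>t. t) t"
    by (rule tri_ext[OF assms(1) tensor_module[OF tri_alg_list[OF assms(1)]] _ lin_id(1) _ assms(2)])
      (use assms(1) in \<open>auto simp: tri_map_pure lin_id intro!: tri_map_lin\<close>)
  then show ?thesis by simp
qed

text \<open>A map that respects the product also respects the reversed product, so the middle factor
  behaves like the outer ones.\<close>

lemma tri_map_alg_hom:
  assumes A: "k_algebra K A" and B: "k_algebra K B" and f: "f \<in> alg_hom K A B"
  shows "tensor_map K (tri B) [f, f, f] \<in> alg_hom K (tensor_alg K (tri A)) (tensor_alg K (tri B))"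
proof -
  note l = alg_hom_lin[OF f]
  have L: "lin_list K (tri A) (tri B) [f, f, f]" using l by (simp add: tri_lin_list)
  interpret A: k_algebra K A by (rule A)
  show ?thesis
    unfolding tensor_map_def
  proof (rule tensor_lift_alg_hom[OF tri_alg_list[OF A] tensor_k_algebra[OF tri_alg_list[OF B]]
        tensor_map_multilin[OF tri_alg_list[OF A] tri_alg_list[OF B] L]])
  qed (auto simp: tri_carrier tri_mult tri_pure_one[OF B] alg_hom_one[OF f] tri_pure_mult[OF B]
      alg_hom_closed[OF f] alg_hom_mult[OF f])
qed

section \<open>Quasi-central group-like elements\<close>

text \<open>Zorn's lemma, applied to submodules not containing \<open>e\<close>: the zero submodule
  is one, and unions of chains are again such. The maximal one will turn out to be a complement of
  the line through \<open>e\<close>, which takes the place of completing \<open>e\<close> to a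
  basis.\<close>

lemma maximal_submodule_avoiding:
  assumes "module K V" "e \<in> carrier V" "e \<noteq> \<zero>\<^bsub>V\<^esub>"
  obtains N where "submodule N K V" "e \<notin> N"
    "\<And>N'. submodule N' K V \<Longrightarrow> e \<notin> N' \<Longrightarrow> N \<subseteq> N' \<Longrightarrow> N' = N"
proof -
  interpret V: module K V by fact
  let ?S = "{N. submodule N K V \<and> e \<notin> N}"
  have "submodule {\<zero>\<^bsub>V\<^esub>} K V" by (rule module_submoduleI[OF assms(1)]) auto
  then have ne: "?S \<noteq> {}" using assms(3) by auto
  have ch: "\<Union>C \<in> ?S" if C: "C \<noteq> {}" "subset.chain ?S C" for C
  proof -
    have sub: "submodule N K V" "e \<notin> N" if "N \<in> C" for N
      using C(2) that by (auto simp: subset.chain_def)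
    note props = submodule_props[OF assms(1) sub(1)]
    have "submodule (\<Union>C) K V"
    proof (rule module_submoduleI[OF assms(1)])
      show "\<Union>C \<subseteq> carrier V" using props(1) by blast
      show "\<zero>\<^bsub>V\<^esub> \<in> \<Union>C" using props(2) C(1) by blast
      fix x y assume "x \<in> \<Union>C" "y \<in> \<Union>C"
      then obtain N N' where N: "N \<in> C" "x \<in> N" "N' \<in> C" "y \<in> N'" by blast
      then have "N \<subseteq> N' \<or> N' \<subseteq> N" using C(2) unfolding subset.chain_def by blast
      then show "x \<oplus>\<^bsub>V\<^esub> y \<in> \<Union>C" using N props(3) by blast
    qed (use props(5) in blast)
    then show ?thesis using sub(2) by auto
  qed
  obtain N where "N \<in> ?S" "\<forall>N'\<in>?S. N \<subseteq> N' \<longrightarrow> N' = N"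
    using subset_Zorn_nonempty[OF ne ch] by blast
  then show ?thesis using that by blast
qed

text \<open>Projection onto the line through \<open>\<one>\<close> along a maximal subspace avoiding
  \<open>\<one>\<close>. It is kept as a map from \<open>R\<close> to \<open>R\<close> with scalar
  values, rather than as a map to the field, so that it can serve as a component of
  \<open>tensor_map\<close>.\<close>

lemma scalar_functional:
  assumes "k_algebra K R" "\<one>\<^bsub>R\<^esub> \<noteq> \<zero>\<^bsub>R\<^esub>"
  obtains f where "f \<in> lin_maps K R R" "f \<one>\<^bsub>R\<^esub> = \<one>\<^bsub>R\<^esub>"
    "\<And>x. x \<in> carrier R \<Longrightarrow> \<exists>a\<in>carrier K. f x = a \<odot>\<^bsub>R\<^esub> \<one>\<^bsub>R\<^esub>"
proof -
  interpret R: k_algebra K R by fact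
  note mod = R.module_axioms
  obtain N where N: "submodule N K R" "\<one>\<^bsub>R\<^esub> \<notin> N"
    and max: "\<And>N'. submodule N' K R \<Longrightarrow> \<one>\<^bsub>R\<^esub> \<notin> N' \<Longrightarrow> N \<subseteq> N' \<Longrightarrow> N' = N"
    using maximal_submodule_avoiding[OF mod _ assms(2)] by blast
  note props = submodule_props[OF mod N(1)]
  have diff_cancel: "u \<ominus>\<^bsub>R\<^esub> (v \<oplus>\<^bsub>R\<^esub> u) = \<ominus>\<^bsub>R\<^esub> v" if "u \<in> carrier R" "v \<in> carrier R" for u v
    using that by algebra
  have diff_diff: "(u \<ominus>\<^bsub>R\<^esub> v) \<ominus>\<^bsub>R\<^esub> (u \<ominus>\<^bsub>R\<^esub> w) = w \<ominus>\<^bsub>R\<^esub> v"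
    if "u \<in> carrier R" "v \<in> carrier R" "w \<in> carrier R" for u v w
    using that by algebra
  have unscale: "x \<in> N" if "a \<in> carrier K" "a \<noteq> \<zero>\<^bsub>K\<^esub>" "x \<in> carrier R" "a \<odot>\<^bsub>R\<^esub> x \<in> N" for a x
  proof -
    have "a \<in> Units K" using that by (simp add: R.K.field_Units)
    then have "inv\<^bsub>K\<^esub> a \<in> carrier K" "inv\<^bsub>K\<^esub> a \<otimes>\<^bsub>K\<^esub> a = \<one>\<^bsub>K\<^esub>" by auto
    then have "x = inv\<^bsub>K\<^esub> a \<odot>\<^bsub>R\<^esub> (a \<odot>\<^bsub>R\<^esub> x)" using that by (simp flip: R.smult_assoc1)
    then show ?thesis using props(5)[OF \<open>inv\<^bsub>K\<^esub> a \<in> carrier K\<close> that(4)] by simp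
  qed
  have ex: "\<exists>b\<in>carrier K. x \<ominus>\<^bsub>R\<^esub> b \<odot>\<^bsub>R\<^esub> \<one>\<^bsub>R\<^esub> \<in> N" if x: "x \<in> carrier R" for x
  proof (cases "x \<in> N")
    case True
    then show ?thesis using x by (intro bexI[of _ "\<zero>\<^bsub>K\<^esub>"]) (auto simp: a_minus_def)
  next
    case False
    \<comment> \<open>For \<open>x\<close> outside \<open>N\<close> the subspace spanned by
      \<open>N\<close> and \<open>x\<close> is strictly larger, so by maximality it contains
      \<open>\<one>\<close>. In the resulting equation
      \<open>\<one> = n \<oplus> a \<odot> x\<close> the scalar \<open>a\<close> is nonzero because
      \<open>\<one>\<close> is not in \<open>N\<close>; dividing by it writes \<open>x\<close> as a
      multiple of \<open>\<one>\<close> modulo \<open>N\<close>.\<close>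
    let ?N = "{n \<oplus>\<^bsub>R\<^esub> a \<odot>\<^bsub>R\<^esub> x | n a. n \<in> N \<and> a \<in> carrier K}"
    have mem: "n \<oplus>\<^bsub>R\<^esub> a \<odot>\<^bsub>R\<^esub> x \<in> ?N" if "n \<in> N" "a \<in> carrier K" for n a using that by blast
    have "submodule ?N K R"
    proof (rule module_submoduleI[OF mod])
      show "?N \<subseteq> carrier R" using props(1) x by auto
      show "\<zero>\<^bsub>R\<^esub> \<in> ?N" using mem[OF props(2), of "\<zero>\<^bsub>K\<^esub>"] x by simp
    next
      fix y z assume "y \<in> ?N" "z \<in> ?N"
      then obtain n a n' a' where *: "n \<in> N" "a \<in> carrier K" "n' \<in> N" "a' \<in> carrier K"
        "y = n \<oplus>\<^bsub>R\<^esub> a \<odot>\<^bsub>R\<^esub> x" "z = n' \<oplus>\<^bsub>R\<^esub> a' \<odot>\<^bsub>R\<^esub> x" by blast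
      have "n \<in> carrier R" "n' \<in> carrier R" using * props(1) by auto
      then have "y \<oplus>\<^bsub>R\<^esub> z = (n \<oplus>\<^bsub>R\<^esub> n') \<oplus>\<^bsub>R\<^esub> (a \<oplus>\<^bsub>K\<^esub> a') \<odot>\<^bsub>R\<^esub> x"
        using * x by (simp add: R.smult_l_distr R.M.add.m_ac)
      then show "y \<oplus>\<^bsub>R\<^esub> z \<in> ?N" using mem[of "n \<oplus>\<^bsub>R\<^esub> n'" "a \<oplus>\<^bsub>K\<^esub> a'"] * props(3) by simp
    next
      fix b y assume "b \<in> carrier K" "y \<in> ?N"
      then obtain n a where *: "b \<in> carrier K" "n \<in> N" "a \<in> carrier K" "y = n \<oplus>\<^bsub>R\<^esub> a \<odot>\<^bsub>R\<^esub> x" by blast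
      have "n \<in> carrier R" using * props(1) by auto
      then have "b \<odot>\<^bsub>R\<^esub> y = b \<odot>\<^bsub>R\<^esub> n \<oplus>\<^bsub>R\<^esub> (b \<otimes>\<^bsub>K\<^esub> a) \<odot>\<^bsub>R\<^esub> x"
        using * x by (simp add: R.smult_r_distr R.smult_assoc1)
      then show "b \<odot>\<^bsub>R\<^esub> y \<in> ?N" using mem[of "b \<odot>\<^bsub>R\<^esub> n" "b \<otimes>\<^bsub>K\<^esub> a"] * props(5) by simp
    qed
    moreover have "N \<subseteq> ?N"
    proof
      fix n assume "n \<in> N"
      then have "n \<oplus>\<^bsub>R\<^esub> \<zero>\<^bsub>K\<^esub> \<odot>\<^bsub>R\<^esub> x = n" using x props(1) by auto
      with mem[OF \<open>n \<in> N\<close>, of "\<zero>\<^bsub>K\<^esub>"] show "n \<in> ?N" by (simp only: R.K.zero_closed)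
    qed
    moreover have "\<zero>\<^bsub>R\<^esub> \<oplus>\<^bsub>R\<^esub> \<one>\<^bsub>K\<^esub> \<odot>\<^bsub>R\<^esub> x = x" using x by simp
    with mem[OF props(2), of "\<one>\<^bsub>K\<^esub>"] have "x \<in> ?N" by (simp only: R.K.one_closed)
    ultimately have "\<one>\<^bsub>R\<^esub> \<in> ?N" using max[of ?N] False by blast
    then obtain n a where na: "n \<in> N" "a \<in> carrier K" "\<one>\<^bsub>R\<^esub> = n \<oplus>\<^bsub>R\<^esub> a \<odot>\<^bsub>R\<^esub> x" by blast
    have nc: "n \<in> carrier R" using na props(1) by auto
    have a0: "a \<noteq> \<zero>\<^bsub>K\<^esub>" using na N(2) x nc by auto
    then have inv: "inv\<^bsub>K\<^esub> a \<in> carrier K" "a \<otimes>\<^bsub>K\<^esub> inv\<^bsub>K\<^esub> a = \<one>\<^bsub>K\<^esub>"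
      using na(2) by (auto simp: R.K.field_Units)
    have "a \<odot>\<^bsub>R\<^esub> (x \<ominus>\<^bsub>R\<^esub> inv\<^bsub>K\<^esub> a \<odot>\<^bsub>R\<^esub> \<one>\<^bsub>R\<^esub>) = a \<odot>\<^bsub>R\<^esub> x \<ominus>\<^bsub>R\<^esub> \<one>\<^bsub>R\<^esub>"
      using x na(2) inv by (simp add: a_minus_def R.smult_r_distr R.smult_r_minus flip: R.smult_assoc1)
    also have "\<dots> = \<ominus>\<^bsub>R\<^esub> n"
      unfolding na(3) using diff_cancel x na(2) nc by simp
    also have "\<dots> \<in> N" using props(4)[OF props(2) na(1)] nc by (simp add: a_minus_def)
    finally have "a \<odot>\<^bsub>R\<^esub> (x \<ominus>\<^bsub>R\<^esub> inv\<^bsub>K\<^esub> a \<odot>\<^bsub>R\<^esub> \<one>\<^bsub>R\<^esub>) \<in> N" .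
    moreover have "x \<ominus>\<^bsub>R\<^esub> inv\<^bsub>K\<^esub> a \<odot>\<^bsub>R\<^esub> \<one>\<^bsub>R\<^esub> \<in> carrier R" using inv(1) x by simp
    ultimately have "x \<ominus>\<^bsub>R\<^esub> inv\<^bsub>K\<^esub> a \<odot>\<^bsub>R\<^esub> \<one>\<^bsub>R\<^esub> \<in> N" by (rule unscale[OF na(2) a0, rotated])
    then show ?thesis using inv(1) by blast
  qed
  \<comment> \<open>If two scalars both work, their difference times \<open>\<one>\<close> lies in
    \<open>N\<close>; were it nonzero, \<open>unscale\<close> would put \<open>\<one>\<close> into
    \<open>N\<close>. This uniqueness also yields linearity of the coefficient
    \<open>\<beta>\<close> defined below.\<close>
  have unique: "b = b'" if "b \<in> carrier K" "b' \<in> carrier K" "x \<in> carrier R" "x \<ominus>\<^bsub>R\<^esub> b \<odot>\<^bsub>R\<^esub> \<one>\<^bsub>R\<^esub> \<in> N"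
    "x \<ominus>\<^bsub>R\<^esub> b' \<odot>\<^bsub>R\<^esub> \<one>\<^bsub>R\<^esub> \<in> N" for b b' x
  proof -
    have "(x \<ominus>\<^bsub>R\<^esub> b \<odot>\<^bsub>R\<^esub> \<one>\<^bsub>R\<^esub>) \<ominus>\<^bsub>R\<^esub> (x \<ominus>\<^bsub>R\<^esub> b' \<odot>\<^bsub>R\<^esub> \<one>\<^bsub>R\<^esub>) = (b' \<ominus>\<^bsub>K\<^esub> b) \<odot>\<^bsub>R\<^esub> \<one>\<^bsub>R\<^esub>"
      using that(1-3) diff_diff by (simp add: a_minus_def[of K] R.smult_l_distr R.smult_l_minus flip: a_minus_def[of R])
    then have "(b' \<ominus>\<^bsub>K\<^esub> b) \<odot>\<^bsub>R\<^esub> \<one>\<^bsub>R\<^esub> \<in> N" using props(4)[OF that(4,5)] by simp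
    then have "b' \<ominus>\<^bsub>K\<^esub> b = \<zero>\<^bsub>K\<^esub>" using unscale[of "b' \<ominus>\<^bsub>K\<^esub> b" "\<one>\<^bsub>R\<^esub>"] that N(2) by auto
    then show ?thesis using diff_eq_zero_iff[OF R.K.abelian_group_axioms that(2,1)] by simp
  qed
  define \<beta> where "\<beta> x = (SOME b. b \<in> carrier K \<and> x \<ominus>\<^bsub>R\<^esub> b \<odot>\<^bsub>R\<^esub> \<one>\<^bsub>R\<^esub> \<in> N)" for x
  have \<beta>: "\<beta> x \<in> carrier K" "x \<ominus>\<^bsub>R\<^esub> \<beta> x \<odot>\<^bsub>R\<^esub> \<one>\<^bsub>R\<^esub> \<in> N" if "x \<in> carrier R" for x
    using someI_ex[of "\<lambda>b. b \<in> carrier K \<and> x \<ominus>\<^bsub>R\<^esub> b \<odot>\<^bsub>R\<^esub> \<one>\<^bsub>R\<^esub> \<in> N"] ex[OF that] by (auto simp: \<beta>_def)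
  have \<beta>_eq: "\<beta> x = b" if "x \<in> carrier R" "b \<in> carrier K" "x \<ominus>\<^bsub>R\<^esub> b \<odot>\<^bsub>R\<^esub> \<one>\<^bsub>R\<^esub> \<in> N" for x b
    using unique that \<beta> by blast
  show ?thesis
  proof (rule that[of "\<lambda>x. \<beta> x \<odot>\<^bsub>R\<^esub> \<one>\<^bsub>R\<^esub>"])
    show "(\<lambda>x. \<beta> x \<odot>\<^bsub>R\<^esub> \<one>\<^bsub>R\<^esub>) \<in> lin_maps K R R"
    proof (rule lin_mapsI)
      fix x y assume xy: "x \<in> carrier R" "y \<in> carrier R"
      have "(x \<oplus>\<^bsub>R\<^esub> y) \<ominus>\<^bsub>R\<^esub> (\<beta> x \<oplus>\<^bsub>K\<^esub> \<beta> y) \<odot>\<^bsub>R\<^esub> \<one>\<^bsub>R\<^esub> = (x \<ominus>\<^bsub>R\<^esub> \<beta> x \<odot>\<^bsub>R\<^esub> \<one>\<^bsub>R\<^esub>) \<oplus>\<^bsub>R\<^esub> (y \<ominus>\<^bsub>R\<^esub> \<beta> y \<odot>\<^bsub>R\<^esub> \<one>\<^bsub>R\<^esub>)"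
        using xy \<beta>(1) by (simp add: a_minus_def R.M.minus_add R.smult_l_distr R.M.add.m_ac)
      then have "\<beta> (x \<oplus>\<^bsub>R\<^esub> y) = \<beta> x \<oplus>\<^bsub>K\<^esub> \<beta> y" using xy \<beta> props(3) by (intro \<beta>_eq) auto
      then show "\<beta> (x \<oplus>\<^bsub>R\<^esub> y) \<odot>\<^bsub>R\<^esub> \<one>\<^bsub>R\<^esub> = \<beta> x \<odot>\<^bsub>R\<^esub> \<one>\<^bsub>R\<^esub> \<oplus>\<^bsub>R\<^esub> \<beta> y \<odot>\<^bsub>R\<^esub> \<one>\<^bsub>R\<^esub>"
        using xy \<beta>(1) by (simp add: R.smult_l_distr)
    next
      fix a x assume ax: "a \<in> carrier K" "x \<in> carrier R"
      have "a \<odot>\<^bsub>R\<^esub> x \<ominus>\<^bsub>R\<^esub> (a \<otimes>\<^bsub>K\<^esub> \<beta> x) \<odot>\<^bsub>R\<^esub> \<one>\<^bsub>R\<^esub> = a \<odot>\<^bsub>R\<^esub> (x \<ominus>\<^bsub>R\<^esub> \<beta> x \<odot>\<^bsub>R\<^esub> \<one>\<^bsub>R\<^esub>)"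
        using ax \<beta>(1) by (simp add: a_minus_def R.smult_r_distr R.smult_r_minus R.smult_assoc1)
      then have "\<beta> (a \<odot>\<^bsub>R\<^esub> x) = a \<otimes>\<^bsub>K\<^esub> \<beta> x" using ax \<beta> props(5) by (intro \<beta>_eq) auto
      then show "\<beta> (a \<odot>\<^bsub>R\<^esub> x) \<odot>\<^bsub>R\<^esub> \<one>\<^bsub>R\<^esub> = a \<odot>\<^bsub>R\<^esub> (\<beta> x \<odot>\<^bsub>R\<^esub> \<one>\<^bsub>R\<^esub>)"
        using ax \<beta>(1) by (simp add: R.smult_assoc1)
    qed (use \<beta>(1) in auto)
    have "\<beta> \<one>\<^bsub>R\<^esub> = \<one>\<^bsub>K\<^esub>"
      by (rule \<beta>_eq) (use props(2) in \<open>auto simp: a_minus_def R.M.r_neg\<close>)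
    then show "\<beta> \<one>\<^bsub>R\<^esub> \<odot>\<^bsub>R\<^esub> \<one>\<^bsub>R\<^esub> = \<one>\<^bsub>R\<^esub>" by simp
  qed (use \<beta>(1) in auto)
qed

text \<open>Multiplying all factors together with the product of \<open>R\<close> is well defined as
  a linear map; it serves to return from a tensor identity to an identity in
  \<open>R\<close>.\<close>

lemma tri_product_lin:
  assumes "k_algebra K R"
  obtains m where "m \<in> lin_maps K (tensor_alg K (tri R)) R"
    "\<And>x y z. x \<in> carrier R \<Longrightarrow> y \<in> carrier R \<Longrightarrow> z \<in> carrier R
      \<Longrightarrow> m (pure K (tri R) [x, y, z]) = x \<otimes>\<^bsub>R\<^esub> y \<otimes>\<^bsub>R\<^esub> z"
proof -
  interpret R: k_algebra K R by fact
  let ?\<phi> = "\<lambda>xs. xs ! 0 \<otimes>\<^bsub>R\<^esub> xs ! 1 \<otimes>\<^bsub>R\<^esub> xs ! 2"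
  have ml: "multilin K (tri R) R ?\<phi>"
    by (rule multilin_triI[OF assms])
      (auto simp: R.A.l_distr R.A.r_distr R.smult_mult_left R.smult_mult_right intro!: lin_mapsI)
  show ?thesis
    by (rule that[of "tensor_lift K R ?\<phi>"])
      (use tensor_lift_lin[OF tri_alg_list[OF assms] R.module_axioms ml]
        tensor_lift_pure[OF tri_alg_list[OF assms] R.module_axioms ml] in \<open>auto simp: tri_carrier\<close>)
qed

text \<open>Applying a functional to one tensor factor of \<open>u \<otimes> u' \<otimes> x = v \<otimes> v' \<otimes> x\<close> shows that
  \<open>u\<close> is a multiple of \<open>v\<close>.\<close>

lemma tri_pure_proportional:
  assumes R: "k_algebra K R" and one: "\<one>\<^bsub>R\<^esub> \<noteq> \<zero>\<^bsub>R\<^esub>"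
    and c: "x \<in> Units R" "y \<in> Units R" "z \<in> Units R" "x' \<in> carrier R" "y' \<in> carrier R" "z' \<in> carrier R"
    and eq: "pure K (tri R) [x, y, z] = pure K (tri R) [x', y', z']"
  shows "x' = x \<Longrightarrow> \<exists>a\<in>carrier K. z = a \<odot>\<^bsub>R\<^esub> z'" and "z' = z \<Longrightarrow> \<exists>a\<in>carrier K. x = a \<odot>\<^bsub>R\<^esub> x'"
proof -
  interpret R: k_algebra K R by fact
  obtain m where m: "m \<in> lin_maps K (tensor_alg K (tri R)) R"
    "\<And>x y z. x \<in> carrier R \<Longrightarrow> y \<in> carrier R \<Longrightarrow> z \<in> carrier R \<Longrightarrow> m (pure K (tri R) [x, y, z]) = x \<otimes>\<^bsub>R\<^esub> y \<otimes>\<^bsub>R\<^esub> z"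
    using tri_product_lin[OF R] by blast
  obtain f where f: "f \<in> lin_maps K R R" "f \<one>\<^bsub>R\<^esub> = \<one>\<^bsub>R\<^esub>" "\<And>x. x \<in> carrier R \<Longrightarrow> \<exists>a\<in>carrier K. f x = a \<odot>\<^bsub>R\<^esub> \<one>\<^bsub>R\<^esub>"
    using scalar_functional[OF R one] by blast
  have cc: "x \<in> carrier R" "y \<in> carrier R" "z \<in> carrier R" "inv\<^bsub>R\<^esub> x \<in> carrier R" "inv\<^bsub>R\<^esub> y \<in> carrier R" "inv\<^bsub>R\<^esub> z \<in> carrier R"
    using c by auto
  have l: "(\<lambda>r. f (inv\<^bsub>R\<^esub> y \<otimes>\<^bsub>R\<^esub> r)) \<in> lin_maps K R R" "(\<lambda>r. inv\<^bsub>R\<^esub> x \<otimes>\<^bsub>R\<^esub> r) \<in> lin_maps K R R"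
    "(\<lambda>r. r \<otimes>\<^bsub>R\<^esub> inv\<^bsub>R\<^esub> z) \<in> lin_maps K R R"
    using cc by (auto intro!: lin_comp[OF f(1)] lin_left_mult[OF R] lin_right_mult[OF R])
  have fc: "f r \<in> carrier R" if "r \<in> carrier R" for r using lin_closed[OF f(1) that] .
  obtain a where a: "a \<in> carrier K" "f (inv\<^bsub>R\<^esub> y \<otimes>\<^bsub>R\<^esub> y') = a \<odot>\<^bsub>R\<^esub> \<one>\<^bsub>R\<^esub>" using f(3) cc c by blast
  note P = tri_map_pure[OF R R]
  show "\<exists>a\<in>carrier K. z = a \<odot>\<^bsub>R\<^esub> z'" if "x' = x"
  proof -
    \<comment> \<open>The first two factors are normalised: on the left they become
      \<open>inv x \<otimes> x = \<one>\<close> and \<open>f \<one> = \<one>\<close>, on the right,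
      where the first entry is also \<open>x\<close>, they become \<open>\<one>\<close> and the
      scalar \<open>a\<close>. Multiplying the factors leaves
      \<open>z = a \<odot> z'\<close>.\<close>
    have "m (tensor_map K (tri R) [\<lambda>r. inv\<^bsub>R\<^esub> x \<otimes>\<^bsub>R\<^esub> r, \<lambda>r. f (inv\<^bsub>R\<^esub> y \<otimes>\<^bsub>R\<^esub> r), \<lambda>r. r] (pure K (tri R) [x, y, z]))
      = m (tensor_map K (tri R) [\<lambda>r. inv\<^bsub>R\<^esub> x \<otimes>\<^bsub>R\<^esub> r, \<lambda>r. f (inv\<^bsub>R\<^esub> y \<otimes>\<^bsub>R\<^esub> r), \<lambda>r. r] (pure K (tri R) [x', y', z']))"
      by (simp add: eq)
    then have "z = a \<odot>\<^bsub>R\<^esub> z'"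
      using c cc a fc f(2) that by (simp add: P[OF l(2,1) lin_id(1)] m(2) R.smult_mult_left)
    then show ?thesis using a by blast
  qed
  show "\<exists>a\<in>carrier K. x = a \<odot>\<^bsub>R\<^esub> x'" if "z' = z"
  proof -
    have "m (tensor_map K (tri R) [\<lambda>r. r, \<lambda>r. f (inv\<^bsub>R\<^esub> y \<otimes>\<^bsub>R\<^esub> r), \<lambda>r. r \<otimes>\<^bsub>R\<^esub> inv\<^bsub>R\<^esub> z] (pure K (tri R) [x, y, z]))
      = m (tensor_map K (tri R) [\<lambda>r. r, \<lambda>r. f (inv\<^bsub>R\<^esub> y \<otimes>\<^bsub>R\<^esub> r), \<lambda>r. r \<otimes>\<^bsub>R\<^esub> inv\<^bsub>R\<^esub> z] (pure K (tri R) [x', y', z']))"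
      by (simp add: eq)
    then have "x = a \<odot>\<^bsub>R\<^esub> x'"
      using c cc a fc f(2) that by (simp add: P[OF lin_id(1) l(1,3)] m(2) R.smult_mult_left R.smult_mult_right)
    then show ?thesis using a by blast
  qed
qed

context hopf_galois_algebra
begin

lemma one_neq_zero: "\<one> \<noteq> \<zero>"
  using nonzero A.one_zeroD by blast

lemma mu_closed: "r \<in> carrier R \<Longrightarrow> \<mu> r \<in> carrier (tensor_alg K (tri R))"
  by (rule alg_hom_closed[OF mu_alg_hom])

lemma group_likeD:
  assumes "x \<in> group_likes K R \<mu>"
  shows "x \<in> Units R" "x \<in> carrier R" "inv x \<in> carrier R" "x \<otimes> inv x = \<one>" "inv x \<otimes> x = \<one>"
    "\<mu> x = pure K (tri R) [x, inv x, x]"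
  using assms by (auto simp: group_likes_def)

text \<open>Scalars depending on \<open>x\<close> already suffice: \<open>g \<otimes> x\<close> is a
  unit, hence nonzero, so its scalar is unique, and uniqueness forces the scalars to be
  multiplicative in \<open>x\<close>.\<close>

lemma quasi_centralI:
  assumes g: "g \<in> group_likes K R \<mu>"
    and sc: "\<And>x. x \<in> group_likes K R \<mu> \<Longrightarrow> \<exists>a\<in>carrier K. x \<otimes> g = a \<odot> (g \<otimes> x)"
  shows "quasi_central K R \<mu> g"
proof -
  have U: "g \<otimes> x \<in> carrier R" "g \<otimes> x \<noteq> \<zero>" "x \<otimes> g \<noteq> \<zero>" if "x \<in> Units R" for x
  proof -
    have "g \<otimes> x \<in> Units R" "x \<otimes> g \<in> Units R" using that group_likeD(1)[OF g] by auto
    moreover have "u \<noteq> \<zero>" if "u \<in> Units R" for u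
      using that one_neq_zero by (metis A.Units_r_inv A.Units_inv_closed A.l_null)
    ultimately show "g \<otimes> x \<in> carrier R" "g \<otimes> x \<noteq> \<zero>" "x \<otimes> g \<noteq> \<zero>" by auto
  qed
  define \<alpha> where "\<alpha> x = (SOME a. a \<in> carrier K \<and> x \<otimes> g = a \<odot> (g \<otimes> x))" for x
  have \<alpha>: "\<alpha> x \<in> carrier K" "x \<otimes> g = \<alpha> x \<odot> (g \<otimes> x)" if "x \<in> group_likes K R \<mu>" for x
    using someI_ex[of "\<lambda>a. a \<in> carrier K \<and> x \<otimes> g = a \<odot> (g \<otimes> x)"] sc[OF that] by (auto simp: \<alpha>_def)
  have unique: "a = b" if "a \<in> carrier K" "b \<in> carrier K" "y \<in> carrier R" "y \<noteq> \<zero>" "a \<odot> y = b \<odot> y" for a b y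
  proof (rule ccontr)
    assume "a \<noteq> b"
    then have d: "a \<ominus>\<^bsub>K\<^esub> b \<in> Units K"
      using that diff_eq_zero_iff[OF K.abelian_group_axioms that(1,2)] by (simp add: K.field_Units)
    have "(a \<ominus>\<^bsub>K\<^esub> b) \<odot> y = \<zero>"
      using that by (simp add: a_minus_def smult_l_distr smult_l_minus M.r_neg)
    then have "inv\<^bsub>K\<^esub> (a \<ominus>\<^bsub>K\<^esub> b) \<odot> ((a \<ominus>\<^bsub>K\<^esub> b) \<odot> y) = \<zero>" using d by simp
    moreover have "inv\<^bsub>K\<^esub> (a \<ominus>\<^bsub>K\<^esub> b) \<odot> ((a \<ominus>\<^bsub>K\<^esub> b) \<odot> y) = y"
      using d that by (simp flip: smult_assoc1)
    ultimately show False using that by simp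
  qed
  have "\<alpha> x \<in> Units K" if "x \<in> group_likes K R \<mu>" for x
  proof -
    have "\<alpha> x \<noteq> \<zero>\<^bsub>K\<^esub>"
      using \<alpha>[OF that] U[OF group_likeD(1)[OF that]] by auto
    then show ?thesis using \<alpha>(1)[OF that] by (simp add: K.field_Units)
  qed
  moreover have "\<alpha> (x \<otimes> y) = \<alpha> x \<otimes>\<^bsub>K\<^esub> \<alpha> y" if x: "x \<in> group_likes K R \<mu>" and y: "y \<in> group_likes K R \<mu>" for x y
  proof -
    note c = group_likeD(2)[OF x] group_likeD(2)[OF y] group_likeD(2)[OF g]
    have "x \<otimes> y \<otimes> g = x \<otimes> (\<alpha> y \<odot> (g \<otimes> y))" using c \<alpha>[OF y] by (simp add: A.m_assoc)
    also have "\<dots> = \<alpha> y \<odot> (x \<otimes> g \<otimes> y)" using c \<alpha>(1)[OF y] by (simp add: A.m_assoc smult_mult_right)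
    also have "x \<otimes> g \<otimes> y = \<alpha> x \<odot> (g \<otimes> x \<otimes> y)" using c \<alpha>[OF x] by (simp add: smult_mult_left)
    also have "\<alpha> y \<odot> (\<alpha> x \<odot> (g \<otimes> x \<otimes> y)) = (\<alpha> x \<otimes>\<^bsub>K\<^esub> \<alpha> y) \<odot> (g \<otimes> (x \<otimes> y))"
      using c \<alpha>(1)[OF x] \<alpha>(1)[OF y] by (simp add: A.m_assoc K.m_comm flip: smult_assoc1)
    finally have eq: "x \<otimes> y \<otimes> g = (\<alpha> x \<otimes>\<^bsub>K\<^esub> \<alpha> y) \<odot> (g \<otimes> (x \<otimes> y))" .
    \<comment> \<open>The existence of a scalar for the product is read off from \<open>eq\<close>
      itself; this avoids having to show that products of group-likes are group-like, since
      \<open>\<alpha>\<close> is defined by choice for every element.\<close>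
    have "\<exists>a. a \<in> carrier K \<and> x \<otimes> y \<otimes> g = a \<odot> (g \<otimes> (x \<otimes> y))"
      using eq \<alpha>(1)[OF x] \<alpha>(1)[OF y] by blast
    then have *: "\<alpha> (x \<otimes> y) \<in> carrier K" "x \<otimes> y \<otimes> g = \<alpha> (x \<otimes> y) \<odot> (g \<otimes> (x \<otimes> y))"
      using someI_ex[of "\<lambda>a. a \<in> carrier K \<and> x \<otimes> y \<otimes> g = a \<odot> (g \<otimes> (x \<otimes> y))"] by (auto simp: \<alpha>_def)
    have "x \<otimes> y \<in> Units R" using group_likeD(1)[OF x] group_likeD(1)[OF y] by auto
    from U(1,2)[OF this] show ?thesis
      by (rule unique[OF *(1) K.m_closed[OF \<alpha>(1)[OF x] \<alpha>(1)[OF y]]]) (simp only: *(2)[symmetric] eq[symmetric])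
  qed
  ultimately have "\<alpha> \<in> hom (R\<lparr>carrier := group_likes K R \<mu>\<rparr>) (units_of K)"
    by (auto simp: hom_def units_of_def)
  then show ?thesis using g \<alpha>(2) by (auto simp: quasi_central_def)
qed

text \<open>At a group-like \<open>x\<close> both hypotheses become equalities of pure tensors. The
  two sides of the first share the first factor \<open>\<tau> x\<close>, those of the second share
  the third factor \<open>x\<close>, so \<open>tri_pure_proportional\<close> applies to
  each.\<close>

lemma quasi_central_from_conditions:
  assumes g: "g \<in> group_likes K R \<mu>" and \<tau>: "\<tau> \<in> alg_hom K R R"
    and 1: "\<And>r. r \<in> carrier R \<Longrightarrow> tensor_map K (tri R) [\<tau>, id, id] (\<mu> r) = tensor_map K (tri R) [\<tau>, \<tau>, \<tau>] (\<mu> r)"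
    and 2: "\<And>r. r \<in> carrier R \<Longrightarrow>
      tensor_map K (tri R) [conj_by R g, conj_by R g, id] (\<mu> r) = tensor_map K (tri R) [\<tau>, \<tau>, id] (\<mu> r)"
  shows "quasi_central K R \<mu> g"
proof (rule quasi_centralI[OF g])
  fix x assume x: "x \<in> group_likes K R \<mu>"
  note alg = k_algebra_axioms
  note gc = group_likeD[OF g] and xc = group_likeD[OF x]
  note tc = alg_hom_closed[OF \<tau>] and tm = alg_hom_mult[OF \<tau>] and t1 = alg_hom_one[OF \<tau>]
  have "conj_by R g = (\<lambda>r. g \<otimes> r \<otimes> inv g)" by (simp add: conj_by_def[abs_def])
  then have cl: "conj_by R g \<in> lin_maps K R R"
    using lin_comp[OF lin_right_mult[OF alg gc(3)] lin_left_mult[OF alg gc(2)]] by simp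
  note tl = alg_hom_lin[OF \<tau>]
  have tU: "\<tau> x \<in> Units R" "\<tau> (inv x) \<in> Units R" "inv x \<in> Units R"
  proof -
    have *: "\<tau> x \<otimes> \<tau> (inv x) = \<one>" "\<tau> (inv x) \<otimes> \<tau> x = \<one>"
      using xc(2-5) by (simp_all add: t1 flip: tm)
    then show "\<tau> x \<in> Units R" using xc(2,3) tc unfolding Units_def by blast
    show "\<tau> (inv x) \<in> Units R" using * xc(2,3) tc unfolding Units_def by blast
    show "inv x \<in> Units R" using xc(1) by simp
  qed
  have cU: "conj_by R g r \<in> Units R" if "r \<in> Units R" for r
    using that gc(1) by (simp add: conj_by_def)
  have "pure K (tri R) [\<tau> x, inv x, x] = pure K (tri R) [\<tau> x, \<tau> (inv x), \<tau> x]"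
    using 1[OF xc(2)] xc(2,3) by (simp add: xc(6) tri_map_pure[OF alg alg] lin_id tl)
  then obtain a where a: "a \<in> carrier K" "x = a \<odot> \<tau> x"
    using tri_pure_proportional(1)[OF alg one_neq_zero tU(1,3) xc(1) tc tc tc] xc(2,3) by blast
  have "pure K (tri R) [conj_by R g x, conj_by R g (inv x), x] = pure K (tri R) [\<tau> x, \<tau> (inv x), x]"
    using 2[OF xc(2)] xc(2,3) by (simp add: xc(6) tri_map_pure[OF alg alg] lin_id tl cl)
  then obtain b where b: "b \<in> carrier K" "conj_by R g x = b \<odot> \<tau> x"
    using tri_pure_proportional(2)[OF alg one_neq_zero cU[OF xc(1)] cU[OF tU(3)] xc(1) tc tc xc(2)] xc(2,3) by blast
  have u: "u \<noteq> \<zero>" if "u \<in> Units R" for u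
    using that one_neq_zero by (metis A.Units_r_inv A.Units_inv_closed A.l_null)
  \<comment> \<open>A vanishing scalar would make the conjugate of \<open>x\<close>, which is a
    unit, equal to zero.\<close>
  have "b \<noteq> \<zero>\<^bsub>K\<^esub>" using b u[OF cU[OF xc(1)]] tc[OF xc(2)] by auto
  then have bi: "inv\<^bsub>K\<^esub> b \<in> carrier K" "inv\<^bsub>K\<^esub> b \<otimes>\<^bsub>K\<^esub> b = \<one>\<^bsub>K\<^esub>" using b by (auto simp: K.field_Units)
  have "\<tau> x = inv\<^bsub>K\<^esub> b \<odot> (g \<otimes> x \<otimes> inv g)"
    using b bi tc[OF xc(2)] by (simp add: conj_by_def flip: smult_assoc1)
  then have "x = (a \<otimes>\<^bsub>K\<^esub> inv\<^bsub>K\<^esub> b) \<odot> (g \<otimes> x \<otimes> inv g)"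
    using a bi gc(2,3) xc(2) by (simp add: smult_assoc1)
  then have "x \<otimes> g = (a \<otimes>\<^bsub>K\<^esub> inv\<^bsub>K\<^esub> b) \<odot> (g \<otimes> x \<otimes> inv g) \<otimes> g" by simp
  also have "\<dots> = (a \<otimes>\<^bsub>K\<^esub> inv\<^bsub>K\<^esub> b) \<odot> (g \<otimes> x)"
    using a bi gc(2-5) xc(2) by (simp add: smult_mult_left A.m_assoc)
  finally show "\<exists>a\<in>carrier K. x \<otimes> g = a \<odot> (g \<otimes> x)" using a bi by blast
qed

end

section \<open>The defining relations in the triple tensor product\<close>

text \<open>The prescribed value of the structure map at a generator. The argument \<open>g'\<close>
  is separate from \<open>g\<close> because it is filled with the image of an inverse in
  \<open>R\<close>.\<close>

definition skew_elt ::
  "('k, 'm) ring_scheme \<Rightarrow> ('k, 'a, 'n) module_scheme \<Rightarrow> 'a \<Rightarrow> 'a \<Rightarrow> 'a \<Rightarrow> ('a list \<Rightarrow> 'k) set"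
  where "skew_elt K A g g' x = pure K (tri A) [x, \<one>\<^bsub>A\<^esub>, \<one>\<^bsub>A\<^esub>]
    \<ominus>\<^bsub>tensor_alg K (tri A)\<^esub> pure K (tri A) [g, g' \<otimes>\<^bsub>A\<^esub> x, \<one>\<^bsub>A\<^esub>]
    \<oplus>\<^bsub>tensor_alg K (tri A)\<^esub> pure K (tri A) [g, g', x]"

lemma lin_conj_by:
  assumes "k_algebra K R" "g \<in> Units R"
  shows "conj_by R g \<in> lin_maps K R R"
proof -
  interpret R: k_algebra K R by fact
  have "conj_by R g = (\<lambda>r. g \<otimes>\<^bsub>R\<^esub> r \<otimes>\<^bsub>R\<^esub> inv\<^bsub>R\<^esub> g)" by (simp add: conj_by_def[abs_def])
  then show ?thesis
    using lin_comp[OF lin_right_mult[OF assms(1)] lin_left_mult[OF assms(1)], of "inv\<^bsub>R\<^esub> g" g] assms(2) by auto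
qed

context
  fixes K :: "('k, 'm) ring_scheme" and R :: "('k, 'a, 'n) module_scheme" and A :: "('k, 'b, 'p) module_scheme"
    and i \<tau> g X
  assumes R: "k_algebra K R" and A: "k_algebra K A" and i: "i \<in> alg_hom K R A"
    and \<tau>: "\<tau> \<in> alg_hom K R R" and g: "g \<in> Units R" and X: "X \<in> carrier A"
    and X_rel: "\<And>r. r \<in> carrier R \<Longrightarrow> X \<otimes>\<^bsub>A\<^esub> i r = i (\<tau> r) \<otimes>\<^bsub>A\<^esub> X"
begin

private abbreviation (input) "RRR \<equiv> tensor_alg K (tri R)"
private abbreviation (input) "AAA \<equiv> tensor_alg K (tri A)"
private abbreviation (input) "g' \<equiv> inv\<^bsub>R\<^esub> g"
private abbreviation (input) "tm \<equiv> tensor_map K (tri A)"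
private abbreviation (input) "skX \<equiv> skew_elt K A (i g) (i g') X"
private abbreviation (input) "trR \<equiv> tensor_map K (tri R)"

private lemma gc: "g \<in> carrier R" "g' \<in> carrier R" "g \<otimes>\<^bsub>R\<^esub> g' = \<one>\<^bsub>R\<^esub>" "g' \<otimes>\<^bsub>R\<^esub> g = \<one>\<^bsub>R\<^esub>"
proof -
  interpret R: k_algebra K R by (rule R)
  show "g \<in> carrier R" "g' \<in> carrier R" "g \<otimes>\<^bsub>R\<^esub> g' = \<one>\<^bsub>R\<^esub>" "g' \<otimes>\<^bsub>R\<^esub> g = \<one>\<^bsub>R\<^esub>" using g by auto
qed

private lemmas ic = alg_hom_closed[OF i]
private lemmas im = alg_hom_mult[OF i]
private lemmas tc = alg_hom_closed[OF \<tau>]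

private lemma linR [simp, intro]:
  "\<tau> \<in> lin_maps K R R" "(\<lambda>x. x) \<in> lin_maps K R R" "id \<in> lin_maps K R R"
  "(\<lambda>x. g \<otimes>\<^bsub>R\<^esub> x) \<in> lin_maps K R R" "(\<lambda>x. x \<otimes>\<^bsub>R\<^esub> g) \<in> lin_maps K R R"
  "(\<lambda>x. g' \<otimes>\<^bsub>R\<^esub> x) \<in> lin_maps K R R" "(\<lambda>x. x \<otimes>\<^bsub>R\<^esub> g') \<in> lin_maps K R R"
  "(\<lambda>x. g' \<otimes>\<^bsub>R\<^esub> \<tau> x) \<in> lin_maps K R R" "conj_by R g \<in> lin_maps K R R"
  using alg_hom_lin[OF \<tau>] lin_id gc lin_left_mult[OF R] lin_right_mult[OF R]
    lin_comp[OF lin_left_mult[OF R gc(2)] alg_hom_lin[OF \<tau>]] lin_conj_by[OF R g] by auto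

private lemma linA:
  assumes "f \<in> lin_maps K R R"
  shows "(\<lambda>x. i (f x)) \<in> lin_maps K R A" "(\<lambda>x. i (f x) \<otimes>\<^bsub>A\<^esub> X) \<in> lin_maps K R A"
  using lin_comp[OF alg_hom_lin[OF i] assms] lin_comp[OF lin_right_mult[OF A X] lin_comp[OF alg_hom_lin[OF i] assms]]
  by auto

private lemma AAA: "k_algebra K AAA" by (rule tensor_k_algebra[OF tri_alg_list[OF A]])
private lemma RRR: "k_algebra K RRR" by (rule tensor_k_algebra[OF tri_alg_list[OF R]])

private lemmas pc = tri_pure_closed[OF A]
private lemmas mc = tri_map_closed[OF R A]

private lemma SX_closed:
  "pure K (tri A) [X, \<one>\<^bsub>A\<^esub>, \<one>\<^bsub>A\<^esub>] \<in> carrier AAA" "pure K (tri A) [i g, i g' \<otimes>\<^bsub>A\<^esub> X, \<one>\<^bsub>A\<^esub>] \<in> carrier AAA"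
  "pure K (tri A) [i g, i g', X] \<in> carrier AAA"
proof -
  interpret A: k_algebra K A by (rule A)
  show "pure K (tri A) [X, \<one>\<^bsub>A\<^esub>, \<one>\<^bsub>A\<^esub>] \<in> carrier AAA" "pure K (tri A) [i g, i g' \<otimes>\<^bsub>A\<^esub> X, \<one>\<^bsub>A\<^esub>] \<in> carrier AAA"
    "pure K (tri A) [i g, i g', X] \<in> carrier AAA"
    using X gc ic by (auto intro!: pc)
qed

text \<open>Normal forms of the three summands of a product with \<open>skX\<close>: all of
  \<open>R\<close> stands to the left of \<open>X\<close> in the factor where \<open>X\<close>
  occurs. The factors \<open>g\<close> and \<open>g'\<close> are placed so that left and right
  products use the same three maps, applied to different tensors over \<open>R\<close>.\<close>

private abbreviation (input) "J1 \<equiv> tm [\<lambda>x. i x \<otimes>\<^bsub>A\<^esub> X, i, i]"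
private abbreviation (input) "J2 \<equiv> tm [\<lambda>x. i (x \<otimes>\<^bsub>R\<^esub> g), \<lambda>x. i (g' \<otimes>\<^bsub>R\<^esub> x) \<otimes>\<^bsub>A\<^esub> X, i]"
private abbreviation (input) "J3 \<equiv> tm [\<lambda>x. i (x \<otimes>\<^bsub>R\<^esub> g), \<lambda>x. i (g' \<otimes>\<^bsub>R\<^esub> x), \<lambda>x. i x \<otimes>\<^bsub>A\<^esub> X]"

private lemmas linJ = linA[OF linR(1)] linA[OF linR(2)] linA[OF linR(4)] linA[OF linR(5)] linA[OF linR(6)]
  linA[OF linR(7)] linA[OF linR(8)] alg_hom_lin[OF i]

private lemma J_closed:
  assumes "t \<in> carrier RRR"
  shows "J1 t \<in> carrier AAA" "J2 t \<in> carrier AAA" "J3 t \<in> carrier AAA"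
  by (rule mc; (rule linJ assms)+)+

text \<open>The conjugations come from writing \<open>g r\<close> as the conjugate of
  \<open>r\<close> times \<open>g\<close> in the first factor and, the middle product being
  reversed, \<open>r g'\<close> as \<open>g'\<close> times the same conjugate in the second. Moving
  \<open>X\<close> to the right produces \<open>\<tau>\<close> in the first or in the third
  factor.\<close>

private lemma skew_mult_left:
  assumes t: "t \<in> carrier RRR"
  shows "skX \<otimes>\<^bsub>AAA\<^esub> tm [i, i, i] t = J1 (trR [\<tau>, id, id] t) \<ominus>\<^bsub>AAA\<^esub> J2 (trR [conj_by R g, conj_by R g, id] t)
    \<oplus>\<^bsub>AAA\<^esub> J3 (trR [conj_by R g, conj_by R g, \<tau>] t)"
proof -
  interpret R: k_algebra K R by (rule R)
  interpret A: k_algebra K A by (rule A)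
  interpret AAA: k_algebra K AAA by (rule AAA)
  note l = alg_hom_lin[OF i]
  have tc': "tm [i, i, i] t \<in> carrier AAA" by (rule mc[OF l l l t])
  have "pure K (tri A) [X, \<one>\<^bsub>A\<^esub>, \<one>\<^bsub>A\<^esub>] \<otimes>\<^bsub>AAA\<^esub> tm [i, i, i] t
      = tm [\<lambda>x. X \<otimes>\<^bsub>A\<^esub> i x, \<lambda>x. i x \<otimes>\<^bsub>A\<^esub> \<one>\<^bsub>A\<^esub>, \<lambda>x. \<one>\<^bsub>A\<^esub> \<otimes>\<^bsub>A\<^esub> i x] t"
    by (rule tri_map_mult_left[OF R A l l l]) (use X t in auto)
  also have "\<dots> = tm [\<lambda>x. i (\<tau> x) \<otimes>\<^bsub>A\<^esub> X, \<lambda>x. i (id x), \<lambda>x. i (id x)] t"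
    by (rule tri_map_cong[OF R A _ _ _ _ _ _ t, symmetric]) (use linJ in \<open>auto simp: X_rel ic\<close>)
  also have "\<dots> = J1 (trR [\<tau>, id, id] t)"
    by (rule tri_map_comp[OF R R _ _ _ A _ _ _ t, symmetric]) (use linJ in auto)
  finally have 1: "pure K (tri A) [X, \<one>\<^bsub>A\<^esub>, \<one>\<^bsub>A\<^esub>] \<otimes>\<^bsub>AAA\<^esub> tm [i, i, i] t = J1 (trR [\<tau>, id, id] t)" .
  have c1: "i g \<otimes>\<^bsub>A\<^esub> i x = i (conj_by R g x \<otimes>\<^bsub>R\<^esub> g)" if "x \<in> carrier R" for x
    using that gc by (simp add: conj_by_def R.A.m_assoc flip: im)
  have c2: "i x \<otimes>\<^bsub>A\<^esub> i g' = i (g' \<otimes>\<^bsub>R\<^esub> conj_by R g x)" if "x \<in> carrier R" for x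
    using that gc by (simp add: conj_by_def flip: R.A.m_assoc im)
  have c2': "i x \<otimes>\<^bsub>A\<^esub> (i g' \<otimes>\<^bsub>A\<^esub> X) = i (g' \<otimes>\<^bsub>R\<^esub> conj_by R g x) \<otimes>\<^bsub>A\<^esub> X" if "x \<in> carrier R" for x
    using that gc X ic by (simp add: c2 flip: A.A.m_assoc)
  have lc: "(\<lambda>x. i (conj_by R g x \<otimes>\<^bsub>R\<^esub> g)) \<in> lin_maps K R A" "(\<lambda>x. i (g' \<otimes>\<^bsub>R\<^esub> conj_by R g x)) \<in> lin_maps K R A"
    "(\<lambda>x. i (g' \<otimes>\<^bsub>R\<^esub> conj_by R g x) \<otimes>\<^bsub>A\<^esub> X) \<in> lin_maps K R A"
    using linA[OF lin_comp[OF linR(5) linR(9)]] linA[OF lin_comp[OF linR(6) linR(9)]] by auto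
  have "pure K (tri A) [i g, i g' \<otimes>\<^bsub>A\<^esub> X, \<one>\<^bsub>A\<^esub>] \<otimes>\<^bsub>AAA\<^esub> tm [i, i, i] t
      = tm [\<lambda>x. i g \<otimes>\<^bsub>A\<^esub> i x, \<lambda>x. i x \<otimes>\<^bsub>A\<^esub> (i g' \<otimes>\<^bsub>A\<^esub> X), \<lambda>x. \<one>\<^bsub>A\<^esub> \<otimes>\<^bsub>A\<^esub> i x] t"
    by (rule tri_map_mult_left[OF R A l l l]) (use X t gc ic in auto)
  also have "\<dots> = tm [\<lambda>x. i (conj_by R g x \<otimes>\<^bsub>R\<^esub> g), \<lambda>x. i (g' \<otimes>\<^bsub>R\<^esub> conj_by R g x) \<otimes>\<^bsub>A\<^esub> X, \<lambda>x. i (id x)] t"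
    by (rule tri_map_cong[OF R A _ _ _ _ _ _ t, symmetric]) (use linJ lc in \<open>auto simp: ic c1 c2'\<close>)
  also have "\<dots> = J2 (trR [conj_by R g, conj_by R g, id] t)"
    by (rule tri_map_comp[OF R R _ _ _ A _ _ _ t, symmetric]) (use linJ in auto)
  finally have 2: "pure K (tri A) [i g, i g' \<otimes>\<^bsub>A\<^esub> X, \<one>\<^bsub>A\<^esub>] \<otimes>\<^bsub>AAA\<^esub> tm [i, i, i] t
    = J2 (trR [conj_by R g, conj_by R g, id] t)" .
  have "pure K (tri A) [i g, i g', X] \<otimes>\<^bsub>AAA\<^esub> tm [i, i, i] t
      = tm [\<lambda>x. i g \<otimes>\<^bsub>A\<^esub> i x, \<lambda>x. i x \<otimes>\<^bsub>A\<^esub> i g', \<lambda>x. X \<otimes>\<^bsub>A\<^esub> i x] t"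
    by (rule tri_map_mult_left[OF R A l l l]) (use X t gc ic in auto)
  also have "\<dots> = tm [\<lambda>x. i (conj_by R g x \<otimes>\<^bsub>R\<^esub> g), \<lambda>x. i (g' \<otimes>\<^bsub>R\<^esub> conj_by R g x), \<lambda>x. i (\<tau> x) \<otimes>\<^bsub>A\<^esub> X] t"
    by (rule tri_map_cong[OF R A _ _ _ _ _ _ t, symmetric]) (use linJ lc in \<open>auto simp: ic c1 c2 X_rel\<close>)
  also have "\<dots> = J3 (trR [conj_by R g, conj_by R g, \<tau>] t)"
    by (rule tri_map_comp[OF R R _ _ _ A _ _ _ t, symmetric]) (use linJ in auto)
  finally have 3: "pure K (tri A) [i g, i g', X] \<otimes>\<^bsub>AAA\<^esub> tm [i, i, i] t = J3 (trR [conj_by R g, conj_by R g, \<tau>] t)" .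
  show ?thesis
    unfolding skew_elt_def
    using SX_closed tc' by (simp add: a_minus_def AAA.A.l_distr AAA.A.l_minus flip: 1 2 3)
qed

text \<open>In the outer factors \<open>X\<close> already stands on the right. In the middle factor
  the reversed product puts \<open>g' X\<close> to the left of \<open>r\<close>, and moving
  \<open>X\<close> past \<open>r\<close> gives the single \<open>\<tau>\<close>.\<close>

private lemma skew_mult_right:
  assumes t: "t \<in> carrier RRR"
  shows "tm [i, i, i] t \<otimes>\<^bsub>AAA\<^esub> skX = J1 t \<ominus>\<^bsub>AAA\<^esub> J2 (trR [id, \<tau>, id] t) \<oplus>\<^bsub>AAA\<^esub> J3 t"
proof -
  interpret R: k_algebra K R by (rule R)
  interpret A: k_algebra K A by (rule A)
  interpret AAA: k_algebra K AAA by (rule AAA)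
  note l = alg_hom_lin[OF i]
  have tc': "tm [i, i, i] t \<in> carrier AAA" by (rule mc[OF l l l t])
  have "tm [i, i, i] t \<otimes>\<^bsub>AAA\<^esub> pure K (tri A) [X, \<one>\<^bsub>A\<^esub>, \<one>\<^bsub>A\<^esub>]
      = tm [\<lambda>x. i x \<otimes>\<^bsub>A\<^esub> X, \<lambda>x. \<one>\<^bsub>A\<^esub> \<otimes>\<^bsub>A\<^esub> i x, \<lambda>x. i x \<otimes>\<^bsub>A\<^esub> \<one>\<^bsub>A\<^esub>] t"
    by (rule tri_map_mult_right[OF R A l l l]) (use X t in auto)
  also have "\<dots> = J1 t"
    by (rule tri_map_cong[OF R A _ _ _ _ _ _ t, symmetric]) (use linJ in \<open>auto simp: ic\<close>)
  finally have 1: "tm [i, i, i] t \<otimes>\<^bsub>AAA\<^esub> pure K (tri A) [X, \<one>\<^bsub>A\<^esub>, \<one>\<^bsub>A\<^esub>] = J1 t" .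
  have "tm [i, i, i] t \<otimes>\<^bsub>AAA\<^esub> pure K (tri A) [i g, i g' \<otimes>\<^bsub>A\<^esub> X, \<one>\<^bsub>A\<^esub>]
      = tm [\<lambda>x. i x \<otimes>\<^bsub>A\<^esub> i g, \<lambda>x. (i g' \<otimes>\<^bsub>A\<^esub> X) \<otimes>\<^bsub>A\<^esub> i x, \<lambda>x. i x \<otimes>\<^bsub>A\<^esub> \<one>\<^bsub>A\<^esub>] t"
    by (rule tri_map_mult_right[OF R A l l l]) (use X t gc ic in auto)
  also have "\<dots> = tm [\<lambda>x. i (id x \<otimes>\<^bsub>R\<^esub> g), \<lambda>x. i (g' \<otimes>\<^bsub>R\<^esub> \<tau> x) \<otimes>\<^bsub>A\<^esub> X, \<lambda>x. i (id x)] t"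
    by (rule tri_map_cong[OF R A _ _ _ _ _ _ t, symmetric])
      (use linJ X gc in \<open>auto simp: ic im tc X_rel A.A.m_assoc\<close>)
  also have "\<dots> = J2 (trR [id, \<tau>, id] t)"
    by (rule tri_map_comp[OF R R _ _ _ A _ _ _ t, symmetric]) (use linJ in auto)
  finally have 2: "tm [i, i, i] t \<otimes>\<^bsub>AAA\<^esub> pure K (tri A) [i g, i g' \<otimes>\<^bsub>A\<^esub> X, \<one>\<^bsub>A\<^esub>] = J2 (trR [id, \<tau>, id] t)" .
  have "tm [i, i, i] t \<otimes>\<^bsub>AAA\<^esub> pure K (tri A) [i g, i g', X]
      = tm [\<lambda>x. i x \<otimes>\<^bsub>A\<^esub> i g, \<lambda>x. i g' \<otimes>\<^bsub>A\<^esub> i x, \<lambda>x. i x \<otimes>\<^bsub>A\<^esub> X] t"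
    by (rule tri_map_mult_right[OF R A l l l]) (use X t gc ic in auto)
  also have "\<dots> = J3 t"
    by (rule tri_map_cong[OF R A _ _ _ _ _ _ t, symmetric]) (use linJ gc in \<open>auto simp: ic im\<close>)
  finally have 3: "tm [i, i, i] t \<otimes>\<^bsub>AAA\<^esub> pure K (tri A) [i g, i g', X] = J3 t" .
  show ?thesis
    unfolding skew_elt_def
    using SX_closed tc' by (simp add: a_minus_def AAA.A.r_distr AAA.A.r_minus flip: 1 2 3)
qed

private lemma tr_comp:
  assumes "t \<in> carrier RRR" "a \<in> lin_maps K R R" "b \<in> lin_maps K R R" "c \<in> lin_maps K R R"
    "a' \<in> lin_maps K R R" "b' \<in> lin_maps K R R" "c' \<in> lin_maps K R R"
  shows "trR [a', b', c'] (trR [a, b, c] t) = trR [\<lambda>x. a' (a x), \<lambda>x. b' (b x), \<lambda>x. c' (c x)] t"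
  by (rule tri_map_comp[OF R R assms(2-4) R assms(5-7,1)])

text \<open>Comparing the two normal forms, three equalities are needed. The first is
  \<open>s(1)\<close>; in the second both sides equal
  \<open>\<tau> \<otimes> \<tau> \<otimes> id\<close> applied to \<open>t\<close>; the third results
  from applying \<open>\<tau>\<close> to the last factor of \<open>conj\<close> and using
  \<open>s(2)\<close>.\<close>

lemma skew_elt_commute:
  assumes t: "t \<in> carrier RRR" and s: "s = trR [\<tau>, id, id] t" "s = trR [\<tau>, \<tau>, \<tau>] t"
    and conj: "trR [conj_by R g, conj_by R g, id] t = trR [\<tau>, \<tau>, id] t"
  shows "skX \<otimes>\<^bsub>AAA\<^esub> tm [i, i, i] t = tm [i, i, i] s \<otimes>\<^bsub>AAA\<^esub> skX"
proof -
  have sc: "s \<in> carrier RRR" unfolding s(1) by (rule tri_map_closed[OF R R _ _ _ t]) auto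
  have "trR [conj_by R g, conj_by R g, \<tau>] t = trR [id, id, \<tau>] (trR [conj_by R g, conj_by R g, id] t)"
    by (subst tr_comp[OF t]) (auto simp: id_def)
  also have "\<dots> = s"
    unfolding conj s(2) by (subst tr_comp[OF t]) (auto simp: id_def)
  finally have "trR [conj_by R g, conj_by R g, \<tau>] t = s" .
  moreover have "trR [id, \<tau>, id] s = trR [\<tau>, \<tau>, id] t"
    unfolding s(1) by (subst tr_comp[OF t]) (auto simp: id_def)
  ultimately show ?thesis
    unfolding skew_mult_left[OF t] skew_mult_right[OF sc] conj by (simp flip: s(1))
qed

text \<open>Linear functionals reading off the coefficients of \<open>1\<close> and \<open>X\<close> separate the three summands.\<close>

lemma skew_elt_commuteD:
  assumes t: "t \<in> carrier RRR" and s: "s \<in> carrier RRR"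
    and eq: "skX \<otimes>\<^bsub>AAA\<^esub> tm [i, i, i] t = tm [i, i, i] s \<otimes>\<^bsub>AAA\<^esub> skX"
    and p: "p \<in> lin_maps K A R" "\<And>r a. r \<in> carrier R \<Longrightarrow> a \<in> carrier A \<Longrightarrow> p (i r \<otimes>\<^bsub>A\<^esub> a) = r \<otimes>\<^bsub>R\<^esub> p a"
      "p \<one>\<^bsub>A\<^esub> = \<one>\<^bsub>R\<^esub>" "p X = \<zero>\<^bsub>R\<^esub>"
    and q: "q \<in> lin_maps K A R" "\<And>r a. r \<in> carrier R \<Longrightarrow> a \<in> carrier A \<Longrightarrow> q (i r \<otimes>\<^bsub>A\<^esub> a) = r \<otimes>\<^bsub>R\<^esub> q a"
      "q \<one>\<^bsub>A\<^esub> = \<zero>\<^bsub>R\<^esub>" "q X = \<one>\<^bsub>R\<^esub>"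
  shows "s = trR [\<tau>, id, id] t" "s = trR [\<tau>, \<tau>, \<tau>] t"
    "trR [conj_by R g, conj_by R g, id] t = trR [\<tau>, \<tau>, id] t"
proof -
  interpret R: k_algebra K R by (rule R)
  interpret A: k_algebra K A by (rule A)
  interpret RRR: k_algebra K RRR by (rule RRR)
  interpret AAA: k_algebra K AAA by (rule AAA)
  have ev: "p (i r) = r" "p (i r \<otimes>\<^bsub>A\<^esub> X) = \<zero>\<^bsub>R\<^esub>" "q (i r) = \<zero>\<^bsub>R\<^esub>" "q (i r \<otimes>\<^bsub>A\<^esub> X) = r" if "r \<in> carrier R" for r
    using that p(2)[of r "\<one>\<^bsub>A\<^esub>"] p(2)[of r X] q(2)[of r "\<one>\<^bsub>A\<^esub>"] q(2)[of r X] X ic by (auto simp: p q)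
  have lp: "(\<lambda>a. p a \<otimes>\<^bsub>R\<^esub> g') \<in> lin_maps K A R" "(\<lambda>a. g \<otimes>\<^bsub>R\<^esub> p a) \<in> lin_maps K A R" "(\<lambda>a. g \<otimes>\<^bsub>R\<^esub> q a) \<in> lin_maps K A R"
    using lin_comp[OF linR(7) p(1)] lin_comp[OF linR(4) p(1)] lin_comp[OF linR(4) q(1)] by auto
  \<comment> \<open>Each map reads the coefficient of \<open>X\<close> in one factor and of 1 in the
    other two, so it inverts one of \<open>J1\<close>, \<open>J2\<close>, \<open>J3\<close> and
    kills the other two. The multiplications by \<open>g\<close> and \<open>g'\<close> undo those
    built into \<open>J2\<close> and \<open>J3\<close>.\<close>
  let ?P1 = "trR [q, p, p]" and ?P2 = "trR [\<lambda>a. p a \<otimes>\<^bsub>R\<^esub> g', \<lambda>a. g \<otimes>\<^bsub>R\<^esub> q a, p]"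
    and ?P3 = "trR [\<lambda>a. p a \<otimes>\<^bsub>R\<^esub> g', \<lambda>a. g \<otimes>\<^bsub>R\<^esub> p a, q]"
  have gg: "(r \<otimes>\<^bsub>R\<^esub> g) \<otimes>\<^bsub>R\<^esub> g' = r" "g \<otimes>\<^bsub>R\<^esub> (g' \<otimes>\<^bsub>R\<^esub> r) = r" if "r \<in> carrier R" for r
    using that gc by (simp add: R.A.m_assoc, simp flip: R.A.m_assoc)
  have comp: "trR [a, b, c] (tm [a', b', c'] u) = trR [\<lambda>x. a (a' x), \<lambda>x. b (b' x), \<lambda>x. c (c' x)] u"
    if "u \<in> carrier RRR" "a \<in> lin_maps K A R" "b \<in> lin_maps K A R" "c \<in> lin_maps K A R"
      "a' \<in> lin_maps K R A" "b' \<in> lin_maps K R A" "c' \<in> lin_maps K R A" for a b c a' b' c' u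
    by (rule tri_map_comp[OF R A that(5-7) R that(2-4,1)])
  have keep: "trR [a, b, c] (tm [a', b', c'] u) = u"
    if "u \<in> carrier RRR" "a \<in> lin_maps K A R" "b \<in> lin_maps K A R" "c \<in> lin_maps K A R"
      "a' \<in> lin_maps K R A" "b' \<in> lin_maps K R A" "c' \<in> lin_maps K R A"
      "\<And>x. x \<in> carrier R \<Longrightarrow> a (a' x) = x" "\<And>x. x \<in> carrier R \<Longrightarrow> b (b' x) = x" "\<And>x. x \<in> carrier R \<Longrightarrow> c (c' x) = x"
    for a b c a' b' c' u
  proof -
    have "trR [\<lambda>x. a (a' x), \<lambda>x. b (b' x), \<lambda>x. c (c' x)] u = trR [\<lambda>x. x, \<lambda>x. x, \<lambda>x. x] u"
      by (rule tri_map_cong[OF R R]) (use that in \<open>auto intro: lin_comp\<close>)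
    then show ?thesis using comp[OF that(1-7)] tri_map_id[OF R that(1)] by simp
  qed
  have kill: "trR [a, b, c] (tm [a', b', c'] u) = \<zero>\<^bsub>RRR\<^esub>"
    if "u \<in> carrier RRR" "a \<in> lin_maps K A R" "b \<in> lin_maps K A R" "c \<in> lin_maps K A R"
      "a' \<in> lin_maps K R A" "b' \<in> lin_maps K R A" "c' \<in> lin_maps K R A"
      "(\<forall>x\<in>carrier R. a (a' x) = \<zero>\<^bsub>R\<^esub>) \<or> (\<forall>x\<in>carrier R. b (b' x) = \<zero>\<^bsub>R\<^esub>) \<or> (\<forall>x\<in>carrier R. c (c' x) = \<zero>\<^bsub>R\<^esub>)"
    for a b c a' b' c' u
    unfolding comp[OF that(1-7)]
    by (rule tri_map_zero[OF R R _ _ _ that(8,1)]) (use that in \<open>auto intro: lin_comp\<close>)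
  note lins = p(1) q(1) lp linJ gc ic tc
  have P1: "?P1 (J1 u) = u" "?P1 (J2 u) = \<zero>\<^bsub>RRR\<^esub>" "?P1 (J3 u) = \<zero>\<^bsub>RRR\<^esub>"
    and P2: "?P2 (J1 u) = \<zero>\<^bsub>RRR\<^esub>" "?P2 (J2 u) = u" "?P2 (J3 u) = \<zero>\<^bsub>RRR\<^esub>"
    and P3: "?P3 (J1 u) = \<zero>\<^bsub>RRR\<^esub>" "?P3 (J2 u) = \<zero>\<^bsub>RRR\<^esub>" "?P3 (J3 u) = u" if "u \<in> carrier RRR" for u
    using that lins by (simp_all add: keep kill ev gg)
  have U_mod: "module K AAA" "module K RRR" by (rule AAA.module_axioms, rule RRR.module_axioms)
  have sep: "P (J1 a \<ominus>\<^bsub>AAA\<^esub> J2 b \<oplus>\<^bsub>AAA\<^esub> J3 c) = P (J1 a) \<ominus>\<^bsub>RRR\<^esub> P (J2 b) \<oplus>\<^bsub>RRR\<^esub> P (J3 c)"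
    if "P \<in> lin_maps K AAA RRR" "a \<in> carrier RRR" "b \<in> carrier RRR" "c \<in> carrier RRR" for P a b c
    using that by (simp add: lin_add[OF that(1)] lin_sub[OF U_mod that(1)] J_closed)
  have lP: "?P1 \<in> lin_maps K AAA RRR" "?P2 \<in> lin_maps K AAA RRR" "?P3 \<in> lin_maps K AAA RRR"
    by (rule tri_map_lin[OF A R]; rule lins)+
  have cl: "trR [\<tau>, id, id] t \<in> carrier RRR" "trR [conj_by R g, conj_by R g, id] t \<in> carrier RRR"
    "trR [conj_by R g, conj_by R g, \<tau>] t \<in> carrier RRR" "trR [id, \<tau>, id] s \<in> carrier RRR"
    by (rule tri_map_closed[OF R R]; (rule t s linR)+)+
  note eq' = eq[unfolded skew_mult_left[OF t] skew_mult_right[OF s]]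
  have e1: "trR [\<tau>, id, id] t = s"
    using arg_cong[OF eq', of ?P1] s cl by (simp add: sep lP P1 a_minus_def[of RRR])
  have "\<ominus>\<^bsub>RRR\<^esub> trR [conj_by R g, conj_by R g, id] t = \<ominus>\<^bsub>RRR\<^esub> trR [id, \<tau>, id] s"
    using arg_cong[OF eq', of ?P2] s cl by (simp add: sep lP P2 a_minus_def[of RRR])
  then have e2: "trR [conj_by R g, conj_by R g, id] t = trR [id, \<tau>, id] s"
    using cl by (metis RRR.M.minus_minus)
  have e3: "trR [conj_by R g, conj_by R g, \<tau>] t = s"
    using arg_cong[OF eq', of ?P3] s cl by (simp add: sep lP P3 a_minus_def[of RRR])
  show "s = trR [\<tau>, id, id] t" by (rule e1[symmetric])
  show c: "trR [conj_by R g, conj_by R g, id] t = trR [\<tau>, \<tau>, id] t"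
    unfolding e2 e1[symmetric] by (subst tr_comp[OF t]) (auto simp: id_def)
  \<comment> \<open>By \<open>e3\<close>, applying \<open>\<tau>\<close> to the third factor of the
    conjugated tensor gives \<open>s\<close>; the conjugations are then replaced by
    \<open>\<tau> \<otimes> \<tau> \<otimes> id\<close> through the identity just proved.\<close>
  have "s = trR [id, id, \<tau>] (trR [conj_by R g, conj_by R g, id] t)"
    unfolding e3[symmetric] by (subst tr_comp[OF t]) (auto simp: id_def)
  also have "\<dots> = trR [\<tau>, \<tau>, \<tau>] t"
    unfolding c by (subst tr_comp[OF t]) (auto simp: id_def)
  finally show "s = trR [\<tau>, \<tau>, \<tau>] t" .
qed

end

text \<open>The nine products are grouped into the diagonal ones, from which the terms in the
  constant \<open>C\<close> arise below, and the six mixed ones, which merely commute up to the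
  scalar \<open>\<xi>\<close>.\<close>

lemma (in ring) signed_sum_mult:
  assumes "x1 \<in> carrier R" "x2 \<in> carrier R" "x3 \<in> carrier R" "y1 \<in> carrier R" "y2 \<in> carrier R" "y3 \<in> carrier R"
  shows "(x1 \<ominus> x2 \<oplus> x3) \<otimes> (y1 \<ominus> y2 \<oplus> y3) = (x1 \<otimes> y1 \<oplus> x2 \<otimes> y2 \<oplus> x3 \<otimes> y3)
    \<oplus> (\<ominus> (x1 \<otimes> y2) \<oplus> x1 \<otimes> y3 \<oplus> (\<ominus> (x2 \<otimes> y1)) \<oplus> (\<ominus> (x2 \<otimes> y3)) \<oplus> x3 \<otimes> y1 \<oplus> (\<ominus> (x3 \<otimes> y2)))"
  using assms by algebra

text \<open>The scalar \<open>l\<close>, by which \<open>G\<close> and \<open>H\<close> commute,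
  drops out because \<open>G H\<close> in the first factor is always accompanied by
  \<open>H' G'\<close> in the second. Each mixed product then commutes up to \<open>\<xi>\<close>,
  and each diagonal one does so up to a single term containing \<open>C\<close>.\<close>

lemma skew_elt_bracket:
  assumes A: "k_algebra K A" and \<xi>: "\<xi> \<in> Units K"
    and c: "X \<in> carrier A" "Y \<in> carrier A" "C \<in> carrier A" "G \<in> carrier A" "G' \<in> carrier A" "H \<in> carrier A" "H' \<in> carrier A"
    and XH: "X \<otimes>\<^bsub>A\<^esub> H = \<xi> \<odot>\<^bsub>A\<^esub> (H \<otimes>\<^bsub>A\<^esub> X)" "X \<otimes>\<^bsub>A\<^esub> H' = inv\<^bsub>K\<^esub> \<xi> \<odot>\<^bsub>A\<^esub> (H' \<otimes>\<^bsub>A\<^esub> X)"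
    and YG: "Y \<otimes>\<^bsub>A\<^esub> G = inv\<^bsub>K\<^esub> \<xi> \<odot>\<^bsub>A\<^esub> (G \<otimes>\<^bsub>A\<^esub> Y)" "Y \<otimes>\<^bsub>A\<^esub> G' = \<xi> \<odot>\<^bsub>A\<^esub> (G' \<otimes>\<^bsub>A\<^esub> Y)"
    and XY: "X \<otimes>\<^bsub>A\<^esub> Y = \<xi> \<odot>\<^bsub>A\<^esub> (Y \<otimes>\<^bsub>A\<^esub> X) \<oplus>\<^bsub>A\<^esub> C"
    and l: "l \<in> Units K" "G \<otimes>\<^bsub>A\<^esub> H = l \<odot>\<^bsub>A\<^esub> (H \<otimes>\<^bsub>A\<^esub> G)" "H' \<otimes>\<^bsub>A\<^esub> G' = inv\<^bsub>K\<^esub> l \<odot>\<^bsub>A\<^esub> (G' \<otimes>\<^bsub>A\<^esub> H')"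
  defines "U \<equiv> tensor_alg K (tri A)"
  shows "skew_elt K A G G' X \<otimes>\<^bsub>U\<^esub> skew_elt K A H H' Y
    = \<xi> \<odot>\<^bsub>U\<^esub> (skew_elt K A H H' Y \<otimes>\<^bsub>U\<^esub> skew_elt K A G G' X)
      \<oplus>\<^bsub>U\<^esub> (pure K (tri A) [C, \<one>\<^bsub>A\<^esub>, \<one>\<^bsub>A\<^esub>]
      \<ominus>\<^bsub>U\<^esub> pure K (tri A) [G \<otimes>\<^bsub>A\<^esub> H, H' \<otimes>\<^bsub>A\<^esub> G' \<otimes>\<^bsub>A\<^esub> C, \<one>\<^bsub>A\<^esub>]
      \<oplus>\<^bsub>U\<^esub> pure K (tri A) [G \<otimes>\<^bsub>A\<^esub> H, H' \<otimes>\<^bsub>A\<^esub> G', C])"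
proof -
  interpret A: k_algebra K A by (rule A)
  interpret U: k_algebra K U unfolding U_def by (rule tensor_k_algebra[OF tri_alg_list[OF A]])
  let ?p = "\<lambda>x y z. pure K (tri A) [x, y, z]"
  note pc = tri_pure_closed[OF A, folded U_def]
  note pm = tri_pure_mult[OF A, folded U_def]
  note pl = tri_pure_lin[OF A, folded U_def]
  have \<xi>c: "\<xi> \<in> carrier K" "inv\<^bsub>K\<^esub> \<xi> \<in> carrier K" "inv\<^bsub>K\<^esub> \<xi> \<otimes>\<^bsub>K\<^esub> \<xi> = \<one>\<^bsub>K\<^esub>" "\<xi> \<otimes>\<^bsub>K\<^esub> inv\<^bsub>K\<^esub> \<xi> = \<one>\<^bsub>K\<^esub>" using \<xi> by auto
  have lc: "l \<in> carrier K" "inv\<^bsub>K\<^esub> l \<in> carrier K" "inv\<^bsub>K\<^esub> l \<otimes>\<^bsub>K\<^esub> l = \<one>\<^bsub>K\<^esub>" "l \<otimes>\<^bsub>K\<^esub> inv\<^bsub>K\<^esub> l = \<one>\<^bsub>K\<^esub>" using l by auto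
  have sc: "?p (a \<odot>\<^bsub>A\<^esub> x) y z = a \<odot>\<^bsub>U\<^esub> ?p x y z" "?p x (a \<odot>\<^bsub>A\<^esub> y) z = a \<odot>\<^bsub>U\<^esub> ?p x y z"
    "?p x y (a \<odot>\<^bsub>A\<^esub> z) = a \<odot>\<^bsub>U\<^esub> ?p x y z"
    if "a \<in> carrier K" "x \<in> carrier A" "y \<in> carrier A" "z \<in> carrier A" for a x y z
    using that lin_smult[OF pl(1)] lin_smult[OF pl(2)] lin_smult[OF pl(3)] by auto
  have ad: "?p (x \<oplus>\<^bsub>A\<^esub> x') y z = ?p x y z \<oplus>\<^bsub>U\<^esub> ?p x' y z" "?p y (x \<oplus>\<^bsub>A\<^esub> x') z = ?p y x z \<oplus>\<^bsub>U\<^esub> ?p y x' z"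
    "?p y z (x \<oplus>\<^bsub>A\<^esub> x') = ?p y z x \<oplus>\<^bsub>U\<^esub> ?p y z x'"
    if "x \<in> carrier A" "x' \<in> carrier A" "y \<in> carrier A" "z \<in> carrier A" for x x' y z
    using that lin_add[OF pl(1)] lin_add[OF pl(2)] lin_add[OF pl(3)] by auto
  have canc: "a \<odot>\<^bsub>U\<^esub> (b \<odot>\<^bsub>U\<^esub> u) = u" if "a \<in> carrier K" "b \<in> carrier K" "a \<otimes>\<^bsub>K\<^esub> b = \<one>\<^bsub>K\<^esub>" "u \<in> carrier U" for a b u
    using that by (simp flip: U.smult_assoc1)
  \<comment> \<open>Reordering \<open>G\<close> and \<open>H\<close> in the first factor costs
    \<open>l\<close>, reordering their inverses in the second costs the inverse of
    \<open>l\<close>.\<close>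
  have swap: "?p (G \<otimes>\<^bsub>A\<^esub> H) (H' \<otimes>\<^bsub>A\<^esub> G' \<otimes>\<^bsub>A\<^esub> y) z = ?p (H \<otimes>\<^bsub>A\<^esub> G) (G' \<otimes>\<^bsub>A\<^esub> H' \<otimes>\<^bsub>A\<^esub> y) z"
    if "y \<in> carrier A" "z \<in> carrier A" for y z
    using c lc that by (simp add: l(2,3) A.smult_mult_left sc canc pc)
  define x1 x2 x3 where x: "x1 = ?p X \<one>\<^bsub>A\<^esub> \<one>\<^bsub>A\<^esub>" "x2 = ?p G (G' \<otimes>\<^bsub>A\<^esub> X) \<one>\<^bsub>A\<^esub>" "x3 = ?p G G' X"
  define y1 y2 y3 where y: "y1 = ?p Y \<one>\<^bsub>A\<^esub> \<one>\<^bsub>A\<^esub>" "y2 = ?p H (H' \<otimes>\<^bsub>A\<^esub> Y) \<one>\<^bsub>A\<^esub>" "y3 = ?p H H' Y"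
  have cl: "x1 \<in> carrier U" "x2 \<in> carrier U" "x3 \<in> carrier U" "y1 \<in> carrier U" "y2 \<in> carrier U" "y3 \<in> carrier U"
    using c by (auto simp: x y intro!: pc)
  have YG'X: "(H' \<otimes>\<^bsub>A\<^esub> Y) \<otimes>\<^bsub>A\<^esub> (G' \<otimes>\<^bsub>A\<^esub> u) = \<xi> \<odot>\<^bsub>A\<^esub> (H' \<otimes>\<^bsub>A\<^esub> G' \<otimes>\<^bsub>A\<^esub> (Y \<otimes>\<^bsub>A\<^esub> u))" if "u \<in> carrier A" for u
  proof -
    have "(H' \<otimes>\<^bsub>A\<^esub> Y) \<otimes>\<^bsub>A\<^esub> (G' \<otimes>\<^bsub>A\<^esub> u) = H' \<otimes>\<^bsub>A\<^esub> (Y \<otimes>\<^bsub>A\<^esub> G') \<otimes>\<^bsub>A\<^esub> u"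
      using c that by (simp add: A.A.m_assoc)
    also have "\<dots> = \<xi> \<odot>\<^bsub>A\<^esub> (H' \<otimes>\<^bsub>A\<^esub> G' \<otimes>\<^bsub>A\<^esub> (Y \<otimes>\<^bsub>A\<^esub> u))"
      using c that \<xi>c by (simp add: YG A.A.m_assoc A.smult_mult_left A.smult_mult_right)
    finally show ?thesis .
  qed
  have XH'Y: "(G' \<otimes>\<^bsub>A\<^esub> X) \<otimes>\<^bsub>A\<^esub> (H' \<otimes>\<^bsub>A\<^esub> u) = inv\<^bsub>K\<^esub> \<xi> \<odot>\<^bsub>A\<^esub> (G' \<otimes>\<^bsub>A\<^esub> H' \<otimes>\<^bsub>A\<^esub> (X \<otimes>\<^bsub>A\<^esub> u))" if "u \<in> carrier A" for u
  proof -
    have "(G' \<otimes>\<^bsub>A\<^esub> X) \<otimes>\<^bsub>A\<^esub> (H' \<otimes>\<^bsub>A\<^esub> u) = G' \<otimes>\<^bsub>A\<^esub> (X \<otimes>\<^bsub>A\<^esub> H') \<otimes>\<^bsub>A\<^esub> u"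
      using c that by (simp add: A.A.m_assoc)
    also have "\<dots> = inv\<^bsub>K\<^esub> \<xi> \<odot>\<^bsub>A\<^esub> (G' \<otimes>\<^bsub>A\<^esub> H' \<otimes>\<^bsub>A\<^esub> (X \<otimes>\<^bsub>A\<^esub> u))"
      using c that \<xi>c by (simp add: XH A.A.m_assoc A.smult_mult_left A.smult_mult_right)
    finally show ?thesis .
  qed
  have YG'1: "(H' \<otimes>\<^bsub>A\<^esub> Y) \<otimes>\<^bsub>A\<^esub> G' = \<xi> \<odot>\<^bsub>A\<^esub> (H' \<otimes>\<^bsub>A\<^esub> G' \<otimes>\<^bsub>A\<^esub> Y)" using YG'X[of "\<one>\<^bsub>A\<^esub>"] c by simp
  have XH'1: "(G' \<otimes>\<^bsub>A\<^esub> X) \<otimes>\<^bsub>A\<^esub> H' = inv\<^bsub>K\<^esub> \<xi> \<odot>\<^bsub>A\<^esub> (G' \<otimes>\<^bsub>A\<^esub> H' \<otimes>\<^bsub>A\<^esub> X)" using XH'Y[of "\<one>\<^bsub>A\<^esub>"] c by simp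
  \<comment> \<open>In these four products the scalar arises in the first factor alone, from
    \<open>X\<close> passing \<open>H\<close> or \<open>Y\<close> passing \<open>G\<close>. For
    \<open>off2\<close> and \<open>off3\<close> it arises in the middle factor, from
    \<open>X\<close> passing \<open>H'\<close> or \<open>Y\<close> passing \<open>G'\<close>, and
    \<open>swap\<close> is needed in addition.\<close>
  have off: "x1 \<otimes>\<^bsub>U\<^esub> y2 = \<xi> \<odot>\<^bsub>U\<^esub> (y2 \<otimes>\<^bsub>U\<^esub> x1)" "x1 \<otimes>\<^bsub>U\<^esub> y3 = \<xi> \<odot>\<^bsub>U\<^esub> (y3 \<otimes>\<^bsub>U\<^esub> x1)"
    "x2 \<otimes>\<^bsub>U\<^esub> y1 = \<xi> \<odot>\<^bsub>U\<^esub> (y1 \<otimes>\<^bsub>U\<^esub> x2)" "x3 \<otimes>\<^bsub>U\<^esub> y1 = \<xi> \<odot>\<^bsub>U\<^esub> (y1 \<otimes>\<^bsub>U\<^esub> x3)"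
    using c \<xi>c by (simp_all add: x y pm XH YG sc canc pc)
  have off2: "x2 \<otimes>\<^bsub>U\<^esub> y3 = \<xi> \<odot>\<^bsub>U\<^esub> (y3 \<otimes>\<^bsub>U\<^esub> x2)"
    using c \<xi>c swap[of X Y] by (simp add: x y pm XH'1 sc canc pc A.A.m_assoc)
  have off3: "x3 \<otimes>\<^bsub>U\<^esub> y2 = \<xi> \<odot>\<^bsub>U\<^esub> (y2 \<otimes>\<^bsub>U\<^esub> x3)"
    using c \<xi>c swap[of Y X] by (simp add: x y pm YG'1 sc pc A.A.m_assoc)
  have d1: "x1 \<otimes>\<^bsub>U\<^esub> y1 = \<xi> \<odot>\<^bsub>U\<^esub> (y1 \<otimes>\<^bsub>U\<^esub> x1) \<oplus>\<^bsub>U\<^esub> ?p C \<one>\<^bsub>A\<^esub> \<one>\<^bsub>A\<^esub>"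
    using c \<xi>c by (simp add: x y pm XY ad sc)
  have d3: "x3 \<otimes>\<^bsub>U\<^esub> y3 = \<xi> \<odot>\<^bsub>U\<^esub> (y3 \<otimes>\<^bsub>U\<^esub> x3) \<oplus>\<^bsub>U\<^esub> ?p (G \<otimes>\<^bsub>A\<^esub> H) (H' \<otimes>\<^bsub>A\<^esub> G') C"
    using c \<xi>c swap[of "\<one>\<^bsub>A\<^esub>" "Y \<otimes>\<^bsub>A\<^esub> X"] by (simp add: x y pm XY ad sc)
  \<comment> \<open>The middle factor is reversed, so here the product \<open>X Y\<close> occurs in
    \<open>y2 x2\<close> and \<open>Y X\<close> in \<open>x2 y2\<close>. Hence \<open>XY\<close> is
    expanded in the former, and solving for \<open>x2 y2\<close> gives the constant term of the
    middle factor its minus sign.\<close>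
  have "\<xi> \<odot>\<^bsub>U\<^esub> (y2 \<otimes>\<^bsub>U\<^esub> x2) = ?p (H \<otimes>\<^bsub>A\<^esub> G) (G' \<otimes>\<^bsub>A\<^esub> H' \<otimes>\<^bsub>A\<^esub> (X \<otimes>\<^bsub>A\<^esub> Y)) \<one>\<^bsub>A\<^esub>"
    using c \<xi>c by (simp add: x y pm XH'Y sc canc pc)
  also have "\<dots> = ?p (G \<otimes>\<^bsub>A\<^esub> H) (H' \<otimes>\<^bsub>A\<^esub> G' \<otimes>\<^bsub>A\<^esub> (X \<otimes>\<^bsub>A\<^esub> Y)) \<one>\<^bsub>A\<^esub>"
    using c by (simp add: swap)
  also have "\<dots> = x2 \<otimes>\<^bsub>U\<^esub> y2 \<oplus>\<^bsub>U\<^esub> ?p (G \<otimes>\<^bsub>A\<^esub> H) (H' \<otimes>\<^bsub>A\<^esub> G' \<otimes>\<^bsub>A\<^esub> C) \<one>\<^bsub>A\<^esub>"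
    using c \<xi>c by (simp add: x y pm YG'X XY A.A.r_distr A.smult_mult_right ad)
  finally have d2': "\<xi> \<odot>\<^bsub>U\<^esub> (y2 \<otimes>\<^bsub>U\<^esub> x2) = x2 \<otimes>\<^bsub>U\<^esub> y2 \<oplus>\<^bsub>U\<^esub> ?p (G \<otimes>\<^bsub>A\<^esub> H) (H' \<otimes>\<^bsub>A\<^esub> G' \<otimes>\<^bsub>A\<^esub> C) \<one>\<^bsub>A\<^esub>" .
  define z1 z2 z3 where z: "z1 = ?p C \<one>\<^bsub>A\<^esub> \<one>\<^bsub>A\<^esub>" "z2 = ?p (G \<otimes>\<^bsub>A\<^esub> H) (H' \<otimes>\<^bsub>A\<^esub> G' \<otimes>\<^bsub>A\<^esub> C) \<one>\<^bsub>A\<^esub>"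
    "z3 = ?p (G \<otimes>\<^bsub>A\<^esub> H) (H' \<otimes>\<^bsub>A\<^esub> G') C"
  have zc: "z1 \<in> carrier U" "z2 \<in> carrier U" "z3 \<in> carrier U" using c by (auto simp: z intro!: pc)
  have d2: "x2 \<otimes>\<^bsub>U\<^esub> y2 = \<xi> \<odot>\<^bsub>U\<^esub> (y2 \<otimes>\<^bsub>U\<^esub> x2) \<ominus>\<^bsub>U\<^esub> z2"
    unfolding d2' z(2)[symmetric] using cl zc by (simp add: a_minus_def U.M.a_assoc U.M.r_neg)
  \<comment> \<open>\<open>?off\<close> and \<open>?dia\<close> are the mixed and diagonal parts of
    the product taken in the opposite order; together they reassemble to that product by
    \<open>signed_sum_mult\<close>.\<close>
  let ?off = "\<ominus>\<^bsub>U\<^esub> (y2 \<otimes>\<^bsub>U\<^esub> x1) \<oplus>\<^bsub>U\<^esub> y3 \<otimes>\<^bsub>U\<^esub> x1 \<oplus>\<^bsub>U\<^esub> (\<ominus>\<^bsub>U\<^esub> (y1 \<otimes>\<^bsub>U\<^esub> x2)) \<oplus>\<^bsub>U\<^esub> (\<ominus>\<^bsub>U\<^esub> (y3 \<otimes>\<^bsub>U\<^esub> x2)) \<oplus>\<^bsub>U\<^esub> y1 \<otimes>\<^bsub>U\<^esub> x3 \<oplus>\<^bsub>U\<^esub> (\<ominus>\<^bsub>U\<^esub> (y2 \<otimes>\<^bsub>U\<^esub> x3))"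
  let ?dia = "y1 \<otimes>\<^bsub>U\<^esub> x1 \<oplus>\<^bsub>U\<^esub> y2 \<otimes>\<^bsub>U\<^esub> x2 \<oplus>\<^bsub>U\<^esub> y3 \<otimes>\<^bsub>U\<^esub> x3"
  have "(x1 \<ominus>\<^bsub>U\<^esub> x2 \<oplus>\<^bsub>U\<^esub> x3) \<otimes>\<^bsub>U\<^esub> (y1 \<ominus>\<^bsub>U\<^esub> y2 \<oplus>\<^bsub>U\<^esub> y3)
    = (x1 \<otimes>\<^bsub>U\<^esub> y1 \<oplus>\<^bsub>U\<^esub> x2 \<otimes>\<^bsub>U\<^esub> y2 \<oplus>\<^bsub>U\<^esub> x3 \<otimes>\<^bsub>U\<^esub> y3) \<oplus>\<^bsub>U\<^esub> \<xi> \<odot>\<^bsub>U\<^esub> ?off"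
    using cl \<xi>c by (simp add: U.A.signed_sum_mult off off2 off3 U.smult_r_distr U.smult_r_minus)
  also have "x1 \<otimes>\<^bsub>U\<^esub> y1 \<oplus>\<^bsub>U\<^esub> x2 \<otimes>\<^bsub>U\<^esub> y2 \<oplus>\<^bsub>U\<^esub> x3 \<otimes>\<^bsub>U\<^esub> y3 = \<xi> \<odot>\<^bsub>U\<^esub> ?dia \<oplus>\<^bsub>U\<^esub> (z1 \<ominus>\<^bsub>U\<^esub> z2 \<oplus>\<^bsub>U\<^esub> z3)"
    using cl \<xi>c zc
    by (simp add: d1 d2 d3 a_minus_def U.smult_r_distr U.M.add.m_ac flip: z)
  also have "\<dots> \<oplus>\<^bsub>U\<^esub> \<xi> \<odot>\<^bsub>U\<^esub> ?off = \<xi> \<odot>\<^bsub>U\<^esub> (?dia \<oplus>\<^bsub>U\<^esub> ?off) \<oplus>\<^bsub>U\<^esub> (z1 \<ominus>\<^bsub>U\<^esub> z2 \<oplus>\<^bsub>U\<^esub> z3)"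
  proof -
    have "?dia \<in> carrier U" "?off \<in> carrier U" "z1 \<ominus>\<^bsub>U\<^esub> z2 \<oplus>\<^bsub>U\<^esub> z3 \<in> carrier U" using cl zc by auto
    then show ?thesis using \<xi>c(1) by (simp add: U.smult_r_distr[of \<xi> ?dia ?off] U.M.a_assoc U.M.a_comm U.M.a_lcomm del: U.M.add.m_closed)
  qed
  also have "?dia \<oplus>\<^bsub>U\<^esub> ?off = (y1 \<ominus>\<^bsub>U\<^esub> y2 \<oplus>\<^bsub>U\<^esub> y3) \<otimes>\<^bsub>U\<^esub> (x1 \<ominus>\<^bsub>U\<^esub> x2 \<oplus>\<^bsub>U\<^esub> x3)"
    unfolding U.A.signed_sum_mult[OF cl(4-6,1-3)] using cl by (simp add: U.M.add.m_ac)
  finally show ?thesis by (simp add: skew_elt_def x y z flip: U_def)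
qed

text \<open>The functional \<open>q \<otimes> s \<otimes> p\<close> isolates the coefficient of
  \<open>X \<otimes> Y \<otimes> 1\<close>. The tensor \<open>t\<close> is left arbitrary so that
  the lemma can be applied a second time with \<open>X\<close> and \<open>Y\<close> exchanged, where
  the constant term is a different multiple of \<open>\<mu> c\<close>.\<close>

lemma skew_elt_bracketD:
  assumes R: "k_algebra K R" and A: "k_algebra K A" and i: "i \<in> alg_hom K R A"
    and \<tau>: "\<tau> \<in> alg_hom K R R" and \<omega>: "\<omega> \<in> alg_hom K R R" and gh: "g \<in> Units R" "h \<in> Units R"
    and X: "X \<in> carrier A" and Y: "Y \<in> carrier A"
    and X_rel: "\<And>r. r \<in> carrier R \<Longrightarrow> X \<otimes>\<^bsub>A\<^esub> i r = i (\<tau> r) \<otimes>\<^bsub>A\<^esub> X"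
    and Y_rel: "\<And>r. r \<in> carrier R \<Longrightarrow> Y \<otimes>\<^bsub>A\<^esub> i r = i (\<omega> r) \<otimes>\<^bsub>A\<^esub> Y"
    and \<xi>c: "\<xi> \<in> carrier K" and t: "t \<in> carrier (tensor_alg K (tri R))"
    and lin: "p \<in> lin_maps K A R" "q \<in> lin_maps K A R" "s \<in> lin_maps K A R"
    and ev: "\<And>r a. r \<in> carrier R \<Longrightarrow> a \<in> carrier A \<Longrightarrow> p (i r \<otimes>\<^bsub>A\<^esub> a) = r \<otimes>\<^bsub>R\<^esub> p a"
    "\<And>r a. r \<in> carrier R \<Longrightarrow> a \<in> carrier A \<Longrightarrow> q (i r \<otimes>\<^bsub>A\<^esub> a) = r \<otimes>\<^bsub>R\<^esub> q a"
    "\<And>r a. r \<in> carrier R \<Longrightarrow> a \<in> carrier A \<Longrightarrow> s (i r \<otimes>\<^bsub>A\<^esub> a) = r \<otimes>\<^bsub>R\<^esub> s a"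
    "p \<one>\<^bsub>A\<^esub> = \<one>\<^bsub>R\<^esub>" "p X = \<zero>\<^bsub>R\<^esub>" "p Y = \<zero>\<^bsub>R\<^esub>"
    "q \<one>\<^bsub>A\<^esub> = \<zero>\<^bsub>R\<^esub>" "q X = \<one>\<^bsub>R\<^esub>"
    "s \<one>\<^bsub>A\<^esub> = \<zero>\<^bsub>R\<^esub>" "s X = \<zero>\<^bsub>R\<^esub>" "s Y = \<one>\<^bsub>R\<^esub>"
  defines "U \<equiv> tensor_alg K (tri A)"
  defines "SX \<equiv> skew_elt K A (i g) (i (inv\<^bsub>R\<^esub> g)) X" and "SY \<equiv> skew_elt K A (i h) (i (inv\<^bsub>R\<^esub> h)) Y"
  assumes eq: "SX \<otimes>\<^bsub>U\<^esub> SY = \<xi> \<odot>\<^bsub>U\<^esub> (SY \<otimes>\<^bsub>U\<^esub> SX) \<oplus>\<^bsub>U\<^esub> tensor_map K (tri A) [i, i, i] t"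
  shows "\<tau> h = \<xi> \<odot>\<^bsub>R\<^esub> h"
proof -
  interpret R: k_algebra K R by (rule R)
  interpret A: k_algebra K A by (rule A)
  interpret T: k_algebra K "tensor_alg K (tri R)" by (rule tensor_k_algebra[OF tri_alg_list[OF R]])
  interpret U: k_algebra K U unfolding U_def by (rule tensor_k_algebra[OF tri_alg_list[OF A]])
  let ?p = "\<lambda>x y z. pure K (tri A) [x, y, z]" and ?r = "\<lambda>x y z. pure K (tri R) [x, y, z]"
  let ?T = "tensor_alg K (tri R)"
  note pc = tri_pure_closed[OF A, folded U_def]
  note pm = tri_pure_mult[OF A, folded U_def]
  note rc = tri_pure_closed[OF R]
  note z = tri_pure_zero[OF R]
  note il = alg_hom_lin[OF i] and ic = alg_hom_closed[OF i]
  have ghc: "g \<in> carrier R" "h \<in> carrier R" "inv\<^bsub>R\<^esub> g \<in> carrier R" "inv\<^bsub>R\<^esub> h \<in> carrier R"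
    "inv\<^bsub>R\<^esub> g \<otimes>\<^bsub>R\<^esub> g = \<one>\<^bsub>R\<^esub>" "inv\<^bsub>R\<^esub> h \<otimes>\<^bsub>R\<^esub> h = \<one>\<^bsub>R\<^esub>" using gh by auto
  have th: "\<tau> h \<in> carrier R" "\<omega> g \<in> carrier R" using alg_hom_closed[OF \<tau>] alg_hom_closed[OF \<omega>] ghc by auto
  note fc = lin_closed[OF lin(1)] lin_closed[OF lin(2)] lin_closed[OF lin(3)]
  have ev1: "p (i r) = r" "q (i r) = \<zero>\<^bsub>R\<^esub>" "s (i r) = \<zero>\<^bsub>R\<^esub>" if "r \<in> carrier R" for r
    using that ev(1-3)[of r "\<one>\<^bsub>A\<^esub>"] ic ev(4,7,9) by auto
  have ii: "i r \<otimes>\<^bsub>A\<^esub> i r' = i (r \<otimes>\<^bsub>R\<^esub> r')" if "r \<in> carrier R" "r' \<in> carrier R" for r r'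
    using that by (simp add: alg_hom_mult[OF i])
  define x1 x2 x3 where x: "x1 = ?p X \<one>\<^bsub>A\<^esub> \<one>\<^bsub>A\<^esub>" "x2 = ?p (i g) (i (inv\<^bsub>R\<^esub> g) \<otimes>\<^bsub>A\<^esub> X) \<one>\<^bsub>A\<^esub>" "x3 = ?p (i g) (i (inv\<^bsub>R\<^esub> g)) X"
  define y1 y2 y3 where y: "y1 = ?p Y \<one>\<^bsub>A\<^esub> \<one>\<^bsub>A\<^esub>" "y2 = ?p (i h) (i (inv\<^bsub>R\<^esub> h) \<otimes>\<^bsub>A\<^esub> Y) \<one>\<^bsub>A\<^esub>" "y3 = ?p (i h) (i (inv\<^bsub>R\<^esub> h)) Y"
  have cl: "x1 \<in> carrier U" "x2 \<in> carrier U" "x3 \<in> carrier U" "y1 \<in> carrier U" "y2 \<in> carrier U" "y3 \<in> carrier U"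
    using X Y ghc ic by (auto simp: x y intro!: pc)
  have SX: "SX = x1 \<ominus>\<^bsub>U\<^esub> x2 \<oplus>\<^bsub>U\<^esub> x3" and SY: "SY = y1 \<ominus>\<^bsub>U\<^esub> y2 \<oplus>\<^bsub>U\<^esub> y3"
    by (simp_all add: SX_def SY_def skew_elt_def x y flip: U_def)
  have Sc: "SX \<in> carrier U" "SY \<in> carrier U" unfolding SX SY using cl by auto
  let ?Q = "tensor_map K (tri R) [q, s, p]"
  have lQ: "?Q \<in> lin_maps K U ?T"
    unfolding U_def by (rule tri_map_lin[OF A R]; rule lin)
  note Qp = tri_map_pure[OF A R lin(2,3,1)]
  have expand: "?Q (SX \<otimes>\<^bsub>U\<^esub> SY) = (?Q (x1 \<otimes>\<^bsub>U\<^esub> y1) \<oplus>\<^bsub>?T\<^esub> ?Q (x2 \<otimes>\<^bsub>U\<^esub> y2) \<oplus>\<^bsub>?T\<^esub> ?Q (x3 \<otimes>\<^bsub>U\<^esub> y3))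
    \<oplus>\<^bsub>?T\<^esub> (\<ominus>\<^bsub>?T\<^esub> ?Q (x1 \<otimes>\<^bsub>U\<^esub> y2) \<oplus>\<^bsub>?T\<^esub> ?Q (x1 \<otimes>\<^bsub>U\<^esub> y3) \<oplus>\<^bsub>?T\<^esub> (\<ominus>\<^bsub>?T\<^esub> ?Q (x2 \<otimes>\<^bsub>U\<^esub> y1)) \<oplus>\<^bsub>?T\<^esub> (\<ominus>\<^bsub>?T\<^esub> ?Q (x2 \<otimes>\<^bsub>U\<^esub> y3))
      \<oplus>\<^bsub>?T\<^esub> ?Q (x3 \<otimes>\<^bsub>U\<^esub> y1) \<oplus>\<^bsub>?T\<^esub> (\<ominus>\<^bsub>?T\<^esub> ?Q (x3 \<otimes>\<^bsub>U\<^esub> y2)))"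
    "?Q (SY \<otimes>\<^bsub>U\<^esub> SX) = (?Q (y1 \<otimes>\<^bsub>U\<^esub> x1) \<oplus>\<^bsub>?T\<^esub> ?Q (y2 \<otimes>\<^bsub>U\<^esub> x2) \<oplus>\<^bsub>?T\<^esub> ?Q (y3 \<otimes>\<^bsub>U\<^esub> x3))
    \<oplus>\<^bsub>?T\<^esub> (\<ominus>\<^bsub>?T\<^esub> ?Q (y1 \<otimes>\<^bsub>U\<^esub> x2) \<oplus>\<^bsub>?T\<^esub> ?Q (y1 \<otimes>\<^bsub>U\<^esub> x3) \<oplus>\<^bsub>?T\<^esub> (\<ominus>\<^bsub>?T\<^esub> ?Q (y2 \<otimes>\<^bsub>U\<^esub> x1)) \<oplus>\<^bsub>?T\<^esub> (\<ominus>\<^bsub>?T\<^esub> ?Q (y2 \<otimes>\<^bsub>U\<^esub> x3))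
      \<oplus>\<^bsub>?T\<^esub> ?Q (y3 \<otimes>\<^bsub>U\<^esub> x1) \<oplus>\<^bsub>?T\<^esub> (\<ominus>\<^bsub>?T\<^esub> ?Q (y3 \<otimes>\<^bsub>U\<^esub> x2)))"
    unfolding SX SY U.A.signed_sum_mult[OF cl] U.A.signed_sum_mult[OF cl(4-6,1-3)]
    using cl by (simp_all add: lin_add[OF lQ] lin_minus[OF U.module_axioms T.module_axioms lQ])
  note Jt = tri_map_closed[OF R A il il il t, folded U_def]
  \<comment> \<open>A tensor coming from \<open>R\<close> has no coefficient at \<open>X\<close> in
    the first factor, so the unknown \<open>t\<close> drops out.\<close>
  have J0: "?Q (tensor_map K (tri A) [i, i, i] t) = \<zero>\<^bsub>?T\<^esub>"
    unfolding tri_map_comp[OF R A il il il R lin(2,3,1) t]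
    by (rule tri_map_zero[OF R R lin_comp[OF lin(2) il] lin_comp[OF lin(3) il] lin_comp[OF lin(1) il] _ t])
      (simp add: ev1)
  have eqQ: "?Q (SX \<otimes>\<^bsub>U\<^esub> SY) = \<xi> \<odot>\<^bsub>?T\<^esub> ?Q (SY \<otimes>\<^bsub>U\<^esub> SX)"
    unfolding eq using Sc Jt \<xi>c J0 lin_closed[OF lQ] by (simp add: lin_add[OF lQ] lin_smult[OF lQ])
  note calc = pm Qp X Y ghc ic th ii X_rel Y_rel ev ev1 z fc rc
  have Q: "?Q (x1 \<otimes>\<^bsub>U\<^esub> y1) = \<zero>\<^bsub>?T\<^esub>" "?Q (x1 \<otimes>\<^bsub>U\<^esub> y2) = ?r (\<tau> h) (inv\<^bsub>R\<^esub> h) \<one>\<^bsub>R\<^esub>" "?Q (x1 \<otimes>\<^bsub>U\<^esub> y3) = \<zero>\<^bsub>?T\<^esub>"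
    "?Q (x2 \<otimes>\<^bsub>U\<^esub> y1) = \<zero>\<^bsub>?T\<^esub>" "?Q (x2 \<otimes>\<^bsub>U\<^esub> y2) = \<zero>\<^bsub>?T\<^esub>" "?Q (x2 \<otimes>\<^bsub>U\<^esub> y3) = \<zero>\<^bsub>?T\<^esub>"
    "?Q (x3 \<otimes>\<^bsub>U\<^esub> y1) = \<zero>\<^bsub>?T\<^esub>" "?Q (x3 \<otimes>\<^bsub>U\<^esub> y2) = \<zero>\<^bsub>?T\<^esub>" "?Q (x3 \<otimes>\<^bsub>U\<^esub> y3) = \<zero>\<^bsub>?T\<^esub>"
    "?Q (y1 \<otimes>\<^bsub>U\<^esub> x1) = \<zero>\<^bsub>?T\<^esub>" "?Q (y2 \<otimes>\<^bsub>U\<^esub> x1) = ?r h (inv\<^bsub>R\<^esub> h) \<one>\<^bsub>R\<^esub>" "?Q (y3 \<otimes>\<^bsub>U\<^esub> x1) = \<zero>\<^bsub>?T\<^esub>"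
    "?Q (y1 \<otimes>\<^bsub>U\<^esub> x2) = \<zero>\<^bsub>?T\<^esub>" "?Q (y2 \<otimes>\<^bsub>U\<^esub> x2) = \<zero>\<^bsub>?T\<^esub>" "?Q (y3 \<otimes>\<^bsub>U\<^esub> x2) = \<zero>\<^bsub>?T\<^esub>"
    "?Q (y1 \<otimes>\<^bsub>U\<^esub> x3) = \<zero>\<^bsub>?T\<^esub>" "?Q (y2 \<otimes>\<^bsub>U\<^esub> x3) = \<zero>\<^bsub>?T\<^esub>" "?Q (y3 \<otimes>\<^bsub>U\<^esub> x3) = \<zero>\<^bsub>?T\<^esub>"
    unfolding x y by (simp_all add: calc)
  \<comment> \<open>Multiplying the tensor factors together brings the identity back to
    \<open>R\<close>, where the factor \<open>inv h\<close> can be cancelled.\<close>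
  obtain m where m: "m \<in> lin_maps K ?T R"
    "\<And>x y z. x \<in> carrier R \<Longrightarrow> y \<in> carrier R \<Longrightarrow> z \<in> carrier R \<Longrightarrow> m (?r x y z) = x \<otimes>\<^bsub>R\<^esub> y \<otimes>\<^bsub>R\<^esub> z"
    using tri_product_lin[OF R] by blast
  have hc: "?r (\<tau> h) (inv\<^bsub>R\<^esub> h) \<one>\<^bsub>R\<^esub> \<in> carrier ?T" "?r h (inv\<^bsub>R\<^esub> h) \<one>\<^bsub>R\<^esub> \<in> carrier ?T"
    using ghc th by (auto intro!: rc)
  then have "\<ominus>\<^bsub>?T\<^esub> ?r (\<tau> h) (inv\<^bsub>R\<^esub> h) \<one>\<^bsub>R\<^esub> = \<ominus>\<^bsub>?T\<^esub> (\<xi> \<odot>\<^bsub>?T\<^esub> ?r h (inv\<^bsub>R\<^esub> h) \<one>\<^bsub>R\<^esub>)"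
    using eqQ \<xi>c unfolding expand Q by (simp add: T.smult_r_minus)
  then have "?r (\<tau> h) (inv\<^bsub>R\<^esub> h) \<one>\<^bsub>R\<^esub> = \<xi> \<odot>\<^bsub>?T\<^esub> ?r h (inv\<^bsub>R\<^esub> h) \<one>\<^bsub>R\<^esub>"
    using hc \<xi>c by (metis T.M.minus_minus T.smult_closed)
  then have "m (?r (\<tau> h) (inv\<^bsub>R\<^esub> h) \<one>\<^bsub>R\<^esub>) = m (\<xi> \<odot>\<^bsub>?T\<^esub> ?r h (inv\<^bsub>R\<^esub> h) \<one>\<^bsub>R\<^esub>)" by simp
  then have "\<tau> h \<otimes>\<^bsub>R\<^esub> inv\<^bsub>R\<^esub> h = \<xi> \<odot>\<^bsub>R\<^esub> (h \<otimes>\<^bsub>R\<^esub> inv\<^bsub>R\<^esub> h)"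
    using hc ghc th \<xi>c by (simp add: m(2) lin_smult[OF m(1)])
  then have "\<tau> h \<otimes>\<^bsub>R\<^esub> inv\<^bsub>R\<^esub> h \<otimes>\<^bsub>R\<^esub> h = \<xi> \<odot>\<^bsub>R\<^esub> (h \<otimes>\<^bsub>R\<^esub> inv\<^bsub>R\<^esub> h) \<otimes>\<^bsub>R\<^esub> h" by simp
  then show "\<tau> h = \<xi> \<odot>\<^bsub>R\<^esub> h"
    using ghc th \<xi>c by (simp add: R.A.m_assoc R.smult_mult_left)
qed

section \<open>Coassociativity and unit axioms\<close>

lemma pure_coord_lin:
  assumes "alg_list K As" "xs \<in> carrier (prod_monoid As)" "i < length As" "As ! i = A \<or> As ! i = op_alg A"
  shows "(\<lambda>x. pure K As (xs[i := x])) \<in> lin_maps K A (tensor_alg K As)"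
  using multilin_lin[OF assms(1) pure_multilin[OF assms(1)] assms(2,3)] assms(4) by auto

lemma pair_pure_lin:
  assumes "k_algebra K A" "x \<in> carrier A"
  shows "(\<lambda>y. pure K [A, A] [y, x]) \<in> lin_maps K A (tensor_alg K [A, A])"
    and "(\<lambda>y. pure K [A, A] [x, y]) \<in> lin_maps K A (tensor_alg K [A, A])"
  using pure_coord_lin[OF pair_alg_list[OF assms(1)], of "[x, x]" 0 A]
    pure_coord_lin[OF pair_alg_list[OF assms(1)], of "[x, x]" 1 A] assms(2)
  by (auto simp: pair_carrier)

lemma quin_pure_lin:
  assumes "k_algebra K A" "x \<in> carrier A" "y \<in> carrier A" "z \<in> carrier A" "u \<in> carrier A"
  shows "(\<lambda>a. pure K (quin A) [a, x, y, z, u]) \<in> lin_maps K A (tensor_alg K (quin A))"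
    and "(\<lambda>a. pure K (quin A) [x, a, y, z, u]) \<in> lin_maps K A (tensor_alg K (quin A))"
    and "(\<lambda>a. pure K (quin A) [x, y, a, z, u]) \<in> lin_maps K A (tensor_alg K (quin A))"
    and "(\<lambda>a. pure K (quin A) [x, y, z, a, u]) \<in> lin_maps K A (tensor_alg K (quin A))"
    and "(\<lambda>a. pure K (quin A) [x, y, z, u, a]) \<in> lin_maps K A (tensor_alg K (quin A))"
proof -
  note l = pure_coord_lin[OF quin_alg_list[OF assms(1)], where A = A]
  show "(\<lambda>a. pure K (quin A) [a, x, y, z, u]) \<in> lin_maps K A (tensor_alg K (quin A))"
    using l[of "[x, x, y, z, u]" 0] assms by (simp add: quin_carrier)
  show "(\<lambda>a. pure K (quin A) [x, a, y, z, u]) \<in> lin_maps K A (tensor_alg K (quin A))"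
    using l[of "[x, x, y, z, u]" "Suc 0"] assms by (simp add: quin_carrier)
  show "(\<lambda>a. pure K (quin A) [x, y, a, z, u]) \<in> lin_maps K A (tensor_alg K (quin A))"
    using l[of "[x, y, y, z, u]" "Suc (Suc 0)"] assms by (simp add: quin_carrier)
  show "(\<lambda>a. pure K (quin A) [x, y, z, a, u]) \<in> lin_maps K A (tensor_alg K (quin A))"
    using l[of "[x, y, z, z, u]" "Suc (Suc (Suc 0))"] assms by (simp add: quin_carrier)
  show "(\<lambda>a. pure K (quin A) [x, y, z, u, a]) \<in> lin_maps K A (tensor_alg K (quin A))"
    using l[of "[x, y, z, u, u]" "Suc (Suc (Suc (Suc 0)))"] assms by (simp add: quin_carrier)
qed

lemma quin_pure_mult:
  assumes "k_algebra K A" "x \<in> carrier A" "y \<in> carrier A" "z \<in> carrier A" "u \<in> carrier A" "v \<in> carrier A"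
    "x' \<in> carrier A" "y' \<in> carrier A" "z' \<in> carrier A" "u' \<in> carrier A" "v' \<in> carrier A"
  shows "pure K (quin A) [x, y, z, u, v] \<otimes>\<^bsub>tensor_alg K (quin A)\<^esub> pure K (quin A) [x', y', z', u', v']
    = pure K (quin A) [x \<otimes>\<^bsub>A\<^esub> x', y' \<otimes>\<^bsub>A\<^esub> y, z \<otimes>\<^bsub>A\<^esub> z', u' \<otimes>\<^bsub>A\<^esub> u, v \<otimes>\<^bsub>A\<^esub> v']"
  using assms by (subst pure_mult[OF quin_alg_list[OF assms(1)]]) (auto simp: quin_carrier quin_mult)

lemma pair_pure_mult:
  assumes "k_algebra K A" "x \<in> carrier A" "y \<in> carrier A" "x' \<in> carrier A" "y' \<in> carrier A"
  shows "pure K [A, A] [x, y] \<otimes>\<^bsub>tensor_alg K [A, A]\<^esub> pure K [A, A] [x', y'] = pure K [A, A] [x \<otimes>\<^bsub>A\<^esub> x', y \<otimes>\<^bsub>A\<^esub> y']"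
  using assms by (subst pure_mult[OF pair_alg_list[OF assms(1)]]) (auto simp: pair_carrier pair_mult)

text \<open>Both \<open>t \<mapsto> t \<otimes> y \<otimes> z\<close> and \<open>t \<mapsto> y \<otimes> z \<otimes> t\<close> from the triple to the quintuple tensor product are
  insertions; \<open>B\<close> and \<open>B'\<close> are the algebras, \<open>A\<close> or its opposite, in which \<open>y\<close> and \<open>z\<close> multiply.\<close>

definition insertion where
  "insertion K A B B' E \<longleftrightarrow> (B = A \<or> B = op_alg A) \<and> (B' = A \<or> B' = op_alg A) \<and>
    (\<forall>a\<in>carrier A. \<forall>b\<in>carrier A. \<forall>c\<in>carrier A. \<forall>y\<in>carrier A. \<forall>z\<in>carrier A.
      (\<lambda>a. pure K (quin A) (E [a, b, c] y z)) \<in> lin_maps K A (tensor_alg K (quin A)) \<and>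
      (\<lambda>b. pure K (quin A) (E [a, b, c] y z)) \<in> lin_maps K A (tensor_alg K (quin A)) \<and>
      (\<lambda>c. pure K (quin A) (E [a, b, c] y z)) \<in> lin_maps K A (tensor_alg K (quin A)) \<and>
      (\<lambda>y. pure K (quin A) (E [a, b, c] y z)) \<in> lin_maps K A (tensor_alg K (quin A)) \<and>
      (\<lambda>z. pure K (quin A) (E [a, b, c] y z)) \<in> lin_maps K A (tensor_alg K (quin A))) \<and>
    (\<forall>a\<in>carrier A. \<forall>b\<in>carrier A. \<forall>c\<in>carrier A. \<forall>y\<in>carrier A. \<forall>z\<in>carrier A.
     \<forall>a'\<in>carrier A. \<forall>b'\<in>carrier A. \<forall>c'\<in>carrier A. \<forall>y'\<in>carrier A. \<forall>z'\<in>carrier A.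
      pure K (quin A) (E [a, b, c] y z) \<otimes>\<^bsub>tensor_alg K (quin A)\<^esub> pure K (quin A) (E [a', b', c'] y' z')
        = pure K (quin A) (E [a \<otimes>\<^bsub>A\<^esub> a', b' \<otimes>\<^bsub>A\<^esub> b, c \<otimes>\<^bsub>A\<^esub> c'] (y \<otimes>\<^bsub>B\<^esub> y') (z \<otimes>\<^bsub>B'\<^esub> z')))"

context
  fixes K :: "('k, 'm) ring_scheme" and A :: "('k, 'a, 'n) module_scheme" and E :: "'a list \<Rightarrow> 'a \<Rightarrow> 'a \<Rightarrow> 'a list"
    and B B' :: "('k, 'a, 'n) module_scheme"
  assumes A: "k_algebra K A" and ins: "insertion K A B B' E"
begin

private lemma E_lin:
  "a \<in> carrier A \<Longrightarrow> b \<in> carrier A \<Longrightarrow> c \<in> carrier A \<Longrightarrow> y \<in> carrier A \<Longrightarrow> z \<in> carrier A \<Longrightarrow>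
      (\<lambda>a. pure K (quin A) (E [a, b, c] y z)) \<in> lin_maps K A (tensor_alg K (quin A)) \<and>
      (\<lambda>b. pure K (quin A) (E [a, b, c] y z)) \<in> lin_maps K A (tensor_alg K (quin A)) \<and>
      (\<lambda>c. pure K (quin A) (E [a, b, c] y z)) \<in> lin_maps K A (tensor_alg K (quin A)) \<and>
      (\<lambda>y. pure K (quin A) (E [a, b, c] y z)) \<in> lin_maps K A (tensor_alg K (quin A)) \<and>
      (\<lambda>z. pure K (quin A) (E [a, b, c] y z)) \<in> lin_maps K A (tensor_alg K (quin A))"
  and E_mult:
  "a \<in> carrier A \<Longrightarrow> b \<in> carrier A \<Longrightarrow> c \<in> carrier A \<Longrightarrow> y \<in> carrier A \<Longrightarrow> z \<in> carrier A \<Longrightarrow>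
      a' \<in> carrier A \<Longrightarrow> b' \<in> carrier A \<Longrightarrow> c' \<in> carrier A \<Longrightarrow> y' \<in> carrier A \<Longrightarrow> z' \<in> carrier A \<Longrightarrow>
      pure K (quin A) (E [a, b, c] y z) \<otimes>\<^bsub>tensor_alg K (quin A)\<^esub> pure K (quin A) (E [a', b', c'] y' z')
        = pure K (quin A) (E [a \<otimes>\<^bsub>A\<^esub> a', b' \<otimes>\<^bsub>A\<^esub> b, c \<otimes>\<^bsub>A\<^esub> c'] (y \<otimes>\<^bsub>B\<^esub> y') (z \<otimes>\<^bsub>B'\<^esub> z'))"
  and insertion_B: "B = A \<or> B = op_alg A" "B' = A \<or> B' = op_alg A"
  using ins unfolding insertion_def by blast+

private abbreviation (input) "T3 \<equiv> tensor_alg K (tri A)"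
private abbreviation (input) "T5 \<equiv> tensor_alg K (quin A)"
private abbreviation (input) "ins y z \<equiv> tensor_lift K T5 (\<lambda>ys. pure K (quin A) (E ys y z))"

private lemma T5_mod: "module K T5" by (rule tensor_module[OF quin_alg_list[OF A]])

private lemma ins_multilin:
  "y \<in> carrier A \<Longrightarrow> z \<in> carrier A \<Longrightarrow> multilin K (tri A) T5 (\<lambda>ys. pure K (quin A) (E ys y z))"
  by (rule multilin_triI[OF A]) (simp_all add: E_lin)

lemma insert_lin: "y \<in> carrier A \<Longrightarrow> z \<in> carrier A \<Longrightarrow> ins y z \<in> lin_maps K T3 T5"
  by (rule tensor_lift_lin[OF tri_alg_list[OF A] T5_mod ins_multilin])

lemma insert_pure:
  "y \<in> carrier A \<Longrightarrow> z \<in> carrier A \<Longrightarrow> a \<in> carrier A \<Longrightarrow> b \<in> carrier A \<Longrightarrow> c \<in> carrier A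
    \<Longrightarrow> ins y z (pure K (tri A) [a, b, c]) = pure K (quin A) (E [a, b, c] y z)"
  by (rule tensor_lift_pure[OF tri_alg_list[OF A] T5_mod ins_multilin]) (auto simp: tri_carrier)

lemma insert_coord_lin:
  assumes t: "t \<in> carrier T3" and z: "z \<in> carrier A"
  shows "(\<lambda>y. ins y z t) \<in> lin_maps K A T5" "(\<lambda>y. ins z y t) \<in> lin_maps K A T5"
proof -
  interpret A: k_algebra K A by (rule A)
  note mod = tensor_module[OF tri_alg_list[OF A]]
  note ext = tri_ext[OF A T5_mod _ _ _ t] and plus = lin_plus[OF mod T5_mod] and scale = lin_scale[OF mod T5_mod]
  have E4: "(\<lambda>y. pure K (quin A) (E [a, b, c] y z)) \<in> lin_maps K A T5"
    and E5: "(\<lambda>y. pure K (quin A) (E [a, b, c] z y)) \<in> lin_maps K A T5"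
    if "a \<in> carrier A" "b \<in> carrier A" "c \<in> carrier A" for a b c
    using E_lin[OF that z z] by auto
  show "(\<lambda>y. ins y z t) \<in> lin_maps K A T5"
  proof (rule lin_mapsI)
    fix y y' assume y: "y \<in> carrier A" "y' \<in> carrier A"
    show "ins (y \<oplus>\<^bsub>A\<^esub> y') z t = ins y z t \<oplus>\<^bsub>T5\<^esub> ins y' z t"
      by (rule ext[OF insert_lin[OF A.M.a_closed[OF y] z] plus[OF insert_lin[OF y(1) z] insert_lin[OF y(2) z]]])
        (use y z lin_add[OF E4] in \<open>simp add: insert_pure\<close>)
  next
    fix k y assume y: "k \<in> carrier K" "y \<in> carrier A"
    show "ins (k \<odot>\<^bsub>A\<^esub> y) z t = k \<odot>\<^bsub>T5\<^esub> ins y z t"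
      by (rule ext[OF insert_lin[OF A.smult_closed[OF y] z] scale[OF insert_lin[OF y(2) z] y(1)]])
        (use y z lin_smult[OF E4] in \<open>simp add: insert_pure\<close>)
  qed (rule lin_closed[OF insert_lin[OF _ z] t])
  show "(\<lambda>y. ins z y t) \<in> lin_maps K A T5"
  proof (rule lin_mapsI)
    fix y y' assume y: "y \<in> carrier A" "y' \<in> carrier A"
    show "ins z (y \<oplus>\<^bsub>A\<^esub> y') t = ins z y t \<oplus>\<^bsub>T5\<^esub> ins z y' t"
      by (rule ext[OF insert_lin[OF z A.M.a_closed[OF y]] plus[OF insert_lin[OF z y(1)] insert_lin[OF z y(2)]]])
        (use y z lin_add[OF E5] in \<open>simp add: insert_pure\<close>)
  next
    fix k y assume y: "k \<in> carrier K" "y \<in> carrier A"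
    show "ins z (k \<odot>\<^bsub>A\<^esub> y) t = k \<odot>\<^bsub>T5\<^esub> ins z y t"
      by (rule ext[OF insert_lin[OF z A.smult_closed[OF y]] scale[OF insert_lin[OF z y(2)] y(1)]])
        (use y z lin_smult[OF E5] in \<open>simp add: insert_pure\<close>)
  qed (rule lin_closed[OF insert_lin[OF z] t])
qed

text \<open>Both sides are bilinear in \<open>s\<close> and \<open>t\<close>; on pure tensors the
  claim is the multiplication rule of the quintuple product, with \<open>B\<close> and
  \<open>B'\<close> recording the direction of the product at the inserted places.\<close>

lemma insert_mult:
  assumes "y \<in> carrier A" "z \<in> carrier A" "y' \<in> carrier A" "z' \<in> carrier A" and s: "s \<in> carrier T3" and t: "t \<in> carrier T3"
  shows "ins y z s \<otimes>\<^bsub>T5\<^esub> ins y' z' t = ins (y \<otimes>\<^bsub>B\<^esub> y') (z \<otimes>\<^bsub>B'\<^esub> z') (s \<otimes>\<^bsub>T3\<^esub> t)"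
proof -
  interpret A: k_algebra K A by (rule A)
  note T3 = tensor_k_algebra[OF tri_alg_list[OF A]] and T5 = tensor_k_algebra[OF quin_alg_list[OF A]]
  have m: "y \<otimes>\<^bsub>B\<^esub> y' \<in> carrier A" "z \<otimes>\<^bsub>B'\<^esub> z' \<in> carrier A" using assms insertion_B by auto
  note L = insert_lin[OF assms(1,2)] and L' = insert_lin[OF assms(3,4)] and LL = insert_lin[OF m]
  have "(\<lambda>s. ins y z s \<otimes>\<^bsub>T5\<^esub> ins y' z' t) s = (\<lambda>s. ins (y \<otimes>\<^bsub>B\<^esub> y') (z \<otimes>\<^bsub>B'\<^esub> z') (s \<otimes>\<^bsub>T3\<^esub> t)) s"
  proof (rule tri_ext[OF A T5_mod _ _ _ s])
    show "(\<lambda>s. ins y z s \<otimes>\<^bsub>T5\<^esub> ins y' z' t) \<in> lin_maps K T3 T5"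
      by (rule lin_comp[OF lin_right_mult[OF T5 lin_closed[OF L' t]] L])
    show "(\<lambda>s. ins (y \<otimes>\<^bsub>B\<^esub> y') (z \<otimes>\<^bsub>B'\<^esub> z') (s \<otimes>\<^bsub>T3\<^esub> t)) \<in> lin_maps K T3 T5"
      by (rule lin_comp[OF LL lin_right_mult[OF T3 t]])
    fix a b c assume abc: "a \<in> carrier A" "b \<in> carrier A" "c \<in> carrier A"
    let ?s = "pure K (tri A) [a, b, c]"
    have s: "?s \<in> carrier T3" using abc by (rule tri_pure_closed[OF A])
    have "(\<lambda>t. ins y z ?s \<otimes>\<^bsub>T5\<^esub> ins y' z' t) t = (\<lambda>t. ins (y \<otimes>\<^bsub>B\<^esub> y') (z \<otimes>\<^bsub>B'\<^esub> z') (?s \<otimes>\<^bsub>T3\<^esub> t)) t"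
    proof (rule tri_ext[OF A T5_mod _ _ _ t])
      show "(\<lambda>t. ins y z ?s \<otimes>\<^bsub>T5\<^esub> ins y' z' t) \<in> lin_maps K T3 T5"
        by (rule lin_comp[OF lin_left_mult[OF T5 lin_closed[OF L s]] L'])
      show "(\<lambda>t. ins (y \<otimes>\<^bsub>B\<^esub> y') (z \<otimes>\<^bsub>B'\<^esub> z') (?s \<otimes>\<^bsub>T3\<^esub> t)) \<in> lin_maps K T3 T5"
        by (rule lin_comp[OF LL lin_left_mult[OF T3 s]])
    qed (use abc assms m in \<open>simp add: insert_pure E_mult tri_pure_mult[OF A]\<close>)
    then show "ins y z ?s \<otimes>\<^bsub>T5\<^esub> ins y' z' t = ins (y \<otimes>\<^bsub>B\<^esub> y') (z \<otimes>\<^bsub>B'\<^esub> z') (?s \<otimes>\<^bsub>T3\<^esub> t)" .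
  qed
  then show ?thesis .
qed

end

context
  fixes K :: "('k, 'm) ring_scheme" and A :: "('k, 'a, 'n) module_scheme"
  assumes A: "k_algebra K A"
begin

private abbreviation (input) "V3 \<equiv> tensor_alg K (tri A)"
private abbreviation (input) "V5 \<equiv> tensor_alg K (quin A)"
private abbreviation (input) "insr y z \<equiv> tensor_lift K V5 (\<lambda>ys. pure K (quin A) (ys @ [y, z]))"
private abbreviation (input) "insl y z \<equiv> tensor_lift K V5 (\<lambda>ys. pure K (quin A) ([y, z] @ ys))"

private lemma insr: "insertion K A (op_alg A) A (\<lambda>ys y z. ys @ [y, z])"
  by (simp add: insertion_def quin_pure_lin[OF A] quin_pure_mult[OF A])

private lemma insl: "insertion K A A (op_alg A) (\<lambda>ys y z. [y, z] @ ys)"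
  by (simp add: insertion_def quin_pure_lin[OF A] quin_pure_mult[OF A])

lemmas insert_right_lin = insert_lin[OF A insr]
  and insert_left_lin = insert_lin[OF A insl]
  and insert_right_pure = insert_pure[OF A insr]
  and insert_left_pure = insert_pure[OF A insl]
  and insert_right_coord_lin = insert_coord_lin[OF A insr]
  and insert_left_coord_lin = insert_coord_lin[OF A insl]
  and insert_right_mult = insert_mult[OF A insr]
  and insert_left_mult = insert_mult[OF A insl]

context
  fixes M assumes M: "M \<in> alg_hom K A V3"
begin

text \<open>Needed for the outer lifts in \<open>mu_id_id\<close> and \<open>id_id_mu\<close>: the
  entry fed to \<open>M\<close> enters linearly by composition, the two inserted entries by
  \<open>insert_coord_lin\<close>.\<close>

private lemma mu_multilin:
  "multilin K (tri A) V5 (\<lambda>xs. insr (xs ! 1) (xs ! 2) (M (xs ! 0)))"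
  "multilin K (tri A) V5 (\<lambda>xs. insl (xs ! 0) (xs ! 1) (M (xs ! 2)))"
proof -
  note Mc = alg_hom_closed[OF M] and Ml = alg_hom_lin[OF M]
  have "(\<lambda>x. insr y z (M x)) \<in> lin_maps K A V5" if "y \<in> carrier A" "z \<in> carrier A" for y z
    by (rule lin_comp[OF insert_right_lin[OF that] Ml])
  moreover have "(\<lambda>x. insr x z (M y)) \<in> lin_maps K A V5" "(\<lambda>x. insr z x (M y)) \<in> lin_maps K A V5"
    if "y \<in> carrier A" "z \<in> carrier A" for y z
    by (rule insert_right_coord_lin[OF Mc[OF that(1)] that(2)])+
  ultimately show "multilin K (tri A) V5 (\<lambda>xs. insr (xs ! 1) (xs ! 2) (M (xs ! 0)))"
    by (intro multilin_triI[OF A]) simp_all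
  have "(\<lambda>x. insl y z (M x)) \<in> lin_maps K A V5" if "y \<in> carrier A" "z \<in> carrier A" for y z
    by (rule lin_comp[OF insert_left_lin[OF that] Ml])
  moreover have "(\<lambda>x. insl x z (M y)) \<in> lin_maps K A V5" "(\<lambda>x. insl z x (M y)) \<in> lin_maps K A V5"
    if "y \<in> carrier A" "z \<in> carrier A" for y z
    by (rule insert_left_coord_lin[OF Mc[OF that(1)] that(2)])+
  ultimately show "multilin K (tri A) V5 (\<lambda>xs. insl (xs ! 0) (xs ! 1) (M (xs ! 2)))"
    by (intro multilin_triI[OF A]) simp_all
qed

lemma mu_id_id_pure:
  "x \<in> carrier A \<Longrightarrow> y \<in> carrier A \<Longrightarrow> z \<in> carrier A \<Longrightarrow> mu_id_id K A M (pure K (tri A) [x, y, z]) = insr y z (M x)"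
  and id_id_mu_pure:
  "x \<in> carrier A \<Longrightarrow> y \<in> carrier A \<Longrightarrow> z \<in> carrier A \<Longrightarrow> id_id_mu K A M (pure K (tri A) [x, y, z]) = insl x y (M z)"
  unfolding mu_id_id_def id_id_mu_def
  using tensor_lift_pure[OF tri_alg_list[OF A] tensor_module[OF quin_alg_list[OF A]] mu_multilin(1), of "[x, y, z]"]
    tensor_lift_pure[OF tri_alg_list[OF A] tensor_module[OF quin_alg_list[OF A]] mu_multilin(2), of "[x, y, z]"]
  by (auto simp: tri_carrier)

text \<open>Insertion is multiplicative with the alternating pattern of opposite products in
  \<open>quin\<close>, and \<open>M\<close> is an algebra map. So the two sides of coassociativity
  can be compared on generators.\<close>

lemma mu_id_id_alg_hom: "mu_id_id K A M \<in> alg_hom K V3 V5"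
  and id_id_mu_alg_hom: "id_id_mu K A M \<in> alg_hom K V3 V5"
proof -
  interpret A: k_algebra K A by (rule A)
  note mult = insert_right_mult[simplified] insert_left_mult[simplified]
  show "mu_id_id K A M \<in> alg_hom K V3 V5"
    unfolding mu_id_id_def
  proof (rule tensor_lift_alg_hom[OF tri_alg_list[OF A] tensor_k_algebra[OF quin_alg_list[OF A]] mu_multilin(1)])
  qed (auto simp: tri_carrier tri_mult alg_hom_one[OF M] alg_hom_mult[OF M] alg_hom_closed[OF M] mult
      tri_pure_one[OF A] insert_right_pure pure_one[OF quin_alg_list[OF A]])
  show "id_id_mu K A M \<in> alg_hom K V3 V5"
    unfolding id_id_mu_def
  proof (rule tensor_lift_alg_hom[OF tri_alg_list[OF A] tensor_k_algebra[OF quin_alg_list[OF A]] mu_multilin(2)])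
  qed (auto simp: tri_carrier tri_mult alg_hom_one[OF M] alg_hom_mult[OF M] alg_hom_closed[OF M] mult
      tri_pure_one[OF A] insert_left_pure[simplified] pure_one[OF quin_alg_list[OF A]])
qed

end

end

section \<open>The unit axioms and products\<close>

context
  fixes K :: "('k, 'm) ring_scheme" and A :: "('k, 'a, 'n) module_scheme"
  assumes A: "k_algebra K A"
begin

private abbreviation (input) "W3 \<equiv> tensor_alg K (tri A)"
private abbreviation (input) "W2 \<equiv> tensor_alg K [A, A]"

private lemma W2_alg: "k_algebra K W2" by (rule tensor_k_algebra[OF pair_alg_list[OF A]])
private lemma W3_alg: "k_algebra K W3" by (rule tensor_k_algebra[OF tri_alg_list[OF A]])
private lemma W2_mod: "module K W2" by (rule k_algebra_module[OF W2_alg])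

private lemma unit_multilin:
  "multilin K (tri A) W2 (\<lambda>xs. pure K [A, A] [xs ! 0 \<otimes>\<^bsub>A\<^esub> xs ! 1, xs ! 2])"
  "multilin K (tri A) W2 (\<lambda>xs. pure K [A, A] [xs ! 0, xs ! 1 \<otimes>\<^bsub>A\<^esub> xs ! 2])"
proof -
  interpret A: k_algebra K A by (rule A)
  note l = pair_pure_lin[OF A] and ml = lin_left_mult[OF A] lin_right_mult[OF A]
  show "multilin K (tri A) W2 (\<lambda>xs. pure K [A, A] [xs ! 0 \<otimes>\<^bsub>A\<^esub> xs ! 1, xs ! 2])"
    by (rule multilin_triI[OF A]) (simp_all add: l lin_comp[OF l(1) ml(1)] lin_comp[OF l(1) ml(2)])
  show "multilin K (tri A) W2 (\<lambda>xs. pure K [A, A] [xs ! 0, xs ! 1 \<otimes>\<^bsub>A\<^esub> xs ! 2])"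
    by (rule multilin_triI[OF A]) (simp_all add: l lin_comp[OF l(2) ml(1)] lin_comp[OF l(2) ml(2)])
qed

lemma mult_id_lin: "mult_id K A \<in> lin_maps K W3 W2" and id_mult_lin: "id_mult K A \<in> lin_maps K W3 W2"
  unfolding mult_id_def id_mult_def
  by (rule tensor_lift_lin[OF tri_alg_list[OF A] W2_mod unit_multilin(1)]
      tensor_lift_lin[OF tri_alg_list[OF A] W2_mod unit_multilin(2)])+

lemma mult_id_pure:
  "x \<in> carrier A \<Longrightarrow> y \<in> carrier A \<Longrightarrow> z \<in> carrier A
    \<Longrightarrow> mult_id K A (pure K (tri A) [x, y, z]) = pure K [A, A] [x \<otimes>\<^bsub>A\<^esub> y, z]"
  and id_mult_pure:
  "x \<in> carrier A \<Longrightarrow> y \<in> carrier A \<Longrightarrow> z \<in> carrier A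
    \<Longrightarrow> id_mult K A (pure K (tri A) [x, y, z]) = pure K [A, A] [x, y \<otimes>\<^bsub>A\<^esub> z]"
  unfolding mult_id_def id_mult_def
  using tensor_lift_pure[OF tri_alg_list[OF A] W2_mod unit_multilin(1), of "[x, y, z]"]
    tensor_lift_pure[OF tri_alg_list[OF A] W2_mod unit_multilin(2), of "[x, y, z]"]
  by (auto simp: tri_carrier)

private lemma pair_closed: "x \<in> carrier A \<Longrightarrow> y \<in> carrier A \<Longrightarrow> pure K [A, A] [x, y] \<in> carrier W2"
  by (rule pure_closed[OF pair_alg_list[OF A]]) (simp add: pair_carrier)

text \<open>The map m \<otimes> id is not multiplicative, but for
  \<open>s = x \<otimes> y \<otimes> z\<close> the reversed middle product gives
  \<open>x t1 t2 y \<otimes> z t3\<close>, where \<open>t1 t2\<close> stand next to each other.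
  Since \<open>t1 t2 \<otimes> t3 = 1 \<otimes> b\<close>, this collapses to
  \<open>x y \<otimes> z b\<close>.\<close>

lemma mult_id_mult:
  assumes s: "s \<in> carrier W3" and t: "t \<in> carrier W3" and b: "b \<in> carrier A"
    and tb: "mult_id K A t = pure K [A, A] [\<one>\<^bsub>A\<^esub>, b]"
  shows "mult_id K A (s \<otimes>\<^bsub>W3\<^esub> t) = mult_id K A s \<otimes>\<^bsub>W2\<^esub> pure K [A, A] [\<one>\<^bsub>A\<^esub>, b]"
proof -
  interpret A: k_algebra K A by (rule A)
  interpret W2: k_algebra K W2 by (rule W2_alg)
  note ext = tri_ext[OF A W2_mod]
  show ?thesis
  proof (rule ext[OF lin_comp[OF mult_id_lin lin_right_mult[OF W3_alg t]]
        lin_comp[OF lin_right_mult[OF W2_alg] mult_id_lin] _ s])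
    fix x y z assume c: "x \<in> carrier A" "y \<in> carrier A" "z \<in> carrier A"
    let ?s = "pure K (tri A) [x, y, z]" and ?u = "pure K [A, A] [x, z]" and ?v = "pure K [A, A] [y, \<one>\<^bsub>A\<^esub>]"
    have uv: "?u \<in> carrier W2" "?v \<in> carrier W2" using c by (auto intro: pair_closed)
    have sc: "?s \<in> carrier W3" by (rule tri_pure_closed[OF A c])
    have "mult_id K A (?s \<otimes>\<^bsub>W3\<^esub> t) = (\<lambda>t. ?u \<otimes>\<^bsub>W2\<^esub> (mult_id K A t \<otimes>\<^bsub>W2\<^esub> ?v)) t"
      by (rule ext[OF lin_comp[OF mult_id_lin lin_left_mult[OF W3_alg sc]]
            lin_comp[OF lin_left_mult[OF W2_alg uv(1)] lin_comp[OF lin_right_mult[OF W2_alg uv(2)] mult_id_lin]] _ t])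
        (use c in \<open>simp add: tri_pure_mult[OF A] mult_id_pure pair_pure_mult[OF A] A.A.m_assoc\<close>)
    then show "mult_id K A (?s \<otimes>\<^bsub>W3\<^esub> t) = mult_id K A ?s \<otimes>\<^bsub>W2\<^esub> pure K [A, A] [\<one>\<^bsub>A\<^esub>, b]"
      using c b by (simp add: tb mult_id_pure pair_pure_mult[OF A])
  qed (use b pair_closed in auto)
qed

text \<open>The mirror image: for \<open>t = x \<otimes> y \<otimes> z\<close> one gets
  \<open>s1 x \<otimes> y s2 s3 z\<close> with \<open>s2 s3\<close> adjacent, so now the hypothesis
  falls on the left factor \<open>s\<close>.\<close>

lemma id_mult_mult:
  assumes s: "s \<in> carrier W3" and t: "t \<in> carrier W3" and b: "b \<in> carrier A"
    and sb: "id_mult K A s = pure K [A, A] [b, \<one>\<^bsub>A\<^esub>]"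
  shows "id_mult K A (s \<otimes>\<^bsub>W3\<^esub> t) = pure K [A, A] [b, \<one>\<^bsub>A\<^esub>] \<otimes>\<^bsub>W2\<^esub> id_mult K A t"
proof -
  interpret A: k_algebra K A by (rule A)
  interpret W2: k_algebra K W2 by (rule W2_alg)
  note ext = tri_ext[OF A W2_mod]
  show ?thesis
  proof (rule ext[OF lin_comp[OF id_mult_lin lin_left_mult[OF W3_alg s]]
        lin_comp[OF lin_left_mult[OF W2_alg] id_mult_lin] _ t])
    fix x y z assume c: "x \<in> carrier A" "y \<in> carrier A" "z \<in> carrier A"
    let ?t = "pure K (tri A) [x, y, z]" and ?u = "pure K [A, A] [\<one>\<^bsub>A\<^esub>, y]" and ?v = "pure K [A, A] [x, z]"
    have uv: "?u \<in> carrier W2" "?v \<in> carrier W2" using c by (auto intro: pair_closed)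
    have tc: "?t \<in> carrier W3" by (rule tri_pure_closed[OF A c])
    have "id_mult K A (s \<otimes>\<^bsub>W3\<^esub> ?t) = (\<lambda>s. ?u \<otimes>\<^bsub>W2\<^esub> (id_mult K A s \<otimes>\<^bsub>W2\<^esub> ?v)) s"
      by (rule ext[OF lin_comp[OF id_mult_lin lin_right_mult[OF W3_alg tc]]
            lin_comp[OF lin_left_mult[OF W2_alg uv(1)] lin_comp[OF lin_right_mult[OF W2_alg uv(2)] id_mult_lin]] _ s])
        (use c in \<open>simp add: tri_pure_mult[OF A] id_mult_pure pair_pure_mult[OF A] A.A.m_assoc\<close>)
    then show "id_mult K A (s \<otimes>\<^bsub>W3\<^esub> ?t) = pure K [A, A] [b, \<one>\<^bsub>A\<^esub>] \<otimes>\<^bsub>W2\<^esub> id_mult K A ?t"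
      using c b by (simp add: sb id_mult_pure pair_pure_mult[OF A])
  qed (use b pair_closed in auto)
qed

lemma unit_subalg:
  assumes M: "M \<in> alg_hom K A W3"
  shows "subalg K A {a \<in> carrier A. mult_id K A (M a) = pure K [A, A] [\<one>\<^bsub>A\<^esub>, a]}" (is "subalg K A ?L")
    and "subalg K A {a \<in> carrier A. id_mult K A (M a) = pure K [A, A] [a, \<one>\<^bsub>A\<^esub>]}" (is "subalg K A ?R")
proof -
  interpret A: k_algebra K A by (rule A)
  note Ml = alg_hom_lin[OF M] and Mc = alg_hom_closed[OF M]
  note l = pair_pure_lin[OF A A.A.one_closed]
  have L: "submodule ?L K A"
    by (rule equalizer_submodule[OF A.module_axioms W2_mod lin_comp[OF mult_id_lin Ml] l(2)])
  have R: "submodule ?R K A"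
    by (rule equalizer_submodule[OF A.module_axioms W2_mod lin_comp[OF id_mult_lin Ml] l(1)])
  show "subalg K A ?L"
    unfolding subalg_def using L
    by (auto simp: alg_hom_one[OF M] tri_pure_one[OF A] mult_id_pure alg_hom_mult[OF M] mult_id_mult Mc
        pair_pure_mult[OF A])
  show "subalg K A ?R"
    unfolding subalg_def using R
    by (auto simp: alg_hom_one[OF M] tri_pure_one[OF A] id_mult_pure alg_hom_mult[OF M] id_mult_mult Mc
        pair_pure_mult[OF A])
qed

end

section \<open>The axioms on the image of \<open>R\<close> and on the skew generators\<close>

context
  fixes K :: "('k, 'm) ring_scheme" and R :: "('k, 'a, 'n) module_scheme" and A :: "('k, 'b, 'p) module_scheme"
    and \<mu> i M
  assumes R: "hopf_galois_algebra K R \<mu>" and A: "k_algebra K A" and i: "i \<in> alg_hom K R A"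
    and M: "M \<in> alg_hom K A (tensor_alg K (tri A))"
    and Mi: "\<And>r. r \<in> carrier R \<Longrightarrow> M (i r) = tensor_map K (tri A) [i, i, i] (\<mu> r)"
begin

interpretation R: hopf_galois_algebra K R \<mu> by (rule R)
interpretation A: k_algebra K A by (rule A)

private abbreviation (input) "JA \<equiv> tensor_map K (tri A) [i, i, i]"
private abbreviation (input) "JA2 \<equiv> tensor_map K [A, A] [i, i]"
private abbreviation (input) "JA5 \<equiv> tensor_map K (quin A) [i, i, i, i, i]"
private abbreviation (input) "R3 \<equiv> tensor_alg K (tri R)"
private abbreviation (input) "A3 \<equiv> tensor_alg K (tri A)"

private lemmas Ra = R.k_algebra_axioms
private lemmas inc = alg_hom_closed[OF i]
private lemmas il = alg_hom_lin[OF i]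
private lemmas \<mu>c = R.mu_closed

private lemma JA: "JA \<in> lin_maps K R3 A3" by (rule tri_map_lin[OF Ra A il il il])

private lemma J_pure: "x \<in> carrier R \<Longrightarrow> y \<in> carrier R \<Longrightarrow> z \<in> carrier R \<Longrightarrow> JA (pure K (tri R) [x, y, z]) = pure K (tri A) [i x, i y, i z]"
  by (rule tri_map_pure[OF Ra A il il il])

private lemma L5: "lin_list K (quin R) (quin A) [i, i, i, i, i]"
  using il by (simp add: lin_list_def less_Suc_eq numeral_eq_Suc all_conj_distrib imp_conjR)

private lemma JA5: "JA5 \<in> lin_maps K (tensor_alg K (quin R)) (tensor_alg K (quin A))"
  by (rule tensor_map_lin[OF quin_alg_list[OF Ra] quin_alg_list[OF A] L5])

private lemma J5_pure:
  "x \<in> carrier R \<Longrightarrow> y \<in> carrier R \<Longrightarrow> z \<in> carrier R \<Longrightarrow> u \<in> carrier R \<Longrightarrow> v \<in> carrier R \<Longrightarrow>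
    JA5 (pure K (quin R) [x, y, z, u, v]) = pure K (quin A) [i x, i y, i z, i u, i v]"
  by (subst tensor_map_pure[OF quin_alg_list[OF Ra] quin_alg_list[OF A] L5]) (auto simp: quin_carrier)

private lemma L2: "lin_list K [R, R] [A, A] [i, i]"
  using il by (simp add: lin_list_def less_Suc_eq numeral_eq_Suc)

private lemma JA2: "JA2 \<in> lin_maps K (tensor_alg K [R, R]) (tensor_alg K [A, A])"
  by (rule tensor_map_lin[OF pair_alg_list[OF Ra] pair_alg_list[OF A] L2])

private lemma J2_pure: "x \<in> carrier R \<Longrightarrow> y \<in> carrier R \<Longrightarrow> JA2 (pure K [R, R] [x, y]) = pure K [A, A] [i x, i y]"
  by (subst tensor_map_pure[OF pair_alg_list[OF Ra] pair_alg_list[OF A] L2]) (auto simp: pair_carrier)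

private lemma A5_mod: "module K (tensor_alg K (quin A))" by (rule tensor_module[OF quin_alg_list[OF A]])
private lemma A2_mod: "module K (tensor_alg K [A, A])" by (rule tensor_module[OF pair_alg_list[OF A]])

text \<open>Inserting entries and applying \<open>i\<close> to all five factors may be done in
  either order; this transports the axioms of \<open>R\<close> along \<open>i\<close>.\<close>

private lemma insert_natural:
  assumes t: "t \<in> carrier R3" and yz: "y \<in> carrier R" "z \<in> carrier R"
  shows "tensor_lift K (tensor_alg K (quin A)) (\<lambda>ys. pure K (quin A) (ys @ [i y, i z])) (JA t)
      = JA5 (tensor_lift K (tensor_alg K (quin R)) (\<lambda>ys. pure K (quin R) (ys @ [y, z])) t)"
    and "tensor_lift K (tensor_alg K (quin A)) (\<lambda>ys. pure K (quin A) ([i y, i z] @ ys)) (JA t)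
      = JA5 (tensor_lift K (tensor_alg K (quin R)) (\<lambda>ys. pure K (quin R) ([y, z] @ ys)) t)"
  by (rule tri_ext[OF Ra A5_mod lin_comp[OF insert_right_lin[OF A inc[OF yz(1)] inc[OF yz(2)]] JA]
        lin_comp[OF JA5 insert_right_lin[OF Ra yz]] _ t],
      use yz inc in \<open>simp add: insert_right_pure[OF Ra] insert_right_pure[OF A] J_pure J5_pure\<close>)
    (rule tri_ext[OF Ra A5_mod lin_comp[OF insert_left_lin[OF A inc[OF yz(1)] inc[OF yz(2)]] JA]
        lin_comp[OF JA5 insert_left_lin[OF Ra yz]] _ t],
      use yz inc in \<open>simp add: insert_left_pure[OF Ra, simplified] insert_left_pure[OF A, simplified] J_pure J5_pure\<close>)

text \<open>Both sides are the images, under \<open>i\<close> applied in all five factors, of the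
  corresponding sides in \<open>R\<close>.\<close>

lemma coassoc_incl:
  assumes r: "r \<in> carrier R"
  shows "mu_id_id K A M (M (i r)) = id_id_mu K A M (M (i r))"
proof -
  note t = \<mu>c[OF r]
  have "mu_id_id K A M (JA (\<mu> r)) = JA5 (mu_id_id K R \<mu> (\<mu> r))"
    by (rule tri_ext[OF Ra A5_mod lin_comp[OF alg_hom_lin[OF mu_id_id_alg_hom[OF A M]] JA]
          lin_comp[OF JA5 alg_hom_lin[OF mu_id_id_alg_hom[OF Ra R.mu_alg_hom]]] _ t])
      (use inc \<mu>c in \<open>simp add: J_pure mu_id_id_pure[OF A M] mu_id_id_pure[OF Ra R.mu_alg_hom] Mi insert_natural(1)\<close>)
  moreover have "id_id_mu K A M (JA (\<mu> r)) = JA5 (id_id_mu K R \<mu> (\<mu> r))"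
    by (rule tri_ext[OF Ra A5_mod lin_comp[OF alg_hom_lin[OF id_id_mu_alg_hom[OF A M]] JA]
          lin_comp[OF JA5 alg_hom_lin[OF id_id_mu_alg_hom[OF Ra R.mu_alg_hom]]] _ t])
      (use inc \<mu>c in \<open>simp add: J_pure id_id_mu_pure[OF A M] id_id_mu_pure[OF Ra R.mu_alg_hom] Mi
        insert_natural(2)[simplified]\<close>)
  ultimately show ?thesis using R.mu_coassoc[OF r] r by (simp add: Mi)
qed

lemma unit_incl:
  assumes r: "r \<in> carrier R"
  shows "mult_id K A (M (i r)) = pure K [A, A] [\<one>\<^bsub>A\<^esub>, i r]" "id_mult K A (M (i r)) = pure K [A, A] [i r, \<one>\<^bsub>A\<^esub>]"
proof -
  note t = \<mu>c[OF r]
  have "mult_id K A (JA (\<mu> r)) = JA2 (mult_id K R (\<mu> r))"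
    by (rule tri_ext[OF Ra A2_mod lin_comp[OF mult_id_lin[OF A] JA] lin_comp[OF JA2 mult_id_lin[OF Ra]] _ t])
      (use inc in \<open>simp add: J_pure mult_id_pure[OF A] mult_id_pure[OF Ra] J2_pure alg_hom_mult[OF i]\<close>)
  then show "mult_id K A (M (i r)) = pure K [A, A] [\<one>\<^bsub>A\<^esub>, i r]"
    using r by (simp add: Mi R.mu_unit_left J2_pure alg_hom_one[OF i])
  have "id_mult K A (JA (\<mu> r)) = JA2 (id_mult K R (\<mu> r))"
    by (rule tri_ext[OF Ra A2_mod lin_comp[OF id_mult_lin[OF A] JA] lin_comp[OF JA2 id_mult_lin[OF Ra]] _ t])
      (use inc in \<open>simp add: J_pure id_mult_pure[OF A] id_mult_pure[OF Ra] J2_pure alg_hom_mult[OF i]\<close>)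
  then show "id_mult K A (M (i r)) = pure K [A, A] [i r, \<one>\<^bsub>A\<^esub>]"
    using r by (simp add: Mi R.mu_unit_right J2_pure alg_hom_one[OF i])
qed

context
  fixes g X
  assumes g: "g \<in> group_likes K R \<mu>" and X: "X \<in> carrier A" and MX: "M X = skew_elt K A (i g) (i (inv\<^bsub>R\<^esub> g)) X"
begin

private abbreviation (input) "G \<equiv> i g"
private abbreviation (input) "G' \<equiv> i (inv\<^bsub>R\<^esub> g)"

private lemma gs: "g \<in> carrier R" "inv\<^bsub>R\<^esub> g \<in> carrier R" "G \<in> carrier A" "G' \<in> carrier A"
  "G \<otimes>\<^bsub>A\<^esub> G' = \<one>\<^bsub>A\<^esub>" "G' \<otimes>\<^bsub>A\<^esub> G = \<one>\<^bsub>A\<^esub>" "M G = pure K (tri A) [G, G', G]"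
  using R.group_likeD[OF g] inc
  by (auto simp: Mi J_pure alg_hom_one[OF i] simp flip: alg_hom_mult[OF i])

private lemma sk_closed:
  "pure K (tri A) [X, \<one>\<^bsub>A\<^esub>, \<one>\<^bsub>A\<^esub>] \<in> carrier A3" "pure K (tri A) [G, G' \<otimes>\<^bsub>A\<^esub> X, \<one>\<^bsub>A\<^esub>] \<in> carrier A3"
  "pure K (tri A) [G, G', X] \<in> carrier A3" "G' \<otimes>\<^bsub>A\<^esub> X \<in> carrier A"
  using gs X by (auto intro!: tri_pure_closed[OF A])

private lemma skew_lin:
  assumes "module K W" "f \<in> lin_maps K A3 W"
  shows "f (M X) = f (pure K (tri A) [X, \<one>\<^bsub>A\<^esub>, \<one>\<^bsub>A\<^esub>]) \<ominus>\<^bsub>W\<^esub> f (pure K (tri A) [G, G' \<otimes>\<^bsub>A\<^esub> X, \<one>\<^bsub>A\<^esub>])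
    \<oplus>\<^bsub>W\<^esub> f (pure K (tri A) [G, G', X])"
proof -
  interpret T: k_algebra K A3 by (rule tensor_k_algebra[OF tri_alg_list[OF A]])
  show ?thesis
    unfolding MX skew_elt_def
    using sk_closed by (simp add: lin_add[OF assms(2)] lin_sub[OF T.module_axioms assms])
qed

text \<open>With \<open>g\<close> group-like and \<open>M\<close> sending 1 to 1 in each factor,
  both sides expand into the same five pure tensors: one with \<open>X\<close> in each of the five
  places, preceded by alternating \<open>g\<close> and its inverse, with a minus sign when
  \<open>X\<close> is in an opposite factor. They differ only in bracketing.\<close>

lemma coassoc_skew: "mu_id_id K A M (M X) = id_id_mu K A M (M X)"
proof -
  interpret W: k_algebra K "tensor_alg K (quin A)" by (rule tensor_k_algebra[OF quin_alg_list[OF A]])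
  note W = W.module_axioms
  note r = skew_lin[OF W insert_right_lin[OF A]] and l = skew_lin[OF W insert_left_lin[OF A]]
  have q: "pure K (quin A) [x, y, z, u, v] \<in> carrier (tensor_alg K (quin A))"
    if "x \<in> carrier A" "y \<in> carrier A" "z \<in> carrier A" "u \<in> carrier A" "v \<in> carrier A" for x y z u v
    using that by (auto intro!: pure_closed[OF quin_alg_list[OF A]] simp: quin_carrier)
  note lin = alg_hom_lin[OF mu_id_id_alg_hom[OF A M]] alg_hom_lin[OF id_id_mu_alg_hom[OF A M]]
  have M1: "M \<one>\<^bsub>A\<^esub> = pure K (tri A) [\<one>\<^bsub>A\<^esub>, \<one>\<^bsub>A\<^esub>, \<one>\<^bsub>A\<^esub>]"
    by (simp add: alg_hom_one[OF M] tri_pure_one[OF A])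
  show ?thesis
    unfolding skew_lin[OF W lin(1)] skew_lin[OF W lin(2)]
    using gs X sk_closed(4) q
    by (simp add: mu_id_id_pure[OF A M] id_id_mu_pure[OF A M] r l[simplified] M1 insert_right_pure[OF A]
        insert_left_pure[OF A, simplified] a_minus_def W.M.a_assoc)
qed

text \<open>The middle summand cancels against the first one when the first two factors are
  multiplied, and against the third one when the last two are.\<close>

lemma unit_skew:
  "mult_id K A (M X) = pure K [A, A] [\<one>\<^bsub>A\<^esub>, X]" "id_mult K A (M X) = pure K [A, A] [X, \<one>\<^bsub>A\<^esub>]"
proof -
  interpret W: k_algebra K "tensor_alg K [A, A]" by (rule tensor_k_algebra[OF pair_alg_list[OF A]])
  note W = W.module_axioms
  have q: "pure K [A, A] [x, y] \<in> carrier (tensor_alg K [A, A])" if "x \<in> carrier A" "y \<in> carrier A" for x y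
    using that by (auto intro!: pure_closed[OF pair_alg_list[OF A]] simp: pair_carrier)
  have "G \<otimes>\<^bsub>A\<^esub> (G' \<otimes>\<^bsub>A\<^esub> X) = X" using gs X by (simp flip: A.A.m_assoc)
  then show "mult_id K A (M X) = pure K [A, A] [\<one>\<^bsub>A\<^esub>, X]"
    unfolding skew_lin[OF W mult_id_lin[OF A]]
    using gs X sk_closed(4) q by (simp add: mult_id_pure[OF A] a_minus_def W.M.r_neg)
  show "id_mult K A (M X) = pure K [A, A] [X, \<one>\<^bsub>A\<^esub>]"
    unfolding skew_lin[OF W id_mult_lin[OF A]]
    using gs X sk_closed(4) q by (simp add: id_mult_pure[OF A] a_minus_def W.M.a_assoc W.M.l_neg)
qed

end

end

section \<open>Hopf-Galois structures on ambiskew algebras\<close>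

lemma alg_aut_hom: "f \<in> alg_aut K R \<Longrightarrow> f \<in> alg_hom K R R"
  by (simp add: alg_aut_def)

lemma extended_structure_skew:
  "extended_structure K R \<mu> \<tau> \<omega> g h c \<xi> M \<longleftrightarrow>
    hopf_galois_algebra K (ambiskew K R \<tau> \<omega> c \<xi>) M \<and>
    (\<forall>r\<in>carrier R. M (ambiskew_incl K R \<tau> \<omega> c \<xi> r)
      = tensor_map K (tri (ambiskew K R \<tau> \<omega> c \<xi>))
          [ambiskew_incl K R \<tau> \<omega> c \<xi>, ambiskew_incl K R \<tau> \<omega> c \<xi>, ambiskew_incl K R \<tau> \<omega> c \<xi>] (\<mu> r)) \<and>
    M (ambiskew_X K R \<tau> \<omega> c \<xi>) = skew_elt K (ambiskew K R \<tau> \<omega> c \<xi>)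
      (ambiskew_incl K R \<tau> \<omega> c \<xi> g) (ambiskew_incl K R \<tau> \<omega> c \<xi> (inv\<^bsub>R\<^esub> g)) (ambiskew_X K R \<tau> \<omega> c \<xi>) \<and>
    M (ambiskew_Y K R \<tau> \<omega> c \<xi>) = skew_elt K (ambiskew K R \<tau> \<omega> c \<xi>)
      (ambiskew_incl K R \<tau> \<omega> c \<xi> h) (ambiskew_incl K R \<tau> \<omega> c \<xi> (inv\<^bsub>R\<^esub> h)) (ambiskew_Y K R \<tau> \<omega> c \<xi>)"
  by (simp add: extended_structure_def skew_elt_def Let_def)

lemma skew_elt_closed:
  assumes "k_algebra K A" "g \<in> carrier A" "g' \<in> carrier A" "x \<in> carrier A"
  shows "skew_elt K A g g' x \<in> carrier (tensor_alg K (tri A))"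
proof -
  interpret A: k_algebra K A by fact
  interpret T: k_algebra K "tensor_alg K (tri A)" by (rule tensor_k_algebra[OF tri_alg_list[OF assms(1)]])
  show ?thesis unfolding skew_elt_def using assms by (auto intro!: tri_pure_closed[OF assms(1)])
qed

text \<open>Applying \<open>f\<close> to \<open>u \<otimes> inv u = \<one>\<close> exhibits
  \<open>f (inv u)\<close> as the inverse of \<open>a \<odot> u\<close>.\<close>

lemma alg_hom_scaled_inv:
  assumes "k_algebra K R" "f \<in> alg_hom K R R" "a \<in> Units K" "u \<in> Units R" "f u = a \<odot>\<^bsub>R\<^esub> u"
  shows "f (inv\<^bsub>R\<^esub> u) = inv\<^bsub>K\<^esub> a \<odot>\<^bsub>R\<^esub> inv\<^bsub>R\<^esub> u"
proof -
  interpret R: k_algebra K R by fact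
  have u: "u \<in> carrier R" "inv\<^bsub>R\<^esub> u \<in> carrier R" "u \<otimes>\<^bsub>R\<^esub> inv\<^bsub>R\<^esub> u = \<one>\<^bsub>R\<^esub>" "inv\<^bsub>R\<^esub> u \<otimes>\<^bsub>R\<^esub> u = \<one>\<^bsub>R\<^esub>" using assms by auto
  have a: "a \<in> carrier K" "inv\<^bsub>K\<^esub> a \<in> carrier K" "inv\<^bsub>K\<^esub> a \<otimes>\<^bsub>K\<^esub> a = \<one>\<^bsub>K\<^esub>" using assms by auto
  note fc = alg_hom_closed[OF assms(2) u(2)]
  have "\<one>\<^bsub>R\<^esub> = a \<odot>\<^bsub>R\<^esub> (u \<otimes>\<^bsub>R\<^esub> f (inv\<^bsub>R\<^esub> u))"
    using u a fc alg_hom_mult[OF assms(2) u(1,2)]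
    by (simp add: assms(5) alg_hom_one[OF assms(2)] R.smult_mult_left)
  then have "inv\<^bsub>K\<^esub> a \<odot>\<^bsub>R\<^esub> (inv\<^bsub>R\<^esub> u \<otimes>\<^bsub>R\<^esub> \<one>\<^bsub>R\<^esub>) = inv\<^bsub>K\<^esub> a \<odot>\<^bsub>R\<^esub> (inv\<^bsub>R\<^esub> u \<otimes>\<^bsub>R\<^esub> (a \<odot>\<^bsub>R\<^esub> (u \<otimes>\<^bsub>R\<^esub> f (inv\<^bsub>R\<^esub> u))))" by simp
  also have "\<dots> = (inv\<^bsub>K\<^esub> a \<otimes>\<^bsub>K\<^esub> a) \<odot>\<^bsub>R\<^esub> ((inv\<^bsub>R\<^esub> u \<otimes>\<^bsub>R\<^esub> u) \<otimes>\<^bsub>R\<^esub> f (inv\<^bsub>R\<^esub> u))"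
    using u(1,2) a(1,2) fc by (simp add: R.smult_mult_right R.smult_assoc1 R.A.m_assoc)
  finally show ?thesis using u a fc by simp
qed

text \<open>The right-hand side of the condition in \<open>skew_prims\<close> for second argument
  \<open>\<one>\<close>; the inverse of \<open>\<one>\<close> is kept so that the two agree
  literally.\<close>

definition skew_prim_value where
  "skew_prim_value K R g x = pure K (tri R) [x, inv\<^bsub>R\<^esub> \<one>\<^bsub>R\<^esub>, \<one>\<^bsub>R\<^esub>]
    \<ominus>\<^bsub>tensor_alg K (tri R)\<^esub> pure K (tri R) [g, inv\<^bsub>R\<^esub> g \<otimes>\<^bsub>R\<^esub> x \<otimes>\<^bsub>R\<^esub> inv\<^bsub>R\<^esub> \<one>\<^bsub>R\<^esub>, \<one>\<^bsub>R\<^esub>]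
    \<oplus>\<^bsub>tensor_alg K (tri R)\<^esub> pure K (tri R) [g, inv\<^bsub>R\<^esub> g, x]"

lemma skew_prims_one:
  "skew_prims K R \<mu> g \<one>\<^bsub>R\<^esub> = {x \<in> carrier R. \<mu> x = skew_prim_value K R g x}"
  by (simp add: skew_prims_def skew_prim_value_def)

context hopf_galois_algebra
begin

text \<open>Shared by both directions. Given condition (4) it is the last relation that the images
  of \<open>X\<close> and \<open>Y\<close> must satisfy; in the converse it is compared with the
  relation known from the structure map, which isolates \<open>\<mu> c\<close>.\<close>

lemma bracket_eq:
  fixes A :: "('a, 'x, 'y) module_scheme"
  assumes A: "k_algebra K A" and i: "i \<in> alg_hom K R A"
    and \<tau>: "\<tau> \<in> alg_hom K R R" and \<omega>: "\<omega> \<in> alg_hom K R R"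
    and g: "g \<in> group_likes K R \<mu>" and h: "h \<in> group_likes K R \<mu>" and qc: "quasi_central K R \<mu> h"
    and X: "X \<in> carrier A" and Y: "Y \<in> carrier A"
    and X_rel: "\<And>r. r \<in> carrier R \<Longrightarrow> X \<otimes>\<^bsub>A\<^esub> i r = i (\<tau> r) \<otimes>\<^bsub>A\<^esub> X"
    and Y_rel: "\<And>r. r \<in> carrier R \<Longrightarrow> Y \<otimes>\<^bsub>A\<^esub> i r = i (\<omega> r) \<otimes>\<^bsub>A\<^esub> Y"
    and XY_rel: "X \<otimes>\<^bsub>A\<^esub> Y = \<xi> \<odot>\<^bsub>A\<^esub> (Y \<otimes>\<^bsub>A\<^esub> X) \<oplus>\<^bsub>A\<^esub> i c"
    and c: "c \<in> carrier R" and cond3: "ambiskew_cond3 K R \<tau> \<omega> g h \<xi>"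
  defines "U \<equiv> tensor_alg K (tri A)"
  defines "SX \<equiv> skew_elt K A (i g) (i (inv g)) X" and "SY \<equiv> skew_elt K A (i h) (i (inv h)) Y"
  shows "SX \<otimes>\<^bsub>U\<^esub> SY = \<xi> \<odot>\<^bsub>U\<^esub> (SY \<otimes>\<^bsub>U\<^esub> SX) \<oplus>\<^bsub>U\<^esub> tensor_map K (tri A) [i, i, i] (skew_prim_value K R (g \<otimes> h) c)"
proof -
  interpret S: k_algebra K A by (rule A)
  interpret T: k_algebra K "tensor_alg K (tri R)" by (rule tensor_k_algebra[OF tri_alg_list[OF k_algebra_axioms]])
  interpret U: k_algebra K U unfolding U_def by (rule tensor_k_algebra[OF tri_alg_list[OF A]])
  note gl = group_likeD[OF g] and hl = group_likeD[OF h]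
  note ic = alg_hom_closed[OF i] and im = alg_hom_mult[OF i] and ism = alg_hom_smult[OF i] and il = alg_hom_lin[OF i]
  have \<xi>: "\<xi> \<in> Units K" and th: "\<tau> h = \<xi> \<odot> h" and og: "\<omega> g = inv\<^bsub>K\<^esub> \<xi> \<odot> g"
    using cond3 by (auto simp: ambiskew_cond3_def)
  have \<xi>c: "\<xi> \<in> carrier K" "inv\<^bsub>K\<^esub> \<xi> \<in> carrier K" using \<xi> by auto
  have \<xi>i: "inv\<^bsub>K\<^esub> \<xi> \<in> Units K" "inv\<^bsub>K\<^esub> (inv\<^bsub>K\<^esub> \<xi>) = \<xi>" using \<xi> by auto
  have th': "\<tau> (inv h) = inv\<^bsub>K\<^esub> \<xi> \<odot> inv h" by (rule alg_hom_scaled_inv[OF k_algebra_axioms \<tau> \<xi> hl(1) th])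
  have og': "\<omega> (inv g) = \<xi> \<odot> inv g" using alg_hom_scaled_inv[OF k_algebra_axioms \<omega> \<xi>i(1) gl(1) og] \<xi>i(2) by simp
  obtain \<alpha> where \<alpha>: "\<alpha> \<in> hom (R\<lparr>carrier := group_likes K R \<mu>\<rparr>) (units_of K)"
    "\<And>x. x \<in> group_likes K R \<mu> \<Longrightarrow> x \<otimes> h = \<alpha> x \<odot> (h \<otimes> x)"
    using qc unfolding quasi_central_def by blast
  \<comment> \<open>Quasi-centrality of \<open>h\<close>, evaluated at the group-like
    \<open>g\<close>, supplies the scalar by which \<open>g\<close> and \<open>h\<close>
    commute.\<close>
  define l where "l = \<alpha> g"
  have l: "l \<in> Units K" "g \<otimes> h = l \<odot> (h \<otimes> g)"
    using \<alpha> g by (auto simp: l_def hom_def units_of_def)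
  have lc: "l \<in> carrier K" "inv\<^bsub>K\<^esub> l \<in> carrier K" "inv\<^bsub>K\<^esub> l \<otimes>\<^bsub>K\<^esub> l = \<one>\<^bsub>K\<^esub>" using l by auto
  have canc: "g \<otimes> (inv g \<otimes> u) = u" "inv g \<otimes> (g \<otimes> u) = u" "h \<otimes> (inv h \<otimes> u) = u" "inv h \<otimes> (h \<otimes> u) = u"
    if "u \<in> carrier R" for u
    using that gl(2-5) hl(2-5) by (simp_all flip: A.m_assoc)
  have gh_inv: "inv (g \<otimes> h) = inv h \<otimes> inv g"
    using gl(2-5) hl(2-5)
    by (intro A.inv_unique'[symmetric]) (simp_all add: A.m_assoc canc)
  \<comment> \<open>Insert \<open>(g h) (inv h) (inv g) = 1\<close> on the right of
    \<open>inv g \<otimes> inv h\<close> and replace \<open>g h\<close> by \<open>l\<close> times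
    \<open>h g\<close>; everything but \<open>inv h \<otimes> inv g\<close> cancels.\<close>
  have l': "inv h \<otimes> inv g = inv\<^bsub>K\<^esub> l \<odot> (inv g \<otimes> inv h)"
  proof -
    have "inv g \<otimes> inv h = inv g \<otimes> (inv h \<otimes> ((g \<otimes> h) \<otimes> (inv h \<otimes> inv g)))"
      using gl(2-5) hl(2-5) by (simp add: A.m_assoc canc)
    also have "\<dots> = l \<odot> (inv h \<otimes> inv g)"
      unfolding l(2) using gl(2,3) hl(2,3) lc by (simp add: A.m_assoc canc smult_mult_left smult_mult_right)
    finally have "inv g \<otimes> inv h = l \<odot> (inv h \<otimes> inv g)" .
    then show ?thesis using lc gl(3) hl(3) by (simp flip: smult_assoc1)
  qed
  have "SX \<otimes>\<^bsub>U\<^esub> SY = \<xi> \<odot>\<^bsub>U\<^esub> (SY \<otimes>\<^bsub>U\<^esub> SX) \<oplus>\<^bsub>U\<^esub> (pure K (tri A) [i c, \<one>\<^bsub>A\<^esub>, \<one>\<^bsub>A\<^esub>]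
      \<ominus>\<^bsub>U\<^esub> pure K (tri A) [i g \<otimes>\<^bsub>A\<^esub> i h, i (inv h) \<otimes>\<^bsub>A\<^esub> i (inv g) \<otimes>\<^bsub>A\<^esub> i c, \<one>\<^bsub>A\<^esub>]
      \<oplus>\<^bsub>U\<^esub> pure K (tri A) [i g \<otimes>\<^bsub>A\<^esub> i h, i (inv h) \<otimes>\<^bsub>A\<^esub> i (inv g), i c])"
    unfolding SX_def SY_def U_def
  proof (rule skew_elt_bracket[OF A \<xi> _ _ _ _ _ _ _ _ _ _ _ _ l(1)])
    show "X \<otimes>\<^bsub>A\<^esub> i h = \<xi> \<odot>\<^bsub>A\<^esub> (i h \<otimes>\<^bsub>A\<^esub> X)" "X \<otimes>\<^bsub>A\<^esub> i (inv h) = inv\<^bsub>K\<^esub> \<xi> \<odot>\<^bsub>A\<^esub> (i (inv h) \<otimes>\<^bsub>A\<^esub> X)"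
      "Y \<otimes>\<^bsub>A\<^esub> i g = inv\<^bsub>K\<^esub> \<xi> \<odot>\<^bsub>A\<^esub> (i g \<otimes>\<^bsub>A\<^esub> Y)" "Y \<otimes>\<^bsub>A\<^esub> i (inv g) = \<xi> \<odot>\<^bsub>A\<^esub> (i (inv g) \<otimes>\<^bsub>A\<^esub> Y)"
      using gl(2,3) hl(2,3) \<xi>c X Y ic by (simp_all add: X_rel Y_rel th th' og og' ism S.smult_mult_left)
    show "i g \<otimes>\<^bsub>A\<^esub> i h = l \<odot>\<^bsub>A\<^esub> (i h \<otimes>\<^bsub>A\<^esub> i g)" "i (inv h) \<otimes>\<^bsub>A\<^esub> i (inv g) = inv\<^bsub>K\<^esub> l \<odot>\<^bsub>A\<^esub> (i (inv g) \<otimes>\<^bsub>A\<^esub> i (inv h))"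
      using gl(2,3) hl(2,3) lc by (simp_all add: l(2) l' ism flip: im)
  qed (use X Y c gl(2,3) hl(2,3) ic XY_rel in auto)
  also have "pure K (tri A) [i c, \<one>\<^bsub>A\<^esub>, \<one>\<^bsub>A\<^esub>]
      \<ominus>\<^bsub>U\<^esub> pure K (tri A) [i g \<otimes>\<^bsub>A\<^esub> i h, i (inv h) \<otimes>\<^bsub>A\<^esub> i (inv g) \<otimes>\<^bsub>A\<^esub> i c, \<one>\<^bsub>A\<^esub>]
      \<oplus>\<^bsub>U\<^esub> pure K (tri A) [i g \<otimes>\<^bsub>A\<^esub> i h, i (inv h) \<otimes>\<^bsub>A\<^esub> i (inv g), i c] = tensor_map K (tri A) [i, i, i] (skew_prim_value K R (g \<otimes> h) c)"
  proof -
    note J = tri_map_lin[OF k_algebra_axioms A il il il, folded U_def]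
    note pc = tri_pure_closed[OF k_algebra_axioms]
    show ?thesis
      unfolding skew_prim_value_def gh_inv using c gl(2,3) hl(2,3) pc
      by (simp add: lin_add[OF J] lin_sub[OF T.module_axioms U.module_axioms J] tri_map_pure[OF k_algebra_axioms A il il il]
          im alg_hom_one[OF i])
  qed
  finally show ?thesis .
qed

end

section \<open>Uniqueness, existence and the converse\<close>

context
  fixes K :: "('k, 'm) ring_scheme" and R :: "('k, 'a, 'n) module_scheme" and \<mu> \<tau> \<omega> g h c \<xi>
  assumes hg: "hopf_galois_algebra K R \<mu>"
    and aut: "commuting_auts K R \<tau> \<omega>" and twist: "c \<in> twisted_center R (\<tau> \<circ> \<omega>)" and \<xi>: "\<xi> \<in> Units K"
    and g: "g \<in> group_likes K R \<mu>" and h: "h \<in> group_likes K R \<mu>"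
begin

interpretation hopf_galois_algebra K R \<mu> by (rule hg)

private abbreviation (input) "S \<equiv> ambiskew K R \<tau> \<omega> c \<xi>"
private abbreviation (input) "\<iota> \<equiv> ambiskew_incl K R \<tau> \<omega> c \<xi>"
private abbreviation (input) "X \<equiv> ambiskew_X K R \<tau> \<omega> c \<xi>"
private abbreviation (input) "Y \<equiv> ambiskew_Y K R \<tau> \<omega> c \<xi>"
private abbreviation (input) "JS \<equiv> tensor_map K (tri S) [\<iota>, \<iota>, \<iota>]"
private abbreviation (input) "TS \<equiv> tensor_alg K (tri S)"
private abbreviation (input) "TR \<equiv> tensor_alg K (tri R)"
private abbreviation (input) "SX \<equiv> skew_elt K S (\<iota> g) (\<iota> (inv\<^bsub>R\<^esub> g)) X"
private abbreviation (input) "SY \<equiv> skew_elt K S (\<iota> h) (\<iota> (inv\<^bsub>R\<^esub> h)) Y"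
private abbreviation (input) "tr \<equiv> tensor_map K (tri R)"

private lemma homs: "\<tau> \<in> alg_hom K R R" "\<omega> \<in> alg_hom K R R"
  and comm: "r \<in> carrier R \<Longrightarrow> \<tau> (\<omega> r) = \<omega> (\<tau> r)"
  and c: "c \<in> carrier R" and c_twist: "r \<in> carrier R \<Longrightarrow> c \<otimes>\<^bsub>R\<^esub> r = \<tau> (\<omega> r) \<otimes>\<^bsub>R\<^esub> c"
  using aut twist by (auto simp: commuting_auts_def twisted_center_def alg_aut_hom)

private lemma \<xi>c: "\<xi> \<in> carrier K" using \<xi> by auto

private lemmas R_alg = k_algebra_axioms
private lemmas S_alg = ambiskew_k_algebra[OF R_alg homs c \<xi>c]
private lemmas \<iota> = ambiskew_incl_hom[OF R_alg homs c \<xi>c]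
private lemmas XY_closed = ambiskew_X_closed[OF R_alg homs c \<xi>c] ambiskew_Y_closed[OF R_alg homs c \<xi>c]
private lemmas X_rel = ambiskew_X_rel[OF R_alg homs c \<xi>c]
private lemmas Y_rel = ambiskew_Y_rel[OF R_alg homs c \<xi>c]
private lemmas XY_rel = ambiskew_XY_rel[OF R_alg homs c \<xi>c]
private lemmas generated = ambiskew_generated[OF R_alg homs c \<xi>c]
private lemmas TS_alg = tensor_k_algebra[OF tri_alg_list[OF S_alg]]
private lemmas gl = group_likeD[OF g]
private lemmas hl = group_likeD[OF h]

private lemma SXY_closed: "SX \<in> carrier TS" "SY \<in> carrier TS"
  using skew_elt_closed[OF S_alg] gl hl alg_hom_closed[OF \<iota>] XY_closed by auto

text \<open>Both structures are algebra maps with the same values on generators, so they agree on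
  the carrier; extensionality settles the arguments outside it, on which the axioms say
  nothing.\<close>

lemma extended_structure_unique:
  assumes M: "extended_structure K R \<mu> \<tau> \<omega> g h c \<xi> M" "M \<in> extensional (carrier S)"
    and M': "extended_structure K R \<mu> \<tau> \<omega> g h c \<xi> M'" "M' \<in> extensional (carrier S)"
  shows "M = M'"
proof (rule extensionalityI[OF M(2) M'(2)])
  fix x assume x: "x \<in> carrier S"
  have hom: "M \<in> alg_hom K S TS" "M' \<in> alg_hom K S TS"
    using M(1) M'(1) by (auto simp: extended_structure_skew hopf_galois_algebra.mu_alg_hom)
  have "x \<in> {x \<in> carrier S. M x = M' x}"
    by (rule generated[OF subalg_equalizer[OF S_alg TS_alg hom] _ _ _ x])
      (use M(1) M'(1) alg_hom_closed[OF \<iota>] XY_closed in \<open>auto simp: extended_structure_skew\<close>)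
  then show "M x = M' x" by simp
qed

lemma extended_structure_exists:
  assumes cond1: "ambiskew_cond1 K R \<mu> \<tau> \<omega>" and cond2: "ambiskew_cond2 K R \<mu> \<tau> \<omega> g h"
    and cond3: "ambiskew_cond3 K R \<tau> \<omega> g h \<xi>" and cond4: "ambiskew_cond4 K R \<mu> \<tau> \<omega> g h c"
  obtains M where "M \<in> extensional (carrier S)" "extended_structure K R \<mu> \<tau> \<omega> g h c \<xi> M"
proof -
  interpret S: k_algebra K S by (rule S_alg)
  have f: "(\<lambda>r. JS (\<mu> r)) \<in> alg_hom K R TS"
    by (rule alg_hom_comp[OF tri_map_alg_hom[OF R_alg S_alg \<iota>] mu_alg_hom])
  have xr: "SX \<otimes>\<^bsub>TS\<^esub> JS (\<mu> r) = JS (\<mu> (\<tau> r)) \<otimes>\<^bsub>TS\<^esub> SX" if r: "r \<in> carrier R" for r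
    using skew_elt_commute[OF R_alg S_alg \<iota> homs(1) gl(1) XY_closed(1) X_rel mu_closed[OF r], of "\<mu> (\<tau> r)"]
      cond1 cond2 r by (auto simp: ambiskew_cond1_def ambiskew_cond2_def)
  have yr: "SY \<otimes>\<^bsub>TS\<^esub> JS (\<mu> r) = JS (\<mu> (\<omega> r)) \<otimes>\<^bsub>TS\<^esub> SY" if r: "r \<in> carrier R" for r
    using skew_elt_commute[OF R_alg S_alg \<iota> homs(2) hl(1) XY_closed(2) Y_rel mu_closed[OF r], of "\<mu> (\<omega> r)"]
      cond1 cond2 r by (auto simp: ambiskew_cond1_def ambiskew_cond2_def)
  have qc: "quasi_central K R \<mu> h" using cond2 by (simp add: ambiskew_cond2_def)
  \<comment> \<open>The constant term supplied by \<open>bracket_eq\<close> is the image of the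
    skew-primitive value, which condition (4) identifies with \<open>\<mu> c\<close>.\<close>
  have xy: "SX \<otimes>\<^bsub>TS\<^esub> SY = \<xi> \<odot>\<^bsub>TS\<^esub> (SY \<otimes>\<^bsub>TS\<^esub> SX) \<oplus>\<^bsub>TS\<^esub> JS (\<mu> c)"
    using bracket_eq[OF S_alg \<iota> homs g h qc XY_closed X_rel Y_rel XY_rel c cond3] cond4
    by (simp add: ambiskew_cond4_def skew_prims_one)
  have "\<exists>N. N \<in> alg_hom K S TS \<and> (\<forall>r\<in>carrier R. N (\<iota> r) = JS (\<mu> r)) \<and> N X = SX \<and> N Y = SY"
  proof (rule ambiskew_lift[OF R_alg homs c \<xi>c TS_alg f SXY_closed])
    fix N assume "N \<in> alg_hom K S TS" "\<And>r. r \<in> carrier R \<Longrightarrow> N (\<iota> r) = JS (\<mu> r)" "N X = SX" "N Y = SY"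
    then show ?thesis by blast
  qed (fact xr yr xy)+
  then obtain N where N: "N \<in> alg_hom K S TS" "\<And>r. r \<in> carrier R \<Longrightarrow> N (\<iota> r) = JS (\<mu> r)" "N X = SX" "N Y = SY"
    by blast
  \<comment> \<open>The universal property fixes values on the carrier only; restricting selects the
    extensional representative.\<close>
  define M where "M = restrict N (carrier S)"
  have M_app: "M x = N x" if "x \<in> carrier S" for x using that by (simp add: M_def)
  have M: "M \<in> alg_hom K S TS"
    by (intro alg_homI lin_cong[OF alg_hom_lin[OF N(1)] S.module_axioms])
      (auto simp: M_app alg_hom_one[OF N(1)] alg_hom_mult[OF N(1)])
  have Mi: "M (\<iota> r) = JS (\<mu> r)" if "r \<in> carrier R" for r
    using that N(2) alg_hom_closed[OF \<iota>] by (simp add: M_app)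
  have MX: "M X = SX" and MY: "M Y = SY" using N(3,4) XY_closed by (simp_all add: M_app)
  note co = coassoc_incl[OF hg S_alg \<iota> M Mi] coassoc_skew[OF hg S_alg \<iota> M Mi g XY_closed(1) MX]
    coassoc_skew[OF hg S_alg \<iota> M Mi h XY_closed(2) MY]
  note un = unit_incl[OF hg S_alg \<iota> M Mi] unit_skew[OF hg S_alg \<iota> M Mi g XY_closed(1) MX]
    unit_skew[OF hg S_alg \<iota> M Mi h XY_closed(2) MY]
  note S5 = tensor_k_algebra[OF quin_alg_list[OF S_alg]]
  have "hopf_galois_algebra K S M"
  proof (intro hopf_galois_algebra.intro hopf_galois_algebra_axioms.intro S_alg M)
    \<comment> \<open>That \<open>A\<close> is not the zero algebra is not evident from its
      presentation; the functional \<open>p\<close> takes the nonzero value \<open>\<one>\<close> at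
      the unit.\<close>
    obtain p where p: "p \<in> lin_maps K S R" "p \<one>\<^bsub>S\<^esub> = \<one>\<^bsub>R\<^esub>"
      using ambiskew_functionals[OF R_alg homs comm c c_twist \<xi>] by metis
    have "\<one>\<^bsub>S\<^esub> \<noteq> \<zero>\<^bsub>S\<^esub>"
      using p(2) lin_zero[OF S.module_axioms module_axioms p(1)] one_neq_zero by auto
    then show "carrier S \<noteq> {\<zero>\<^bsub>S\<^esub>}" using S.A.one_closed by blast
    fix r assume r: "r \<in> carrier S"
    have "subalg K S {x \<in> carrier S. mu_id_id K S M (M x) = id_id_mu K S M (M x)}"
      by (rule subalg_equalizer[OF S_alg S5 alg_hom_comp[OF mu_id_id_alg_hom[OF S_alg M] M]
            alg_hom_comp[OF id_id_mu_alg_hom[OF S_alg M] M]])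
    then have "r \<in> {x \<in> carrier S. mu_id_id K S M (M x) = id_id_mu K S M (M x)}"
      by (rule generated) (use co alg_hom_closed[OF \<iota>] XY_closed r in auto)
    then show "mu_id_id K S M (M r) = id_id_mu K S M (M r)" by simp
    have "r \<in> {a \<in> carrier S. mult_id K S (M a) = pure K [S, S] [\<one>\<^bsub>S\<^esub>, a]}"
      by (rule generated[OF unit_subalg(1)[OF S_alg M]]) (use un alg_hom_closed[OF \<iota>] XY_closed r in auto)
    then show "mult_id K S (M r) = pure K [S, S] [\<one>\<^bsub>S\<^esub>, r]" by simp
    have "r \<in> {a \<in> carrier S. id_mult K S (M a) = pure K [S, S] [a, \<one>\<^bsub>S\<^esub>]}"
      by (rule generated[OF unit_subalg(2)[OF S_alg M]]) (use un alg_hom_closed[OF \<iota>] XY_closed r in auto)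
    then show "id_mult K S (M r) = pure K [S, S] [r, \<one>\<^bsub>S\<^esub>]" by simp
  qed
  then have "extended_structure K R \<mu> \<tau> \<omega> g h c \<xi> M"
    by (simp add: extended_structure_skew Mi MX MY)
  then show ?thesis by (rule that[rotated]) (simp add: M_def)
qed

lemma extended_structureD:
  assumes "extended_structure K R \<mu> \<tau> \<omega> g h c \<xi> M"
  shows "ambiskew_cond1 K R \<mu> \<tau> \<omega>" "ambiskew_cond2 K R \<mu> \<tau> \<omega> g h"
    "ambiskew_cond3 K R \<tau> \<omega> g h \<xi>" "ambiskew_cond4 K R \<mu> \<tau> \<omega> g h c"
proof -
  interpret S: k_algebra K S by (rule S_alg)
  interpret TS: k_algebra K TS by (rule TS_alg)
  interpret TR: k_algebra K TR by (rule tensor_k_algebra[OF tri_alg_list[OF R_alg]])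
  have M: "M \<in> alg_hom K S TS" and Mi: "\<And>r. r \<in> carrier R \<Longrightarrow> M (\<iota> r) = JS (\<mu> r)" and MX: "M X = SX" and MY: "M Y = SY"
    using assms by (auto simp: extended_structure_skew hopf_galois_algebra.mu_alg_hom)
  note ic = alg_hom_closed[OF \<iota>] and il = alg_hom_lin[OF \<iota>] and tc = alg_hom_closed[OF homs(1)] and oc = alg_hom_closed[OF homs(2)]
  obtain p q s where lin: "p \<in> lin_maps K S R" "q \<in> lin_maps K S R" "s \<in> lin_maps K S R"
    and ev: "\<And>r a. r \<in> carrier R \<Longrightarrow> a \<in> carrier S \<Longrightarrow> p (\<iota> r \<otimes>\<^bsub>S\<^esub> a) = r \<otimes>\<^bsub>R\<^esub> p a"
    "\<And>r a. r \<in> carrier R \<Longrightarrow> a \<in> carrier S \<Longrightarrow> q (\<iota> r \<otimes>\<^bsub>S\<^esub> a) = r \<otimes>\<^bsub>R\<^esub> q a"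
    "\<And>r a. r \<in> carrier R \<Longrightarrow> a \<in> carrier S \<Longrightarrow> s (\<iota> r \<otimes>\<^bsub>S\<^esub> a) = r \<otimes>\<^bsub>R\<^esub> s a"
    "p \<one>\<^bsub>S\<^esub> = \<one>\<^bsub>R\<^esub>" "p X = \<zero>\<^bsub>R\<^esub>" "p Y = \<zero>\<^bsub>R\<^esub>"
    "q \<one>\<^bsub>S\<^esub> = \<zero>\<^bsub>R\<^esub>" "q X = \<one>\<^bsub>R\<^esub>" "q Y = \<zero>\<^bsub>R\<^esub>"
    "s \<one>\<^bsub>S\<^esub> = \<zero>\<^bsub>R\<^esub>" "s X = \<zero>\<^bsub>R\<^esub>" "s Y = \<one>\<^bsub>R\<^esub>"
    by (rule ambiskew_functionals[OF R_alg homs comm c c_twist \<xi>]) (assumption | blast)+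
  have xr: "SX \<otimes>\<^bsub>TS\<^esub> JS (\<mu> r) = JS (\<mu> (\<tau> r)) \<otimes>\<^bsub>TS\<^esub> SX" if r: "r \<in> carrier R" for r
    using arg_cong[OF X_rel[OF r], of M] r ic tc XY_closed by (simp add: alg_hom_mult[OF M] Mi MX)
  have yr: "SY \<otimes>\<^bsub>TS\<^esub> JS (\<mu> r) = JS (\<mu> (\<omega> r)) \<otimes>\<^bsub>TS\<^esub> SY" if r: "r \<in> carrier R" for r
    using arg_cong[OF Y_rel[OF r], of M] r ic oc XY_closed by (simp add: alg_hom_mult[OF M] Mi MY)
  have xy: "SX \<otimes>\<^bsub>TS\<^esub> SY = \<xi> \<odot>\<^bsub>TS\<^esub> (SY \<otimes>\<^bsub>TS\<^esub> SX) \<oplus>\<^bsub>TS\<^esub> JS (\<mu> c)"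
    using arg_cong[OF XY_rel, of M] c ic \<xi>c XY_closed
    by (simp add: alg_hom_mult[OF M] alg_hom_add[OF M] alg_hom_smult[OF M] Mi MX MY)
  \<comment> \<open>The relation for \<open>X\<close> is probed with \<open>p\<close> and
    \<open>q\<close>, the one for \<open>Y\<close> with \<open>p\<close> and \<open>s\<close>: in
    each case the coefficients of 1 and of the generator concerned.\<close>
  have X1: "\<mu> (\<tau> r) = tr [\<tau>, id, id] (\<mu> r)" "\<mu> (\<tau> r) = tr [\<tau>, \<tau>, \<tau>] (\<mu> r)"
    "tr [conj_by R g, conj_by R g, id] (\<mu> r) = tr [\<tau>, \<tau>, id] (\<mu> r)" if r: "r \<in> carrier R" for r
    by (rule skew_elt_commuteD[OF R_alg S_alg \<iota> homs(1) gl(1) XY_closed(1) X_rel mu_closed[OF r] mu_closed[OF tc[OF r]]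
          xr[OF r] lin(1) ev(1,4,5) lin(2) ev(2,7,8)]; assumption)+
  have Y1: "\<mu> (\<omega> r) = tr [\<omega>, id, id] (\<mu> r)" "\<mu> (\<omega> r) = tr [\<omega>, \<omega>, \<omega>] (\<mu> r)"
    "tr [conj_by R h, conj_by R h, id] (\<mu> r) = tr [\<omega>, \<omega>, id] (\<mu> r)" if r: "r \<in> carrier R" for r
    by (rule skew_elt_commuteD[OF R_alg S_alg \<iota> homs(2) hl(1) XY_closed(2) Y_rel mu_closed[OF r] mu_closed[OF oc[OF r]]
          yr[OF r] lin(1) ev(1,4,6) lin(3) ev(3,10,12)]; assumption)+
  show "ambiskew_cond1 K R \<mu> \<tau> \<omega>"
    unfolding ambiskew_cond1_def
    by (intro conjI ballI aut X1(1) Y1(1) trans[OF X1(1)[symmetric] X1(2)] trans[OF Y1(1)[symmetric] Y1(2)])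
  have qg: "quasi_central K R \<mu> g"
    by (rule quasi_central_from_conditions[OF g homs(1) trans[OF X1(1)[symmetric] X1(2)] X1(3)])
  have qh: "quasi_central K R \<mu> h"
    by (rule quasi_central_from_conditions[OF h homs(2) trans[OF Y1(1)[symmetric] Y1(2)] Y1(3)])
  show "ambiskew_cond2 K R \<mu> \<tau> \<omega> g h"
    using g h qg qh X1(3) Y1(3) by (simp add: ambiskew_cond2_def)
  note Jc = tri_map_closed[OF R_alg S_alg il il il]
  have \<xi>i: "inv\<^bsub>K\<^esub> \<xi> \<in> carrier K" "inv\<^bsub>K\<^esub> \<xi> \<otimes>\<^bsub>K\<^esub> \<xi> = \<one>\<^bsub>K\<^esub>" using \<xi> by auto
  \<comment> \<open>The constant term after solving the relation for \<open>SY SX\<close>. With it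
    the bracket relation takes the form required for the same lemma with the two generators
    exchanged, which yields the value of \<open>\<omega>\<close> at \<open>g\<close>.\<close>
  let ?t = "\<ominus>\<^bsub>TR\<^esub> (inv\<^bsub>K\<^esub> \<xi> \<odot>\<^bsub>TR\<^esub> \<mu> c)"
  have t: "?t \<in> carrier TR" using \<xi>i mu_closed[OF c] by simp
  have "JS ?t = \<ominus>\<^bsub>TS\<^esub> (inv\<^bsub>K\<^esub> \<xi> \<odot>\<^bsub>TS\<^esub> JS (\<mu> c))"
    using \<xi>i mu_closed[OF c] tri_map_lin[OF R_alg S_alg il il il]
    by (simp add: lin_minus[OF TR.module_axioms TS.module_axioms] lin_smult)
  then have "SY \<otimes>\<^bsub>TS\<^esub> SX = inv\<^bsub>K\<^esub> \<xi> \<odot>\<^bsub>TS\<^esub> (SX \<otimes>\<^bsub>TS\<^esub> SY) \<oplus>\<^bsub>TS\<^esub> JS ?t"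
    using SXY_closed Jc[OF mu_closed[OF c]] \<xi>i \<xi>c
    by (simp add: xy TS.smult_r_distr TS.M.a_assoc TS.M.r_neg flip: TS.smult_assoc1)
  then have "\<omega> g = inv\<^bsub>K\<^esub> \<xi> \<odot>\<^bsub>R\<^esub> g"
    by (intro skew_elt_bracketD[OF R_alg S_alg \<iota> homs(2,1) hl(1) gl(1) XY_closed(2,1) Y_rel X_rel \<xi>i(1) t
          lin(1,3,2) ev(1,3,2,4,6,5,10,12,7,9,8)])
  moreover have "\<tau> h = \<xi> \<odot>\<^bsub>R\<^esub> h"
    using skew_elt_bracketD[OF R_alg S_alg \<iota> homs gl(1) hl(1) XY_closed X_rel Y_rel \<xi>c mu_closed[OF c] lin
        ev(1-8,10-12) xy] by auto
  ultimately show cond3: "ambiskew_cond3 K R \<tau> \<omega> g h \<xi>" using \<xi> by (simp add: ambiskew_cond3_def)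
  let ?P = "skew_prim_value K R (g \<otimes>\<^bsub>R\<^esub> h) c"
  have "inv\<^bsub>R\<^esub> (g \<otimes>\<^bsub>R\<^esub> h) \<in> carrier R" using gl(1) hl(1) by auto
  then have Pc: "?P \<in> carrier TR"
    unfolding skew_prim_value_def using c gl(2) hl(2) by (auto intro!: tri_pure_closed[OF R_alg])
  \<comment> \<open>Two expressions for \<open>SX SY\<close>: one from the structure map applied to
    the relation, one computed by \<open>bracket_eq\<close>. They share the first summand, so only
    the constant terms remain.\<close>
  have "\<xi> \<odot>\<^bsub>TS\<^esub> (SY \<otimes>\<^bsub>TS\<^esub> SX) \<oplus>\<^bsub>TS\<^esub> JS (\<mu> c) = \<xi> \<odot>\<^bsub>TS\<^esub> (SY \<otimes>\<^bsub>TS\<^esub> SX) \<oplus>\<^bsub>TS\<^esub> JS ?P"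
    using bracket_eq[OF S_alg \<iota> homs g h qh XY_closed X_rel Y_rel XY_rel c cond3] xy by simp
  then have JJ: "JS (\<mu> c) = JS ?P"
    using Jc[OF mu_closed[OF c]] Jc[OF Pc] SXY_closed \<xi>c by simp
  \<comment> \<open>The functional \<open>p\<close> is a left inverse of \<open>\<iota>\<close>, so
    its triple tensor power is a left inverse of \<open>JS\<close>. This supplies the injectivity
    needed to descend from \<open>A\<close> to \<open>R\<close>.\<close>
  have inj: "tr [p, p, p] (JS t) = t" if t: "t \<in> carrier TR" for t
  proof -
    have "tr [p, p, p] (JS t) = tr [\<lambda>x. p (\<iota> x), \<lambda>x. p (\<iota> x), \<lambda>x. p (\<iota> x)] t"
      by (rule tri_map_comp[OF R_alg S_alg il il il R_alg lin(1) lin(1) lin(1) t])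
    also have "\<dots> = tr [\<lambda>x. x, \<lambda>x. x, \<lambda>x. x] t"
    proof (rule tri_map_cong[OF R_alg R_alg _ _ _ _ _ _ t])
      show "p (\<iota> x) = x" if "x \<in> carrier R" for x
        using ev(1)[OF that S.A.one_closed] that ic by (simp add: ev(4))
      then show "p (\<iota> x) = x" "p (\<iota> x) = x" if "x \<in> carrier R" for x using that by auto
    qed (rule lin_comp[OF lin(1) il])+
    finally show ?thesis using tri_map_id[OF R_alg t] by simp
  qed
  have "\<mu> c = ?P"
    using arg_cong[OF JJ, of "tr [p, p, p]"] inj[OF mu_closed[OF c]] inj[OF Pc] by simp
  then show "ambiskew_cond4 K R \<mu> \<tau> \<omega> g h c"
    using c twist by (simp add: ambiskew_cond4_def skew_prims_one)
qed

end

theorem theorem4p1: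
  fixes K :: "('k, 'm) ring_scheme" and R :: "('k, 'a, 'n) module_scheme"
    and \<mu> :: "'a \<Rightarrow> ('a list \<Rightarrow> 'k) set"
  assumes "hopf_galois_algebra K R \<mu>"
  shows "(\<forall>\<tau> \<omega> g h c \<xi>.
            ambiskew_cond1 K R \<mu> \<tau> \<omega> \<and>
            ambiskew_cond2 K R \<mu> \<tau> \<omega> g h \<and>
            ambiskew_cond3 K R \<tau> \<omega> g h \<xi> \<and>
            ambiskew_cond4 K R \<mu> \<tau> \<omega> g h c
            \<longrightarrow> (\<exists>!M. M \<in> extensional (carrier (ambiskew K R \<tau> \<omega> c \<xi>)) \<and>
                     extended_structure K R \<mu> \<tau> \<omega> g h c \<xi> M))
       \<and> (\<forall>\<tau> \<omega> c \<xi> g h.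
            commuting_auts K R \<tau> \<omega> \<and>
            c \<in> twisted_center R (\<tau> \<circ> \<omega>) \<and>
            \<xi> \<in> Units K \<and>
            g \<in> group_likes K R \<mu> \<and> h \<in> group_likes K R \<mu> \<and>
            (\<exists>M. extended_structure K R \<mu> \<tau> \<omega> g h c \<xi> M)
            \<longrightarrow> ambiskew_cond1 K R \<mu> \<tau> \<omega> \<and>
                ambiskew_cond2 K R \<mu> \<tau> \<omega> g h \<and>
                ambiskew_cond3 K R \<tau> \<omega> g h \<xi> \<and>
                ambiskew_cond4 K R \<mu> \<tau> \<omega> g h c)"
proof (intro conjI allI impI; elim conjE exE)
  fix \<tau> \<omega> g h c \<xi>
  assume conds: "ambiskew_cond1 K R \<mu> \<tau> \<omega>" "ambiskew_cond2 K R \<mu> \<tau> \<omega> g h"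
    "ambiskew_cond3 K R \<tau> \<omega> g h \<xi>" "ambiskew_cond4 K R \<mu> \<tau> \<omega> g h c"
  \<comment> \<open>Conditions (1) to (4) already contain the data fixed in the preceding context,
    so its results apply.\<close>
  then have data: "commuting_auts K R \<tau> \<omega>" "c \<in> twisted_center R (\<tau> \<circ> \<omega>)" "\<xi> \<in> Units K"
    "g \<in> group_likes K R \<mu>" "h \<in> group_likes K R \<mu>"
    by (auto simp: ambiskew_cond1_def ambiskew_cond2_def ambiskew_cond3_def ambiskew_cond4_def)
  show "\<exists>!M. M \<in> extensional (carrier (ambiskew K R \<tau> \<omega> c \<xi>)) \<and> extended_structure K R \<mu> \<tau> \<omega> g h c \<xi> M"
    using extended_structure_exists[OF assms data conds] extended_structure_unique[OF assms data] by metis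
qed (rule extended_structureD[OF assms], assumption+)+

end
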